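(* Let $\mathcal{V}$ be a locally presentable symmetric monoidal closed category, let $H$ be a cocommutative Hopf monoid in $\mathcal{V}$, and let $B$ be any commutative monoid in $\mathcal{V}$. Then $P(H,B)$ is a Hopf monoid.
   Context: A Hopf monoid is a bimonoid $H$ with an antipode, i.e. a morphism $s\colon H\to H$ with $\mu(s\otimes 1)\Delta=\iota\varepsilon=\mu(1\otimes s)\Delta$. For a comonoid $C$ and a monoid $B$ in $\mathcal{V}$, the internal hom $[C,B]$ has the convolution monoid structure. $P(H,B)$, the universal measuring comonoid, is the comonoid with natural bijections $\mathbf{Mon}(\mathcal{V})(H,[C,B])\cong\mathbf{Comon}(\mathcal{V})(C,P(H,B))$ for comonoids $C$; it exists under the stated hypotheses. Let $\eta\colon H\to[P(H,B),B]$ be the monoid morphism corresponding to the identity of $P(H,B)$. When $H$ is a bimonoid and $B$ is commutative, $P(H,B)$ is a bimonoid as follows. Its multiplication $P(H,B)\otimes P(H,B)\to P(H,B)$ is the comonoid morphism corresponding to the monoid morphism $$H\xrightarrow{\Delta}H\otimes H\xrightarrow{\eta\otimes\eta}[P(H,B),B]\otimes[P(H,B),B]\to[P(H,B)\otimes P(H,B),B\otimes B]\xrightarrow{[1,\mu_B]}[P(H,B)\otimes P(H,B),B],$$ and its unit $I\to P(H,B)$ is the comonoid morphism corresponding to $H\xrightarrow{\varepsilon}I\xrightarrow{\iota_B}B\cong[I,B]$. The claim is that this bimonoid has an antipode. *)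

theory Defs
  imports Main "HOL-Library.FuncSet"
begin

unbundle cardinal_syntax

section \<open>Categories, functors and colimits\<close>

record ('o, 'a) category =
  Obj :: "'o set"
  Arr :: "'a set"
  src :: "'a \<Rightarrow> 'o"
  tgt :: "'a \<Rightarrow> 'o"
  ident :: "'o \<Rightarrow> 'a" (\<open>\<one>\<index>\<close>)
  cmp :: "'a \<Rightarrow> 'a \<Rightarrow> 'a" (infixr \<open>\<cdot>\<index>\<close> 55)

definition Hom :: "('o, 'a, 'm) category_scheme \<Rightarrow> 'o \<Rightarrow> 'o \<Rightarrow> 'a set" where
  "Hom C X Y = {f \<in> Arr C. src C f = X \<and> tgt C f = Y}"

locale category =
  fixes C :: "('o, 'a, 'm) category_scheme" (structure)
  assumes src_in_Obj: "f \<in> Arr C \<Longrightarrow> src C f \<in> Obj C"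
    and tgt_in_Obj: "f \<in> Arr C \<Longrightarrow> tgt C f \<in> Obj C"
    and ident_in_Hom: "X \<in> Obj C \<Longrightarrow> \<one> X \<in> Hom C X X"
    and cmp_in_Hom: "f \<in> Hom C X Y \<Longrightarrow> g \<in> Hom C Y Z \<Longrightarrow> g \<cdot> f \<in> Hom C X Z"
    and cmp_ident_right: "f \<in> Hom C X Y \<Longrightarrow> f \<cdot> \<one> X = f"
    and cmp_ident_left: "f \<in> Hom C X Y \<Longrightarrow> \<one> Y \<cdot> f = f"
    and cmp_assoc: "f \<in> Hom C W X \<Longrightarrow> g \<in> Hom C X Y \<Longrightarrow> h \<in> Hom C Y Z \<Longrightarrow>
      (h \<cdot> g) \<cdot> f = h \<cdot> (g \<cdot> f)"

definition inverse_arrows :: "('o, 'a, 'm) category_scheme \<Rightarrow> 'a \<Rightarrow> 'a \<Rightarrow> bool" where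
  "inverse_arrows C f g \<longleftrightarrow>
     f \<in> Arr C \<and> g \<in> Hom C (tgt C f) (src C f) \<and>
     cmp C g f = ident C (src C f) \<and> cmp C f g = ident C (tgt C f)"

definition iso_arrow :: "('o, 'a, 'm) category_scheme \<Rightarrow> 'a \<Rightarrow> bool" where
  "iso_arrow C f \<longleftrightarrow> (\<exists>g. inverse_arrows C f g)"

definition inv_arrow :: "('o, 'a, 'm) category_scheme \<Rightarrow> 'a \<Rightarrow> 'a" where
  "inv_arrow C f = (THE g. inverse_arrows C f g)"

definition is_functor ::
  "('p, 'b, 'n) category_scheme \<Rightarrow> ('o, 'a, 'm) category_scheme \<Rightarrow> ('p \<Rightarrow> 'o) \<Rightarrow> ('b \<Rightarrow> 'a) \<Rightarrow> bool"
where
  "is_functor J C Fo Fa \<longleftrightarrow>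
     (\<forall>j \<in> Obj J. Fo j \<in> Obj C) \<and>
     (\<forall>u \<in> Arr J. Fa u \<in> Hom C (Fo (src J u)) (Fo (tgt J u))) \<and>
     (\<forall>j \<in> Obj J. Fa (ident J j) = ident C (Fo j)) \<and>
     (\<forall>i j k. \<forall>u \<in> Hom J i j. \<forall>v \<in> Hom J j k. Fa (cmp J v u) = cmp C (Fa v) (Fa u))"

definition is_cocone ::
  "('p, 'b, 'n) category_scheme \<Rightarrow> ('o, 'a, 'm) category_scheme \<Rightarrow> ('p \<Rightarrow> 'o) \<Rightarrow> ('b \<Rightarrow> 'a) \<Rightarrow>
   'o \<Rightarrow> ('p \<Rightarrow> 'a) \<Rightarrow> bool"
where
  "is_cocone J C Fo Fa L c \<longleftrightarrow>
     L \<in> Obj C \<and> (\<forall>j \<in> Obj J. c j \<in> Hom C (Fo j) L) \<and>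
     (\<forall>u \<in> Arr J. cmp C (c (tgt J u)) (Fa u) = c (src J u))"

definition is_colimit ::
  "('p, 'b, 'n) category_scheme \<Rightarrow> ('o, 'a, 'm) category_scheme \<Rightarrow> ('p \<Rightarrow> 'o) \<Rightarrow> ('b \<Rightarrow> 'a) \<Rightarrow>
   'o \<Rightarrow> ('p \<Rightarrow> 'a) \<Rightarrow> bool"
where
  "is_colimit J C Fo Fa L c \<longleftrightarrow>
     is_cocone J C Fo Fa L c \<and>
     (\<forall>L' c'. is_cocone J C Fo Fa L' c' \<longrightarrow>
        (\<exists>!m. m \<in> Hom C L L' \<and> (\<forall>j \<in> Obj J. cmp C m (c j) = c' j)))"


section \<open>Locally presentable categories\<close>

text \<open>
  Size is measured against a Grothendieck universe, given by an uncountable strongly inaccessible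
  cardinal \<open>\<kappa>\<close> on a type \<open>'u\<close>: a set, of elements of any type, is small if its cardinality is
  below \<open>\<kappa>\<close>. Every small category and every small poset has an isomorphic copy whose objects and
  arrows are elements of \<open>'u\<close>, and every cardinal below \<open>\<kappa>\<close> is represented by a relation on \<open>'u\<close>,
  so it is enough to let index categories, posets and small cardinals range over that type.
\<close>

definition inaccessible :: "'u rel \<Rightarrow> bool" where
  "inaccessible \<kappa> \<longleftrightarrow>
     Card_order \<kappa> \<and> natLeq <o \<kappa> \<and> regularCard \<kappa> \<and>
     (\<forall>X \<subseteq> Field \<kappa>. |X| <o \<kappa> \<longrightarrow> |Pow X| <o \<kappa>)"

definition locally_small :: "'u rel \<Rightarrow> ('o, 'a, 'm) category_scheme \<Rightarrow> bool" where
  "locally_small \<kappa> C \<longleftrightarrow> (\<forall>X \<in> Obj C. \<forall>Y \<in> Obj C. |Hom C X Y| <o \<kappa>)"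

definition cocomplete :: "'u rel \<Rightarrow> ('o, 'a, 'm) category_scheme \<Rightarrow> bool" where
  "cocomplete \<kappa> C \<longleftrightarrow>
     (\<forall>(J :: ('u, 'u) category) Fo Fa.
        category J \<and> |Obj J| <o \<kappa> \<and> |Arr J| <o \<kappa> \<and> is_functor J C Fo Fa \<longrightarrow>
        (\<exists>L c. is_colimit J C Fo Fa L c))"

definition poset_cat :: "'i set \<Rightarrow> 'i rel \<Rightarrow> ('i, 'i \<times> 'i) category" where
  "poset_cat A r =
     \<lparr>Obj = A, Arr = r, src = fst, tgt = snd, ident = (\<lambda>i. (i, i)), cmp = (\<lambda>v u. (fst u, snd v))\<rparr>"

definition small_directed_poset :: "'u rel \<Rightarrow> 'u rel \<Rightarrow> 'u set \<Rightarrow> 'u rel \<Rightarrow> bool" where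
  "small_directed_poset \<kappa> \<mu> A r \<longleftrightarrow>
     |A| <o \<kappa> \<and> r \<subseteq> A \<times> A \<and> partial_order_on A r \<and>
     (\<forall>S \<subseteq> A. |S| <o \<mu> \<longrightarrow> (\<exists>u \<in> A. \<forall>s \<in> S. (s, u) \<in> r))"

definition set_cat :: "'u rel \<Rightarrow> ('x set, 'x set \<times> ('x \<Rightarrow> 'x) \<times> 'x set) category" where
  "set_cat \<kappa> =
     \<lparr>Obj = {X. |X| <o \<kappa>},
      Arr = {(X, f, Y). |X| <o \<kappa> \<and> |Y| <o \<kappa> \<and> f \<in> X \<rightarrow>\<^sub>E Y},
      src = (\<lambda>(X, f, Y). X),
      tgt = (\<lambda>(X, f, Y). Y),
      ident = (\<lambda>X. (X, restrict (\<lambda>x. x) X, X)),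
      cmp = (\<lambda>(Y', g, Z) (X, f, Y). (X, compose X g f, Z))\<rparr>"

definition hom_functor_arr ::
  "('o, 'a, 'm) category_scheme \<Rightarrow> 'o \<Rightarrow> 'a \<Rightarrow> 'a set \<times> ('a \<Rightarrow> 'a) \<times> 'a set" where
  "hom_functor_arr C K f =
     (Hom C K (src C f), (\<lambda>g \<in> Hom C K (src C f). cmp C f g), Hom C K (tgt C f))"

definition preserves_directed_colimits ::
  "'u rel \<Rightarrow> 'u rel \<Rightarrow> ('o, 'a, 'm) category_scheme \<Rightarrow> ('p, 'b, 'n) category_scheme \<Rightarrow>
   ('o \<Rightarrow> 'p) \<Rightarrow> ('a \<Rightarrow> 'b) \<Rightarrow> bool"
where
  "preserves_directed_colimits \<kappa> \<mu> C D Go Ga \<longleftrightarrow>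
     (\<forall>A r Fo Fa L c.
        small_directed_poset \<kappa> \<mu> A r \<and> is_functor (poset_cat A r) C Fo Fa \<and>
        is_colimit (poset_cat A r) C Fo Fa L c \<longrightarrow>
        is_colimit (poset_cat A r) D (Go \<circ> Fo) (Ga \<circ> Fa) (Go L) (Ga \<circ> c))"

definition presentable ::
  "'u rel \<Rightarrow> 'u rel \<Rightarrow> ('o, 'a, 'm) category_scheme \<Rightarrow> 'o \<Rightarrow> bool" where
  "presentable \<kappa> \<mu> C K \<longleftrightarrow>
     K \<in> Obj C \<and> preserves_directed_colimits \<kappa> \<mu> C (set_cat \<kappa>) (Hom C K) (hom_functor_arr C K)"

definition locally_presentable :: "'u rel \<Rightarrow> ('o, 'a, 'm) category_scheme \<Rightarrow> bool" where
  "locally_presentable \<kappa> C \<longleftrightarrow>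
     category C \<and> locally_small \<kappa> C \<and> cocomplete \<kappa> C \<and>
     (\<exists>\<mu> :: 'u rel. Cinfinite \<mu> \<and> regularCard \<mu> \<and> \<mu> <o \<kappa> \<and>
        (\<exists>G. |G| <o \<kappa> \<and> (\<forall>K \<in> G. presentable \<kappa> \<mu> C K) \<and>
           (\<forall>X \<in> Obj C. \<exists>A r Fo Fa c.
              small_directed_poset \<kappa> \<mu> A r \<and> is_functor (poset_cat A r) C Fo Fa \<and>
              (\<forall>i \<in> A. Fo i \<in> G) \<and> is_colimit (poset_cat A r) C Fo Fa X c)))"


section \<open>Symmetric monoidal closed categories\<close>

text \<open>
  The tensor product has separate symbols for objects (\<open>\<otimes>\<close>) and arrows (\<open>\<otimes>\<^sub>a\<close>). The constraints are
  \<open>assc X Y Z : (X \<otimes> Y) \<otimes> Z \<rightarrow> X \<otimes> (Y \<otimes> Z)\<close>, \<open>lun X : I \<otimes> X \<rightarrow> X\<close>, \<open>run X : X \<otimes> I \<rightarrow> X\<close> and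
  \<open>sym X Y : X \<otimes> Y \<rightarrow> Y \<otimes> X\<close>; the evaluation is \<open>ev X Y : ihom X Y \<otimes> X \<rightarrow> Y\<close>.
\<close>

record ('o, 'a) smc_category = "('o, 'a) category" +
  tensO :: "'o \<Rightarrow> 'o \<Rightarrow> 'o" (infixr \<open>\<otimes>\<index>\<close> 70)
  tensA :: "'a \<Rightarrow> 'a \<Rightarrow> 'a" (infixr \<open>\<otimes>\<^sub>a\<index>\<close> 70)
  unitO :: "'o" (\<open>\<I>\<index>\<close>)
  assc :: "'o \<Rightarrow> 'o \<Rightarrow> 'o \<Rightarrow> 'a" (\<open>\<alpha>\<index>\<close>)
  lun :: "'o \<Rightarrow> 'a" (\<open>\<lambda>\<^sub>I\<index>\<close>)
  run :: "'o \<Rightarrow> 'a" (\<open>\<rho>\<^sub>I\<index>\<close>)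
  sym :: "'o \<Rightarrow> 'o \<Rightarrow> 'a" (\<open>\<sigma>\<index>\<close>)
  ihom :: "'o \<Rightarrow> 'o \<Rightarrow> 'o"
  ev :: "'o \<Rightarrow> 'o \<Rightarrow> 'a"

locale symmetric_monoidal_closed_category = category V
  for V :: "('o, 'a) smc_category" (structure) +
  assumes tensO_in_Obj: "X \<in> Obj V \<Longrightarrow> Y \<in> Obj V \<Longrightarrow> X \<otimes> Y \<in> Obj V"
    and tensA_in_Hom: "f \<in> Hom V X X' \<Longrightarrow> g \<in> Hom V Y Y' \<Longrightarrow> f \<otimes>\<^sub>a g \<in> Hom V (X \<otimes> Y) (X' \<otimes> Y')"
    and tens_ident: "X \<in> Obj V \<Longrightarrow> Y \<in> Obj V \<Longrightarrow> \<one> X \<otimes>\<^sub>a \<one> Y = \<one> (X \<otimes> Y)"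
    and tens_cmp: "f \<in> Hom V X X' \<Longrightarrow> f' \<in> Hom V X' X'' \<Longrightarrow> g \<in> Hom V Y Y' \<Longrightarrow> g' \<in> Hom V Y' Y'' \<Longrightarrow>
      (f' \<cdot> f) \<otimes>\<^sub>a (g' \<cdot> g) = (f' \<otimes>\<^sub>a g') \<cdot> (f \<otimes>\<^sub>a g)"
    and unitO_in_Obj: "\<I> \<in> Obj V"
    and assc_in_Hom: "X \<in> Obj V \<Longrightarrow> Y \<in> Obj V \<Longrightarrow> Z \<in> Obj V \<Longrightarrow>
      \<alpha> X Y Z \<in> Hom V ((X \<otimes> Y) \<otimes> Z) (X \<otimes> (Y \<otimes> Z))"
    and assc_iso: "X \<in> Obj V \<Longrightarrow> Y \<in> Obj V \<Longrightarrow> Z \<in> Obj V \<Longrightarrow> iso_arrow V (\<alpha> X Y Z)"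
    and assc_natural: "f \<in> Hom V X X' \<Longrightarrow> g \<in> Hom V Y Y' \<Longrightarrow> h \<in> Hom V Z Z' \<Longrightarrow>
      \<alpha> X' Y' Z' \<cdot> ((f \<otimes>\<^sub>a g) \<otimes>\<^sub>a h) = (f \<otimes>\<^sub>a (g \<otimes>\<^sub>a h)) \<cdot> \<alpha> X Y Z"
    and lun_in_Hom: "X \<in> Obj V \<Longrightarrow> \<lambda>\<^sub>I X \<in> Hom V (\<I> \<otimes> X) X"
    and lun_iso: "X \<in> Obj V \<Longrightarrow> iso_arrow V (\<lambda>\<^sub>I X)"
    and lun_natural: "f \<in> Hom V X X' \<Longrightarrow> \<lambda>\<^sub>I X' \<cdot> (\<one> \<I> \<otimes>\<^sub>a f) = f \<cdot> \<lambda>\<^sub>I X"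
    and run_in_Hom: "X \<in> Obj V \<Longrightarrow> \<rho>\<^sub>I X \<in> Hom V (X \<otimes> \<I>) X"
    and run_iso: "X \<in> Obj V \<Longrightarrow> iso_arrow V (\<rho>\<^sub>I X)"
    and run_natural: "f \<in> Hom V X X' \<Longrightarrow> \<rho>\<^sub>I X' \<cdot> (f \<otimes>\<^sub>a \<one> \<I>) = f \<cdot> \<rho>\<^sub>I X"
    and pentagon: "W \<in> Obj V \<Longrightarrow> X \<in> Obj V \<Longrightarrow> Y \<in> Obj V \<Longrightarrow> Z \<in> Obj V \<Longrightarrow>
      (\<one> W \<otimes>\<^sub>a \<alpha> X Y Z) \<cdot> \<alpha> W (X \<otimes> Y) Z \<cdot> (\<alpha> W X Y \<otimes>\<^sub>a \<one> Z) = \<alpha> W X (Y \<otimes> Z) \<cdot> \<alpha> (W \<otimes> X) Y Z"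
    and triangle: "X \<in> Obj V \<Longrightarrow> Y \<in> Obj V \<Longrightarrow> (\<one> X \<otimes>\<^sub>a \<lambda>\<^sub>I Y) \<cdot> \<alpha> X \<I> Y = \<rho>\<^sub>I X \<otimes>\<^sub>a \<one> Y"
    and sym_in_Hom: "X \<in> Obj V \<Longrightarrow> Y \<in> Obj V \<Longrightarrow> \<sigma> X Y \<in> Hom V (X \<otimes> Y) (Y \<otimes> X)"
    and sym_natural: "f \<in> Hom V X X' \<Longrightarrow> g \<in> Hom V Y Y' \<Longrightarrow>
      \<sigma> X' Y' \<cdot> (f \<otimes>\<^sub>a g) = (g \<otimes>\<^sub>a f) \<cdot> \<sigma> X Y"
    and sym_sym: "X \<in> Obj V \<Longrightarrow> Y \<in> Obj V \<Longrightarrow> \<sigma> Y X \<cdot> \<sigma> X Y = \<one> (X \<otimes> Y)"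
    and hexagon: "X \<in> Obj V \<Longrightarrow> Y \<in> Obj V \<Longrightarrow> Z \<in> Obj V \<Longrightarrow>
      \<alpha> Y Z X \<cdot> \<sigma> X (Y \<otimes> Z) \<cdot> \<alpha> X Y Z = (\<one> Y \<otimes>\<^sub>a \<sigma> X Z) \<cdot> \<alpha> Y X Z \<cdot> (\<sigma> X Y \<otimes>\<^sub>a \<one> Z)"
    and ihom_in_Obj: "X \<in> Obj V \<Longrightarrow> Y \<in> Obj V \<Longrightarrow> ihom V X Y \<in> Obj V"
    and ev_in_Hom: "X \<in> Obj V \<Longrightarrow> Y \<in> Obj V \<Longrightarrow> ev V X Y \<in> Hom V (ihom V X Y \<otimes> X) Y"
    and ev_universal: "X \<in> Obj V \<Longrightarrow> Y \<in> Obj V \<Longrightarrow> Z \<in> Obj V \<Longrightarrow> f \<in> Hom V (Z \<otimes> X) Y \<Longrightarrow>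
      \<exists>!g. g \<in> Hom V Z (ihom V X Y) \<and> ev V X Y \<cdot> (g \<otimes>\<^sub>a \<one> X) = f"


section \<open>Monoids, comonoids and Hopf monoids\<close>

record ('o, 'a) monoid_obj =
  mcar :: 'o
  mul :: 'a
  one :: 'a

record ('o, 'a) comonoid_obj =
  ccar :: 'o
  comul :: 'a
  counit :: 'a

record ('o, 'a) bimonoid_obj =
  bcar :: 'o
  bmul :: 'a
  bone :: 'a
  bcomul :: 'a
  bcounit :: 'a

definition monoid_of :: "('o, 'a) bimonoid_obj \<Rightarrow> ('o, 'a) monoid_obj" where
  "monoid_of H = \<lparr>mcar = bcar H, mul = bmul H, one = bone H\<rparr>"

definition comonoid_of :: "('o, 'a) bimonoid_obj \<Rightarrow> ('o, 'a) comonoid_obj" where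
  "comonoid_of H = \<lparr>ccar = bcar H, comul = bcomul H, counit = bcounit H\<rparr>"

context
  fixes V :: "('o, 'a) smc_category" (structure)
begin

definition is_monoid :: "('o, 'a) monoid_obj \<Rightarrow> bool" where
  "is_monoid M \<longleftrightarrow>
     mcar M \<in> Obj V \<and> mul M \<in> Hom V (mcar M \<otimes> mcar M) (mcar M) \<and> one M \<in> Hom V \<I> (mcar M) \<and>
     mul M \<cdot> (mul M \<otimes>\<^sub>a \<one> (mcar M)) =
       mul M \<cdot> (\<one> (mcar M) \<otimes>\<^sub>a mul M) \<cdot> \<alpha> (mcar M) (mcar M) (mcar M) \<and>
     mul M \<cdot> (one M \<otimes>\<^sub>a \<one> (mcar M)) = \<lambda>\<^sub>I (mcar M) \<and>
     mul M \<cdot> (\<one> (mcar M) \<otimes>\<^sub>a one M) = \<rho>\<^sub>I (mcar M)"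

definition is_commutative_monoid :: "('o, 'a) monoid_obj \<Rightarrow> bool" where
  "is_commutative_monoid M \<longleftrightarrow> is_monoid M \<and> mul M \<cdot> \<sigma> (mcar M) (mcar M) = mul M"

definition monoid_homs :: "('o, 'a) monoid_obj \<Rightarrow> ('o, 'a) monoid_obj \<Rightarrow> 'a set" where
  "monoid_homs M N =
     {f \<in> Hom V (mcar M) (mcar N). f \<cdot> mul M = mul N \<cdot> (f \<otimes>\<^sub>a f) \<and> f \<cdot> one M = one N}"

definition is_comonoid :: "('o, 'a) comonoid_obj \<Rightarrow> bool" where
  "is_comonoid C \<longleftrightarrow>
     ccar C \<in> Obj V \<and> comul C \<in> Hom V (ccar C) (ccar C \<otimes> ccar C) \<and> counit C \<in> Hom V (ccar C) \<I> \<and>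
     \<alpha> (ccar C) (ccar C) (ccar C) \<cdot> (comul C \<otimes>\<^sub>a \<one> (ccar C)) \<cdot> comul C =
       (\<one> (ccar C) \<otimes>\<^sub>a comul C) \<cdot> comul C \<and>
     \<lambda>\<^sub>I (ccar C) \<cdot> (counit C \<otimes>\<^sub>a \<one> (ccar C)) \<cdot> comul C = \<one> (ccar C) \<and>
     \<rho>\<^sub>I (ccar C) \<cdot> (\<one> (ccar C) \<otimes>\<^sub>a counit C) \<cdot> comul C = \<one> (ccar C)"

definition is_cocommutative :: "('o, 'a) comonoid_obj \<Rightarrow> bool" where
  "is_cocommutative C \<longleftrightarrow> \<sigma> (ccar C) (ccar C) \<cdot> comul C = comul C"

definition comonoid_homs :: "('o, 'a) comonoid_obj \<Rightarrow> ('o, 'a) comonoid_obj \<Rightarrow> 'a set" where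
  "comonoid_homs C D =
     {f \<in> Hom V (ccar C) (ccar D). comul D \<cdot> f = (f \<otimes>\<^sub>a f) \<cdot> comul C \<and> counit D \<cdot> f = counit C}"

definition interchange :: "'o \<Rightarrow> 'o \<Rightarrow> 'o \<Rightarrow> 'o \<Rightarrow> 'a" \<comment> \<open>\<open>(W \<otimes> X) \<otimes> (Y \<otimes> Z) \<rightarrow> (W \<otimes> Y) \<otimes> (X \<otimes> Z)\<close>\<close> where
  "interchange W X Y Z =
     inv_arrow V (\<alpha> W Y (X \<otimes> Z)) \<cdot>
     (\<one> W \<otimes>\<^sub>a (\<alpha> Y X Z \<cdot> (\<sigma> X Y \<otimes>\<^sub>a \<one> Z) \<cdot> inv_arrow V (\<alpha> X Y Z))) \<cdot>
     \<alpha> W X (Y \<otimes> Z)"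

definition tensor_comonoid ::
  "('o, 'a) comonoid_obj \<Rightarrow> ('o, 'a) comonoid_obj \<Rightarrow> ('o, 'a) comonoid_obj" where
  "tensor_comonoid C D =
     \<lparr>ccar = ccar C \<otimes> ccar D,
      comul = interchange (ccar C) (ccar C) (ccar D) (ccar D) \<cdot> (comul C \<otimes>\<^sub>a comul D),
      counit = \<lambda>\<^sub>I \<I> \<cdot> (counit C \<otimes>\<^sub>a counit D)\<rparr>"

definition unit_comonoid :: "('o, 'a) comonoid_obj" where
  "unit_comonoid = \<lparr>ccar = \<I>, comul = inv_arrow V (\<lambda>\<^sub>I \<I>), counit = \<one> \<I>\<rparr>"

definition is_bimonoid :: "('o, 'a) bimonoid_obj \<Rightarrow> bool" where
  "is_bimonoid H \<longleftrightarrow>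
     is_monoid (monoid_of H) \<and> is_comonoid (comonoid_of H) \<and>
     bmul H \<in> comonoid_homs (tensor_comonoid (comonoid_of H) (comonoid_of H)) (comonoid_of H) \<and>
     bone H \<in> comonoid_homs unit_comonoid (comonoid_of H)"

definition is_antipode :: "('o, 'a) bimonoid_obj \<Rightarrow> 'a \<Rightarrow> bool" where
  "is_antipode H s \<longleftrightarrow>
     s \<in> Hom V (bcar H) (bcar H) \<and>
     bmul H \<cdot> (s \<otimes>\<^sub>a \<one> (bcar H)) \<cdot> bcomul H = bone H \<cdot> bcounit H \<and>
     bmul H \<cdot> (\<one> (bcar H) \<otimes>\<^sub>a s) \<cdot> bcomul H = bone H \<cdot> bcounit H"

definition is_Hopf_monoid :: "('o, 'a) bimonoid_obj \<Rightarrow> bool" where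
  "is_Hopf_monoid H \<longleftrightarrow> is_bimonoid H \<and> (\<exists>s. is_antipode H s)"


section \<open>Convolution and universal measuring comonoids\<close>

text \<open>\<open>transp Z X Y f : Z \<rightarrow> ihom X Y\<close> is the arrow corresponding to \<open>f : Z \<otimes> X \<rightarrow> Y\<close>.\<close>

definition transp :: "'o \<Rightarrow> 'o \<Rightarrow> 'o \<Rightarrow> 'a \<Rightarrow> 'a" where
  "transp Z X Y f = (THE g. g \<in> Hom V Z (ihom V X Y) \<and> ev V X Y \<cdot> (g \<otimes>\<^sub>a \<one> X) = f)"

text \<open>For \<open>f : X' \<rightarrow> X\<close> and \<open>g : Y \<rightarrow> Y'\<close>, this is \<open>[f, g] : ihom X Y \<rightarrow> ihom X' Y'\<close>.\<close>

definition ihom_arr :: "'a \<Rightarrow> 'a \<Rightarrow> 'a" where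
  "ihom_arr f g =
     transp (ihom V (tgt V f) (src V g)) (src V f) (tgt V g)
       (g \<cdot> ev V (tgt V f) (src V g) \<cdot> (\<one> (ihom V (tgt V f) (src V g)) \<otimes>\<^sub>a f))"

text \<open>The canonical arrow \<open>ihom X Y \<otimes> ihom X' Y' \<rightarrow> ihom (X \<otimes> X') (Y \<otimes> Y')\<close>.\<close>

definition ihom_tensor :: "'o \<Rightarrow> 'o \<Rightarrow> 'o \<Rightarrow> 'o \<Rightarrow> 'a" where
  "ihom_tensor X Y X' Y' =
     transp (ihom V X Y \<otimes> ihom V X' Y') (X \<otimes> X') (Y \<otimes> Y')
       ((ev V X Y \<otimes>\<^sub>a ev V X' Y') \<cdot> interchange (ihom V X Y) (ihom V X' Y') X X')"

definition convolution_monoid ::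
  "('o, 'a) comonoid_obj \<Rightarrow> ('o, 'a) monoid_obj \<Rightarrow> ('o, 'a) monoid_obj" where
  "convolution_monoid C B =
     \<lparr>mcar = ihom V (ccar C) (mcar B),
      mul = ihom_arr (comul C) (mul B) \<cdot> ihom_tensor (ccar C) (mcar B) (ccar C) (mcar B),
      one = ihom_arr (counit C) (one B) \<cdot> transp \<I> \<I> \<I> (\<lambda>\<^sub>I \<I>)\<rparr>"

text \<open>
  \<open>P\<close> is a universal measuring comonoid for the monoids \<open>A\<close> and \<open>B\<close>, exhibited by bijections
  \<open>\<Phi> C : Mon(A, [C, B]) \<rightarrow> Comon(C, P)\<close> natural in the comonoid \<open>C\<close>.
\<close>

definition is_universal_measuring_comonoid ::
  "('o, 'a) monoid_obj \<Rightarrow> ('o, 'a) monoid_obj \<Rightarrow> ('o, 'a) comonoid_obj \<Rightarrow>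
   (('o, 'a) comonoid_obj \<Rightarrow> 'a \<Rightarrow> 'a) \<Rightarrow> bool"
where
  "is_universal_measuring_comonoid A B P \<Phi> \<longleftrightarrow>
     is_comonoid P \<and>
     (\<forall>C. is_comonoid C \<longrightarrow>
        bij_betw (\<Phi> C) (monoid_homs A (convolution_monoid C B)) (comonoid_homs C P)) \<and>
     (\<forall>C C'. is_comonoid C \<and> is_comonoid C' \<longrightarrow>
        (\<forall>g \<in> comonoid_homs C' C. \<forall>f \<in> monoid_homs A (convolution_monoid C B).
           \<Phi> C' (ihom_arr g (\<one> (mcar B)) \<cdot> f) = \<Phi> C f \<cdot> g))"

definition universal_measuring ::
  "('o, 'a) monoid_obj \<Rightarrow> ('o, 'a) monoid_obj \<Rightarrow> ('o, 'a) comonoid_obj \<Rightarrow>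
   (('o, 'a) comonoid_obj \<Rightarrow> 'a \<Rightarrow> 'a) \<Rightarrow> 'a"
where
  "universal_measuring A B P \<Phi> =
     inv_into (monoid_homs A (convolution_monoid P B)) (\<Phi> P) (\<one> (ccar P))"

text \<open>
  The bimonoid structure on \<open>P(H, B)\<close>. The isomorphism \<open>B \<cong> [I, B]\<close> used for the unit is the
  transpose of \<open>\<rho>\<^sub>I B : B \<otimes> I \<rightarrow> B\<close>.
\<close>

definition measuring_bimonoid ::
  "('o, 'a) bimonoid_obj \<Rightarrow> ('o, 'a) monoid_obj \<Rightarrow> ('o, 'a) comonoid_obj \<Rightarrow>
   (('o, 'a) comonoid_obj \<Rightarrow> 'a \<Rightarrow> 'a) \<Rightarrow> ('o, 'a) bimonoid_obj"
where
  "measuring_bimonoid H B P \<Phi> =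
     (let \<eta> = universal_measuring (monoid_of H) B P \<Phi> in
      \<lparr>bcar = ccar P,
       bmul = \<Phi> (tensor_comonoid P P)
         (ihom_arr (\<one> (ccar P \<otimes> ccar P)) (mul B) \<cdot>
          ihom_tensor (ccar P) (mcar B) (ccar P) (mcar B) \<cdot> (\<eta> \<otimes>\<^sub>a \<eta>) \<cdot> bcomul H),
       bone = \<Phi> unit_comonoid
         (transp (mcar B) \<I> (mcar B) (\<rho>\<^sub>I (mcar B)) \<cdot> one B \<cdot> bcounit H),
       bcomul = comul P,
       bcounit = counit P\<rparr>)"

end

end

theory Submission
  imports Defs
begin

text \<open>
  A monoid morphism \<open>H \<rightarrow> [C, B]\<close> is the same thing as a measuring \<open>H \<otimes> C \<rightarrow> B\<close>; let \<open>e\<close> be the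
  universal one. As \<open>s\<close> is an anti-homomorphism and \<open>B\<close> is commutative, \<open>e (s \<otimes> 1)\<close> is a measuring by
  the co-opposite of \<open>P\<close>, which gives a comonoid morphism \<open>t : P\<^sup>c\<^sup>o\<^sup>p \<rightarrow> P\<close> with \<open>e (1 \<otimes> t) = e (s \<otimes> 1)\<close>.
  Put \<open>\<theta> = \<mu> (1 \<otimes> t) : P \<otimes> P\<^sup>c\<^sup>o\<^sup>p \<rightarrow> P\<close>, \<open>u = \<Delta>\<close> and \<open>v = (\<iota> \<otimes> \<iota>) \<epsilon>\<close>; the antipode axiom reads
  \<open>\<theta> u = \<theta> v\<close>, and the antipode axiom of \<open>H\<close> yields \<open>e (1 \<otimes> \<theta> u) = e (1 \<otimes> \<theta> v)\<close>. This does not suffice,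
  since \<open>u\<close> is not a comonoid morphism. But the coequalizer \<open>\<pi>\<close> of \<open>u\<close> and \<open>v\<close> is a quotient comonoid
  of \<open>P \<otimes> P\<^sup>c\<^sup>o\<^sup>p\<close>, because \<open>p\<^sub>1 \<otimes> p\<^sub>4 \<otimes> p\<^sub>2 \<otimes> p\<^sub>3\<close> collapses under \<open>\<pi> \<otimes> \<pi>\<close> from the inside out, and
  \<open>e (1 \<otimes> \<theta>)\<close> descends to a measuring by this quotient. Hence \<open>\<theta>\<close> factors through \<open>\<pi>\<close>.
\<close>

section \<open>Symmetric monoidal coherence\<close>

text \<open>\<open>P\<close> is universal for comonoid morphisms only: agreement after composition
  with \<open>e\<close> need not separate arbitrary arrows into \<open>P\<close>. The
  comultiplication of \<open>tensor_comonoid V P (cop P)\<close> sends p1 \<otimes> p2 to (p1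
  \<otimes> p4) \<otimes> (p2 \<otimes> p3), whereas a comonoid morphism would need (p1 \<otimes>
  p2) \<otimes> (p3 \<otimes> p4); this is the obstacle that forces the detour through a quotient.
  Descent to the quotient rests on closedness: tensoring with a fixed object is a left adjoint, so
  it keeps \<pi> epi and lets a map out of H \<otimes> E that equalizes both arrows factor through H
  \<otimes> L. Local presentability enters through the existence of this coequalizer. The
  calculations permute many tensor factors at a time. Giving the factors names instead of positions
  makes associators and symmetries disappear; the price is the coherence theorem
  \<open>can_unique\<close> and the side conditions that names are distinct and fresh.\<close>

context category
begin

lemma HomD: "f \<in> Hom C X Y \<Longrightarrow> f \<in> Arr C" "f \<in> Hom C X Y \<Longrightarrow> src C f = X" "f \<in> Hom C X Y \<Longrightarrow> tgt C f = Y"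
  by (auto simp: Hom_def)

lemma Hom_self: "f \<in> Arr C \<Longrightarrow> f \<in> Hom C (src C f) (tgt C f)"
  by (auto simp: Hom_def)

lemmas [simp] = src_in_Obj tgt_in_Obj

lemma Arr_ident [simp]: "X \<in> Obj C \<Longrightarrow> \<one> X \<in> Arr C"
  and src_ident [simp]: "X \<in> Obj C \<Longrightarrow> src C (\<one> X) = X"
  and tgt_ident [simp]: "X \<in> Obj C \<Longrightarrow> tgt C (\<one> X) = X"
  using ident_in_Hom[of X] by (auto simp: Hom_def)

lemma Arr_cmp [simp]: "f \<in> Arr C \<Longrightarrow> g \<in> Arr C \<Longrightarrow> src C g = tgt C f \<Longrightarrow> g \<cdot> f \<in> Arr C"
  and src_cmp [simp]: "f \<in> Arr C \<Longrightarrow> g \<in> Arr C \<Longrightarrow> src C g = tgt C f \<Longrightarrow> src C (g \<cdot> f) = src C f"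
  and tgt_cmp [simp]: "f \<in> Arr C \<Longrightarrow> g \<in> Arr C \<Longrightarrow> src C g = tgt C f \<Longrightarrow> tgt C (g \<cdot> f) = tgt C g"
  using cmp_in_Hom[of f "src C f" "tgt C f" g "tgt C g"] by (auto simp: Hom_def)

lemma cmp_id [simp]: "f \<in> Arr C \<Longrightarrow> src C f = X \<Longrightarrow> f \<cdot> \<one> X = f"
  using cmp_ident_right[of f X "tgt C f"] by (auto simp: Hom_def)

lemma id_cmp [simp]: "f \<in> Arr C \<Longrightarrow> tgt C f = X \<Longrightarrow> \<one> X \<cdot> f = f"
  using cmp_ident_left[of f "src C f" X] by (auto simp: Hom_def)

lemma cmp_assoc' [simp]: "f \<in> Arr C \<Longrightarrow> g \<in> Arr C \<Longrightarrow> h \<in> Arr C \<Longrightarrow> src C g = tgt C f \<Longrightarrow> src C h = tgt C g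
   \<Longrightarrow> (h \<cdot> g) \<cdot> f = h \<cdot> (g \<cdot> f)"
  using cmp_assoc[of f "src C f" "tgt C f" g "tgt C g" h "tgt C h"] by (auto simp: Hom_def)

lemma inverse_arrows_unique:
  assumes "inverse_arrows C f g" "inverse_arrows C f h" shows "g = h"
proof -
  have t: "f \<in> Arr C" "g \<in> Hom C (tgt C f) (src C f)" "h \<in> Hom C (tgt C f) (src C f)"
    "h \<cdot> f = \<one> (src C f)" "f \<cdot> g = \<one> (tgt C f)"
    using assms by (auto simp: inverse_arrows_def)
  have "(h \<cdot> f) \<cdot> g = h \<cdot> (f \<cdot> g)" using t(1-3) by (intro cmp_assoc') (auto simp: Hom_def)
  then show ?thesis using t by (simp add: HomD)
qed

lemma inv_arrow_inverse: "iso_arrow C f \<Longrightarrow> inverse_arrows C f (inv_arrow C f)"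
  unfolding iso_arrow_def inv_arrow_def
  by (metis inverse_arrows_unique theI)

lemma iso_inv:
  assumes "iso_arrow C f"
  shows "inv_arrow C f \<in> Arr C" "src C (inv_arrow C f) = tgt C f" "tgt C (inv_arrow C f) = src C f"
    "inv_arrow C f \<cdot> f = \<one> (src C f)" "f \<cdot> inv_arrow C f = \<one> (tgt C f)" "f \<in> Arr C"
  using inv_arrow_inverse[OF assms] by (auto simp: inverse_arrows_def Hom_def)

lemma iso_inv_cmp:
  assumes "iso_arrow C f" "g \<in> Arr C"
  shows "tgt C g = src C f \<Longrightarrow> inv_arrow C f \<cdot> (f \<cdot> g) = g"
    and "tgt C g = tgt C f \<Longrightarrow> f \<cdot> (inv_arrow C f \<cdot> g) = g"
proof -
  note i = iso_inv[OF assms(1)]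
  show "inv_arrow C f \<cdot> (f \<cdot> g) = g" if "tgt C g = src C f"
    using cmp_assoc'[of g f "inv_arrow C f"] i(1-4,6) assms(2) that by simp
  show "f \<cdot> (inv_arrow C f \<cdot> g) = g" if "tgt C g = tgt C f"
    using cmp_assoc'[of g "inv_arrow C f" f] i(1-3,5,6) assms(2) that by simp
qed

lemma iso_arrowI:
  assumes "f \<in> Arr C" "g \<in> Arr C" "src C g = tgt C f" "tgt C g = src C f"
    "g \<cdot> f = \<one> (src C f)" "f \<cdot> g = \<one> (tgt C f)"
  shows "iso_arrow C f"
  using assms unfolding iso_arrow_def inverse_arrows_def Hom_def by auto

lemma iso_cancel_right:
  assumes "iso_arrow C f" "g \<in> Arr C" "h \<in> Arr C" "src C g = tgt C f" "src C h = tgt C f" "g \<cdot> f = h \<cdot> f"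
  shows "g = h"
proof -
  note i = iso_inv[OF assms(1)]
  have "(g \<cdot> f) \<cdot> inv_arrow C f = (h \<cdot> f) \<cdot> inv_arrow C f" using assms(6) by simp
  then show ?thesis using assms(2-5) i by simp
qed

lemma iso_cancel_left:
  assumes "iso_arrow C f" "g \<in> Arr C" "h \<in> Arr C" "tgt C g = src C f" "tgt C h = src C f" "f \<cdot> g = f \<cdot> h"
  shows "g = h"
proof -
  have "inv_arrow C f \<cdot> (f \<cdot> g) = inv_arrow C f \<cdot> (f \<cdot> h)" using assms(6) by simp
  then show ?thesis using assms(2-5) iso_inv_cmp(1)[OF assms(1)] by simp
qed

end

context symmetric_monoidal_closed_category
begin

lemmas [simp] = tensO_in_Obj unitO_in_Obj ihom_in_Obj tens_ident

lemma Arr_tens [simp]: "f \<in> Arr V \<Longrightarrow> g \<in> Arr V \<Longrightarrow> f \<otimes>\<^sub>a g \<in> Arr V"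
  and src_tens [simp]: "f \<in> Arr V \<Longrightarrow> g \<in> Arr V \<Longrightarrow> src V (f \<otimes>\<^sub>a g) = src V f \<otimes> src V g"
  and tgt_tens [simp]: "f \<in> Arr V \<Longrightarrow> g \<in> Arr V \<Longrightarrow> tgt V (f \<otimes>\<^sub>a g) = tgt V f \<otimes> tgt V g"
  using tensA_in_Hom[OF Hom_self Hom_self, of f g] by (auto simp: Hom_def)

lemma tens_merge [simp]:
  assumes "f \<in> Arr V" "f' \<in> Arr V" "g \<in> Arr V" "g' \<in> Arr V" "src V f' = tgt V f" "src V g' = tgt V g"
  shows "(f' \<otimes>\<^sub>a g') \<cdot> (f \<otimes>\<^sub>a g) = (f' \<cdot> f) \<otimes>\<^sub>a (g' \<cdot> g)"
  using assms tens_cmp[of f "src V f" "tgt V f" f' "tgt V f'" g "src V g" "tgt V g" g' "tgt V g'"]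
  by (auto simp: Hom_def)

lemma tens_merge_cmp [simp]:
  assumes "f \<in> Arr V" "f' \<in> Arr V" "g \<in> Arr V" "g' \<in> Arr V" "src V f' = tgt V f" "src V g' = tgt V g"
    "h \<in> Arr V" "tgt V h = src V f \<otimes> src V g"
  shows "(f' \<otimes>\<^sub>a g') \<cdot> ((f \<otimes>\<^sub>a g) \<cdot> h) = ((f' \<cdot> f) \<otimes>\<^sub>a (g' \<cdot> g)) \<cdot> h"
  using assms tens_merge[OF assms(1-6)] by (metis Arr_tens cmp_assoc' src_tens tgt_tens)

lemma assc_simps [simp]:
  assumes "X \<in> Obj V" "Y \<in> Obj V" "Z \<in> Obj V"
  shows "\<alpha> X Y Z \<in> Arr V" "src V (\<alpha> X Y Z) = (X \<otimes> Y) \<otimes> Z" "tgt V (\<alpha> X Y Z) = X \<otimes> (Y \<otimes> Z)"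
  using assc_in_Hom[OF assms] by (auto simp: Hom_def)

lemma sym_simps [simp]:
  assumes "X \<in> Obj V" "Y \<in> Obj V"
  shows "\<sigma> X Y \<in> Arr V" "src V (\<sigma> X Y) = X \<otimes> Y" "tgt V (\<sigma> X Y) = Y \<otimes> X"
  using sym_in_Hom[OF assms] by (auto simp: Hom_def)

lemma unit_simps [simp]:
  assumes "X \<in> Obj V"
  shows "\<lambda>\<^sub>I X \<in> Arr V" "src V (\<lambda>\<^sub>I X) = \<I> \<otimes> X" "tgt V (\<lambda>\<^sub>I X) = X"
    "\<rho>\<^sub>I X \<in> Arr V" "src V (\<rho>\<^sub>I X) = X \<otimes> \<I>" "tgt V (\<rho>\<^sub>I X) = X"
  using lun_in_Hom[OF assms] run_in_Hom[OF assms] by (auto simp: Hom_def)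

abbreviation "asc' X Y Z \<equiv> inv_arrow V (\<alpha> X Y Z)"
abbreviation "lun' X \<equiv> inv_arrow V (\<lambda>\<^sub>I X)"
abbreviation "run' X \<equiv> inv_arrow V (\<rho>\<^sub>I X)"

lemma asc'_simps [simp]:
  assumes "X \<in> Obj V" "Y \<in> Obj V" "Z \<in> Obj V"
  shows "asc' X Y Z \<in> Arr V" "src V (asc' X Y Z) = X \<otimes> (Y \<otimes> Z)" "tgt V (asc' X Y Z) = (X \<otimes> Y) \<otimes> Z"
    "asc' X Y Z \<cdot> \<alpha> X Y Z = \<one> ((X \<otimes> Y) \<otimes> Z)" "\<alpha> X Y Z \<cdot> asc' X Y Z = \<one> (X \<otimes> (Y \<otimes> Z))"
  using iso_inv[OF assc_iso[OF assms]] assms by auto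

lemma asc'_cmp [simp]:
  assumes "X \<in> Obj V" "Y \<in> Obj V" "Z \<in> Obj V" "f \<in> Arr V"
  shows "tgt V f = (X \<otimes> Y) \<otimes> Z \<Longrightarrow> asc' X Y Z \<cdot> (\<alpha> X Y Z \<cdot> f) = f"
    "tgt V f = X \<otimes> (Y \<otimes> Z) \<Longrightarrow> \<alpha> X Y Z \<cdot> (asc' X Y Z \<cdot> f) = f"
  using iso_inv_cmp[OF assc_iso[OF assms(1-3)] assms(4)] assms by auto

lemma unit'_simps [simp]:
  assumes "X \<in> Obj V"
  shows "lun' X \<in> Arr V" "src V (lun' X) = X" "tgt V (lun' X) = \<I> \<otimes> X"
    "lun' X \<cdot> \<lambda>\<^sub>I X = \<one> (\<I> \<otimes> X)" "\<lambda>\<^sub>I X \<cdot> lun' X = \<one> X"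
    "run' X \<in> Arr V" "src V (run' X) = X" "tgt V (run' X) = X \<otimes> \<I>"
    "run' X \<cdot> \<rho>\<^sub>I X = \<one> (X \<otimes> \<I>)" "\<rho>\<^sub>I X \<cdot> run' X = \<one> X"
  using iso_inv[OF lun_iso[OF assms]] iso_inv[OF run_iso[OF assms]] assms by auto

lemma lun'_cmp [simp]:
  assumes "X \<in> Obj V" "f \<in> Arr V"
  shows "tgt V f = \<I> \<otimes> X \<Longrightarrow> lun' X \<cdot> (\<lambda>\<^sub>I X \<cdot> f) = f"
    "tgt V f = X \<Longrightarrow> \<lambda>\<^sub>I X \<cdot> (lun' X \<cdot> f) = f"
  using iso_inv_cmp[OF lun_iso[OF assms(1)] assms(2)] assms by auto

lemma sym_sym' [simp]:
  assumes "X \<in> Obj V" "Y \<in> Obj V"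
  shows "\<sigma> Y X \<cdot> \<sigma> X Y = \<one> (X \<otimes> Y)"
    "f \<in> Arr V \<Longrightarrow> tgt V f = X \<otimes> Y \<Longrightarrow> \<sigma> Y X \<cdot> (\<sigma> X Y \<cdot> f) = f"
proof -
  show 1: "\<sigma> Y X \<cdot> \<sigma> X Y = \<one> (X \<otimes> Y)" using sym_sym assms by simp
  show "\<sigma> Y X \<cdot> (\<sigma> X Y \<cdot> f) = f" if "f \<in> Arr V" "tgt V f = X \<otimes> Y"
    using cmp_assoc'[of f "\<sigma> X Y" "\<sigma> Y X"] 1 that assms by simp
qed

lemma assc_nat:
  assumes "f \<in> Arr V" "g \<in> Arr V" "h \<in> Arr V"
  shows "\<alpha> (tgt V f) (tgt V g) (tgt V h) \<cdot> ((f \<otimes>\<^sub>a g) \<otimes>\<^sub>a h) =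
    (f \<otimes>\<^sub>a (g \<otimes>\<^sub>a h)) \<cdot> \<alpha> (src V f) (src V g) (src V h)"
  using assc_natural[OF Hom_self Hom_self Hom_self, of f g h] assms by auto

lemma asc'_nat:
  assumes "f \<in> Arr V" "g \<in> Arr V" "h \<in> Arr V"
  shows "asc' (tgt V f) (tgt V g) (tgt V h) \<cdot> (f \<otimes>\<^sub>a (g \<otimes>\<^sub>a h)) =
    ((f \<otimes>\<^sub>a g) \<otimes>\<^sub>a h) \<cdot> asc' (src V f) (src V g) (src V h)"
proof -
  let ?a = "asc' (src V f) (src V g) (src V h)" and ?a' = "asc' (tgt V f) (tgt V g) (tgt V h)"
  have "?a' \<cdot> (f \<otimes>\<^sub>a (g \<otimes>\<^sub>a h)) = ?a' \<cdot> ((f \<otimes>\<^sub>a (g \<otimes>\<^sub>a h)) \<cdot> \<alpha> (src V f) (src V g) (src V h)) \<cdot> ?a"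
    using assms by simp
  also have "\<dots> = ((f \<otimes>\<^sub>a g) \<otimes>\<^sub>a h) \<cdot> ?a"
    unfolding assc_nat[OF assms, symmetric] using assms by simp
  finally show ?thesis .
qed

lemma lun_nat: "f \<in> Arr V \<Longrightarrow> \<lambda>\<^sub>I (tgt V f) \<cdot> (\<one> \<I> \<otimes>\<^sub>a f) = f \<cdot> \<lambda>\<^sub>I (src V f)"
  using lun_natural[OF Hom_self] by auto

lemma run_nat: "f \<in> Arr V \<Longrightarrow> \<rho>\<^sub>I (tgt V f) \<cdot> (f \<otimes>\<^sub>a \<one> \<I>) = f \<cdot> \<rho>\<^sub>I (src V f)"
  using run_natural[OF Hom_self] by auto

lemma sym_nat: "f \<in> Arr V \<Longrightarrow> g \<in> Arr V \<Longrightarrow>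
   \<sigma> (tgt V f) (tgt V g) \<cdot> (f \<otimes>\<^sub>a g) = (g \<otimes>\<^sub>a f) \<cdot> \<sigma> (src V f) (src V g)"
  using sym_natural[OF Hom_self Hom_self] by auto

section \<open>Unit coherence derived from pentagon, triangle and hexagon\<close>

lemma unit_tens_faithful:
  assumes "f \<in> Arr V" "g \<in> Arr V" "src V f = src V g" "tgt V f = tgt V g"
  shows "\<one> \<I> \<otimes>\<^sub>a f = \<one> \<I> \<otimes>\<^sub>a g \<Longrightarrow> f = g" and "f \<otimes>\<^sub>a \<one> \<I> = g \<otimes>\<^sub>a \<one> \<I> \<Longrightarrow> f = g"
proof -
  have o: "src V f \<in> Obj V" using assms by simp
  show "f = g" if "\<one> \<I> \<otimes>\<^sub>a f = \<one> \<I> \<otimes>\<^sub>a g"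
  proof (rule iso_cancel_right[OF lun_iso[OF o]])
    show "f \<cdot> \<lambda>\<^sub>I (src V f) = g \<cdot> \<lambda>\<^sub>I (src V f)"
      using lun_nat[OF assms(1)] lun_nat[OF assms(2)] that assms(3,4) by metis
  qed (use assms o in simp_all)
  show "f = g" if "f \<otimes>\<^sub>a \<one> \<I> = g \<otimes>\<^sub>a \<one> \<I>"
  proof (rule iso_cancel_right[OF run_iso[OF o]])
    show "f \<cdot> \<rho>\<^sub>I (src V f) = g \<cdot> \<rho>\<^sub>I (src V f)"
      using run_nat[OF assms(1)] run_nat[OF assms(2)] that assms(3,4) by metis
  qed (use assms o in simp_all)
qed

lemma triangle': "X \<in> Obj V \<Longrightarrow> Y \<in> Obj V \<Longrightarrow> f \<in> Arr V \<Longrightarrow> tgt V f = (X \<otimes> \<I>) \<otimes> Y \<Longrightarrow>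
   (\<one> X \<otimes>\<^sub>a \<lambda>\<^sub>I Y) \<cdot> (\<alpha> X \<I> Y \<cdot> f) = (\<rho>\<^sub>I X \<otimes>\<^sub>a \<one> Y) \<cdot> f"
  by (simp add: triangle[symmetric])

text \<open>Kelly's argument. The triangle axiom only concerns a unit in the middle, so both sides
  are first tensored with I on the left, which loses nothing by \<open>unit_tens_faithful\<close>;
  the pentagon at I, I, X, Y and two triangles then compare them up to the invertible arrow
  \<open>?p\<close>.\<close>

lemma lun_assc:
  assumes "X \<in> Obj V" "Y \<in> Obj V"
  shows "\<lambda>\<^sub>I (X \<otimes> Y) \<cdot> \<alpha> \<I> X Y = \<lambda>\<^sub>I X \<otimes>\<^sub>a \<one> Y"
proof (rule unit_tens_faithful(1))
  let ?p = "\<alpha> \<I> (\<I> \<otimes> X) Y \<cdot> (\<alpha> \<I> \<I> X \<otimes>\<^sub>a \<one> Y)"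
  have i: "iso_arrow V ?p"
  proof (rule iso_arrowI[where g = "(asc' \<I> \<I> X \<otimes>\<^sub>a \<one> Y) \<cdot> asc' \<I> (\<I> \<otimes> X) Y"])
  qed (use assms in auto)
  have 1: "(\<one> \<I> \<otimes>\<^sub>a (\<lambda>\<^sub>I (X \<otimes> Y) \<cdot> \<alpha> \<I> X Y)) \<cdot> ?p = (\<one> \<I> \<otimes>\<^sub>a \<lambda>\<^sub>I (X \<otimes> Y)) \<cdot> (\<one> \<I> \<otimes>\<^sub>a \<alpha> \<I> X Y) \<cdot> ?p"
    using assms by simp
  also have "\<dots> = (\<one> \<I> \<otimes>\<^sub>a \<lambda>\<^sub>I (X \<otimes> Y)) \<cdot> (\<alpha> \<I> \<I> (X \<otimes> Y) \<cdot> \<alpha> (\<I> \<otimes> \<I>) X Y)"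
    using pentagon[of \<I> \<I> X Y] assms by simp
  also have "\<dots> = (\<rho>\<^sub>I \<I> \<otimes>\<^sub>a (\<one> X \<otimes>\<^sub>a \<one> Y)) \<cdot> \<alpha> (\<I> \<otimes> \<I>) X Y"
    using assms triangle' by simp
  also have "\<dots> = \<alpha> \<I> X Y \<cdot> ((\<rho>\<^sub>I \<I> \<otimes>\<^sub>a \<one> X) \<otimes>\<^sub>a \<one> Y)"
    using assms assc_nat[of "\<rho>\<^sub>I \<I>" "\<one> X" "\<one> Y"] by simp
  also have "\<dots> = \<alpha> \<I> X Y \<cdot> ((\<one> \<I> \<otimes>\<^sub>a \<lambda>\<^sub>I X) \<otimes>\<^sub>a \<one> Y) \<cdot> (\<alpha> \<I> \<I> X \<otimes>\<^sub>a \<one> Y)"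
    using assms by (simp add: triangle)
  also have "\<dots> = (\<alpha> \<I> X Y \<cdot> ((\<one> \<I> \<otimes>\<^sub>a \<lambda>\<^sub>I X) \<otimes>\<^sub>a \<one> Y)) \<cdot> (\<alpha> \<I> \<I> X \<otimes>\<^sub>a \<one> Y)"
    using assms by simp
  also have "\<dots> = (\<one> \<I> \<otimes>\<^sub>a (\<lambda>\<^sub>I X \<otimes>\<^sub>a \<one> Y)) \<cdot> ?p"
    using assms assc_nat[of "\<one> \<I>" "\<lambda>\<^sub>I X" "\<one> Y"] by simp
  finally show "\<one> \<I> \<otimes>\<^sub>a (\<lambda>\<^sub>I (X \<otimes> Y) \<cdot> \<alpha> \<I> X Y) = \<one> \<I> \<otimes>\<^sub>a (\<lambda>\<^sub>I X \<otimes>\<^sub>a \<one> Y)"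
    by (rule iso_cancel_right[OF i, rotated 4])  (use assms in auto)
qed (use assms in auto)

text \<open>Naturality of \<lambda> at itself identifies \<lambda> at I \<otimes> I with 1 \<otimes>
  \<lambda>. Hence \<open>lun_assc\<close> and the triangle evaluate one and the same composite,
  once as \<lambda> \<otimes> 1 and once as \<rho> \<otimes> 1.\<close>

lemma lun_unit_eq: "\<lambda>\<^sub>I \<I> = \<rho>\<^sub>I \<I>"
proof (rule unit_tens_faithful(2))
  have "\<lambda>\<^sub>I (\<I> \<otimes> \<I>) = \<one> \<I> \<otimes>\<^sub>a \<lambda>\<^sub>I \<I>"
    by (rule iso_cancel_left[OF lun_iso[of \<I>]]) (use lun_nat[of "\<lambda>\<^sub>I \<I>"] in auto)
  then show "\<lambda>\<^sub>I \<I> \<otimes>\<^sub>a \<one> \<I> = \<rho>\<^sub>I \<I> \<otimes>\<^sub>a \<one> \<I>"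
    using lun_assc[of \<I> \<I>] triangle[of \<I> \<I>] by simp
qed auto

text \<open>After tensoring with I on the right, the hexagon at X, I, I together with naturality of
  \<lambda> makes \<open>\<lambda>\<^sub>I X \<cdot> \<sigma> X \<I>\<close> appear as a left factor
  on both sides. It is invertible and can be cancelled.\<close>

lemma lun_sym:
  assumes "X \<in> Obj V" shows "\<lambda>\<^sub>I X \<cdot> \<sigma> X \<I> = \<rho>\<^sub>I X"
proof (rule unit_tens_faithful(2))
  have i: "iso_arrow V (\<lambda>\<^sub>I X \<cdot> \<sigma> X \<I>)"
    by (rule iso_arrowI[where g = "\<sigma> \<I> X \<cdot> lun' X"]) (use assms in auto)
  have "(\<lambda>\<^sub>I X \<cdot> \<sigma> X \<I>) \<cdot> (\<rho>\<^sub>I X \<otimes>\<^sub>a \<one> \<I>) = \<lambda>\<^sub>I X \<cdot> (\<sigma> X \<I> \<cdot> (\<one> X \<otimes>\<^sub>a \<lambda>\<^sub>I \<I>)) \<cdot> \<alpha> X \<I> \<I>"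
    using assms by (simp add: triangle)
  also have "\<dots> = \<lambda>\<^sub>I X \<cdot> (\<one> \<I> \<otimes>\<^sub>a \<lambda>\<^sub>I X) \<cdot> (\<alpha> \<I> \<I> X \<cdot> \<sigma> X (\<I> \<otimes> \<I>) \<cdot> \<alpha> X \<I> \<I>)"
    using assms sym_nat[of "\<one> X" "\<lambda>\<^sub>I \<I>"] triangle'[of \<I> X] by (simp add: lun_unit_eq)
  also have "\<dots> = (\<lambda>\<^sub>I X \<cdot> (\<one> \<I> \<otimes>\<^sub>a (\<lambda>\<^sub>I X \<cdot> \<sigma> X \<I>))) \<cdot> \<alpha> \<I> X \<I> \<cdot> (\<sigma> X \<I> \<otimes>\<^sub>a \<one> \<I>)"
    using assms hexagon[of X \<I> \<I>] by simp
  also have "\<dots> = (\<lambda>\<^sub>I X \<cdot> \<sigma> X \<I>) \<cdot> (\<lambda>\<^sub>I (X \<otimes> \<I>) \<cdot> \<alpha> \<I> X \<I>) \<cdot> (\<sigma> X \<I> \<otimes>\<^sub>a \<one> \<I>)"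
    using assms lun_nat[of "\<lambda>\<^sub>I X \<cdot> \<sigma> X \<I>"] by simp
  also have "\<dots> = (\<lambda>\<^sub>I X \<cdot> \<sigma> X \<I>) \<cdot> ((\<lambda>\<^sub>I X \<cdot> \<sigma> X \<I>) \<otimes>\<^sub>a \<one> \<I>)"
    unfolding lun_assc[OF assms unitO_in_Obj] using assms by simp
  finally show "(\<lambda>\<^sub>I X \<cdot> \<sigma> X \<I>) \<otimes>\<^sub>a \<one> \<I> = \<rho>\<^sub>I X \<otimes>\<^sub>a \<one> \<I>"
    by (rule iso_cancel_left[OF i, rotated 4, THEN HOL.sym])  (use assms in auto)
qed (use assms in auto)

lemma run_sym: "X \<in> Obj V \<Longrightarrow> \<rho>\<^sub>I X \<cdot> \<sigma> \<I> X = \<lambda>\<^sub>I X"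
  using lun_sym[of X, symmetric] by simp

text \<open>The elementary transposition in a right-nested product X \<otimes> (Y \<otimes> D). The
  tail D is carried along because lists of wires are interpreted as right-nested products, so that
  two neighbours are always exchanged in front of a remainder.\<close>

definition swap :: "'o \<Rightarrow> 'o \<Rightarrow> 'o \<Rightarrow> 'a" where
  "swap X Y D = \<alpha> Y X D \<cdot> (\<sigma> X Y \<otimes>\<^sub>a \<one> D) \<cdot> asc' X Y D"

lemma swap_simps [simp]:
  assumes "X \<in> Obj V" "Y \<in> Obj V" "D \<in> Obj V"
  shows "swap X Y D \<in> Arr V" "src V (swap X Y D) = X \<otimes> (Y \<otimes> D)" "tgt V (swap X Y D) = Y \<otimes> (X \<otimes> D)"
  using assms by (auto simp: swap_def)

lemma swap_nat:
  assumes "f \<in> Arr V" "g \<in> Arr V" "h \<in> Arr V"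
  shows "swap (tgt V f) (tgt V g) (tgt V h) \<cdot> (f \<otimes>\<^sub>a (g \<otimes>\<^sub>a h)) =
    (g \<otimes>\<^sub>a (f \<otimes>\<^sub>a h)) \<cdot> swap (src V f) (src V g) (src V h)"
proof -
  let ?a = "asc' (src V f) (src V g) (src V h)" and ?b = "\<alpha> (tgt V g) (tgt V f) (tgt V h)"
  have "swap (tgt V f) (tgt V g) (tgt V h) \<cdot> (f \<otimes>\<^sub>a (g \<otimes>\<^sub>a h)) =
    ?b \<cdot> ((\<sigma> (tgt V f) (tgt V g) \<cdot> (f \<otimes>\<^sub>a g)) \<otimes>\<^sub>a h) \<cdot> ?a"
    unfolding swap_def using assms asc'_nat[OF assms] by simp
  also have "\<dots> = (?b \<cdot> ((g \<otimes>\<^sub>a f) \<otimes>\<^sub>a h)) \<cdot> (\<sigma> (src V f) (src V g) \<otimes>\<^sub>a \<one> (src V h)) \<cdot> ?a"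
    using assms by (simp add: sym_nat)
  also have "\<dots> = (g \<otimes>\<^sub>a (f \<otimes>\<^sub>a h)) \<cdot> swap (src V f) (src V g) (src V h)"
    unfolding swap_def assc_nat[OF assms(2,1,3)] using assms by simp
  finally show ?thesis .
qed

lemma swap_swap [simp]:
  assumes "X \<in> Obj V" "Y \<in> Obj V" "D \<in> Obj V"
  shows "swap Y X D \<cdot> swap X Y D = \<one> (X \<otimes> (Y \<otimes> D))"
    "f \<in> Arr V \<Longrightarrow> tgt V f = X \<otimes> (Y \<otimes> D) \<Longrightarrow> swap Y X D \<cdot> (swap X Y D \<cdot> f) = f"
  using assms by (auto simp: swap_def)

text \<open>This is the hexagon in the presence of a tail D. Pentagons rearrange the brackets around
  it, and precomposition with the invertible arrow \<open>?p\<close> gives both sides a common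
  source.\<close>

lemma swap_tens_right:
  assumes "X \<in> Obj V" "Y \<in> Obj V" "Z \<in> Obj V" "D \<in> Obj V"
  shows "\<alpha> X Y (Z \<otimes> D) \<cdot> swap Z (X \<otimes> Y) D = (\<one> X \<otimes>\<^sub>a swap Z Y D) \<cdot> swap Z X (Y \<otimes> D) \<cdot> (\<one> Z \<otimes>\<^sub>a \<alpha> X Y D)"
proof -
  let ?p = "\<alpha> Z (X \<otimes> Y) D \<cdot> (\<alpha> Z X Y \<otimes>\<^sub>a \<one> D)"
  have i: "iso_arrow V ?p"
    by (rule iso_arrowI[where g = "(asc' Z X Y \<otimes>\<^sub>a \<one> D) \<cdot> asc' Z (X \<otimes> Y) D"]) (use assms in auto)
  have "(\<alpha> X Y (Z \<otimes> D) \<cdot> swap Z (X \<otimes> Y) D) \<cdot> ?p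
      = (\<alpha> X Y (Z \<otimes> D) \<cdot> \<alpha> (X \<otimes> Y) Z D) \<cdot> ((\<sigma> Z (X \<otimes> Y) \<cdot> \<alpha> Z X Y) \<otimes>\<^sub>a \<one> D)"
    unfolding swap_def using assms by simp
  also have "\<dots> = (\<one> X \<otimes>\<^sub>a \<alpha> Y Z D) \<cdot> \<alpha> X (Y \<otimes> Z) D \<cdot> ((\<alpha> X Y Z \<cdot> \<sigma> Z (X \<otimes> Y) \<cdot> \<alpha> Z X Y) \<otimes>\<^sub>a \<one> D)"
    unfolding pentagon[OF assms, symmetric] using assms by simp
  also have "\<dots> = (\<one> X \<otimes>\<^sub>a \<alpha> Y Z D) \<cdot> \<alpha> X (Y \<otimes> Z) D \<cdot> (((\<one> X \<otimes>\<^sub>a \<sigma> Z Y) \<cdot> \<alpha> X Z Y \<cdot> (\<sigma> Z X \<otimes>\<^sub>a \<one> Y)) \<otimes>\<^sub>a \<one> D)"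
    unfolding hexagon[OF assms(3,1,2)] ..
  also have "\<dots> = (\<one> X \<otimes>\<^sub>a \<alpha> Y Z D) \<cdot> (\<alpha> X (Y \<otimes> Z) D \<cdot> ((\<one> X \<otimes>\<^sub>a \<sigma> Z Y) \<otimes>\<^sub>a \<one> D)) \<cdot> (\<alpha> X Z Y \<otimes>\<^sub>a \<one> D) \<cdot> ((\<sigma> Z X \<otimes>\<^sub>a \<one> Y) \<otimes>\<^sub>a \<one> D)"
    using assms by simp
  also have "\<dots> = (\<one> X \<otimes>\<^sub>a \<alpha> Y Z D) \<cdot> (\<one> X \<otimes>\<^sub>a (\<sigma> Z Y \<otimes>\<^sub>a \<one> D)) \<cdot> (\<one> X \<otimes>\<^sub>a asc' Z Y D) \<cdot>
     ((\<one> X \<otimes>\<^sub>a \<alpha> Z Y D) \<cdot> \<alpha> X (Z \<otimes> Y) D \<cdot> (\<alpha> X Z Y \<otimes>\<^sub>a \<one> D)) \<cdot> ((\<sigma> Z X \<otimes>\<^sub>a \<one> Y) \<otimes>\<^sub>a \<one> D)"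
    using assms assc_nat[of "\<one> X" "\<sigma> Z Y" "\<one> D"] by simp
  also have "\<dots> = (\<one> X \<otimes>\<^sub>a swap Z Y D) \<cdot> \<alpha> X Z (Y \<otimes> D) \<cdot> (\<alpha> (X \<otimes> Z) Y D \<cdot> ((\<sigma> Z X \<otimes>\<^sub>a \<one> Y) \<otimes>\<^sub>a \<one> D))"
    unfolding pentagon[OF assms(1,3,2,4)] using assms by (simp add: swap_def)
  also have "\<dots> = (\<one> X \<otimes>\<^sub>a swap Z Y D) \<cdot> swap Z X (Y \<otimes> D) \<cdot> (\<alpha> Z X (Y \<otimes> D) \<cdot> \<alpha> (Z \<otimes> X) Y D)"
    using assms assc_nat[of "\<sigma> Z X" "\<one> Y" "\<one> D"] by (simp add: swap_def)
  also have "\<dots> = ((\<one> X \<otimes>\<^sub>a swap Z Y D) \<cdot> swap Z X (Y \<otimes> D) \<cdot> (\<one> Z \<otimes>\<^sub>a \<alpha> X Y D)) \<cdot> ?p"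
    unfolding pentagon[OF assms(3,1,2,4), symmetric] using assms by simp
  finally show ?thesis
    by (rule iso_cancel_right[OF i, rotated 4])  (use assms in auto)
qed

lemma swap_tens_left:
  assumes "X \<in> Obj V" "Y \<in> Obj V" "Z \<in> Obj V" "D \<in> Obj V"
  shows "(\<one> Z \<otimes>\<^sub>a \<alpha> X Y D) \<cdot> swap (X \<otimes> Y) Z D = swap X Z (Y \<otimes> D) \<cdot> (\<one> X \<otimes>\<^sub>a swap Y Z D) \<cdot> \<alpha> X Y (Z \<otimes> D)"
proof -
  have "swap X Z (Y \<otimes> D) \<cdot> (\<one> X \<otimes>\<^sub>a swap Y Z D) \<cdot> (\<alpha> X Y (Z \<otimes> D) \<cdot> swap Z (X \<otimes> Y) D) \<cdot> swap (X \<otimes> Y) Z D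
     = (\<one> Z \<otimes>\<^sub>a \<alpha> X Y D) \<cdot> swap (X \<otimes> Y) Z D"
    unfolding swap_tens_right[OF assms] using assms by simp
  then show ?thesis using assms by simp
qed

lemma swap_unit:
  assumes "X \<in> Obj V" "D \<in> Obj V"
  shows "(\<one> X \<otimes>\<^sub>a \<lambda>\<^sub>I D) \<cdot> swap \<I> X D = \<lambda>\<^sub>I (X \<otimes> D)"
proof -
  have "(\<one> X \<otimes>\<^sub>a \<lambda>\<^sub>I D) \<cdot> swap \<I> X D = ((\<rho>\<^sub>I X \<cdot> \<sigma> \<I> X) \<otimes>\<^sub>a \<one> D) \<cdot> asc' \<I> X D"
    unfolding swap_def using assms triangle' by simp
  then show ?thesis unfolding run_sym[OF assms(1)] lun_assc[OF assms, symmetric] using assms by simp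
qed

text \<open>The Yang-Baxter relation. It is naturality of the swap of the compound factor X
  \<otimes> Y with Z, applied to the symmetry of X and Y, once \<open>swap_tens_left\<close> has
  split the compound swaps.\<close>

lemma swap_braid:
  assumes "X \<in> Obj V" "Y \<in> Obj V" "Z \<in> Obj V" "D \<in> Obj V"
  shows "(\<one> Z \<otimes>\<^sub>a swap X Y D) \<cdot> swap X Z (Y \<otimes> D) \<cdot> (\<one> X \<otimes>\<^sub>a swap Y Z D)
       = swap Y Z (X \<otimes> D) \<cdot> (\<one> Y \<otimes>\<^sub>a swap X Z D) \<cdot> swap X Y (Z \<otimes> D)"
proof -
  have "((\<one> Z \<otimes>\<^sub>a swap X Y D) \<cdot> swap X Z (Y \<otimes> D) \<cdot> (\<one> X \<otimes>\<^sub>a swap Y Z D)) \<cdot> \<alpha> X Y (Z \<otimes> D)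
    = (\<one> Z \<otimes>\<^sub>a swap X Y D) \<cdot> ((\<one> Z \<otimes>\<^sub>a \<alpha> X Y D) \<cdot> swap (X \<otimes> Y) Z D)"
    unfolding swap_tens_left[OF assms] using assms by simp
  also have "\<dots> = (\<one> Z \<otimes>\<^sub>a \<alpha> Y X D) \<cdot> (\<one> Z \<otimes>\<^sub>a (\<sigma> X Y \<otimes>\<^sub>a \<one> D)) \<cdot> swap (X \<otimes> Y) Z D"
    using assms by (simp add: swap_def)
  also have "\<dots> = ((\<one> Z \<otimes>\<^sub>a \<alpha> Y X D) \<cdot> swap (Y \<otimes> X) Z D) \<cdot> (\<sigma> X Y \<otimes>\<^sub>a \<one> (Z \<otimes> D))"
    using assms swap_nat[of "\<sigma> X Y" "\<one> Z" "\<one> D"] by simp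
  also have "\<dots> = (swap Y Z (X \<otimes> D) \<cdot> (\<one> Y \<otimes>\<^sub>a swap X Z D) \<cdot> swap X Y (Z \<otimes> D)) \<cdot> \<alpha> X Y (Z \<otimes> D)"
    unfolding swap_tens_left[OF assms(2,1,3,4)] using assms by (simp add: swap_def)
  finally show ?thesis
    by (rule iso_cancel_right[OF assc_iso, rotated 7])  (use assms in auto)
qed

end

section \<open>Named wires\<close>

text \<open>The number is the name of a wire and the object is its type. Both belong to its
  identity, so \<open>(9, X)\<close> and \<open>(9, Y)\<close> are different wires when X and Y
  differ. The numerals in later statements are arbitrary; only their distinctness matters.\<close>

type_synonym 'x wire = "nat \<times> 'x"

context symmetric_monoidal_closed_category
begin

lemma Hom_iff [simp]: "f \<in> Hom V X Y \<longleftrightarrow> f \<in> Arr V \<and> src V f = X \<and> tgt V f = Y"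
  by (auto simp: Hom_def)

text \<open>The tail \<open>D\<close> stands for whatever follows the listed wires. It turns
  concatenation of lists into composition of functions, and it allows an operation on the first
  wires to be a family natural in the rest.\<close>

fun TT :: "'o wire list \<Rightarrow> 'o \<Rightarrow> 'o" where
  "TT [] D = D"
| "TT (x # xs) D = snd x \<otimes> TT xs D"

fun TA :: "'o wire list \<Rightarrow> 'a \<Rightarrow> 'a" where
  "TA [] h = h"
| "TA (x # xs) h = \<one> (snd x) \<otimes>\<^sub>a TA xs h"

abbreviation "T xs \<equiv> TT xs \<I>"

definition wf :: "'o wire list \<Rightarrow> bool" where
  "wf xs \<longleftrightarrow> snd ` set xs \<subseteq> Obj V"

lemma wf_simps [simp]: "wf []" "wf (x # xs) \<longleftrightarrow> snd x \<in> Obj V \<and> wf xs" "wf (xs @ ys) \<longleftrightarrow> wf xs \<and> wf ys"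
  by (auto simp: wf_def)

lemma wf_cong: "set xs = set ys \<Longrightarrow> wf xs \<longleftrightarrow> wf ys"
  by (simp add: wf_def)

lemma TT_append [simp]: "TT (xs @ ys) D = TT xs (TT ys D)"
  by (induction xs) auto

lemma TT_Obj [simp]: "wf xs \<Longrightarrow> D \<in> Obj V \<Longrightarrow> TT xs D \<in> Obj V"
  by (induction xs) auto

lemma TA_simps [simp]:
  assumes "wf xs" "h \<in> Arr V"
  shows "TA xs h \<in> Arr V" "src V (TA xs h) = TT xs (src V h)" "tgt V (TA xs h) = TT xs (tgt V h)"
  using assms by (induction xs) auto

text \<open>Words in adjacent transpositions, together with the arrows they denote. Nothing here
  says that two words for the same permutation denote the same arrow; that is the coherence theorem
  \<open>can_unique\<close>.\<close>

inductive pa :: "'o wire list \<Rightarrow> 'o wire list \<Rightarrow> 'a \<Rightarrow> bool" where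
  nil: "pa [] [] (\<one> \<I>)"
| cons: "pa xs ys f \<Longrightarrow> snd x \<in> Obj V \<Longrightarrow> pa (x # xs) (x # ys) (\<one> (snd x) \<otimes>\<^sub>a f)"
| swap: "wf (x # y # xs) \<Longrightarrow> pa (x # y # xs) (y # x # xs) (swap (snd x) (snd y) (T xs))"
| trans: "pa xs ys f \<Longrightarrow> pa ys zs g \<Longrightarrow> pa xs zs (g \<cdot> f)"

lemma pa_simps:
  assumes "pa xs ys f"
  shows "f \<in> Arr V" "src V f = T xs" "tgt V f = T ys" "wf xs" "wf ys" "set ys = set xs" "distinct ys \<longleftrightarrow> distinct xs"
  using assms by (induction rule: pa.induct) auto

lemma pa_refl: "wf xs \<Longrightarrow> pa xs xs (\<one> (T xs))"
proof (induction xs)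
  case (Cons x xs)
  then show ?case using pa.cons[of xs xs "\<one> (T xs)" x] by simp
qed (auto intro: pa.nil)

lemma pa_TA: "pa xs ys f \<Longrightarrow> wf zs \<Longrightarrow> pa (zs @ xs) (zs @ ys) (TA zs f)"
  by (induction zs) (auto intro: pa.cons)

text \<open>Bubbles the wire \<open>y\<close> to the front by transpositions and keeps the order of
  the others. The value for an absent \<open>y\<close> carries no meaning; membership is assumed
  wherever \<open>ext\<close> is used.\<close>

fun ext :: "'o wire \<Rightarrow> 'o wire list \<Rightarrow> 'a" where
  "ext y [] = \<one> \<I>"
| "ext y (x # xs) = (if x = y then \<one> (T (x # xs))
     else swap (snd x) (snd y) (T (remove1 y xs)) \<cdot> (\<one> (snd x) \<otimes>\<^sub>a ext y xs))"

lemma wf_remove1 [simp]: "wf xs \<Longrightarrow> wf (remove1 y xs)"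
  using set_remove1_subset[of y xs] by (auto simp: wf_def)

lemma pa_ext: "y \<in> set xs \<Longrightarrow> wf xs \<Longrightarrow> pa xs (y # remove1 y xs) (ext y xs)"
proof (induction xs)
  case (Cons x xs)
  show ?case
  proof (cases "x = y")
    case True
    then show ?thesis using Cons pa_refl[of "x # xs"] by simp
  next
    case False
    then have y: "y \<in> set xs" using Cons.prems by auto
    then have "snd y \<in> Obj V" using Cons.prems by (auto simp: wf_def)
    then show ?thesis using Cons False y
      by (auto intro!: pa.trans[OF pa.cons pa.swap])
  qed
qed simp

lemma ext_simps [simp]:
  assumes "y \<in> set xs" "wf xs"
  shows "ext y xs \<in> Arr V" "src V (ext y xs) = T xs" "tgt V (ext y xs) = snd y \<otimes> T (remove1 y xs)"
  using pa_simps[OF pa_ext[OF assms]] by auto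

text \<open>A transposition that moves \<open>y\<close> is absorbed into the bubbling or cancels
  against it, and one that exchanges two other wires passes through by the braid relation. So a word
  acts on the remaining wires alone once \<open>y\<close> stands in front, which is what the
  induction in \<open>can_pa\<close> needs.\<close>

lemma pa_ext_natural:
  assumes "pa xs zs f" "distinct xs" "y \<in> set xs"
  shows "\<exists>f'. pa (remove1 y xs) (remove1 y zs) f' \<and> ext y zs \<cdot> f = (\<one> (snd y) \<otimes>\<^sub>a f') \<cdot> ext y xs"
  using assms
proof (induction rule: pa.induct)
  case nil
  then show ?case by simp
next
  case (cons xs ys f x)
  note f = pa_simps[OF cons.hyps(1)]
  show ?case
  proof (cases "x = y")
    case True
    then show ?thesis using cons f by auto
  next
    case False
    then have y: "y \<in> set xs" "y \<in> set ys" "snd y \<in> Obj V" using cons.prems f by (auto simp: wf_def)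
    obtain f' where f': "pa (remove1 y xs) (remove1 y ys) f'" "ext y ys \<cdot> f = (\<one> (snd y) \<otimes>\<^sub>a f') \<cdot> ext y xs"
      using cons y by auto
    note t = pa_simps[OF f'(1)]
    have n: "swap (snd x) (snd y) (T (remove1 y ys)) \<cdot> (\<one> (snd x) \<otimes>\<^sub>a (\<one> (snd y) \<otimes>\<^sub>a f')) =
      (\<one> (snd y) \<otimes>\<^sub>a (\<one> (snd x) \<otimes>\<^sub>a f')) \<cdot> swap (snd x) (snd y) (T (remove1 y xs))"
      using swap_nat[of "\<one> (snd x)" "\<one> (snd y)" f'] t cons.hyps y by simp
    have "ext y (x # ys) \<cdot> (\<one> (snd x) \<otimes>\<^sub>a f) =
      swap (snd x) (snd y) (T (remove1 y ys)) \<cdot> (\<one> (snd x) \<otimes>\<^sub>a (ext y ys \<cdot> f))"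
      using False y f cons.hyps by simp
    also have "\<dots> = (swap (snd x) (snd y) (T (remove1 y ys)) \<cdot> (\<one> (snd x) \<otimes>\<^sub>a (\<one> (snd y) \<otimes>\<^sub>a f'))) \<cdot> (\<one> (snd x) \<otimes>\<^sub>a ext y xs)"
      unfolding f'(2) using y t f cons.hyps by simp
    also have "\<dots> = (\<one> (snd y) \<otimes>\<^sub>a (\<one> (snd x) \<otimes>\<^sub>a f')) \<cdot> ext y (x # xs)"
      unfolding n using y t f cons.hyps False by simp
    finally show ?thesis using False pa.cons[OF f'(1) cons.hyps(2)] by (intro exI) auto
  qed
next
  case (swap a b xs)
  then have o: "snd a \<in> Obj V" "snd b \<in> Obj V" "wf xs" "a \<noteq> b" by auto
  consider "y = a" | "y = b" | "y \<noteq> a" "y \<noteq> b" "y \<in> set xs" using swap by auto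
  then show ?case
  proof cases
    case 1
    then show ?thesis using o pa_refl[of "b # xs"] by (intro exI[of _ "\<one> (T (b # xs))"]) simp
  next
    case 2
    then show ?thesis using o pa_refl[of "a # xs"] by (intro exI[of _ "\<one> (T (a # xs))"]) simp
  next
    case 3
    let ?r = "remove1 y xs" and ?A = "snd a" and ?B = "snd b" and ?Y = "snd y"
    have y: "?Y \<in> Obj V" using 3 o by (auto simp: wf_def)
    have n: "(\<one> ?B \<otimes>\<^sub>a (\<one> ?A \<otimes>\<^sub>a ext y xs)) \<cdot> swap ?A ?B (T xs) =
        swap ?A ?B (?Y \<otimes> T ?r) \<cdot> (\<one> ?A \<otimes>\<^sub>a (\<one> ?B \<otimes>\<^sub>a ext y xs))"
      using swap_nat[of "\<one> ?A" "\<one> ?B" "ext y xs"] o y 3 by simp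
    have "ext y (b # a # xs) \<cdot> swap ?A ?B (T xs)
      = swap ?B ?Y (?A \<otimes> T ?r) \<cdot> (\<one> ?B \<otimes>\<^sub>a swap ?A ?Y (T ?r)) \<cdot> ((\<one> ?B \<otimes>\<^sub>a (\<one> ?A \<otimes>\<^sub>a ext y xs)) \<cdot> swap ?A ?B (T xs))"
      using o y 3 by simp
    also have "\<dots> = (swap ?B ?Y (?A \<otimes> T ?r) \<cdot> (\<one> ?B \<otimes>\<^sub>a swap ?A ?Y (T ?r)) \<cdot> swap ?A ?B (?Y \<otimes> T ?r)) \<cdot> (\<one> ?A \<otimes>\<^sub>a (\<one> ?B \<otimes>\<^sub>a ext y xs))"
      unfolding n using o y 3 by simp
    also have "\<dots> = (\<one> ?Y \<otimes>\<^sub>a swap ?A ?B (T ?r)) \<cdot> ext y (a # b # xs)"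
      unfolding swap_braid[OF o(1,2) y TT_Obj[OF wf_remove1[OF o(3)] unitO_in_Obj], symmetric]
      using o y 3 by simp
    finally show ?thesis using 3 o pa.swap[of a b ?r] by (intro exI) auto
  qed
next
  case (trans xs ys f zs g)
  note f = pa_simps[OF trans.hyps(1)] and g = pa_simps[OF trans.hyps(2)]
  obtain f' where f': "pa (remove1 y xs) (remove1 y ys) f'" "ext y ys \<cdot> f = (\<one> (snd y) \<otimes>\<^sub>a f') \<cdot> ext y xs"
    using trans by auto
  obtain g' where g': "pa (remove1 y ys) (remove1 y zs) g'" "ext y zs \<cdot> g = (\<one> (snd y) \<otimes>\<^sub>a g') \<cdot> ext y ys"
    using trans f by auto
  note tf = pa_simps[OF f'(1)] and tg = pa_simps[OF g'(1)]
  have y: "y \<in> set xs" "y \<in> set ys" "y \<in> set zs" "snd y \<in> Obj V" using trans.prems f g by (auto simp: wf_def)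
  have "ext y zs \<cdot> (g \<cdot> f) = (ext y zs \<cdot> g) \<cdot> f" using f g y by simp
  also have "\<dots> = (\<one> (snd y) \<otimes>\<^sub>a g') \<cdot> (ext y ys \<cdot> f)" unfolding g'(2) using f g y tg by simp
  also have "\<dots> = (\<one> (snd y) \<otimes>\<^sub>a (g' \<cdot> f')) \<cdot> ext y xs" unfolding f'(2) using f g y tg tf by simp
  finally show ?case using pa.trans[OF f'(1) g'(1)] by auto
qed

text \<open>Selection sort: the wires of the target list are extracted from the source one after the
  other. The recursion on the target fits \<open>pa_ext_natural\<close>, which treats one extracted
  wire at a time.\<close>

fun can :: "'o wire list \<Rightarrow> 'o wire list \<Rightarrow> 'a" where
  "can xs [] = \<one> \<I>"
| "can xs (y # ys) = (\<one> (snd y) \<otimes>\<^sub>a can (remove1 y xs) ys) \<cdot> ext y xs"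

lemma pa_can: "wf xs \<Longrightarrow> distinct xs \<Longrightarrow> distinct ys \<Longrightarrow> set xs = set ys \<Longrightarrow> pa xs ys (can xs ys)"
proof (induction ys arbitrary: xs)
  case Nil
  then show ?case by (auto intro: pa.nil)
next
  case (Cons y ys)
  have "pa (remove1 y xs) ys (can (remove1 y xs) ys)"
    using Cons.prems by (intro Cons.IH) auto
  then show ?case using Cons.prems pa_ext[of y xs] by (auto intro!: pa.trans pa.cons simp: wf_def)
qed

lemma can_simps [simp]:
  assumes "wf xs" "distinct xs" "distinct ys" "set xs = set ys"
  shows "can xs ys \<in> Arr V" "src V (can xs ys) = T xs" "tgt V (can xs ys) = T ys"
  using pa_simps[OF pa_can[OF assms]] by auto

text \<open>The first target wire is peeled off with \<open>pa_ext_natural\<close>, and the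
  induction hypothesis treats the rest. Distinctness of the wires is essential: with repeated names,
  the symmetry of X \<otimes> X and the identity would connect the same lists. The case
  \<open>ys = zs\<close> is the coherence theorem \<open>can_unique\<close>.\<close>

lemma can_pa:
  assumes "pa xs zs f" "distinct xs" "distinct ys" "set ys = set xs"
  shows "can zs ys \<cdot> f = can xs ys"
  using assms
proof (induction ys arbitrary: xs zs f)
  case Nil
  \<comment> \<open>With no wires left, every word is a composite of identities of the unit
    object.\<close>
  have "pa xs zs f \<Longrightarrow> xs = [] \<Longrightarrow> f = \<one> \<I>" for xs zs f
  proof (induction rule: pa.induct)
    case (trans xs ys f zs g)
    then have "ys = []" using pa_simps[OF trans.hyps(1)] by auto
    then have "f = \<one> \<I>" "g = \<one> \<I>" using trans by auto
    then show ?case by simp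
  qed auto
  then have "f = \<one> \<I>" using Nil by simp
  then show ?case by simp
next
  case (Cons y ys)
  note f = pa_simps[OF Cons.prems(1)]
  have y: "y \<in> set xs" "y \<in> set zs" "snd y \<in> Obj V" using Cons.prems f by (auto simp: wf_def)
  obtain f' where f': "pa (remove1 y xs) (remove1 y zs) f'" "ext y zs \<cdot> f = (\<one> (snd y) \<otimes>\<^sub>a f') \<cdot> ext y xs"
    using pa_ext_natural[OF Cons.prems(1,2) y(1)] by auto
  note t = pa_simps[OF f'(1)]
  have s: "set (remove1 y zs) = set ys" "set (remove1 y xs) = set ys" "distinct ys" "distinct zs" using Cons.prems f by auto
  have IH: "can (remove1 y zs) ys \<cdot> f' = can (remove1 y xs) ys"
    using Cons.prems s by (intro Cons.IH[OF f'(1)]) auto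
  have "can zs (y # ys) \<cdot> f = (\<one> (snd y) \<otimes>\<^sub>a can (remove1 y zs) ys) \<cdot> (ext y zs \<cdot> f)"
    using f y s Cons.prems by simp
  also have "\<dots> = (\<one> (snd y) \<otimes>\<^sub>a (can (remove1 y zs) ys \<cdot> f')) \<cdot> ext y xs"
    unfolding f'(2) using f t y s Cons.prems by simp
  finally show ?case using IH by simp
qed

lemma can_self [simp]: "wf xs \<Longrightarrow> distinct xs \<Longrightarrow> can xs xs = \<one> (T xs)"
  by (induction xs) auto

lemma can_unique: "pa xs zs f \<Longrightarrow> distinct xs \<Longrightarrow> f = can xs zs"
  using can_pa[of xs zs f zs] pa_simps[of xs zs f] by simp

lemma can_can [simp]:
  assumes "wf xs" "distinct xs" "distinct ys" "distinct zs" "set xs = set ys" "set ys = set zs"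
  shows "can ys zs \<cdot> can xs ys = can xs zs"
    "f \<in> Arr V \<Longrightarrow> tgt V f = T xs \<Longrightarrow> can ys zs \<cdot> (can xs ys \<cdot> f) = can xs zs \<cdot> f"
proof -
  have w: "wf ys" using assms wf_cong by blast
  show 1: "can ys zs \<cdot> can xs ys = can xs zs"
    using can_pa[OF pa_can[of xs ys]] assms by simp
  show "can ys zs \<cdot> (can xs ys \<cdot> f) = can xs zs \<cdot> f" if "f \<in> Arr V" "tgt V f = T xs"
    using 1 cmp_assoc'[of f "can xs ys" "can ys zs"] that assms w by simp
qed

text \<open>
  A pair \<open>K = (\<Gamma>, f)\<close> with \<open>val K\<close> is an arrow \<open>f\<close> out of the tensor product of a finite set \<open>\<Gamma>\<close> of
  named wires. The order of the factors is immaterial: \<open>mk xs f\<close> reads \<open>f\<close> in the order \<open>xs\<close>,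
  and all orders are identified through the canonical symmetries \<open>can\<close>.
\<close>

definition enum :: "'o wire set \<Rightarrow> 'o wire list" where
  "enum \<Gamma> = (SOME xs. distinct xs \<and> set xs = \<Gamma>)"

lemma enum [simp]:
  assumes "finite \<Gamma>" shows "distinct (enum \<Gamma>)" "set (enum \<Gamma>) = \<Gamma>"
  using finite_distinct_list[OF assms] someI_ex[of "\<lambda>xs. distinct xs \<and> set xs = \<Gamma>"]
  unfolding enum_def by auto

definition mk :: "'o wire list \<Rightarrow> 'a \<Rightarrow> 'o wire set \<times> 'a" where
  "mk xs f = (set xs, f \<cdot> can (enum (set xs)) xs)"

definition val :: "'o wire set \<times> 'a \<Rightarrow> bool" where
  "val K \<longleftrightarrow> finite (fst K) \<and> wf (enum (fst K)) \<and> snd K \<in> Arr V \<and> src V (snd K) = T (enum (fst K))"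

lemma wf_enum [simp]: "wf (enum (set xs)) \<longleftrightarrow> wf xs"
  by (simp add: wf_def)

lemma fst_mk [simp]: "fst (mk xs f) = set xs"
  by (simp add: mk_def)

lemma val_mk [simp]: "distinct xs \<Longrightarrow> wf xs \<Longrightarrow> f \<in> Arr V \<Longrightarrow> src V f = T xs \<Longrightarrow> val (mk xs f)"
  by (simp add: val_def mk_def)

lemma mk_can:
  assumes "distinct xs" "distinct ys" "set ys = set xs" "wf xs" "f \<in> Arr V" "src V f = T ys"
  shows "mk xs (f \<cdot> can xs ys) = mk ys f"
  unfolding mk_def using assms by simp

lemma mk_pa:
  assumes "pa xs ys g" "distinct xs" "f \<in> Arr V" "src V f = T ys"
  shows "mk xs (f \<cdot> g) = mk ys f"
  using mk_can[of xs ys f] can_unique[OF assms(1,2)] pa_simps[OF assms(1)] assms by simp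

lemma mk_inject:
  assumes "mk xs f = mk xs g" "distinct xs" "wf xs" "f \<in> Arr V" "src V f = T xs" "g \<in> Arr V" "src V g = T xs"
  shows "f = g"
proof -
  let ?c = "can (enum (set xs)) xs" and ?d = "can xs (enum (set xs))"
  have "(f \<cdot> ?c) \<cdot> ?d = (g \<cdot> ?c) \<cdot> ?d" using assms(1) by (simp add: mk_def)
  then show ?thesis using assms(2-) by simp
qed

lemma val_mk_ex:
  assumes "val K" "distinct xs" "set xs \<subseteq> fst K"
  obtains ds k where "distinct (xs @ ds)" "wf (xs @ ds)" "k \<in> Arr V" "src V k = T (xs @ ds)" "K = mk (xs @ ds) k"
proof -
  obtain \<Gamma> f where K: "K = (\<Gamma>, f)" by (cases K)
  have v: "finite \<Gamma>" "wf (enum \<Gamma>)" "f \<in> Arr V" "src V f = T (enum \<Gamma>)" using assms(1) K by (auto simp: val_def)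
  let ?ds = "enum (\<Gamma> - set xs)"
  have d: "distinct (xs @ ?ds)" "set (xs @ ?ds) = \<Gamma>" using v assms K by auto
  then have w: "wf (xs @ ?ds)" using v wf_cong[of "xs @ ?ds" "enum \<Gamma>"] by simp
  have "K = mk (xs @ ?ds) (f \<cdot> can (xs @ ?ds) (enum \<Gamma>))"
    unfolding mk_def d(2) K using v d w by simp
  then show ?thesis using that[of ?ds "f \<cdot> can (xs @ ?ds) (enum \<Gamma>)"] d w v by simp
qed

section \<open>Operations that touch only some of the wires\<close>

fun mv :: "'o \<Rightarrow> 'o wire list \<Rightarrow> 'o \<Rightarrow> 'a" where
  "mv c [] D = \<one> (c \<otimes> D)"
| "mv c (a # as) D = swap (snd a) c (TT as D) \<cdot> (\<one> (snd a) \<otimes>\<^sub>a mv c as D)"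

lemma mv_simps [simp]:
  assumes "c \<in> Obj V" "wf as" "D \<in> Obj V"
  shows "mv c as D \<in> Arr V" "src V (mv c as D) = TT as (c \<otimes> D)" "tgt V (mv c as D) = c \<otimes> TT as D"
  using assms by (induction as) auto

lemma pa_mv: "snd c \<in> Obj V \<Longrightarrow> wf as \<Longrightarrow> wf ds \<Longrightarrow> pa (as @ c # ds) (c # as @ ds) (mv (snd c) as (T ds))"
proof (induction as)
  case Nil
  then show ?case using pa_refl[of "c # ds"] by simp
next
  case (Cons a as)
  then show ?case using pa.swap[of a c "as @ ds"] by (auto intro!: pa.trans[OF pa.cons])
qed

text \<open>The block \<open>cs\<close> passes the block \<open>bs\<close> one wire at a time, so
  that compatibility with a single passing wire, as demanded in \<open>good\<close>, extends to
  blocks in \<open>good_mvs\<close>.\<close>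

fun mvs :: "'o wire list \<Rightarrow> 'o wire list \<Rightarrow> 'o \<Rightarrow> 'a" where
  "mvs bs [] D = \<one> (TT bs D)"
| "mvs bs (c # cs) D = (\<one> (snd c) \<otimes>\<^sub>a mvs bs cs D) \<cdot> mv (snd c) bs (TT cs D)"

lemma mvs_simps [simp]:
  assumes "wf bs" "wf cs" "D \<in> Obj V"
  shows "mvs bs cs D \<in> Arr V" "src V (mvs bs cs D) = TT bs (TT cs D)" "tgt V (mvs bs cs D) = TT cs (TT bs D)"
  using assms by (induction cs) auto

lemma pa_mvs: "wf bs \<Longrightarrow> wf cs \<Longrightarrow> wf ds \<Longrightarrow> pa (bs @ cs @ ds) (cs @ bs @ ds) (mvs bs cs (T ds))"
proof (induction cs)
  case Nil
  then show ?case using pa_refl[of "bs @ ds"] by simp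
next
  case (Cons c cs)
  then show ?case using pa_mv[of c bs "cs @ ds"] by (auto intro!: pa.trans[OF _ pa.cons])
qed

text \<open>
  A family \<open>G\<close>, natural in \<open>D\<close> and compatible with moving a further wire past it, is an operation that
  only touches the wires \<open>as\<close> and \<open>bs\<close>; two such operations on disjoint wires commute.
\<close>

definition good :: "'o wire list \<Rightarrow> 'o wire list \<Rightarrow> ('o \<Rightarrow> 'a) \<Rightarrow> bool" where
  "good as bs G \<longleftrightarrow> wf as \<and> wf bs \<and> distinct as \<and> distinct bs \<and>
     (\<forall>D \<in> Obj V. G D \<in> Hom V (TT as D) (TT bs D)) \<and>
     (\<forall>h \<in> Arr V. TA bs h \<cdot> G (src V h) = G (tgt V h) \<cdot> TA as h) \<and>
     (\<forall>c \<in> Obj V. \<forall>D \<in> Obj V. mv c bs D \<cdot> G (c \<otimes> D) = (\<one> c \<otimes>\<^sub>a G D) \<cdot> mv c as D)"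

lemma good_simps:
  assumes "good as bs G"
  shows "wf as" "wf bs" "distinct as" "distinct bs"
    "D \<in> Obj V \<Longrightarrow> G D \<in> Arr V" "D \<in> Obj V \<Longrightarrow> src V (G D) = TT as D" "D \<in> Obj V \<Longrightarrow> tgt V (G D) = TT bs D"
    "h \<in> Arr V \<Longrightarrow> TA bs h \<cdot> G (src V h) = G (tgt V h) \<cdot> TA as h"
    "c \<in> Obj V \<Longrightarrow> D \<in> Obj V \<Longrightarrow> mv c bs D \<cdot> G (c \<otimes> D) = (\<one> c \<otimes>\<^sub>a G D) \<cdot> mv c as D"
  using assms by (auto simp: good_def)

lemma good_mvs:
  assumes "good as bs G" "wf cs" "D \<in> Obj V"
  shows "mvs bs cs D \<cdot> G (TT cs D) = TA cs (G D) \<cdot> mvs as cs D"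
  using assms(2)
proof (induction cs)
  case Nil
  then show ?case using assms good_simps[OF assms(1)] by simp
next
  case (Cons c cs)
  note g = good_simps(1-7)[OF assms(1)]
  have o: "snd c \<in> Obj V" "TT cs D \<in> Obj V" "wf cs" using Cons assms by auto
  have "mvs bs (c # cs) D \<cdot> G (TT (c # cs) D) = (\<one> (snd c) \<otimes>\<^sub>a mvs bs cs D) \<cdot> (mv (snd c) bs (TT cs D) \<cdot> G (snd c \<otimes> TT cs D))"
    using o g assms by simp
  also have "\<dots> = (\<one> (snd c) \<otimes>\<^sub>a (mvs bs cs D \<cdot> G (TT cs D))) \<cdot> mv (snd c) as (TT cs D)"
    unfolding good_simps(9)[OF assms(1) o(1,2)] using o g assms by simp
  also have "\<dots> = TA (c # cs) (G D) \<cdot> mvs as (c # cs) D"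
    unfolding Cons.IH[OF o(3)] using o g assms by simp
  finally show ?case .
qed

text \<open>\<open>K\<close> is an arrow out of its wires, so operating on it means precomposing:
  the wires \<open>bs\<close> of \<open>K\<close> are fed by \<open>G\<close>, and \<open>as\<close>
  become inputs instead. Nested operations therefore read in the order in which an input passes
  through them, the outermost first. The order of the untouched wires is an arbitrary choice,
  harmless by \<open>opr_mk\<close>.\<close>

definition opr :: "'o wire list \<Rightarrow> 'o wire list \<Rightarrow> ('o \<Rightarrow> 'a) \<Rightarrow> 'o wire set \<times> 'a \<Rightarrow> 'o wire set \<times> 'a" where
  "opr as bs G K = (let ds = enum (fst K - set bs) in
     (set as \<union> (fst K - set bs), snd (mk (as @ ds) (snd K \<cdot> can (bs @ ds) (enum (fst K)) \<cdot> G (T ds)))))"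

lemma fst_opr: "fst (opr as bs G K) = set as \<union> (fst K - set bs)"
  by (simp add: opr_def Let_def)

text \<open>Naturality of \<open>G\<close> in its tail, applied to a permutation of the untouched
  wires, removes the dependence on the order chosen in \<open>opr\<close>.\<close>

lemma opr_mk:
  assumes "good as bs G" "distinct (bs @ ds)" "distinct (as @ ds)" "wf ds" "k \<in> Arr V" "src V k = T (bs @ ds)"
  shows "opr as bs G (mk (bs @ ds) k) = mk (as @ ds) (k \<cdot> G (T ds))"
proof -
  note g = good_simps(1-7)[OF assms(1)]
  let ?E = "enum (set (bs @ ds))" and ?ds = "enum (set (bs @ ds) - set bs)"
  have E: "distinct ?E" "set ?E = set (bs @ ds)" "wf ?E" using g assms by (auto simp del: set_append)
  have D: "distinct ?ds" "set ?ds = set ds" using assms by auto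
  then have wD: "wf ?ds" using assms wf_cong by blast
  have eq: "set (bs @ ds) - set bs = set ds" using assms(2) by auto
  have c: "can (bs @ ?ds) (bs @ ds) = TA bs (can ?ds ds)"
    using g assms D wD by (intro can_unique[OF pa_TA[OF pa_can], symmetric]) auto
  have c': "can (as @ ?ds) (as @ ds) = TA as (can ?ds ds)"
    using g assms D wD by (intro can_unique[OF pa_TA[OF pa_can], symmetric]) auto
  have n: "TA bs (can ?ds ds) \<cdot> G (T ?ds) = G (T ds) \<cdot> TA as (can ?ds ds)"
    using good_simps(8)[OF assms(1), of "can ?ds ds"] D wD assms by simp
  have "opr as bs G (mk (bs @ ds) k) = mk (as @ ?ds) ((k \<cdot> can ?E (bs @ ds)) \<cdot> can (bs @ ?ds) ?E \<cdot> G (T ?ds))"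
    using D eq by (simp add: opr_def Let_def mk_def)
  also have "(k \<cdot> can ?E (bs @ ds)) \<cdot> can (bs @ ?ds) ?E \<cdot> G (T ?ds) = k \<cdot> can (bs @ ?ds) (bs @ ds) \<cdot> G (T ?ds)"
    using g assms D wD E by simp
  also have "\<dots> = (k \<cdot> G (T ds)) \<cdot> can (as @ ?ds) (as @ ds)"
    unfolding c c' n using g assms D wD by simp
  also have "mk (as @ ?ds) \<dots> = mk (as @ ds) (k \<cdot> G (T ds))"
    using g assms D wD by (intro mk_can) auto
  finally show ?thesis .
qed

text \<open>The wires \<open>cs\<close> in front are moved behind the active ones, the operation is
  applied there, and \<open>good_mvs\<close> moves them back.\<close>

lemma opr_mk_mid:
  assumes "good as bs G" "distinct (cs @ bs @ ds)" "distinct (cs @ as @ ds)" "wf cs" "wf ds"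
    "k \<in> Arr V" "src V k = T (cs @ bs @ ds)"
  shows "opr as bs G (mk (cs @ bs @ ds) k) = mk (cs @ as @ ds) (k \<cdot> TA cs (G (T ds)))"
proof -
  note g = good_simps(1-7)[OF assms(1)]
  have "mk (cs @ bs @ ds) k = mk (bs @ cs @ ds) (k \<cdot> mvs bs cs (T ds))"
    using pa_mvs[of bs cs ds] assms g by (intro mk_pa[symmetric]) auto
  also have "opr as bs G \<dots> = mk (as @ cs @ ds) ((k \<cdot> mvs bs cs (T ds)) \<cdot> G (T (cs @ ds)))"
    using assms g by (intro opr_mk) auto
  also have "(k \<cdot> mvs bs cs (T ds)) \<cdot> G (T (cs @ ds)) = k \<cdot> (mvs bs cs (T ds) \<cdot> G (TT cs (T ds)))"
    using assms g by simp
  also have "\<dots> = (k \<cdot> TA cs (G (T ds))) \<cdot> mvs as cs (T ds)"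
    unfolding good_mvs[OF assms(1,4) TT_Obj[OF assms(5) unitO_in_Obj]] using assms g by simp
  also have "mk (as @ cs @ ds) \<dots> = mk (cs @ as @ ds) (k \<cdot> TA cs (G (T ds)))"
    using pa_mvs[of as cs ds] assms g by (intro mk_pa) auto
  finally show ?thesis .
qed

lemma val_opr:
  assumes "good as bs G" "val K" "set bs \<subseteq> fst K" "set as \<inter> (fst K - set bs) = {}"
  shows "val (opr as bs G K)"
proof -
  note g = good_simps(1-7)[OF assms(1)]
  obtain ds k where k: "distinct (bs @ ds)" "wf (bs @ ds)" "k \<in> Arr V" "src V k = T (bs @ ds)" "K = mk (bs @ ds) k"
    using val_mk_ex[OF assms(2) g(4) assms(3)] .
  have "distinct (as @ ds)" using assms k g by auto
  then show ?thesis using opr_mk[OF assms(1) k(1)] k g by simp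
qed

definition is_op where "is_op F as bs \<longleftrightarrow> (\<exists>G. good as bs G \<and> F = opr as bs G)"

text \<open>The interchange law. With the wires of \<open>K\<close> listed as \<open>bs\<close>,
  \<open>bs'\<close> and the rest, the second operation takes place inside the tail of the first,
  and naturality of \<open>G\<close> at the arrow \<open>G' (T ds)\<close> exchanges the two. The
  side conditions keep the active wires disjoint and the new ones fresh.\<close>

lemma op_comm:
  assumes F: "is_op F as bs" and F': "is_op F' as' bs'" and K: "val K" "set bs \<subseteq> fst K" "set bs' \<subseteq> fst K"
    and d: "set bs \<inter> set bs' = {}" "set as \<inter> set as' = {}"
      "set as \<inter> (fst K - set bs) = {}" "set as' \<inter> (fst K - set bs') = {}"
  shows "F (F' K) = F' (F K)"
proof -
  obtain G G' where G: "good as bs G" "F = opr as bs G" and G': "good as' bs' G'" "F' = opr as' bs' G'"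
    using F F' by (auto simp: is_op_def)
  note g = good_simps(1-7)[OF G(1)] and g' = good_simps(1-7)[OF G'(1)]
  have "distinct (bs @ bs')" "set (bs @ bs') \<subseteq> fst K" using g g' d K by auto
  then obtain ds k where k: "distinct ((bs @ bs') @ ds)" "wf ((bs @ bs') @ ds)" "k \<in> Arr V"
      "src V k = T ((bs @ bs') @ ds)" "K = mk ((bs @ bs') @ ds) k"
    using val_mk_ex[OF K(1)] by blast
  have K': "K = mk (bs @ bs' @ ds) k" "fst K = set bs \<union> set bs' \<union> set ds" using k by auto
  have di: "distinct (as @ bs' @ ds)" "distinct (bs @ as' @ ds)" "distinct (as @ as' @ ds)"
    using d k g g' K' by auto
  have "F (F' K) = mk (as @ as' @ ds) ((k \<cdot> TA bs (G' (T ds))) \<cdot> G (T (as' @ ds)))"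
    unfolding K' G G' using k g g' di by (simp add: opr_mk_mid[OF G'(1)] opr_mk[OF G(1)])
  moreover have "F' (F K) = mk (as @ as' @ ds) ((k \<cdot> G (T (bs' @ ds))) \<cdot> TA as (G' (T ds)))"
    unfolding K' G G' using k g g' di by (simp add: opr_mk_mid[OF G'(1)] opr_mk[OF G(1)])
  moreover have "(k \<cdot> TA bs (G' (T ds))) \<cdot> G (T (as' @ ds)) = k \<cdot> (TA bs (G' (T ds)) \<cdot> G (src V (G' (T ds))))"
    using k g g' di by simp
  moreover have "\<dots> = (k \<cdot> G (T (bs' @ ds))) \<cdot> TA as (G' (T ds))"
    using good_simps(8)[OF G(1), of "G' (T ds)"] k g g' di by simp
  ultimately show ?thesis by simp
qed

lemma good_cmp:
  assumes "good as bs G" "good bs cs G'"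
  shows "good as cs (\<lambda>D. G' D \<cdot> G D)"
proof -
  note g = good_simps(1-7)[OF assms(1)] and g' = good_simps(1-7)[OF assms(2)]
  have n: "TA cs h \<cdot> (G' (src V h) \<cdot> G (src V h)) = (G' (tgt V h) \<cdot> G (tgt V h)) \<cdot> TA as h" if h: "h \<in> Arr V" for h
  proof -
    have "TA cs h \<cdot> (G' (src V h) \<cdot> G (src V h)) = (TA cs h \<cdot> G' (src V h)) \<cdot> G (src V h)"
      using g g' h by simp
    also have "\<dots> = G' (tgt V h) \<cdot> (TA bs h \<cdot> G (src V h))"
      unfolding good_simps(8)[OF assms(2) h] using g g' h by simp
    also have "\<dots> = (G' (tgt V h) \<cdot> G (tgt V h)) \<cdot> TA as h"
      unfolding good_simps(8)[OF assms(1) h] using g g' h by simp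
    finally show ?thesis .
  qed
  have s: "mv c cs D \<cdot> (G' (c \<otimes> D) \<cdot> G (c \<otimes> D)) = (\<one> c \<otimes>\<^sub>a (G' D \<cdot> G D)) \<cdot> mv c as D"
    if c: "c \<in> Obj V" "D \<in> Obj V" for c D
  proof -
    have "mv c cs D \<cdot> (G' (c \<otimes> D) \<cdot> G (c \<otimes> D)) = (mv c cs D \<cdot> G' (c \<otimes> D)) \<cdot> G (c \<otimes> D)"
      using g g' c by simp
    also have "\<dots> = (\<one> c \<otimes>\<^sub>a G' D) \<cdot> (mv c bs D \<cdot> G (c \<otimes> D))"
      unfolding good_simps(9)[OF assms(2) c] using g g' c by simp
    also have "\<dots> = (\<one> c \<otimes>\<^sub>a (G' D \<cdot> G D)) \<cdot> mv c as D"
      unfolding good_simps(9)[OF assms(1) c] using g g' c by simp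
    finally show ?thesis .
  qed
  show ?thesis unfolding good_def using g g' n s by simp
qed

text \<open>Both conditions on a family pass to its pointwise inverse. This yields the inverse
  associators and unitors as operations without further coherence calculations.\<close>

lemma good_inv:
  assumes G: "good as bs G"
    and i: "\<And>D. D \<in> Obj V \<Longrightarrow> G' D \<in> Hom V (TT bs D) (TT as D)"
      "\<And>D. D \<in> Obj V \<Longrightarrow> G' D \<cdot> G D = \<one> (TT as D)" "\<And>D. D \<in> Obj V \<Longrightarrow> G D \<cdot> G' D = \<one> (TT bs D)"
  shows "good bs as G'"
proof -
  note g = good_simps(1-7)[OF assms(1)]
  have t: "G' D \<in> Arr V" "src V (G' D) = TT bs D" "tgt V (G' D) = TT as D" if "D \<in> Obj V" for D
    using i(1)[OF that] by auto
  have i': "G' D \<cdot> (G D \<cdot> f) = f" if "D \<in> Obj V" "f \<in> Arr V" "tgt V f = TT as D" for D f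
    using cmp_assoc'[of f "G D" "G' D"] i(2) t g that by simp
  have n: "TA as h \<cdot> G' (src V h) = G' (tgt V h) \<cdot> TA bs h" if h: "h \<in> Arr V" for h
  proof -
    have "TA as h \<cdot> G' (src V h) = G' (tgt V h) \<cdot> (G (tgt V h) \<cdot> TA as h) \<cdot> G' (src V h)"
      using g t i' h by simp
    also have "\<dots> = G' (tgt V h) \<cdot> TA bs h"
      unfolding good_simps(8)[OF G h, symmetric] using g t i h by simp
    finally show ?thesis .
  qed
  have s: "mv c as D \<cdot> G' (c \<otimes> D) = (\<one> c \<otimes>\<^sub>a G' D) \<cdot> mv c bs D" if c: "c \<in> Obj V" "D \<in> Obj V" for c D
  proof -
    have "mv c as D \<cdot> G' (c \<otimes> D) = (\<one> c \<otimes>\<^sub>a G' D) \<cdot> ((\<one> c \<otimes>\<^sub>a G D) \<cdot> mv c as D) \<cdot> G' (c \<otimes> D)"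
      using g t i c by simp
    also have "\<dots> = (\<one> c \<otimes>\<^sub>a G' D) \<cdot> mv c bs D"
      unfolding good_simps(9)[OF G c, symmetric] using g t i c by simp
    finally show ?thesis .
  qed
  show ?thesis unfolding good_def using g t n s by simp
qed

lemma good_arr:
  assumes "f \<in> Hom V (snd x) (snd y)"
  shows "good [x] [y] (\<lambda>D. f \<otimes>\<^sub>a \<one> D)"
proof -
  have f: "f \<in> Arr V" "src V f = snd x" "tgt V f = snd y" "snd x \<in> Obj V" "snd y \<in> Obj V"
    using assms src_in_Obj[of f] tgt_in_Obj[of f] by auto
  have "swap (snd y) c D \<cdot> (f \<otimes>\<^sub>a \<one> (c \<otimes> D)) = (\<one> c \<otimes>\<^sub>a (f \<otimes>\<^sub>a \<one> D)) \<cdot> swap (snd x) c D"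
    if "c \<in> Obj V" "D \<in> Obj V" for c D
    using swap_nat[of f "\<one> c" "\<one> D"] f that by simp
  then show ?thesis unfolding good_def using f by simp
qed

text \<open>Compatibility with a passing wire is \<open>swap_tens_left\<close>: to pass the bundle
  of two wires is to pass both of them in turn.\<close>

lemma good_assc:
  assumes "snd x \<in> Obj V" "snd y \<in> Obj V" "snd z = snd x \<otimes> snd y" "x \<noteq> y"
  shows "good [z] [x, y] (\<alpha> (snd x) (snd y))"
proof -
  have "(\<one> (snd x) \<otimes>\<^sub>a (\<one> (snd y) \<otimes>\<^sub>a h)) \<cdot> \<alpha> (snd x) (snd y) (src V h) =
    \<alpha> (snd x) (snd y) (tgt V h) \<cdot> (\<one> (snd z) \<otimes>\<^sub>a h)" if "h \<in> Arr V" for h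
    using assc_nat[of "\<one> (snd x)" "\<one> (snd y)" h] assms that by simp
  moreover have "swap (snd x) c (snd y \<otimes> D) \<cdot> (\<one> (snd x) \<otimes>\<^sub>a swap (snd y) c D) \<cdot> \<alpha> (snd x) (snd y) (c \<otimes> D)
     = (\<one> c \<otimes>\<^sub>a \<alpha> (snd x) (snd y) D) \<cdot> swap (snd z) c D" if "c \<in> Obj V" "D \<in> Obj V" for c D
    using swap_tens_left[of "snd x" "snd y" c D] assms that by simp
  ultimately show ?thesis unfolding good_def using assms by simp
qed

lemma good_asc':
  assumes "snd x \<in> Obj V" "snd y \<in> Obj V" "snd z = snd x \<otimes> snd y" "x \<noteq> y"
  shows "good [x, y] [z] (\<lambda>D. asc' (snd x) (snd y) D)"
  by (rule good_inv[OF good_assc[OF assms]]) (use assms in auto)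

lemma good_lun: "snd z = \<I> \<Longrightarrow> good [z] [] (\<lambda>D. \<lambda>\<^sub>I D)"
  unfolding good_def using swap_unit lun_nat by simp

lemma good_lun': "snd z = \<I> \<Longrightarrow> good [] [z] (\<lambda>D. lun' D)"
  by (rule good_inv[OF good_lun]) auto

lemma wire_Obj: "val K \<Longrightarrow> x \<in> fst K \<Longrightarrow> snd x \<in> Obj V"
  by (auto simp: val_def wf_def)

text \<open>
  In Sweedler notation these operations substitute into \<open>K\<close>: \<open>y := f x\<close> for \<open>sub f x y K\<close>,
  \<open>z := f (x \<otimes> y)\<close> for \<open>bin f x y z K\<close>, \<open>x \<otimes> y := f z\<close> for \<open>cob f z x y K\<close>, and \<open>z := f\<close> for
  \<open>nul f z K\<close>; \<open>del f z K\<close> multiplies by the scalar \<open>f z\<close>, where \<open>z\<close> is a new wire.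
\<close>

definition "sub f x y = opr [x] [y] (\<lambda>D. f \<otimes>\<^sub>a \<one> D)"
definition "bin f x y z = opr [x, y] [z] (\<lambda>D. (f \<otimes>\<^sub>a \<one> D) \<cdot> asc' (snd x) (snd y) D)"
definition "cob f z x y = opr [z] [x, y] (\<lambda>D. \<alpha> (snd x) (snd y) D \<cdot> (f \<otimes>\<^sub>a \<one> D))"
definition "nul f z = opr [] [z] (\<lambda>D. (f \<otimes>\<^sub>a \<one> D) \<cdot> lun' D)"
definition "del f z = opr [z] [] (\<lambda>D. \<lambda>\<^sub>I D \<cdot> (f \<otimes>\<^sub>a \<one> D))"

lemma good_bin:
  assumes "snd x \<in> Obj V" "snd y \<in> Obj V" "f \<in> Hom V (snd x \<otimes> snd y) (snd z)" "x \<noteq> y"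
  shows "good [x, y] [z] (\<lambda>D. (f \<otimes>\<^sub>a \<one> D) \<cdot> asc' (snd x) (snd y) D)"
  by (rule good_cmp[OF good_asc'[of x y "(0, snd x \<otimes> snd y)"] good_arr]) (use assms in auto)

lemma good_cob:
  assumes "snd x \<in> Obj V" "snd y \<in> Obj V" "f \<in> Hom V (snd z) (snd x \<otimes> snd y)" "x \<noteq> y"
  shows "good [z] [x, y] (\<lambda>D. \<alpha> (snd x) (snd y) D \<cdot> (f \<otimes>\<^sub>a \<one> D))"
  by (rule good_cmp[OF good_arr[of _ _ "(0, snd x \<otimes> snd y)"] good_assc]) (use assms in auto)

lemma good_nul: "f \<in> Hom V \<I> (snd z) \<Longrightarrow> good [] [z] (\<lambda>D. (f \<otimes>\<^sub>a \<one> D) \<cdot> lun' D)"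
  by (rule good_cmp[OF good_lun'[of "(0, \<I>)"] good_arr]) auto

lemma good_del: "f \<in> Hom V (snd z) \<I> \<Longrightarrow> good [z] [] (\<lambda>D. \<lambda>\<^sub>I D \<cdot> (f \<otimes>\<^sub>a \<one> D))"
  by (rule good_cmp[OF good_arr[of _ _ "(0, \<I>)"] good_lun]) auto

lemma is_op_sub: "f \<in> Hom V (snd x) (snd y) \<Longrightarrow> is_op (sub f x y) [x] [y]"
  unfolding is_op_def sub_def using good_arr by blast

lemma is_op_bin: "snd x \<in> Obj V \<Longrightarrow> snd y \<in> Obj V \<Longrightarrow> f \<in> Hom V (snd x \<otimes> snd y) (snd z) \<Longrightarrow> x \<noteq> y \<Longrightarrow>
    is_op (bin f x y z) [x, y] [z]"
  unfolding is_op_def bin_def using good_bin by blast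

lemma is_op_cob: "snd x \<in> Obj V \<Longrightarrow> snd y \<in> Obj V \<Longrightarrow> f \<in> Hom V (snd z) (snd x \<otimes> snd y) \<Longrightarrow> x \<noteq> y \<Longrightarrow>
    is_op (cob f z x y) [z] [x, y]"
  unfolding is_op_def cob_def using good_cob by blast

lemma is_op_nul: "f \<in> Hom V \<I> (snd z) \<Longrightarrow> is_op (nul f z) [] [z]"
  unfolding is_op_def nul_def using good_nul by blast

lemma is_op_del: "f \<in> Hom V (snd z) \<I> \<Longrightarrow> is_op (del f z) [z] []"
  unfolding is_op_def del_def using good_del by blast

lemma fst_op [simp]:
  "fst (sub f x y K) = insert x (fst K - {y})"
  "fst (bin f x y z K) = insert x (insert y (fst K - {z}))"
  "fst (cob f z x y K) = insert z (fst K - {x, y})"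
  "fst (nul f z K) = fst K - {z}"
  "fst (del f z K) = insert z (fst K)"
  by (auto simp: fst_opr sub_def bin_def cob_def nul_def del_def)

lemma val_sub [simp]: "f \<in> Hom V (snd x) (snd y) \<Longrightarrow> val K \<Longrightarrow> y \<in> fst K \<Longrightarrow> x \<notin> fst K - {y} \<Longrightarrow>
    val (sub f x y K)"
  unfolding sub_def by (rule val_opr[OF good_arr]) auto

lemma val_bin [simp]: "snd x \<in> Obj V \<Longrightarrow> snd y \<in> Obj V \<Longrightarrow> f \<in> Hom V (snd x \<otimes> snd y) (snd z) \<Longrightarrow> x \<noteq> y \<Longrightarrow>
    val K \<Longrightarrow> z \<in> fst K \<Longrightarrow> x \<notin> fst K - {z} \<Longrightarrow> y \<notin> fst K - {z} \<Longrightarrow> val (bin f x y z K)"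
  unfolding bin_def by (rule val_opr[OF good_bin]) auto

lemma val_cob [simp]: "f \<in> Hom V (snd z) (snd x \<otimes> snd y) \<Longrightarrow> x \<noteq> y \<Longrightarrow>
    val K \<Longrightarrow> x \<in> fst K \<Longrightarrow> y \<in> fst K \<Longrightarrow> z \<notin> fst K - {x, y} \<Longrightarrow> val (cob f z x y K)"
  unfolding cob_def by (rule val_opr[OF good_cob]) (auto simp: wire_Obj)

lemma val_nul [simp]: "f \<in> Hom V \<I> (snd z) \<Longrightarrow> val K \<Longrightarrow> z \<in> fst K \<Longrightarrow> val (nul f z K)"
  unfolding nul_def by (rule val_opr[OF good_nul]) auto

lemma val_del [simp]: "f \<in> Hom V (snd z) \<I> \<Longrightarrow> val K \<Longrightarrow> z \<notin> fst K \<Longrightarrow> val (del f z K)"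
  unfolding del_def by (rule val_opr[OF good_del]) auto

section \<open>Commutation of operations on disjoint wires\<close>

lemma cob_cob_comm:
  "f \<in> Hom V (snd z) (snd x \<otimes> snd y) \<Longrightarrow> f' \<in> Hom V (snd z') (snd x' \<otimes> snd y') \<Longrightarrow> x \<noteq> y \<Longrightarrow> x' \<noteq> y' \<Longrightarrow> val K \<Longrightarrow> x \<in> fst K \<Longrightarrow> y \<in> fst K \<Longrightarrow> x' \<in> fst K \<Longrightarrow> y' \<in> fst K \<Longrightarrow> x \<noteq> x' \<Longrightarrow> x \<noteq> y' \<Longrightarrow> y \<noteq> x' \<Longrightarrow> y \<noteq> y' \<Longrightarrow> z \<noteq> z' \<Longrightarrow> z \<notin> fst K - {x, y} \<Longrightarrow> z' \<notin> fst K - {x', y'} \<Longrightarrow>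
   cob f' z' x' y' (cob f z x y K) = cob f z x y (cob f' z' x' y' K)"
  by (rule op_comm[OF is_op_cob is_op_cob]) (auto intro: wire_Obj)

lemma cob_del_comm:
  "f \<in> Hom V (snd z) (snd x \<otimes> snd y) \<Longrightarrow> f' \<in> Hom V (snd x') \<I> \<Longrightarrow> x \<noteq> y \<Longrightarrow> val K \<Longrightarrow> x \<in> fst K \<Longrightarrow> y \<in> fst K \<Longrightarrow> z \<noteq> x' \<Longrightarrow> z \<notin> fst K - {x, y} \<Longrightarrow> x' \<notin> fst K \<Longrightarrow>
   del f' x' (cob f z x y K) = cob f z x y (del f' x' K)"
  by (rule op_comm[OF is_op_del is_op_cob]) (auto intro: wire_Obj)

lemma cob_sub_comm:
  "f \<in> Hom V (snd z) (snd x \<otimes> snd y) \<Longrightarrow> f' \<in> Hom V (snd x') (snd y') \<Longrightarrow> x \<noteq> y \<Longrightarrow> val K \<Longrightarrow> x \<in> fst K \<Longrightarrow> y \<in> fst K \<Longrightarrow> y' \<in> fst K \<Longrightarrow> x \<noteq> y' \<Longrightarrow> y \<noteq> y' \<Longrightarrow> z \<noteq> x' \<Longrightarrow> z \<notin> fst K - {x, y} \<Longrightarrow> x' \<notin> fst K - {y'} \<Longrightarrow>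
   sub f' x' y' (cob f z x y K) = cob f z x y (sub f' x' y' K)"
  by (rule op_comm[OF is_op_sub is_op_cob]) (auto intro: wire_Obj)

lemma cob_bin_comm:
  "f \<in> Hom V (snd z) (snd x \<otimes> snd y) \<Longrightarrow> snd x' \<in> Obj V \<Longrightarrow> snd y' \<in> Obj V \<Longrightarrow> f' \<in> Hom V (snd x' \<otimes> snd y') (snd z') \<Longrightarrow> x \<noteq> y \<Longrightarrow> x' \<noteq> y' \<Longrightarrow> val K \<Longrightarrow> x \<in> fst K \<Longrightarrow> y \<in> fst K \<Longrightarrow> z' \<in> fst K \<Longrightarrow> x \<noteq> z' \<Longrightarrow> y \<noteq> z' \<Longrightarrow> z \<noteq> x' \<Longrightarrow> z \<noteq> y' \<Longrightarrow> z \<notin> fst K - {x, y} \<Longrightarrow> x' \<notin> fst K - {z'} \<Longrightarrow> y' \<notin> fst K - {z'} \<Longrightarrow>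
   bin f' x' y' z' (cob f z x y K) = cob f z x y (bin f' x' y' z' K)"
  by (rule op_comm[OF is_op_bin is_op_cob]) (auto intro: wire_Obj)

lemma cob_nul_comm:
  "f \<in> Hom V (snd z) (snd x \<otimes> snd y) \<Longrightarrow> f' \<in> Hom V \<I> (snd z') \<Longrightarrow> x \<noteq> y \<Longrightarrow> val K \<Longrightarrow> x \<in> fst K \<Longrightarrow> y \<in> fst K \<Longrightarrow> z' \<in> fst K \<Longrightarrow> x \<noteq> z' \<Longrightarrow> y \<noteq> z' \<Longrightarrow> z \<notin> fst K - {x, y} \<Longrightarrow>
   nul f' z' (cob f z x y K) = cob f z x y (nul f' z' K)"
  by (rule op_comm[OF is_op_nul is_op_cob]) (auto intro: wire_Obj)

lemma del_del_comm:
  "f \<in> Hom V (snd x) \<I> \<Longrightarrow> f' \<in> Hom V (snd x') \<I> \<Longrightarrow> val K \<Longrightarrow> x \<noteq> x' \<Longrightarrow> x \<notin> fst K \<Longrightarrow> x' \<notin> fst K \<Longrightarrow>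
   del f' x' (del f x K) = del f x (del f' x' K)"
  by (rule op_comm[OF is_op_del is_op_del]) (auto intro: wire_Obj)

lemma del_sub_comm:
  "f \<in> Hom V (snd x) \<I> \<Longrightarrow> f' \<in> Hom V (snd x') (snd y') \<Longrightarrow> val K \<Longrightarrow> y' \<in> fst K \<Longrightarrow> x \<noteq> x' \<Longrightarrow> x \<notin> fst K \<Longrightarrow> x' \<notin> fst K - {y'} \<Longrightarrow>
   sub f' x' y' (del f x K) = del f x (sub f' x' y' K)"
  by (rule op_comm[OF is_op_sub is_op_del]) (auto intro: wire_Obj)

lemma del_bin_comm:
  "f \<in> Hom V (snd x) \<I> \<Longrightarrow> snd x' \<in> Obj V \<Longrightarrow> snd y' \<in> Obj V \<Longrightarrow> f' \<in> Hom V (snd x' \<otimes> snd y') (snd z') \<Longrightarrow> x' \<noteq> y' \<Longrightarrow> val K \<Longrightarrow> z' \<in> fst K \<Longrightarrow> x \<noteq> x' \<Longrightarrow> x \<noteq> y' \<Longrightarrow> x \<notin> fst K \<Longrightarrow> x' \<notin> fst K - {z'} \<Longrightarrow> y' \<notin> fst K - {z'} \<Longrightarrow>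
   bin f' x' y' z' (del f x K) = del f x (bin f' x' y' z' K)"
  by (rule op_comm[OF is_op_bin is_op_del]) (auto intro: wire_Obj)

lemma del_nul_comm:
  "f \<in> Hom V (snd x) \<I> \<Longrightarrow> f' \<in> Hom V \<I> (snd z') \<Longrightarrow> val K \<Longrightarrow> z' \<in> fst K \<Longrightarrow> x \<notin> fst K \<Longrightarrow>
   nul f' z' (del f x K) = del f x (nul f' z' K)"
  by (rule op_comm[OF is_op_nul is_op_del]) (auto intro: wire_Obj)

lemma sub_sub_comm:
  "f \<in> Hom V (snd x) (snd y) \<Longrightarrow> f' \<in> Hom V (snd x') (snd y') \<Longrightarrow> val K \<Longrightarrow> y \<in> fst K \<Longrightarrow> y' \<in> fst K \<Longrightarrow> y \<noteq> y' \<Longrightarrow> x \<noteq> x' \<Longrightarrow> x \<notin> fst K - {y} \<Longrightarrow> x' \<notin> fst K - {y'} \<Longrightarrow>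
   sub f' x' y' (sub f x y K) = sub f x y (sub f' x' y' K)"
  by (rule op_comm[OF is_op_sub is_op_sub]) (auto intro: wire_Obj)

lemma sub_bin_comm:
  "f \<in> Hom V (snd x) (snd y) \<Longrightarrow> snd x' \<in> Obj V \<Longrightarrow> snd y' \<in> Obj V \<Longrightarrow> f' \<in> Hom V (snd x' \<otimes> snd y') (snd z') \<Longrightarrow> x' \<noteq> y' \<Longrightarrow> val K \<Longrightarrow> y \<in> fst K \<Longrightarrow> z' \<in> fst K \<Longrightarrow> y \<noteq> z' \<Longrightarrow> x \<noteq> x' \<Longrightarrow> x \<noteq> y' \<Longrightarrow> x \<notin> fst K - {y} \<Longrightarrow> x' \<notin> fst K - {z'} \<Longrightarrow> y' \<notin> fst K - {z'} \<Longrightarrow>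
   bin f' x' y' z' (sub f x y K) = sub f x y (bin f' x' y' z' K)"
  by (rule op_comm[OF is_op_bin is_op_sub]) (auto intro: wire_Obj)

lemma sub_nul_comm:
  "f \<in> Hom V (snd x) (snd y) \<Longrightarrow> f' \<in> Hom V \<I> (snd z') \<Longrightarrow> val K \<Longrightarrow> y \<in> fst K \<Longrightarrow> z' \<in> fst K \<Longrightarrow> y \<noteq> z' \<Longrightarrow> x \<notin> fst K - {y} \<Longrightarrow>
   nul f' z' (sub f x y K) = sub f x y (nul f' z' K)"
  by (rule op_comm[OF is_op_nul is_op_sub]) (auto intro: wire_Obj)

lemma bin_bin_comm:
  "snd x \<in> Obj V \<Longrightarrow> snd y \<in> Obj V \<Longrightarrow> f \<in> Hom V (snd x \<otimes> snd y) (snd z) \<Longrightarrow> snd x' \<in> Obj V \<Longrightarrow> snd y' \<in> Obj V \<Longrightarrow> f' \<in> Hom V (snd x' \<otimes> snd y') (snd z') \<Longrightarrow> x \<noteq> y \<Longrightarrow> x' \<noteq> y' \<Longrightarrow> val K \<Longrightarrow> z \<in> fst K \<Longrightarrow> z' \<in> fst K \<Longrightarrow> z \<noteq> z' \<Longrightarrow> x \<noteq> x' \<Longrightarrow> x \<noteq> y' \<Longrightarrow> y \<noteq> x' \<Longrightarrow> y \<noteq> y' \<Longrightarrow> x \<notin> fst K - {z} \<Longrightarrow> y \<notin> fst K - {z} \<Longrightarrow> x' \<notin> fst K - {z'} \<Longrightarrow> y' \<notin> fst K - {z'} \<Longrightarrow>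
   bin f' x' y' z' (bin f x y z K) = bin f x y z (bin f' x' y' z' K)"
  by (rule op_comm[OF is_op_bin is_op_bin]) (auto intro: wire_Obj)

lemma bin_nul_comm:
  "snd x \<in> Obj V \<Longrightarrow> snd y \<in> Obj V \<Longrightarrow> f \<in> Hom V (snd x \<otimes> snd y) (snd z) \<Longrightarrow> f' \<in> Hom V \<I> (snd z') \<Longrightarrow> x \<noteq> y \<Longrightarrow> val K \<Longrightarrow> z \<in> fst K \<Longrightarrow> z' \<in> fst K \<Longrightarrow> z \<noteq> z' \<Longrightarrow> x \<notin> fst K - {z} \<Longrightarrow> y \<notin> fst K - {z} \<Longrightarrow>
   nul f' z' (bin f x y z K) = bin f x y z (nul f' z' K)"
  by (rule op_comm[OF is_op_nul is_op_bin]) (auto intro: wire_Obj)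

lemma nul_nul_comm:
  "f \<in> Hom V \<I> (snd z) \<Longrightarrow> f' \<in> Hom V \<I> (snd z') \<Longrightarrow> val K \<Longrightarrow> z \<in> fst K \<Longrightarrow> z' \<in> fst K \<Longrightarrow> z \<noteq> z' \<Longrightarrow>
   nul f' z' (nul f z K) = nul f z (nul f' z' K)"
  by (rule op_comm[OF is_op_nul is_op_nul]) (auto intro: wire_Obj)

lemmas comms = cob_cob_comm cob_del_comm cob_sub_comm cob_bin_comm cob_nul_comm del_del_comm del_sub_comm del_bin_comm del_nul_comm sub_sub_comm sub_bin_comm sub_nul_comm bin_bin_comm bin_nul_comm nul_nul_comm

section \<open>The operations in an explicit order of the wires\<close>

lemma sub_mk:
  "f \<in> Hom V (snd x) (snd y) \<Longrightarrow> distinct (y # ds) \<Longrightarrow> x \<notin> set ds \<Longrightarrow> wf ds \<Longrightarrow> k \<in> Arr V \<Longrightarrow>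
      src V k = T (y # ds) \<Longrightarrow> sub f x y (mk (y # ds) k) = mk (x # ds) (k \<cdot> (f \<otimes>\<^sub>a \<one> (T ds)))"
  unfolding sub_def using opr_mk[OF good_arr, of f x y ds k] by auto

lemma bin_mk:
  "f \<in> Hom V (snd x \<otimes> snd y) (snd z) \<Longrightarrow> snd x \<in> Obj V \<Longrightarrow> snd y \<in> Obj V \<Longrightarrow> distinct (z # ds) \<Longrightarrow>
      distinct (x # y # ds) \<Longrightarrow> wf ds \<Longrightarrow> k \<in> Arr V \<Longrightarrow> src V k = T (z # ds) \<Longrightarrow>
      bin f x y z (mk (z # ds) k) = mk (x # y # ds) (k \<cdot> (f \<otimes>\<^sub>a \<one> (T ds)) \<cdot> asc' (snd x) (snd y) (T ds))"
  unfolding bin_def using opr_mk[OF good_bin, of x y f z ds k] by auto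

lemma cob_mk:
  "f \<in> Hom V (snd z) (snd x \<otimes> snd y) \<Longrightarrow> snd x \<in> Obj V \<Longrightarrow> snd y \<in> Obj V \<Longrightarrow> distinct (z # ds) \<Longrightarrow>
      distinct (x # y # ds) \<Longrightarrow> wf ds \<Longrightarrow> k \<in> Arr V \<Longrightarrow> src V k = T (x # y # ds) \<Longrightarrow>
      cob f z x y (mk (x # y # ds) k) = mk (z # ds) (k \<cdot> \<alpha> (snd x) (snd y) (T ds) \<cdot> (f \<otimes>\<^sub>a \<one> (T ds)))"
  unfolding cob_def using opr_mk[OF good_cob, of x y f z ds k] by auto

lemma nul_mk:
  "f \<in> Hom V \<I> (snd z) \<Longrightarrow> distinct (z # ds) \<Longrightarrow> wf ds \<Longrightarrow> k \<in> Arr V \<Longrightarrow> src V k = T (z # ds) \<Longrightarrow>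
      nul f z (mk (z # ds) k) = mk ds (k \<cdot> (f \<otimes>\<^sub>a \<one> (T ds)) \<cdot> lun' (T ds))"
  unfolding nul_def using opr_mk[OF good_nul, of f z ds k] by auto

lemma del_mk:
  "f \<in> Hom V (snd z) \<I> \<Longrightarrow> distinct (z # ds) \<Longrightarrow> wf ds \<Longrightarrow> k \<in> Arr V \<Longrightarrow> src V k = T ds \<Longrightarrow>
      del f z (mk ds k) = mk (z # ds) (k \<cdot> \<lambda>\<^sub>I (T ds) \<cdot> (f \<otimes>\<^sub>a \<one> (T ds)))"
  unfolding del_def using opr_mk[OF good_del, of f z ds k] by auto

lemma sub_mk1:
  "f \<in> Hom V (snd x) (snd y) \<Longrightarrow> distinct (c # y # ds) \<Longrightarrow> x \<notin> set (c # ds) \<Longrightarrow> wf (c # ds) \<Longrightarrow> k \<in> Arr V \<Longrightarrow>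
      src V k = T (c # y # ds) \<Longrightarrow> sub f x y (mk (c # y # ds) k) = mk (c # x # ds) (k \<cdot> (\<one> (snd c) \<otimes>\<^sub>a (f \<otimes>\<^sub>a \<one> (T ds))))"
  unfolding sub_def using opr_mk_mid[OF good_arr, of f x y "[c]" ds k] by auto

lemma bin_mk1:
  "f \<in> Hom V (snd x \<otimes> snd y) (snd z) \<Longrightarrow> snd x \<in> Obj V \<Longrightarrow> snd y \<in> Obj V \<Longrightarrow> distinct (c # z # ds) \<Longrightarrow>
      distinct (c # x # y # ds) \<Longrightarrow> wf (c # ds) \<Longrightarrow> k \<in> Arr V \<Longrightarrow> src V k = T (c # z # ds) \<Longrightarrow>
      bin f x y z (mk (c # z # ds) k) = mk (c # x # y # ds) (k \<cdot> (\<one> (snd c) \<otimes>\<^sub>a ((f \<otimes>\<^sub>a \<one> (T ds)) \<cdot> asc' (snd x) (snd y) (T ds))))"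
  unfolding bin_def using opr_mk_mid[OF good_bin, of x y f z "[c]" ds k] by auto

lemma cob_mk1:
  "f \<in> Hom V (snd z) (snd x \<otimes> snd y) \<Longrightarrow> snd x \<in> Obj V \<Longrightarrow> snd y \<in> Obj V \<Longrightarrow> distinct (c # z # ds) \<Longrightarrow>
      distinct (c # x # y # ds) \<Longrightarrow> wf (c # ds) \<Longrightarrow> k \<in> Arr V \<Longrightarrow> src V k = T (c # x # y # ds) \<Longrightarrow>
      cob f z x y (mk (c # x # y # ds) k) = mk (c # z # ds) (k \<cdot> (\<one> (snd c) \<otimes>\<^sub>a (\<alpha> (snd x) (snd y) (T ds) \<cdot> (f \<otimes>\<^sub>a \<one> (T ds)))))"
  unfolding cob_def using opr_mk_mid[OF good_cob, of x y f z "[c]" ds k] by auto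

lemma nul_mk1:
  "f \<in> Hom V \<I> (snd z) \<Longrightarrow> distinct (c # z # ds) \<Longrightarrow> wf (c # ds) \<Longrightarrow> k \<in> Arr V \<Longrightarrow> src V k = T (c # z # ds) \<Longrightarrow>
      nul f z (mk (c # z # ds) k) = mk (c # ds) (k \<cdot> (\<one> (snd c) \<otimes>\<^sub>a ((f \<otimes>\<^sub>a \<one> (T ds)) \<cdot> lun' (T ds))))"
  unfolding nul_def using opr_mk_mid[OF good_nul, of f z "[c]" ds k] by auto

lemma del_mk1:
  "f \<in> Hom V (snd z) \<I> \<Longrightarrow> distinct (c # z # ds) \<Longrightarrow> wf (c # ds) \<Longrightarrow> k \<in> Arr V \<Longrightarrow> src V k = T (c # ds) \<Longrightarrow>
      del f z (mk (c # ds) k) = mk (c # z # ds) (k \<cdot> (\<one> (snd c) \<otimes>\<^sub>a (\<lambda>\<^sub>I (T ds) \<cdot> (f \<otimes>\<^sub>a \<one> (T ds)))))"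
  unfolding del_def using opr_mk_mid[OF good_del, of f z "[c]" ds k] by auto

lemma mk_swap:
  assumes "distinct (x # y # ds)" "wf (x # y # ds)" "k \<in> Arr V" "src V k = T (y # x # ds)"
  shows "mk (x # y # ds) (k \<cdot> swap (snd x) (snd y) (T ds)) = mk (y # x # ds) k"
  using mk_pa[OF pa.swap] assms by auto

lemma val_cases0:
  assumes "val K"
  obtains ds k where "distinct ds" "wf ds" "k \<in> Arr V" "src V k = T ds" "K = mk ds k" "fst K = set ds"
  using val_mk_ex[OF assms, of "[]"] by auto

lemma val_cases1:
  assumes "val K" "x \<in> fst K"
  obtains ds k where "distinct (x # ds)" "wf (x # ds)" "k \<in> Arr V" "src V k = T (x # ds)" "K = mk (x # ds) k"
    "fst K = set (x # ds)"
  using val_mk_ex[OF assms(1), of "[x]"] assms(2) by auto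

lemma val_cases2:
  assumes "val K" "x \<in> fst K" "y \<in> fst K" "x \<noteq> y"
  obtains ds k where "distinct (x # y # ds)" "wf (x # y # ds)" "k \<in> Arr V" "src V k = T (x # y # ds)"
    "K = mk (x # y # ds) k" "fst K = set (x # y # ds)"
  using val_mk_ex[OF assms(1), of "[x, y]"] assms(2-) by auto

lemma val_cases3:
  assumes "val K" "x \<in> fst K" "y \<in> fst K" "z \<in> fst K" "distinct [x, y, z]"
  obtains ds k where "distinct (x # y # z # ds)" "wf (x # y # z # ds)" "k \<in> Arr V" "src V k = T (x # y # z # ds)"
    "K = mk (x # y # z # ds) k" "fst K = set (x # y # z # ds)"
  using val_mk_ex[OF assms(1), of "[x, y, z]"] assms(2-) by auto

section \<open>Laws for consecutive operations on the same wires\<close>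

lemma sub_sub:
  assumes "f \<in> Hom V (snd x) (snd y)" "g \<in> Hom V (snd y) (snd z)" "val K" "z \<in> fst K"
    "y \<notin> fst K - {z}" "x \<notin> fst K - {z}"
  shows "sub f x y (sub g y z K) = sub (g \<cdot> f) x z K"
proof -
  obtain ds k where k: "distinct (z # ds)" "wf (z # ds)" "k \<in> Arr V" "src V k = T (z # ds)" "K = mk (z # ds) k"
    "fst K = set (z # ds)" using val_cases1 assms(3,4) by blast
  then show ?thesis using assms by (auto simp: sub_mk)
qed

lemma sub_id:
  assumes "val K" "x \<in> fst K" "snd x = X" shows "sub (\<one> X) x x K = K"
proof -
  obtain ds k where k: "distinct (x # ds)" "wf (x # ds)" "k \<in> Arr V" "src V k = T (x # ds)" "K = mk (x # ds) k"
    "fst K = set (x # ds)" using val_cases1 assms(1,2) by blast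
  then show ?thesis using assms(3) by (auto simp: sub_mk)
qed

lemma bin_sub:
  assumes "f \<in> Hom V (snd x \<otimes> snd y) (snd z)" "g \<in> Hom V (snd z) (snd w)" "val K" "w \<in> fst K"
    "snd x \<in> Obj V" "snd y \<in> Obj V" "x \<noteq> y" "z \<notin> fst K - {w}" "x \<notin> fst K - {w}" "y \<notin> fst K - {w}"
  shows "bin f x y z (sub g z w K) = bin (g \<cdot> f) x y w K"
proof -
  obtain ds k where k: "distinct (w # ds)" "wf (w # ds)" "k \<in> Arr V" "src V k = T (w # ds)" "K = mk (w # ds) k"
    "fst K = set (w # ds)" using val_cases1 assms(3,4) by blast
  then show ?thesis using assms by (auto simp: sub_mk bin_mk)
qed

lemma sub_bin1:
  assumes "g \<in> Hom V (snd x) (snd x')" "f \<in> Hom V (snd x' \<otimes> snd y) (snd z)" "val K" "z \<in> fst K"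
    "snd y \<in> Obj V" "x \<noteq> y" "x' \<noteq> y" "x' \<notin> fst K - {z}" "x \<notin> fst K - {z}" "y \<notin> fst K - {z}"
  shows "sub g x x' (bin f x' y z K) = bin (f \<cdot> (g \<otimes>\<^sub>a \<one> (snd y))) x y z K"
proof -
  have o: "snd x \<in> Obj V" "snd x' \<in> Obj V" using assms src_in_Obj[of g] tgt_in_Obj[of g] by auto
  obtain ds k where k: "distinct (z # ds)" "wf (z # ds)" "k \<in> Arr V" "src V k = T (z # ds)" "K = mk (z # ds) k"
    "fst K = set (z # ds)" using val_cases1 assms(3,4) by blast
  have "asc' (snd x') (snd y) (T ds) \<cdot> (g \<otimes>\<^sub>a \<one> (snd y \<otimes> T ds)) = ((g \<otimes>\<^sub>a \<one> (snd y)) \<otimes>\<^sub>a \<one> (T ds)) \<cdot> asc' (snd x) (snd y) (T ds)"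
    using asc'_nat[of g "\<one> (snd y)" "\<one> (T ds)"] assms k o by auto
  then show ?thesis using assms k o by (auto simp: sub_mk bin_mk)
qed

lemma sub_bin2:
  assumes "g \<in> Hom V (snd y) (snd y')" "f \<in> Hom V (snd x \<otimes> snd y') (snd z)" "val K" "z \<in> fst K"
    "snd x \<in> Obj V" "x \<noteq> y" "x \<noteq> y'" "y' \<notin> fst K - {z}" "x \<notin> fst K - {z}" "y \<notin> fst K - {z}"
  shows "sub g y y' (bin f x y' z K) = bin (f \<cdot> (\<one> (snd x) \<otimes>\<^sub>a g)) x y z K"
proof -
  have o: "snd y \<in> Obj V" "snd y' \<in> Obj V" using assms src_in_Obj[of g] tgt_in_Obj[of g] by auto
  obtain ds k where k: "distinct (z # ds)" "wf (z # ds)" "k \<in> Arr V" "src V k = T (z # ds)" "K = mk (z # ds) k"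
    "fst K = set (z # ds)" using val_cases1 assms(3,4) by blast
  have "asc' (snd x) (snd y') (T ds) \<cdot> (\<one> (snd x) \<otimes>\<^sub>a (g \<otimes>\<^sub>a \<one> (T ds))) = ((\<one> (snd x) \<otimes>\<^sub>a g) \<otimes>\<^sub>a \<one> (T ds)) \<cdot> asc' (snd x) (snd y) (T ds)"
    using asc'_nat[of "\<one> (snd x)" g "\<one> (T ds)"] assms k o by auto
  then show ?thesis using assms k o by (auto simp: sub_mk1 bin_mk)
qed

lemma sub_cob:
  assumes "g \<in> Hom V (snd w) (snd z)" "f \<in> Hom V (snd z) (snd x \<otimes> snd y)" "val K" "x \<in> fst K" "y \<in> fst K"
    "x \<noteq> y" "z \<notin> fst K - {x, y}" "w \<notin> fst K - {x, y}"
  shows "sub g w z (cob f z x y K) = cob (f \<cdot> g) w x y K"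
proof -
  obtain ds k where k: "distinct (x # y # ds)" "wf (x # y # ds)" "k \<in> Arr V" "src V k = T (x # y # ds)" "K = mk (x # y # ds) k"
    "fst K = set (x # y # ds)" using val_cases2[OF assms(3-6)] by blast
  then show ?thesis using assms by (auto simp: sub_mk cob_mk)
qed

lemma cob_sub1:
  assumes "f \<in> Hom V (snd z) (snd x' \<otimes> snd y)" "g \<in> Hom V (snd x') (snd x)" "val K" "x \<in> fst K" "y \<in> fst K"
    "x \<noteq> y" "x' \<notin> fst K - {x}" "z \<notin> fst K - {x, y}"
  shows "cob f z x' y (sub g x' x K) = cob ((g \<otimes>\<^sub>a \<one> (snd y)) \<cdot> f) z x y K"
proof -
  have o: "snd x \<in> Obj V" "snd x' \<in> Obj V" using assms src_in_Obj[of g] tgt_in_Obj[of g] by auto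
  obtain ds k where k: "distinct (x # y # ds)" "wf (x # y # ds)" "k \<in> Arr V" "src V k = T (x # y # ds)" "K = mk (x # y # ds) k"
    "fst K = set (x # y # ds)" using val_cases2[OF assms(3-6)] by blast
  have "(g \<otimes>\<^sub>a \<one> (snd y \<otimes> T ds)) \<cdot> \<alpha> (snd x') (snd y) (T ds) = \<alpha> (snd x) (snd y) (T ds) \<cdot> ((g \<otimes>\<^sub>a \<one> (snd y)) \<otimes>\<^sub>a \<one> (T ds))"
    using assc_nat[of g "\<one> (snd y)" "\<one> (T ds)"] assms k o by auto
  then have "(g \<otimes>\<^sub>a \<one> (snd y \<otimes> T ds)) \<cdot> \<alpha> (snd x') (snd y) (T ds) \<cdot> (f \<otimes>\<^sub>a \<one> (T ds)) = \<alpha> (snd x) (snd y) (T ds) \<cdot> (((g \<otimes>\<^sub>a \<one> (snd y)) \<cdot> f) \<otimes>\<^sub>a \<one> (T ds))"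
    using assms k o cmp_assoc'[of "f \<otimes>\<^sub>a \<one> (T ds)" "\<alpha> (snd x') (snd y) (T ds)" "g \<otimes>\<^sub>a \<one> (snd y \<otimes> T ds)"] by auto
  then show ?thesis using assms k o by (auto simp: sub_mk cob_mk)
qed

lemma cob_sub2:
  assumes "f \<in> Hom V (snd z) (snd x \<otimes> snd y')" "g \<in> Hom V (snd y') (snd y)" "val K" "x \<in> fst K" "y \<in> fst K"
    "x \<noteq> y" "y' \<notin> fst K - {y}" "z \<notin> fst K - {x, y}"
  shows "cob f z x y' (sub g y' y K) = cob ((\<one> (snd x) \<otimes>\<^sub>a g) \<cdot> f) z x y K"
proof -
  have o: "snd y \<in> Obj V" "snd y' \<in> Obj V" using assms src_in_Obj[of g] tgt_in_Obj[of g] by auto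
  obtain ds k where k: "distinct (x # y # ds)" "wf (x # y # ds)" "k \<in> Arr V" "src V k = T (x # y # ds)" "K = mk (x # y # ds) k"
    "fst K = set (x # y # ds)" using val_cases2[OF assms(3-6)] by blast
  have "(\<one> (snd x) \<otimes>\<^sub>a (g \<otimes>\<^sub>a \<one> (T ds))) \<cdot> \<alpha> (snd x) (snd y') (T ds) = \<alpha> (snd x) (snd y) (T ds) \<cdot> ((\<one> (snd x) \<otimes>\<^sub>a g) \<otimes>\<^sub>a \<one> (T ds))"
    using assc_nat[of "\<one> (snd x)" g "\<one> (T ds)"] assms k o by auto
  then have "(\<one> (snd x) \<otimes>\<^sub>a (g \<otimes>\<^sub>a \<one> (T ds))) \<cdot> \<alpha> (snd x) (snd y') (T ds) \<cdot> (f \<otimes>\<^sub>a \<one> (T ds)) = \<alpha> (snd x) (snd y) (T ds) \<cdot> (((\<one> (snd x) \<otimes>\<^sub>a g) \<cdot> f) \<otimes>\<^sub>a \<one> (T ds))"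
    using assms k o cmp_assoc'[of "f \<otimes>\<^sub>a \<one> (T ds)" "\<alpha> (snd x) (snd y') (T ds)" "\<one> (snd x) \<otimes>\<^sub>a (g \<otimes>\<^sub>a \<one> (T ds))"] by auto
  then show ?thesis using assms k o by (auto simp: sub_mk1 cob_mk)
qed

lemma cob_bin:
  assumes "f \<in> Hom V (snd z) (snd x \<otimes> snd y)" "g \<in> Hom V (snd x \<otimes> snd y) (snd w)" "val K" "w \<in> fst K"
    "snd x \<in> Obj V" "snd y \<in> Obj V" "x \<noteq> y" "z \<notin> fst K - {w}" "x \<notin> fst K - {w}" "y \<notin> fst K - {w}"
  shows "cob f z x y (bin g x y w K) = sub (g \<cdot> f) z w K"
proof -
  obtain ds k where k: "distinct (w # ds)" "wf (w # ds)" "k \<in> Arr V" "src V k = T (w # ds)" "K = mk (w # ds) k"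
    "fst K = set (w # ds)" using val_cases1[OF assms(3,4)] by blast
  then show ?thesis using assms by (auto simp: bin_mk cob_mk sub_mk)
qed

lemma bin_cob:
  assumes "f \<in> Hom V (snd x \<otimes> snd y) (snd z)" "g \<in> Hom V (snd z) (snd x' \<otimes> snd y')" "val K" "x' \<in> fst K" "y' \<in> fst K"
    "p \<in> Hom V (snd x) (snd x')" "q \<in> Hom V (snd y) (snd y')" "g \<cdot> f = p \<otimes>\<^sub>a q"
    "x \<noteq> y" "x' \<noteq> y'" "x \<noteq> y'" "y \<noteq> x'" "z \<notin> fst K - {x', y'}" "x \<notin> fst K - {x', y'}" "y \<notin> fst K - {x', y'}"
  shows "bin f x y z (cob g z x' y' K) = sub p x x' (sub q y y' K)"
proof -
  have o: "snd x \<in> Obj V" "snd y \<in> Obj V" "snd x' \<in> Obj V" "snd y' \<in> Obj V" using assms src_in_Obj[of p] tgt_in_Obj[of p]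
     src_in_Obj[of q] tgt_in_Obj[of q] by auto
  obtain ds k where k: "distinct (x' # y' # ds)" "wf (x' # y' # ds)" "k \<in> Arr V" "src V k = T (x' # y' # ds)" "K = mk (x' # y' # ds) k"
    "fst K = set (x' # y' # ds)" using val_cases2[OF assms(3-5) assms(10)] by blast
  have "(g \<otimes>\<^sub>a \<one> (T ds)) \<cdot> (f \<otimes>\<^sub>a \<one> (T ds)) \<cdot> asc' (snd x) (snd y) (T ds) = ((p \<otimes>\<^sub>a q) \<otimes>\<^sub>a \<one> (T ds)) \<cdot> asc' (snd x) (snd y) (T ds)"
    using assms k o by auto
  also have "\<dots> = asc' (snd x') (snd y') (T ds) \<cdot> (p \<otimes>\<^sub>a (q \<otimes>\<^sub>a \<one> (T ds)))"
    using asc'_nat[of p q "\<one> (T ds)"] assms k o by auto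
  finally have e: "(g \<otimes>\<^sub>a \<one> (T ds)) \<cdot> (f \<otimes>\<^sub>a \<one> (T ds)) \<cdot> asc' (snd x) (snd y) (T ds) = asc' (snd x') (snd y') (T ds) \<cdot> (p \<otimes>\<^sub>a (q \<otimes>\<^sub>a \<one> (T ds)))" .
  have "bin f x y z (cob g z x' y' K) = mk (x # y # ds) (k \<cdot> \<alpha> (snd x') (snd y') (T ds) \<cdot> ((g \<otimes>\<^sub>a \<one> (T ds)) \<cdot> (f \<otimes>\<^sub>a \<one> (T ds)) \<cdot> asc' (snd x) (snd y) (T ds)))"
    using assms k o by (auto simp: bin_mk cob_mk)
  also have "\<dots> = mk (x # y # ds) (k \<cdot> (p \<otimes>\<^sub>a (q \<otimes>\<^sub>a \<one> (T ds))))"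
    unfolding e using assms k o by auto
  also have "\<dots> = sub p x x' (sub q y y' K)"
    using assms k o by (auto simp: sub_mk1 sub_mk)
  finally show ?thesis .
qed

text \<open>The symmetry merely reorders the two new wires, and \<open>mk_swap\<close> makes a
  reordering invisible. Here and in \<open>cob_sym\<close> a symmetry inside an arrow is traded for
  an exchange of names.\<close>

lemma bin_sym:
  assumes "f \<in> Hom V (snd x \<otimes> snd y) (snd z)" "val K" "z \<in> fst K"
    "snd x \<in> Obj V" "snd y \<in> Obj V" "x \<noteq> y" "x \<notin> fst K - {z}" "y \<notin> fst K - {z}"
  shows "bin f x y z K = bin (f \<cdot> \<sigma> (snd y) (snd x)) y x z K"
proof -
  obtain ds k where k: "distinct (z # ds)" "wf (z # ds)" "k \<in> Arr V" "src V k = T (z # ds)" "K = mk (z # ds) k"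
    "fst K = set (z # ds)" using val_cases1[OF assms(2,3)] by blast
  have "bin f x y z K = mk (x # y # ds) ((k \<cdot> ((f \<cdot> \<sigma> (snd y) (snd x)) \<otimes>\<^sub>a \<one> (T ds)) \<cdot> asc' (snd y) (snd x) (T ds)) \<cdot> swap (snd x) (snd y) (T ds))"
    using assms k by (auto simp: bin_mk swap_def)
  also have "\<dots> = mk (y # x # ds) (k \<cdot> ((f \<cdot> \<sigma> (snd y) (snd x)) \<otimes>\<^sub>a \<one> (T ds)) \<cdot> asc' (snd y) (snd x) (T ds))"
    using assms k by (intro mk_swap) auto
  also have "\<dots> = bin (f \<cdot> \<sigma> (snd y) (snd x)) y x z K"
    using assms k by (auto simp: bin_mk)
  finally show ?thesis .
qed

lemma cob_sym:
  assumes "f \<in> Hom V (snd z) (snd x \<otimes> snd y)" "val K" "x \<in> fst K" "y \<in> fst K" "x \<noteq> y" "z \<notin> fst K - {x, y}"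
  shows "cob f z x y K = cob (\<sigma> (snd x) (snd y) \<cdot> f) z y x K"
proof -
  obtain ds k where k: "distinct (y # x # ds)" "wf (y # x # ds)" "k \<in> Arr V" "src V k = T (y # x # ds)" "K = mk (y # x # ds) k"
    "fst K = set (y # x # ds)" using val_cases2[OF assms(2) assms(4,3)] assms(5) by blast
  have K: "K = mk (x # y # ds) (k \<cdot> swap (snd x) (snd y) (T ds))"
    unfolding k(5) using k by (intro mk_swap[symmetric]) auto
  show ?thesis
    by (subst K, unfold k(5), insert assms k) (auto simp: cob_mk swap_def)
qed

text \<open>The associators that come from listing the wires are absorbed by the pentagon in step
  \<open>3\<close>; one remains in the hypothesis that relates the four arrows. With
  \<open>mul\<close> for all of them this is associativity of a monoid, with identities among them
  it rebrackets a tensor product.\<close>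

lemma bin_bin_assoc:
  assumes f: "f \<in> Hom V (snd x \<otimes> snd y) (snd u)" "g \<in> Hom V (snd u \<otimes> snd z) (snd w)"
      "f' \<in> Hom V (snd y \<otimes> snd z) (snd v)" "g' \<in> Hom V (snd x \<otimes> snd v) (snd w)"
    and e: "g \<cdot> (f \<otimes>\<^sub>a \<one> (snd z)) = g' \<cdot> (\<one> (snd x) \<otimes>\<^sub>a f') \<cdot> \<alpha> (snd x) (snd y) (snd z)"
    and K: "val K" "w \<in> fst K" "snd x \<in> Obj V" "snd y \<in> Obj V" "snd z \<in> Obj V"
      "distinct [x, y, z]" "u \<noteq> z" "v \<noteq> x" "u \<notin> fst K - {w}" "v \<notin> fst K - {w}" "set [x, y, z] \<inter> (fst K - {w}) = {}"
  shows "bin f x y u (bin g u z w K) = bin f' y z v (bin g' x v w K)"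
proof -
  let ?X = "snd x" and ?Y = "snd y" and ?Z = "snd z"
  have o: "snd u \<in> Obj V" "snd v \<in> Obj V" "snd w \<in> Obj V"
    using f tgt_in_Obj[of f] tgt_in_Obj[of f'] tgt_in_Obj[of g] by auto
  obtain ds k where k: "distinct (w # ds)" "wf (w # ds)" "k \<in> Arr V" "src V k = T (w # ds)" "K = mk (w # ds) k"
    "fst K = set (w # ds)" using val_cases1[OF K(1,2)] by blast
  let ?D = "T ds"
  have 1: "asc' (snd u) ?Z ?D \<cdot> (f \<otimes>\<^sub>a \<one> (?Z \<otimes> ?D)) = ((f \<otimes>\<^sub>a \<one> ?Z) \<otimes>\<^sub>a \<one> ?D) \<cdot> asc' (?X \<otimes> ?Y) ?Z ?D"
    using asc'_nat[of f "\<one> ?Z" "\<one> ?D"] f k K o by auto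
  have 2: "asc' ?X (snd v) ?D \<cdot> (\<one> ?X \<otimes>\<^sub>a (f' \<otimes>\<^sub>a \<one> ?D)) = ((\<one> ?X \<otimes>\<^sub>a f') \<otimes>\<^sub>a \<one> ?D) \<cdot> asc' ?X (?Y \<otimes> ?Z) ?D"
    using asc'_nat[of "\<one> ?X" f' "\<one> ?D"] f k K o by auto
  have "(\<alpha> ?X ?Y ?Z \<otimes>\<^sub>a \<one> ?D) \<cdot> asc' (?X \<otimes> ?Y) ?Z ?D \<cdot> asc' ?X ?Y (?Z \<otimes> ?D)
     = asc' ?X (?Y \<otimes> ?Z) ?D \<cdot> (\<one> ?X \<otimes>\<^sub>a asc' ?Y ?Z ?D) \<cdot> ((\<one> ?X \<otimes>\<^sub>a \<alpha> ?Y ?Z ?D) \<cdot> \<alpha> ?X (?Y \<otimes> ?Z) ?D \<cdot> (\<alpha> ?X ?Y ?Z \<otimes>\<^sub>a \<one> ?D)) \<cdot> asc' (?X \<otimes> ?Y) ?Z ?D \<cdot> asc' ?X ?Y (?Z \<otimes> ?D)"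
    using f k K o by auto
  also have "\<dots> = asc' ?X (?Y \<otimes> ?Z) ?D \<cdot> (\<one> ?X \<otimes>\<^sub>a asc' ?Y ?Z ?D)"
    using pentagon[of ?X ?Y ?Z ?D] f k K o by auto
  finally have 3: "(\<alpha> ?X ?Y ?Z \<otimes>\<^sub>a \<one> ?D) \<cdot> asc' (?X \<otimes> ?Y) ?Z ?D \<cdot> asc' ?X ?Y (?Z \<otimes> ?D)
     = asc' ?X (?Y \<otimes> ?Z) ?D \<cdot> (\<one> ?X \<otimes>\<^sub>a asc' ?Y ?Z ?D)" .
  have "bin f x y u (bin g u z w K) = mk (x # y # z # ds) (k \<cdot> (g \<otimes>\<^sub>a \<one> ?D) \<cdot> (asc' (snd u) ?Z ?D \<cdot> (f \<otimes>\<^sub>a \<one> (?Z \<otimes> ?D))) \<cdot> asc' ?X ?Y (?Z \<otimes> ?D))"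
    using f k K o by (auto simp: bin_mk)
  also have "\<dots> = mk (x # y # z # ds) (k \<cdot> ((g \<cdot> (f \<otimes>\<^sub>a \<one> ?Z)) \<otimes>\<^sub>a \<one> ?D) \<cdot> asc' (?X \<otimes> ?Y) ?Z ?D \<cdot> asc' ?X ?Y (?Z \<otimes> ?D))"
    unfolding 1 using f k K o by auto
  also have "\<dots> = mk (x # y # z # ds) (k \<cdot> ((g' \<cdot> (\<one> ?X \<otimes>\<^sub>a f')) \<otimes>\<^sub>a \<one> ?D) \<cdot> ((\<alpha> ?X ?Y ?Z \<otimes>\<^sub>a \<one> ?D) \<cdot> asc' (?X \<otimes> ?Y) ?Z ?D \<cdot> asc' ?X ?Y (?Z \<otimes> ?D)))"
    unfolding e using f k K o by auto
  also have "\<dots> = mk (x # y # z # ds) (k \<cdot> (g' \<otimes>\<^sub>a \<one> ?D) \<cdot> (((\<one> ?X \<otimes>\<^sub>a f') \<otimes>\<^sub>a \<one> ?D) \<cdot> asc' ?X (?Y \<otimes> ?Z) ?D) \<cdot> (\<one> ?X \<otimes>\<^sub>a asc' ?Y ?Z ?D))"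
    unfolding 3 using f k K o by auto
  also have "\<dots> = mk (x # y # z # ds) (k \<cdot> (g' \<otimes>\<^sub>a \<one> ?D) \<cdot> asc' ?X (snd v) ?D \<cdot> (\<one> ?X \<otimes>\<^sub>a ((f' \<otimes>\<^sub>a \<one> ?D) \<cdot> asc' ?Y ?Z ?D)))"
    unfolding 2[symmetric] using f k K o by auto
  also have "\<dots> = bin f' y z v (bin g' x v w K)"
    using f k K o by (auto simp: bin_mk1 bin_mk)
  finally show ?thesis .
qed

lemma cob_cob_assoc:
  assumes f: "f \<in> Hom V (snd w) (snd u \<otimes> snd z)" "g \<in> Hom V (snd u) (snd x \<otimes> snd y)"
      "f' \<in> Hom V (snd w) (snd x \<otimes> snd v)" "g' \<in> Hom V (snd v) (snd y \<otimes> snd z)"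
    and e: "\<alpha> (snd x) (snd y) (snd z) \<cdot> (g \<otimes>\<^sub>a \<one> (snd z)) \<cdot> f = (\<one> (snd x) \<otimes>\<^sub>a g') \<cdot> f'"
    and K: "val K" "x \<in> fst K" "y \<in> fst K" "z \<in> fst K" "snd u \<in> Obj V" "snd v \<in> Obj V"
      "distinct [x, y, z]" "u \<noteq> z" "v \<noteq> x" "u \<notin> fst K - {x, y, z}" "v \<notin> fst K - {x, y, z}" "w \<notin> fst K - {x, y, z}"
  shows "cob f w u z (cob g u x y K) = cob f' w x v (cob g' v y z K)"
proof -
  let ?X = "snd x" and ?Y = "snd y" and ?Z = "snd z"
  obtain ds k where k: "distinct (x # y # z # ds)" "wf (x # y # z # ds)" "k \<in> Arr V" "src V k = T (x # y # z # ds)"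
    "K = mk (x # y # z # ds) k" "fst K = set (x # y # z # ds)" using val_cases3[OF K(1-4,7)] by blast
  then have o: "?X \<in> Obj V" "?Y \<in> Obj V" "?Z \<in> Obj V" "snd w \<in> Obj V" using f src_in_Obj[of f] by auto
  let ?D = "T ds"
  have 1: "(g \<otimes>\<^sub>a \<one> (?Z \<otimes> ?D)) \<cdot> \<alpha> (snd u) ?Z ?D = \<alpha> (?X \<otimes> ?Y) ?Z ?D \<cdot> ((g \<otimes>\<^sub>a \<one> ?Z) \<otimes>\<^sub>a \<one> ?D)"
    using assc_nat[of g "\<one> ?Z" "\<one> ?D"] f k K o by auto
  have 2: "(\<one> ?X \<otimes>\<^sub>a (g' \<otimes>\<^sub>a \<one> ?D)) \<cdot> \<alpha> ?X (snd v) ?D = \<alpha> ?X (?Y \<otimes> ?Z) ?D \<cdot> ((\<one> ?X \<otimes>\<^sub>a g') \<otimes>\<^sub>a \<one> ?D)"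
    using assc_nat[of "\<one> ?X" g' "\<one> ?D"] f k K o by auto
  have "cob f w u z (cob g u x y K) = mk (w # ds) (k \<cdot> \<alpha> ?X ?Y (?Z \<otimes> ?D) \<cdot> ((g \<otimes>\<^sub>a \<one> (?Z \<otimes> ?D)) \<cdot> \<alpha> (snd u) ?Z ?D) \<cdot> (f \<otimes>\<^sub>a \<one> ?D))"
    using f k K o by (auto simp: cob_mk)
  also have "\<dots> = mk (w # ds) (k \<cdot> (\<alpha> ?X ?Y (?Z \<otimes> ?D) \<cdot> \<alpha> (?X \<otimes> ?Y) ?Z ?D) \<cdot> (((g \<otimes>\<^sub>a \<one> ?Z) \<cdot> f) \<otimes>\<^sub>a \<one> ?D))"
    unfolding 1 using f k K o by auto
  also have "\<dots> = mk (w # ds) (k \<cdot> (\<one> ?X \<otimes>\<^sub>a \<alpha> ?Y ?Z ?D) \<cdot> \<alpha> ?X (?Y \<otimes> ?Z) ?D \<cdot> ((\<alpha> ?X ?Y ?Z \<cdot> (g \<otimes>\<^sub>a \<one> ?Z) \<cdot> f) \<otimes>\<^sub>a \<one> ?D))"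
    unfolding pentagon[OF o(1-3) TT_Obj[OF _ unitO_in_Obj], of ds, symmetric, OF k(2)[unfolded wf_simps, THEN conjunct2, THEN conjunct2, THEN conjunct2]]
    using f k K o by auto
  also have "\<dots> = mk (w # ds) (k \<cdot> (\<one> ?X \<otimes>\<^sub>a \<alpha> ?Y ?Z ?D) \<cdot> (\<alpha> ?X (?Y \<otimes> ?Z) ?D \<cdot> ((\<one> ?X \<otimes>\<^sub>a g') \<otimes>\<^sub>a \<one> ?D)) \<cdot> (f' \<otimes>\<^sub>a \<one> ?D))"
    unfolding e using f k K o by auto
  also have "\<dots> = mk (w # ds) (k \<cdot> (\<one> ?X \<otimes>\<^sub>a (\<alpha> ?Y ?Z ?D \<cdot> (g' \<otimes>\<^sub>a \<one> ?D))) \<cdot> \<alpha> ?X (snd v) ?D \<cdot> (f' \<otimes>\<^sub>a \<one> ?D))"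
    unfolding 2[symmetric] using f k K o by auto
  also have "\<dots> = cob f' w x v (cob g' v y z K)"
    using f k K o by (auto simp: cob_mk1 cob_mk)
  finally show ?thesis .
qed

lemma lun'_assc: "X \<in> Obj V \<Longrightarrow> Y \<in> Obj V \<Longrightarrow> \<alpha> \<I> X Y \<cdot> (lun' X \<otimes>\<^sub>a \<one> Y) = lun' (X \<otimes> Y)"
  "X \<in> Obj V \<Longrightarrow> Y \<in> Obj V \<Longrightarrow> asc' \<I> X Y \<cdot> lun' (X \<otimes> Y) = lun' X \<otimes>\<^sub>a \<one> Y"
proof -
  assume o: "X \<in> Obj V" "Y \<in> Obj V"
  have "lun' (X \<otimes> Y) = lun' (X \<otimes> Y) \<cdot> (\<lambda>\<^sub>I X \<otimes>\<^sub>a \<one> Y) \<cdot> (lun' X \<otimes>\<^sub>a \<one> Y)"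
    using o by simp
  also have "\<dots> = \<alpha> \<I> X Y \<cdot> (lun' X \<otimes>\<^sub>a \<one> Y)"
    unfolding lun_assc[OF o, symmetric] using o by simp
  finally show 1: "\<alpha> \<I> X Y \<cdot> (lun' X \<otimes>\<^sub>a \<one> Y) = lun' (X \<otimes> Y)" by simp
  show "asc' \<I> X Y \<cdot> lun' (X \<otimes> Y) = lun' X \<otimes>\<^sub>a \<one> Y"
    unfolding 1[symmetric] using o by simp
qed

lemma run'_asc':
  assumes "X \<in> Obj V" "Y \<in> Obj V" shows "asc' X \<I> Y \<cdot> (\<one> X \<otimes>\<^sub>a lun' Y) = run' X \<otimes>\<^sub>a \<one> Y"
proof -
  have "(run' X \<otimes>\<^sub>a \<one> Y) \<cdot> (\<rho>\<^sub>I X \<otimes>\<^sub>a \<one> Y) \<cdot> asc' X \<I> Y \<cdot> (\<one> X \<otimes>\<^sub>a lun' Y) = run' X \<otimes>\<^sub>a \<one> Y"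
    unfolding triangle[OF assms, symmetric] using assms by simp
  then show ?thesis using assms by simp
qed

lemma lun'_nat: "f \<in> Arr V \<Longrightarrow> lun' (tgt V f) \<cdot> f = (\<one> \<I> \<otimes>\<^sub>a f) \<cdot> lun' (src V f)"
proof -
  assume f: "f \<in> Arr V"
  have "lun' (tgt V f) \<cdot> (f \<cdot> \<lambda>\<^sub>I (src V f)) \<cdot> lun' (src V f) = lun' (tgt V f) \<cdot> f" using f by simp
  then show ?thesis unfolding lun_nat[OF f, symmetric] using f by simp
qed

lemma nul_sub:
  assumes "f \<in> Hom V \<I> (snd z)" "g \<in> Hom V (snd z) (snd w)" "val K" "w \<in> fst K" "z \<notin> fst K - {w}"
  shows "nul f z (sub g z w K) = nul (g \<cdot> f) w K"
proof -
  obtain ds k where k: "distinct (w # ds)" "wf (w # ds)" "k \<in> Arr V" "src V k = T (w # ds)" "K = mk (w # ds) k"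
    "fst K = set (w # ds)" using val_cases1[OF assms(3,4)] by blast
  then show ?thesis using assms by (auto simp: sub_mk nul_mk)
qed

lemma nul_bin1:
  assumes "f \<in> Hom V \<I> (snd x)" "g \<in> Hom V (snd x \<otimes> snd y) (snd z)" "val K" "z \<in> fst K" "snd y \<in> Obj V" "x \<noteq> y"
    "x \<notin> fst K - {z}" "y \<notin> fst K - {z}"
  shows "nul f x (bin g x y z K) = sub (g \<cdot> (f \<otimes>\<^sub>a \<one> (snd y)) \<cdot> lun' (snd y)) y z K"
proof -
  obtain ds k where k: "distinct (z # ds)" "wf (z # ds)" "k \<in> Arr V" "src V k = T (z # ds)" "K = mk (z # ds) k"
    "fst K = set (z # ds)" using val_cases1[OF assms(3,4)] by blast
  have o: "snd x \<in> Obj V" using assms tgt_in_Obj[of f] by auto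
  let ?D = "T ds" and ?X = "snd x" and ?Y = "snd y"
  have 1: "asc' ?X ?Y ?D \<cdot> (f \<otimes>\<^sub>a \<one> (?Y \<otimes> ?D)) = ((f \<otimes>\<^sub>a \<one> ?Y) \<otimes>\<^sub>a \<one> ?D) \<cdot> asc' \<I> ?Y ?D"
    using asc'_nat[of f "\<one> ?Y" "\<one> ?D"] assms k o by auto
  have "nul f x (bin g x y z K) = mk (y # ds) (k \<cdot> (g \<otimes>\<^sub>a \<one> ?D) \<cdot> (asc' ?X ?Y ?D \<cdot> (f \<otimes>\<^sub>a \<one> (?Y \<otimes> ?D))) \<cdot> lun' (?Y \<otimes> ?D))"
    using assms k o by (auto simp: bin_mk nul_mk)
  also have "\<dots> = sub (g \<cdot> (f \<otimes>\<^sub>a \<one> (snd y)) \<cdot> lun' (snd y)) y z K"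
    unfolding 1 using assms k o by (auto simp: sub_mk lun'_assc)
  finally show ?thesis .
qed

lemma nul_bin2:
  assumes "f \<in> Hom V \<I> (snd y)" "g \<in> Hom V (snd x \<otimes> snd y) (snd z)" "val K" "z \<in> fst K" "snd x \<in> Obj V" "x \<noteq> y"
    "x \<notin> fst K - {z}" "y \<notin> fst K - {z}"
  shows "nul f y (bin g x y z K) = sub (g \<cdot> (\<one> (snd x) \<otimes>\<^sub>a f) \<cdot> run' (snd x)) x z K"
proof -
  obtain ds k where k: "distinct (z # ds)" "wf (z # ds)" "k \<in> Arr V" "src V k = T (z # ds)" "K = mk (z # ds) k"
    "fst K = set (z # ds)" using val_cases1[OF assms(3,4)] by blast
  have o: "snd y \<in> Obj V" using assms tgt_in_Obj[of f] by auto
  let ?D = "T ds" and ?X = "snd x" and ?Y = "snd y"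
  have 1: "asc' ?X ?Y ?D \<cdot> (\<one> ?X \<otimes>\<^sub>a (f \<otimes>\<^sub>a \<one> ?D)) = ((\<one> ?X \<otimes>\<^sub>a f) \<otimes>\<^sub>a \<one> ?D) \<cdot> asc' ?X \<I> ?D"
    using asc'_nat[of "\<one> ?X" f "\<one> ?D"] assms k o by auto
  have "nul f y (bin g x y z K) = mk (x # ds) (k \<cdot> (g \<otimes>\<^sub>a \<one> ?D) \<cdot> (asc' ?X ?Y ?D \<cdot> (\<one> ?X \<otimes>\<^sub>a (f \<otimes>\<^sub>a \<one> ?D))) \<cdot> (\<one> ?X \<otimes>\<^sub>a lun' ?D))"
    using assms k o by (auto simp: bin_mk nul_mk1)
  also have "\<dots> = sub (g \<cdot> (\<one> (snd x) \<otimes>\<^sub>a f) \<cdot> run' (snd x)) x z K"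
    unfolding 1 using assms k o by (auto simp: sub_mk run'_asc')
  finally show ?thesis .
qed

lemma nul_del:
  assumes "f \<in> Hom V \<I> (snd z)" "g \<in> Hom V (snd z) \<I>" "g \<cdot> f = \<one> \<I>" "val K" "z \<notin> fst K"
  shows "nul f z (del g z K) = K"
proof -
  obtain ds k where k: "distinct ds" "wf ds" "k \<in> Arr V" "src V k = T ds" "K = mk ds k"
    "fst K = set ds" using val_cases0[OF assms(4)] by blast
  then show ?thesis using assms by (auto simp: del_mk nul_mk)
qed

text \<open>The hypothesis says that \<open>g\<close> splits the point \<open>f\<close> into the
  points \<open>p\<close> and \<open>q\<close>. For a comonoid morphism out of the unit all three
  coincide and \<open>f\<close> is grouplike, which is the case in
  \<open>nul_cob_hom\<close>.\<close>

lemma nul_cob: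
  assumes "f \<in> Hom V \<I> (snd z)" "g \<in> Hom V (snd z) (snd x \<otimes> snd y)" "p \<in> Hom V \<I> (snd x)" "q \<in> Hom V \<I> (snd y)"
    "g \<cdot> f = (p \<otimes>\<^sub>a q) \<cdot> lun' \<I>" "val K" "x \<in> fst K" "y \<in> fst K" "x \<noteq> y" "z \<notin> fst K - {x, y}"
  shows "nul f z (cob g z x y K) = nul p x (nul q y K)"
proof -
  obtain ds k where k: "distinct (x # y # ds)" "wf (x # y # ds)" "k \<in> Arr V" "src V k = T (x # y # ds)" "K = mk (x # y # ds) k"
    "fst K = set (x # y # ds)" using val_cases2[OF assms(6-9)] by blast
  let ?D = "T ds" and ?X = "snd x" and ?Y = "snd y"
  have 1: "\<alpha> ?X ?Y ?D \<cdot> ((p \<otimes>\<^sub>a q) \<otimes>\<^sub>a \<one> ?D) = (p \<otimes>\<^sub>a (q \<otimes>\<^sub>a \<one> ?D)) \<cdot> \<alpha> \<I> \<I> ?D"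
    using assc_nat[of p q "\<one> ?D"] assms k by auto
  have 2: "lun' (?Y \<otimes> ?D) \<cdot> (q \<otimes>\<^sub>a \<one> ?D) = (\<one> \<I> \<otimes>\<^sub>a (q \<otimes>\<^sub>a \<one> ?D)) \<cdot> lun' (\<I> \<otimes> ?D)"
    using lun'_nat[of "q \<otimes>\<^sub>a \<one> ?D"] assms k by auto
  have "nul f z (cob g z x y K) = mk ds (k \<cdot> \<alpha> ?X ?Y ?D \<cdot> ((g \<cdot> f) \<otimes>\<^sub>a \<one> ?D) \<cdot> lun' ?D)"
    using assms k by (auto simp: cob_mk nul_mk)
  also have "\<dots> = mk ds (k \<cdot> (\<alpha> ?X ?Y ?D \<cdot> ((p \<otimes>\<^sub>a q) \<otimes>\<^sub>a \<one> ?D)) \<cdot> (lun' \<I> \<otimes>\<^sub>a \<one> ?D) \<cdot> lun' ?D)"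
    unfolding assms(5) using assms k by auto
  also have "\<dots> = mk ds (k \<cdot> (p \<otimes>\<^sub>a (q \<otimes>\<^sub>a \<one> ?D)) \<cdot> (\<alpha> \<I> \<I> ?D \<cdot> (lun' \<I> \<otimes>\<^sub>a \<one> ?D)) \<cdot> lun' ?D)"
    unfolding 1 using assms k by auto
  also have "\<dots> = mk ds (k \<cdot> (p \<otimes>\<^sub>a \<one> (?Y \<otimes> ?D)) \<cdot> ((\<one> \<I> \<otimes>\<^sub>a (q \<otimes>\<^sub>a \<one> ?D)) \<cdot> lun' (\<I> \<otimes> ?D)) \<cdot> lun' ?D)"
    using assms k by (auto simp: lun'_assc)
  also have "\<dots> = nul q y (nul p x K)"
    unfolding 2[symmetric] using assms k by (auto simp: nul_mk)
  also have "\<dots> = nul p x (nul q y K)"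
    by (rule nul_nul_comm) (use assms in auto)
  finally show ?thesis .
qed

lemma sub_del:
  assumes "f \<in> Hom V (snd z) (snd w)" "g \<in> Hom V (snd w) \<I>" "val K" "z \<notin> fst K" "w \<notin> fst K"
  shows "sub f z w (del g w K) = del (g \<cdot> f) z K"
proof -
  obtain ds k where k: "distinct ds" "wf ds" "k \<in> Arr V" "src V k = T ds" "K = mk ds k"
    "fst K = set ds" using val_cases0[OF assms(3)] by blast
  moreover have "snd z \<in> Obj V" using assms src_in_Obj[of f] by auto
  ultimately show ?thesis using assms by (auto simp: del_mk sub_mk)
qed

lemma cob_del1:
  assumes "f \<in> Hom V (snd z) (snd x \<otimes> snd y)" "g \<in> Hom V (snd x) \<I>" "val K" "y \<in> fst K" "x \<notin> fst K" "z \<notin> fst K - {y}"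
  shows "cob f z x y (del g x K) = sub (\<lambda>\<^sub>I (snd y) \<cdot> (g \<otimes>\<^sub>a \<one> (snd y)) \<cdot> f) z y K"
proof -
  obtain ds k where k: "distinct (y # ds)" "wf (y # ds)" "k \<in> Arr V" "src V k = T (y # ds)" "K = mk (y # ds) k"
    "fst K = set (y # ds)" using val_cases1[OF assms(3,4)] by blast
  have o: "snd x \<in> Obj V" "snd z \<in> Obj V" using assms src_in_Obj[of f] src_in_Obj[of g] by auto
  let ?D = "T ds" and ?X = "snd x" and ?Y = "snd y"
  have 1: "(g \<otimes>\<^sub>a \<one> (?Y \<otimes> ?D)) \<cdot> \<alpha> ?X ?Y ?D = \<alpha> \<I> ?Y ?D \<cdot> ((g \<otimes>\<^sub>a \<one> ?Y) \<otimes>\<^sub>a \<one> ?D)"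
    using assc_nat[of g "\<one> ?Y" "\<one> ?D"] assms k o by auto
  have "cob f z x y (del g x K) = mk (z # ds) (k \<cdot> \<lambda>\<^sub>I (?Y \<otimes> ?D) \<cdot> ((g \<otimes>\<^sub>a \<one> (?Y \<otimes> ?D)) \<cdot> \<alpha> ?X ?Y ?D) \<cdot> (f \<otimes>\<^sub>a \<one> ?D))"
    using assms k o by (auto simp: cob_mk del_mk)
  also have "\<dots> = mk (z # ds) (k \<cdot> (\<lambda>\<^sub>I (?Y \<otimes> ?D) \<cdot> \<alpha> \<I> ?Y ?D) \<cdot> ((g \<otimes>\<^sub>a \<one> ?Y) \<otimes>\<^sub>a \<one> ?D) \<cdot> (f \<otimes>\<^sub>a \<one> ?D))"
    unfolding 1 using assms k o by auto
  also have "\<dots> = sub (\<lambda>\<^sub>I (snd y) \<cdot> (g \<otimes>\<^sub>a \<one> (snd y)) \<cdot> f) z y K"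
    using assms k o by (auto simp: sub_mk lun_assc simp del: cmp_assoc')
  finally show ?thesis .
qed

lemma cob_del2:
  assumes "f \<in> Hom V (snd z) (snd x \<otimes> snd y)" "g \<in> Hom V (snd y) \<I>" "val K" "x \<in> fst K" "y \<notin> fst K" "z \<notin> fst K - {x}"
  shows "cob f z x y (del g y K) = sub (\<rho>\<^sub>I (snd x) \<cdot> (\<one> (snd x) \<otimes>\<^sub>a g) \<cdot> f) z x K"
proof -
  obtain ds k where k: "distinct (x # ds)" "wf (x # ds)" "k \<in> Arr V" "src V k = T (x # ds)" "K = mk (x # ds) k"
    "fst K = set (x # ds)" using val_cases1[OF assms(3,4)] by blast
  have o: "snd y \<in> Obj V" "snd z \<in> Obj V" using assms src_in_Obj[of f] src_in_Obj[of g] by auto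
  let ?D = "T ds" and ?X = "snd x" and ?Y = "snd y"
  have 1: "(\<one> ?X \<otimes>\<^sub>a (g \<otimes>\<^sub>a \<one> ?D)) \<cdot> \<alpha> ?X ?Y ?D = \<alpha> ?X \<I> ?D \<cdot> ((\<one> ?X \<otimes>\<^sub>a g) \<otimes>\<^sub>a \<one> ?D)"
    using assc_nat[of "\<one> ?X" g "\<one> ?D"] assms k o by auto
  have "cob f z x y (del g y K) = mk (z # ds) (k \<cdot> (\<one> ?X \<otimes>\<^sub>a \<lambda>\<^sub>I ?D) \<cdot> ((\<one> ?X \<otimes>\<^sub>a (g \<otimes>\<^sub>a \<one> ?D)) \<cdot> \<alpha> ?X ?Y ?D) \<cdot> (f \<otimes>\<^sub>a \<one> ?D))"
    using assms k o by (auto simp: cob_mk del_mk1)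
  also have "\<dots> = mk (z # ds) (k \<cdot> ((\<one> ?X \<otimes>\<^sub>a \<lambda>\<^sub>I ?D) \<cdot> \<alpha> ?X \<I> ?D) \<cdot> ((\<one> ?X \<otimes>\<^sub>a g) \<otimes>\<^sub>a \<one> ?D) \<cdot> (f \<otimes>\<^sub>a \<one> ?D))"
    unfolding 1 using assms k o by auto
  also have "\<dots> = sub (\<rho>\<^sub>I (snd x) \<cdot> (\<one> (snd x) \<otimes>\<^sub>a g) \<cdot> f) z x K"
    using assms k o by (auto simp: sub_mk triangle simp del: cmp_assoc')
  finally show ?thesis .
qed

lemma bin_del:
  assumes "f \<in> Hom V (snd x \<otimes> snd y) (snd z)" "g \<in> Hom V (snd z) \<I>" "p \<in> Hom V (snd x) \<I>" "q \<in> Hom V (snd y) \<I>"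
    "g \<cdot> f = \<lambda>\<^sub>I \<I> \<cdot> (p \<otimes>\<^sub>a q)" "val K" "x \<noteq> y" "x \<notin> fst K" "y \<notin> fst K" "z \<notin> fst K"
  shows "bin f x y z (del g z K) = del p x (del q y K)"
proof -
  obtain ds k where k: "distinct ds" "wf ds" "k \<in> Arr V" "src V k = T ds" "K = mk ds k"
    "fst K = set ds" using val_cases0[OF assms(6)] by blast
  have o: "snd x \<in> Obj V" "snd y \<in> Obj V" "snd z \<in> Obj V" using assms src_in_Obj[of g] src_in_Obj[of p] src_in_Obj[of q] by auto
  let ?D = "T ds" and ?X = "snd x" and ?Y = "snd y"
  have 1: "((p \<otimes>\<^sub>a q) \<otimes>\<^sub>a \<one> ?D) \<cdot> asc' ?X ?Y ?D = asc' \<I> \<I> ?D \<cdot> (p \<otimes>\<^sub>a (q \<otimes>\<^sub>a \<one> ?D))"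
    using asc'_nat[of p q "\<one> ?D"] assms k by auto
  have 2: "\<lambda>\<^sub>I ?D \<cdot> (\<one> \<I> \<otimes>\<^sub>a \<lambda>\<^sub>I ?D) = \<lambda>\<^sub>I ?D \<cdot> \<lambda>\<^sub>I (\<I> \<otimes> ?D)"
    using lun_nat[of "\<lambda>\<^sub>I ?D"] k by auto
  have 3: "(\<lambda>\<^sub>I \<I> \<otimes>\<^sub>a \<one> ?D) \<cdot> asc' \<I> \<I> ?D = \<lambda>\<^sub>I (\<I> \<otimes> ?D)"
    unfolding lun_assc[OF unitO_in_Obj TT_Obj[OF k(2) unitO_in_Obj], symmetric] using k by auto
  have 4: "(q \<otimes>\<^sub>a \<one> ?D) \<cdot> \<lambda>\<^sub>I (?Y \<otimes> ?D) = \<lambda>\<^sub>I (\<I> \<otimes> ?D) \<cdot> (\<one> \<I> \<otimes>\<^sub>a (q \<otimes>\<^sub>a \<one> ?D))"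
    using lun_nat[of "q \<otimes>\<^sub>a \<one> ?D"] assms k by auto
  have "bin f x y z (del g z K) = mk (x # y # ds) (k \<cdot> \<lambda>\<^sub>I ?D \<cdot> ((g \<cdot> f) \<otimes>\<^sub>a \<one> ?D) \<cdot> asc' ?X ?Y ?D)"
    using assms k o by (auto simp: bin_mk del_mk)
  also have "\<dots> = mk (x # y # ds) (k \<cdot> \<lambda>\<^sub>I ?D \<cdot> (\<lambda>\<^sub>I \<I> \<otimes>\<^sub>a \<one> ?D) \<cdot> (((p \<otimes>\<^sub>a q) \<otimes>\<^sub>a \<one> ?D) \<cdot> asc' ?X ?Y ?D))"
    unfolding assms(5) using assms k o by auto
  also have "\<dots> = mk (x # y # ds) (k \<cdot> \<lambda>\<^sub>I ?D \<cdot> ((\<lambda>\<^sub>I \<I> \<otimes>\<^sub>a \<one> ?D) \<cdot> asc' \<I> \<I> ?D) \<cdot> (p \<otimes>\<^sub>a (q \<otimes>\<^sub>a \<one> ?D)))"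
    unfolding 1 using assms k o by auto
  also have "\<dots> = mk (x # y # ds) (k \<cdot> \<lambda>\<^sub>I ?D \<cdot> (\<lambda>\<^sub>I (\<I> \<otimes> ?D) \<cdot> (\<one> \<I> \<otimes>\<^sub>a (q \<otimes>\<^sub>a \<one> ?D))) \<cdot> (p \<otimes>\<^sub>a (\<one> (?Y \<otimes> ?D))))"
    unfolding 3 using assms k o by auto
  also have "\<dots> = del p x (del q y K)"
    unfolding 4[symmetric] using assms k o by (auto simp: del_mk)
  finally show ?thesis .
qed

section \<open>Detecting equality of arrows on wires\<close>

lemma cob_bin_cancel:
  assumes "val K" "z \<in> fst K" "snd z = snd x \<otimes> snd y" "snd x \<in> Obj V" "snd y \<in> Obj V" "x \<noteq> y" "x \<notin> fst K - {z}" "y \<notin> fst K - {z}"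
  shows "cob (\<one> (snd z)) z x y (bin (\<one> (snd z)) x y z K) = K"
  using assms by (simp add: cob_bin sub_id)

text \<open>Substitution into the identity of Z already separates \<open>f\<close> from
  \<open>g\<close>. Equations between arrows can therefore be proved in Sweedler form, with an
  arbitrary \<open>K\<close> waiting at the output.\<close>

lemma eq_by_sub:
  assumes "f \<in> Hom V X Z" "g \<in> Hom V X Z"
    and "\<And>K. val K \<Longrightarrow> fst K = {(n, Z)} \<Longrightarrow> sub f (m, X) (n, Z) K = sub g (m, X) (n, Z) K"
  shows "f = g"
proof -
  \<comment> \<open>A list with a single wire is interpreted as Z \<otimes> I, so the unitor takes
    the role of the identity of Z.\<close>
  let ?K = "mk [(n, Z)] (\<rho>\<^sub>I Z)"
  have o: "X \<in> Obj V" "Z \<in> Obj V" using assms(1) by auto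
  have "sub f (m, X) (n, Z) ?K = sub g (m, X) (n, Z) ?K"
    by (rule assms(3)) (use o in auto)
  then have "mk [(m, X)] (\<rho>\<^sub>I Z \<cdot> (f \<otimes>\<^sub>a \<one> \<I>)) = mk [(m, X)] (\<rho>\<^sub>I Z \<cdot> (g \<otimes>\<^sub>a \<one> \<I>))"
    using assms(1,2) o by (simp add: sub_mk)
  then have "\<rho>\<^sub>I Z \<cdot> (f \<otimes>\<^sub>a \<one> \<I>) = \<rho>\<^sub>I Z \<cdot> (g \<otimes>\<^sub>a \<one> \<I>)"
    by (rule mk_inject) (use assms(1,2) o in auto)
  then have "f \<cdot> \<rho>\<^sub>I X = g \<cdot> \<rho>\<^sub>I X" using run_nat[of f] run_nat[of g] assms(1,2) by auto
  then show ?thesis by (rule iso_cancel_right[OF run_iso, rotated 5]) (use assms(1,2) o in auto)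
qed

text \<open>\<open>bin\<close> with an identity takes the wire \<open>z\<close> apart into its two
  tensor factors, and \<open>cob\<close> with the identity undoes this. Equations about a wire of
  type X \<otimes> Y may thus be verified on two separate wires; composite objects are treated in
  this way below.\<close>

lemma bin_inject:
  assumes "bin (\<one> Z) x y z K = bin (\<one> Z) x y z K'" "snd z = Z" "Z = snd x \<otimes> snd y" "snd x \<in> Obj V" "snd y \<in> Obj V"
    "val K" "val K'" "z \<in> fst K" "fst K' = fst K" "x \<noteq> y" "x \<notin> fst K - {z}" "y \<notin> fst K - {z}"
  shows "K = K'"
proof -
  have "cob (\<one> (snd z)) z x y (bin (\<one> (snd z)) x y z L) = L" if "L = K \<or> L = K'" for L
    by (rule cob_bin_cancel) (use assms(2-) that in \<open>auto\<close>)
  then show ?thesis using assms(1,2) by metis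
qed

lemma nul_inject:
  assumes "nul (\<one> \<I>) z K = nul (\<one> \<I>) z K'" "snd z = \<I>" "val K" "val K'" "z \<in> fst K" "fst K' = fst K"
  shows "K = K'"
proof -
  have "del (\<one> \<I>) z (nul (\<one> \<I>) z K) = K" if K: "val K" "z \<in> fst K" for K
  proof -
    obtain ds k where k: "distinct (z # ds)" "wf (z # ds)" "k \<in> Arr V" "src V k = T (z # ds)" "K = mk (z # ds) k"
      "fst K = set (z # ds)" using val_cases1[OF K] by blast
    then show ?thesis using assms(2) by (auto simp: nul_mk del_mk)
  qed
  then show ?thesis using assms by metis
qed

section \<open>Comonoids and measurings\<close>

lemma sub_cob_bin:
  assumes "f \<in> Hom V (snd z) (snd w)" "snd w = snd x \<otimes> snd y" "snd x \<in> Obj V" "snd y \<in> Obj V"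
    "val K" "w \<in> fst K" "x \<noteq> y" "z \<notin> fst K - {w}" "x \<notin> fst K - {w}" "y \<notin> fst K - {w}"
  shows "sub f z w K = cob f z x y (bin (\<one> (snd w)) x y w K)"
  using assms by (simp add: cob_bin)

lemma bin_tens:
  assumes "f \<in> Hom V (snd x) (snd x')" "g \<in> Hom V (snd y) (snd y')" "snd z = snd x' \<otimes> snd y'"
    "val K" "z \<in> fst K" "distinct [x, y, x', y']" "set [x, y, x', y'] \<inter> (fst K - {z}) = {}"
  shows "bin (f \<otimes>\<^sub>a g) x y z K = sub f x x' (sub g y y' (bin (\<one> (snd z)) x' y' z K))"
proof -
  have o: "snd x \<in> Obj V" "snd x' \<in> Obj V" "snd y \<in> Obj V" "snd y' \<in> Obj V"
    using assms src_in_Obj[of f] tgt_in_Obj[of f] src_in_Obj[of g] tgt_in_Obj[of g] by auto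
  have "sub g y y' (bin (\<one> (snd z)) x' y' z K) = bin (\<one> (snd z) \<cdot> (\<one> (snd x') \<otimes>\<^sub>a g)) x' y z K"
    using assms o by (intro sub_bin2) auto
  also have "sub f x x' \<dots> = bin ((\<one> (snd z) \<cdot> (\<one> (snd x') \<otimes>\<^sub>a g)) \<cdot> (f \<otimes>\<^sub>a \<one> (snd y))) x y z K"
    using assms o by (intro sub_bin1) auto
  finally show ?thesis using assms o by simp
qed

text \<open>On wires the middle-four interchange is only a regrouping of four names. Its definition
  by associators and one symmetry is unwound with \<open>bin_bin_assoc\<close> and
  \<open>bin_sym\<close>; \<open>q\<close> and \<open>r\<close> are the bundles of wires that occur
  on the way.\<close>

lemma bin_interchange:
  assumes "snd u = snd w \<otimes> snd x" "snd v = snd y \<otimes> snd z" "snd u' = snd w \<otimes> snd y" "snd v' = snd x \<otimes> snd z"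
    "snd s = snd u' \<otimes> snd v'" "snd w \<in> Obj V" "snd x \<in> Obj V" "snd y \<in> Obj V" "snd z \<in> Obj V"
    "snd q = snd x \<otimes> snd v" "snd r = snd x \<otimes> snd y"
    "distinct [w, x, y, z, u, v, u', v', q, r]" "val K" "s \<in> fst K" "set [w, x, y, z, u, v, u', v', q, r] \<inter> (fst K - {s}) = {}"
  shows "bin (\<one> (snd u)) w x u (bin (\<one> (snd v)) y z v (bin (interchange V (snd w) (snd x) (snd y) (snd z)) u v s K)) =
    bin (\<one> (snd u')) w y u' (bin (\<one> (snd v')) x z v' (bin (\<one> (snd s)) u' v' s K))"
proof -
  let ?W = "snd w" and ?X = "snd x" and ?Y = "snd y" and ?Z = "snd z"
  let ?i = "interchange V ?W ?X ?Y ?Z"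
  let ?g = "\<alpha> ?Y ?X ?Z \<cdot> (\<sigma> ?X ?Y \<otimes>\<^sub>a \<one> ?Z) \<cdot> asc' ?X ?Y ?Z"
  let ?g' = "asc' ?W ?Y (?X \<otimes> ?Z) \<cdot> (\<one> ?W \<otimes>\<^sub>a ?g)"
  let ?h = "\<alpha> ?X ?Y ?Z \<cdot> (\<sigma> ?Y ?X \<otimes>\<^sub>a \<one> ?Z) \<cdot> asc' ?Y ?X ?Z"
  have i: "?i = ?g' \<cdot> \<alpha> ?W ?X (?Y \<otimes> ?Z)" using assms(6-9) by (simp add: interchange_def)
  have ti: "?i \<in> Hom V (snd u \<otimes> snd v) (snd s)" unfolding i using assms by simp
  have "bin (\<one> (snd u)) w x u (bin (\<one> (snd v)) y z v (bin ?i u v s K))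
      = bin (\<one> (snd v)) y z v (bin (\<one> (snd u)) w x u (bin ?i u v s K))"
    using assms ti by (intro bin_bin_comm) auto
  also have "bin (\<one> (snd u)) w x u (bin ?i u v s K) = bin (\<one> (snd q)) x v q (bin ?g' w q s K)"
    using assms ti i by (intro bin_bin_assoc) auto
  also have "bin (\<one> (snd v)) y z v \<dots> = bin (\<one> (snd r)) x y r (bin (\<alpha> ?X ?Y ?Z) r z q (bin ?g' w q s K))"
    using assms by (intro bin_bin_assoc[symmetric]) auto
  also have "\<dots> = bin (\<sigma> ?Y ?X) y x r (bin (\<alpha> ?X ?Y ?Z) r z q (bin ?g' w q s K))"
    using assms by (subst bin_sym) auto
  also have "\<dots> = bin (\<one> (snd v')) x z v' (bin ?h y v' q (bin ?g' w q s K))"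
    using assms by (intro bin_bin_assoc) auto
  also have "bin ?h y v' q (bin ?g' w q s K) = bin (\<one> (snd u')) w y u' (bin (\<one> (snd s)) u' v' s K)"
    using assms by (intro bin_bin_assoc[symmetric]) auto
  also have "bin (\<one> (snd v')) x z v' \<dots> = bin (\<one> (snd u')) w y u' (bin (\<one> (snd v')) x z v' (bin (\<one> (snd s)) u' v' s K))"
    using assms by (intro bin_bin_comm) auto
  finally show ?thesis .
qed

lemma comonoid_types:
  assumes "is_comonoid V C"
  shows "ccar C \<in> Obj V" "comul C \<in> Arr V" "src V (comul C) = ccar C" "tgt V (comul C) = ccar C \<otimes> ccar C"
    "counit C \<in> Arr V" "src V (counit C) = ccar C" "tgt V (counit C) = \<I>"
  using assms by (auto simp: is_comonoid_def)

lemma monoid_types: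
  assumes "is_monoid V M"
  shows "mcar M \<in> Obj V" "mul M \<in> Arr V" "src V (mul M) = mcar M \<otimes> mcar M" "tgt V (mul M) = mcar M"
    "one M \<in> Arr V" "src V (one M) = \<I>" "tgt V (one M) = mcar M"
  using assms by (auto simp: is_monoid_def)

lemma cob_coassoc:
  assumes "is_comonoid V C" "snd w = ccar C" "snd u = ccar C" "snd v = ccar C" "snd x = ccar C" "snd y = ccar C" "snd z = ccar C"
    "val K" "x \<in> fst K" "y \<in> fst K" "z \<in> fst K" "distinct [x, y, z]" "u \<noteq> z" "v \<noteq> x"
    "u \<notin> fst K - {x, y, z}" "v \<notin> fst K - {x, y, z}" "w \<notin> fst K - {x, y, z}"
  shows "cob (comul C) w u z (cob (comul C) u x y K) = cob (comul C) w x v (cob (comul C) v y z K)"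
  by (rule cob_cob_assoc) (use assms comonoid_types[OF assms(1)] in \<open>auto simp: is_comonoid_def\<close>)

lemma cob_counit:
  assumes "is_comonoid V C" "snd z = ccar C" "snd x = ccar C" "snd y = ccar C" "val K" "y \<in> fst K" "x \<notin> fst K" "z \<notin> fst K - {y}"
  shows "cob (comul C) z x y (del (counit C) x K) = sub (\<one> (ccar C)) z y K"
    "cob (comul C) z y x (del (counit C) x K) = sub (\<one> (ccar C)) z y K"
  using assms comonoid_types[OF assms(1)] by (auto simp: cob_del1 cob_del2 is_comonoid_def)

lemma bin_assoc:
  assumes "is_monoid V M" "snd w = mcar M" "snd u = mcar M" "snd v = mcar M" "snd x = mcar M" "snd y = mcar M" "snd z = mcar M"
    "val K" "w \<in> fst K" "distinct [x, y, z]" "u \<noteq> z" "v \<noteq> x" "u \<notin> fst K - {w}" "v \<notin> fst K - {w}"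
    "set [x, y, z] \<inter> (fst K - {w}) = {}"
  shows "bin (mul M) x y u (bin (mul M) u z w K) = bin (mul M) y z v (bin (mul M) x v w K)"
  by (rule bin_bin_assoc) (use assms monoid_types[OF assms(1)] in \<open>auto simp: is_monoid_def\<close>)

lemma bin_unit:
  assumes "is_monoid V M" "snd x = mcar M" "snd y = mcar M" "snd z = mcar M" "val K" "z \<in> fst K" "x \<noteq> y"
    "x \<notin> fst K - {z}" "y \<notin> fst K - {z}"
  shows "nul (one M) x (bin (mul M) x y z K) = sub (\<one> (mcar M)) y z K"
    "nul (one M) x (bin (mul M) y x z K) = sub (\<one> (mcar M)) y z K"
proof -
  note t = monoid_types[OF assms(1)]
  have u: "mul M \<cdot> (one M \<otimes>\<^sub>a \<one> (mcar M)) \<cdot> lun' (mcar M) = \<one> (mcar M)"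
    "mul M \<cdot> (\<one> (mcar M) \<otimes>\<^sub>a one M) \<cdot> run' (mcar M) = \<one> (mcar M)"
    using assms(1) t cmp_assoc'[of "lun' (mcar M)" "one M \<otimes>\<^sub>a \<one> (mcar M)" "mul M"]
      cmp_assoc'[of "run' (mcar M)" "\<one> (mcar M) \<otimes>\<^sub>a one M" "mul M"] by (auto simp: is_monoid_def)
  have "nul (one M) x (bin (mul M) x y z K) = sub (mul M \<cdot> (one M \<otimes>\<^sub>a \<one> (snd y)) \<cdot> lun' (snd y)) y z K"
    by (rule nul_bin1) (use assms t in auto)
  then show "nul (one M) x (bin (mul M) x y z K) = sub (\<one> (mcar M)) y z K" using assms u by simp
  have "nul (one M) x (bin (mul M) y x z K) = sub (mul M \<cdot> (\<one> (snd y) \<otimes>\<^sub>a one M) \<cdot> run' (snd y)) y z K"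
    by (rule nul_bin2) (use assms t in auto)
  then show "nul (one M) x (bin (mul M) y x z K) = sub (\<one> (mcar M)) y z K" using assms u by simp
qed

lemma bin_comm:
  assumes "is_commutative_monoid V M" "snd x = mcar M" "snd y = mcar M" "snd z = mcar M" "val K" "z \<in> fst K" "x \<noteq> y"
    "x \<notin> fst K - {z}" "y \<notin> fst K - {z}"
  shows "bin (mul M) x y z K = bin (mul M) y x z K"
proof -
  have "is_monoid V M" "mul M \<cdot> \<sigma> (mcar M) (mcar M) = mul M" using assms(1) by (auto simp: is_commutative_monoid_def)
  then show ?thesis using bin_sym[of "mul M" x y z K] monoid_types[of M] assms by auto
qed

text \<open>The axioms in Sweedler form, converse to \<open>cob_coassoc\<close> and
  \<open>cob_counit\<close>. The test against every \<open>K\<close> with three wires replaces the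
  iterated tensor product of the axiom by three separate outputs.\<close>

lemma comonoidI:
  assumes t: "ccar C = X" "X \<in> Obj V" "comul C \<in> Hom V X (X \<otimes> X)" "counit C \<in> Hom V X \<I>"
    and a: "\<And>K. val K \<Longrightarrow> fst K = {(2, X), (3, X), (4, X)} \<Longrightarrow>
      cob (comul C) (0, X) (1, X) (4, X) (cob (comul C) (1, X) (2, X) (3, X) K) =
      cob (comul C) (0, X) (2, X) (5, X) (cob (comul C) (5, X) (3, X) (4, X) K)"
    and u: "\<And>K. val K \<Longrightarrow> fst K = {(1, X)} \<Longrightarrow> cob (comul C) (0, X) (2, X) (1, X) (del (counit C) (2, X) K) = sub (\<one> X) (0, X) (1, X) K"
      "\<And>K. val K \<Longrightarrow> fst K = {(1, X)} \<Longrightarrow> cob (comul C) (0, X) (1, X) (2, X) (del (counit C) (2, X) K) = sub (\<one> X) (0, X) (1, X) K"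
  shows "is_comonoid V C"
proof -
  let ?d = "comul C" and ?e = "counit C"
  have "\<alpha> X X X \<cdot> (?d \<otimes>\<^sub>a \<one> X) \<cdot> ?d = (\<one> X \<otimes>\<^sub>a ?d) \<cdot> ?d"
  proof (rule eq_by_sub[where X = X and Z = "X \<otimes> (X \<otimes> X)" and m = 0 and n = 9])
    fix K assume K: "val K" "fst K = {(9, X \<otimes> (X \<otimes> X))}"
    \<comment> \<open>The triple tensor product at the output is taken apart into the wires 2, 3 and
      4.\<close>
    let ?K = "bin (\<one> (X \<otimes> X)) (3, X) (4, X) (8, X \<otimes> X) (bin (\<one> (X \<otimes> (X \<otimes> X))) (2, X) (8, X \<otimes> X) (9, X \<otimes> (X \<otimes> X)) K)"
    have "sub (\<alpha> X X X \<cdot> (?d \<otimes>\<^sub>a \<one> X) \<cdot> ?d) (0, X) (9, X \<otimes> (X \<otimes> X)) K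
      = cob ?d (0, X) (1, X) (4, X) (bin (\<alpha> X X X \<cdot> (?d \<otimes>\<^sub>a \<one> X)) (1, X) (4, X) (9, X \<otimes> (X \<otimes> X)) K)"
      using t K by (subst cob_bin) auto
    also have "bin (\<alpha> X X X \<cdot> (?d \<otimes>\<^sub>a \<one> X)) (1, X) (4, X) (9, X \<otimes> (X \<otimes> X)) K =
       sub ?d (1, X) (7, X \<otimes> X) (bin (\<alpha> X X X) (7, X \<otimes> X) (4, X) (9, X \<otimes> (X \<otimes> X)) K)"
      using t K by (subst sub_bin1) auto
    also have "\<dots> = cob ?d (1, X) (2, X) (3, X) (bin (\<one> (X \<otimes> X)) (2, X) (3, X) (7, X \<otimes> X) (bin (\<alpha> X X X) (7, X \<otimes> X) (4, X) (9, X \<otimes> (X \<otimes> X)) K))"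
      using t K by (subst sub_cob_bin[where x = "(2, X)" and y = "(3, X)"]) auto
    also have "bin (\<one> (X \<otimes> X)) (2, X) (3, X) (7, X \<otimes> X) (bin (\<alpha> X X X) (7, X \<otimes> X) (4, X) (9, X \<otimes> (X \<otimes> X)) K) = ?K"
      using t K by (intro bin_bin_assoc) auto
    also have "cob ?d (0, X) (1, X) (4, X) (cob ?d (1, X) (2, X) (3, X) ?K) = cob ?d (0, X) (2, X) (5, X) (cob ?d (5, X) (3, X) (4, X) ?K)"
      using t K by (intro a) auto
    also have "cob ?d (5, X) (3, X) (4, X) ?K = bin (\<one> X \<otimes>\<^sub>a ?d) (2, X) (5, X) (9, X \<otimes> (X \<otimes> X)) K"
      using t K by (subst cob_bin) (auto simp: sub_bin2)
    also have "cob ?d (0, X) (2, X) (5, X) \<dots> = sub ((\<one> X \<otimes>\<^sub>a ?d) \<cdot> ?d) (0, X) (9, X \<otimes> (X \<otimes> X)) K"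
      using t K by (subst cob_bin) auto
    finally show "sub (\<alpha> X X X \<cdot> (?d \<otimes>\<^sub>a \<one> X) \<cdot> ?d) (0, X) (9, X \<otimes> (X \<otimes> X)) K = sub ((\<one> X \<otimes>\<^sub>a ?d) \<cdot> ?d) (0, X) (9, X \<otimes> (X \<otimes> X)) K" .
  qed (use t in auto)
  moreover have "\<lambda>\<^sub>I X \<cdot> (?e \<otimes>\<^sub>a \<one> X) \<cdot> ?d = \<one> X"
    by (rule eq_by_sub[where X = X and Z = X and m = 0 and n = 1])
      (use t u(1) cob_del1[of ?d "(0, X)" "(2, X)" "(1, X)" ?e] in auto)
  moreover have "\<rho>\<^sub>I X \<cdot> (\<one> X \<otimes>\<^sub>a ?e) \<cdot> ?d = \<one> X"
    by (rule eq_by_sub[where X = X and Z = X and m = 0 and n = 1])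
      (use t u(2) cob_del2[of ?d "(0, X)" "(1, X)" "(2, X)" ?e] in auto)
  ultimately show ?thesis unfolding is_comonoid_def using t by auto
qed

lemma comonoid_hom_types:
  assumes "f \<in> comonoid_homs V C D"
  shows "f \<in> Arr V" "src V f = ccar C" "tgt V f = ccar D"
  using assms by (auto simp: comonoid_homs_def)

lemma sub_cob_hom:
  assumes "is_comonoid V C" "is_comonoid V D" "f \<in> comonoid_homs V C D" "snd z = ccar C" "snd w = ccar D"
    "snd x = ccar D" "snd y = ccar D" "snd x' = ccar C" "snd y' = ccar C" "val K" "x \<in> fst K" "y \<in> fst K"
    "distinct [x, y, x', y']" "w \<notin> fst K - {x, y}" "z \<notin> fst K - {x, y}" "x' \<notin> fst K" "y' \<notin> fst K"
  shows "sub f z w (cob (comul D) w x y K) = cob (comul C) z x' y' (sub f x' x (sub f y' y K))"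
proof -
  note t = comonoid_types[OF assms(1)] comonoid_types[OF assms(2)] comonoid_hom_types[OF assms(3)]
  have "sub f z w (cob (comul D) w x y K) = cob (comul D \<cdot> f) z x y K"
    by (rule sub_cob) (use assms t in auto)
  also have "comul D \<cdot> f = (\<one> (snd x) \<otimes>\<^sub>a f) \<cdot> (f \<otimes>\<^sub>a \<one> (snd y')) \<cdot> comul C"
    using assms t by (simp add: comonoid_homs_def)
  also have "cob \<dots> z x y K = cob ((f \<otimes>\<^sub>a \<one> (snd y')) \<cdot> comul C) z x y' (sub f y' y K)"
    by (rule cob_sub2[symmetric]) (use assms t in auto)
  also have "\<dots> = cob (comul C) z x' y' (sub f x' x (sub f y' y K))"
    by (rule cob_sub1[symmetric]) (use assms t in auto)
  finally show ?thesis .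
qed

lemma sub_del_hom:
  assumes "is_comonoid V C" "is_comonoid V D" "f \<in> comonoid_homs V C D" "snd z = ccar C" "snd w = ccar D"
    "val K" "z \<notin> fst K" "w \<notin> fst K"
  shows "sub f z w (del (counit D) w K) = del (counit C) z K"
  using assms sub_del[of f z w "counit D" K] comonoid_types[OF assms(1)] comonoid_types[OF assms(2)]
  by (auto simp: comonoid_homs_def)

lemma comonoid_homI:
  assumes c: "ccar C = X" "ccar D = Y" "is_comonoid V C" "is_comonoid V D" "f \<in> Hom V X Y"
    and m: "\<And>K. val K \<Longrightarrow> fst K = {(3, Y), (4, Y)} \<Longrightarrow>
      sub f (0, X) (1, Y) (cob (comul D) (1, Y) (3, Y) (4, Y) K) =
      cob (comul C) (0, X) (5, X) (6, X) (sub f (5, X) (3, Y) (sub f (6, X) (4, Y) K))"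
    and e: "\<And>K. val K \<Longrightarrow> fst K = {} \<Longrightarrow> sub f (0, X) (1, Y) (del (counit D) (1, Y) K) = del (counit C) (0, X) K"
  shows "f \<in> comonoid_homs V C D"
proof -
  note t = comonoid_types[OF c(3)] comonoid_types[OF c(4)]
  have "comul D \<cdot> f = (f \<otimes>\<^sub>a f) \<cdot> comul C"
  proof (rule eq_by_sub[where X = X and Z = "Y \<otimes> Y" and m = 0 and n = 9])
    fix K assume K: "val K" "fst K = {(9, Y \<otimes> Y)}"
    let ?K = "bin (\<one> (Y \<otimes> Y)) (3, Y) (4, Y) (9, Y \<otimes> Y) K"
    have "sub (comul D \<cdot> f) (0, X) (9, Y \<otimes> Y) K = sub f (0, X) (1, Y) (cob (comul D) (1, Y) (3, Y) (4, Y) ?K)"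
      using t K c by (simp add: sub_cob cob_bin sub_sub)
    also have "\<dots> = cob (comul C) (0, X) (5, X) (6, X) (sub f (5, X) (3, Y) (sub f (6, X) (4, Y) ?K))"
      using t K c by (intro m) auto
    also have "\<dots> = sub ((f \<otimes>\<^sub>a f) \<cdot> comul C) (0, X) (9, Y \<otimes> Y) K"
      using t K c by (simp add: sub_bin1 sub_bin2 cob_bin)
    finally show "sub (comul D \<cdot> f) (0, X) (9, Y \<otimes> Y) K = sub ((f \<otimes>\<^sub>a f) \<cdot> comul C) (0, X) (9, Y \<otimes> Y) K" .
  qed (use t c in auto)
  moreover have "counit D \<cdot> f = counit C"
  proof (rule eq_by_sub[where X = X and Z = \<I> and m = 0 and n = 9])
    fix K assume K: "val K" "fst K = {(9, \<I>)}"
    \<comment> \<open>A wire of type I can be closed with the identity, so substituting an arrow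
      into I for it amounts to multiplication by a scalar.\<close>
    have i: "sub g (0, snd z) (9, \<I>) K = del g (0, snd z) (nul (\<one> \<I>) (9, \<I>) K)" if "g \<in> Hom V (snd z) \<I>" for g and z :: "nat \<times> 'o"
    proof -
      obtain ds k where k: "distinct ((9, \<I>) # ds)" "wf ((9, \<I>) # ds)" "k \<in> Arr V" "src V k = T ((9, \<I>) # ds)" "K = mk ((9, \<I>) # ds) k"
        "fst K = set ((9, \<I>) # ds)" using val_cases1[OF K(1), of "(9, \<I>)"] K(2) by blast
      moreover have "ds = []" using k K(2) by (cases ds) auto
      ultimately show ?thesis using that by (auto simp: sub_mk nul_mk del_mk)
    qed
    have "sub (counit D \<cdot> f) (0, X) (9, \<I>) K = del (counit D \<cdot> f) (0, X) (nul (\<one> \<I>) (9, \<I>) K)"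
      using i[of "counit D \<cdot> f" "(0, X)"] c t by simp
    also have "\<dots> = sub f (0, X) (1, Y) (del (counit D) (1, Y) (nul (\<one> \<I>) (9, \<I>) K))"
      using c t K by (simp add: sub_del)
    also have "\<dots> = sub (counit C) (0, X) (9, \<I>) K"
      using i[of "counit C" "(0, X)"] e[of "nul (\<one> \<I>) (9, \<I>) K"] c t K by simp
    finally show "sub (counit D \<cdot> f) (0, X) (9, \<I>) K = sub (counit C) (0, X) (9, \<I>) K" .
  qed (use t c in auto)
  ultimately show ?thesis using c by (simp add: comonoid_homs_def)
qed

text \<open>Only finitely many wires occur, so beyond some number all names are free, and this for
  every object at once. It supplies the auxiliary wires for lemmas whose own wires are
  variables.\<close>

lemma fresh_wires:
  assumes "finite (S :: 'o wire set)" obtains n where "\<And>m X. n \<le> m \<Longrightarrow> (m, X) \<notin> S"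
proof -
  have b: "i \<le> Max (fst ` S)" if "(i, X) \<in> S" for i X using assms that by (intro Max_ge) force+
  show ?thesis by (rule that[of "Suc (Max (fst ` S))"]) (use b in force)
qed

lemma val_finite: "val K \<Longrightarrow> finite (fst K)"
  by (simp add: val_def)

lemma sub_via_unit:
  assumes "f \<in> Hom V (snd x) \<I>" "g \<in> Hom V \<I> (snd y)" "val K" "y \<in> fst K" "x \<notin> fst K - {y}"
  shows "sub (g \<cdot> f) x y K = del f x (nul g y K)"
proof -
  obtain ds k where k: "distinct (y # ds)" "wf (y # ds)" "k \<in> Arr V" "src V k = T (y # ds)" "K = mk (y # ds) k"
    "fst K = set (y # ds)" using val_cases1[OF assms(3,4)] by blast
  then show ?thesis using assms by (auto simp: sub_mk nul_mk del_mk)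
qed

section \<open>Tensor products of comonoids\<close>

lemma tensor_comonoid_simps [simp]:
  "ccar (tensor_comonoid V C D) = ccar C \<otimes> ccar D"
  "counit (tensor_comonoid V C D) = \<lambda>\<^sub>I \<I> \<cdot> (counit C \<otimes>\<^sub>a counit D)"
  by (simp_all add: tensor_comonoid_def)

lemma interchange_simps [simp]:
  assumes "W \<in> Obj V" "X \<in> Obj V" "Y \<in> Obj V" "Z \<in> Obj V"
  shows "interchange V W X Y Z \<in> Arr V" "src V (interchange V W X Y Z) = (W \<otimes> X) \<otimes> (Y \<otimes> Z)"
    "tgt V (interchange V W X Y Z) = (W \<otimes> Y) \<otimes> (X \<otimes> Z)"
  using assms by (auto simp: interchange_def)

lemma tensor_comul:
  assumes "is_comonoid V C" "is_comonoid V D"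
  shows "comul (tensor_comonoid V C D) \<in> Hom V (ccar C \<otimes> ccar D) ((ccar C \<otimes> ccar D) \<otimes> (ccar C \<otimes> ccar D))"
  using comonoid_types[OF assms(1)] comonoid_types[OF assms(2)] by (simp add: tensor_comonoid_def)

text \<open>\<open>bin_interchange\<close> turns the interchange inside the comultiplication into a
  regrouping of names, so that c \<otimes> d splits into (c1 \<otimes> d1) \<otimes> (c2 \<otimes>
  d2) and both factors are split independently.\<close>

lemma bin_tensor_comul:
  assumes C: "is_comonoid V C" "is_comonoid V D"
    and w: "snd x = ccar C" "snd x1 = ccar C" "snd x2 = ccar C" "snd y = ccar D" "snd y1 = ccar D" "snd y2 = ccar D"
      "snd t = ccar C \<otimes> ccar D" "snd t1 = ccar C \<otimes> ccar D" "snd t2 = ccar C \<otimes> ccar D"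
    and K: "val K" "t1 \<in> fst K" "t2 \<in> fst K"
    and d: "distinct [x, y, t, x1, x2, y1, y2, t1, t2]" "set [x, y, t, x1, x2, y1, y2] \<inter> fst K = {}"
  shows "bin (\<one> (ccar C \<otimes> ccar D)) x y t (cob (comul (tensor_comonoid V C D)) t t1 t2 K) =
    cob (comul C) x x1 x2 (cob (comul D) y y1 y2
      (bin (\<one> (ccar C \<otimes> ccar D)) x1 y1 t1 (bin (\<one> (ccar C \<otimes> ccar D)) x2 y2 t2 K)))"
proof -
  note ty = comonoid_types[OF C(1)] comonoid_types[OF C(2)]
  let ?X = "ccar C" and ?Y = "ccar D"
  let ?T = "?X \<otimes> ?Y" and ?i = "interchange V ?X ?X ?Y ?Y"
  let ?D = "comul (tensor_comonoid V C D)"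
  have D: "?D = ?i \<cdot> (comul C \<otimes>\<^sub>a comul D)" by (simp add: tensor_comonoid_def)
  obtain n where n: "\<And>m X. n \<le> m \<Longrightarrow> (m, X) \<notin> fst K \<union> {x, y, t, x1, x2, y1, y2, t1, t2}"
    using fresh_wires[of "fst K \<union> {x, y, t, x1, x2, y1, y2, t1, t2}"] val_finite[OF K(1)] by auto
  let ?s = "(n, ?T \<otimes> ?T)" and ?r = "(n + 1, (?X \<otimes> ?X) \<otimes> (?Y \<otimes> ?Y))" and ?x' = "(n + 2, ?X \<otimes> ?X)" and ?y' = "(n + 3, ?Y \<otimes> ?Y)"
    and ?q = "(n + 4, ?X \<otimes> (?Y \<otimes> ?Y))" and ?p = "(n + 5, ?X \<otimes> ?Y)"
  have nn: "?s \<notin> fst K \<union> {x, y, t, x1, x2, y1, y2, t1, t2}" "?r \<notin> fst K \<union> {x, y, t, x1, x2, y1, y2, t1, t2}"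
    "?x' \<notin> fst K \<union> {x, y, t, x1, x2, y1, y2, t1, t2}" "?y' \<notin> fst K \<union> {x, y, t, x1, x2, y1, y2, t1, t2}"
    "?q \<notin> fst K \<union> {x, y, t, x1, x2, y1, y2, t1, t2}" "?p \<notin> fst K \<union> {x, y, t, x1, x2, y1, y2, t1, t2}"
    by (intro n, simp)+
  have nn': "\<forall>v \<in> {x, y, t, x1, x2, y1, y2, t1, t2}. v \<noteq> ?s \<and> v \<noteq> ?r \<and> v \<noteq> ?x' \<and> v \<noteq> ?y' \<and> v \<noteq> ?q \<and> v \<noteq> ?p"
    using nn by blast
  have d': "distinct [t2, t1, y2, y1, x2, x1, t, y, x]" using d(1) by auto
  note a = ty w K d d' nn nn'
  \<comment> \<open>The two outputs of the comultiplication are bundled into one wire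
    \<open>?s\<close>, so that the comultiplication becomes a plain substitution.\<close>
  let ?L = "cob (\<one> (?T \<otimes> ?T)) ?s t1 t2 K"
  have L: "val ?L" "fst ?L = insert ?s (fst K - {t1, t2})" using a by auto
  have "cob ?D t t1 t2 K = sub ?D t ?s ?L"
    using a by (subst sub_cob) (auto simp: D)
  then have "bin (\<one> ?T) x y t (cob ?D t t1 t2 K) = bin (\<one> ?T) x y t (sub ?D t ?s ?L)" by simp
  also have "\<dots> = bin ?D x y ?s ?L"
    using a L by (subst bin_sub) (auto simp: D)
  also have "\<dots> = bin (comul C \<otimes>\<^sub>a comul D) x y ?r (sub ?i ?r ?s ?L)"
    unfolding D using a L by (intro bin_sub[symmetric]) simp_all
  also have "\<dots> = sub (comul C) x ?x' (sub (comul D) y ?y' (bin (\<one> (snd ?r)) ?x' ?y' ?r (sub ?i ?r ?s ?L)))"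
    using a L by (intro bin_tens) simp_all
  also have "bin (\<one> (snd ?r)) ?x' ?y' ?r (sub ?i ?r ?s ?L) = bin ?i ?x' ?y' ?s ?L"
    using a L by (subst bin_sub) simp_all
  also have "sub (comul D) y ?y' (bin ?i ?x' ?y' ?s ?L) = cob (comul D) y y1 y2 (bin (\<one> (snd ?y')) y1 y2 ?y' (bin ?i ?x' ?y' ?s ?L))"
    using a L by (intro sub_cob_bin) simp_all
  also have "sub (comul C) x ?x' \<dots> = cob (comul C) x x1 x2 (bin (\<one> (snd ?x')) x1 x2 ?x' (cob (comul D) y y1 y2 (bin (\<one> (snd ?y')) y1 y2 ?y' (bin ?i ?x' ?y' ?s ?L))))"
    using a L by (intro sub_cob_bin) simp_all
  also have "bin (\<one> (snd ?x')) x1 x2 ?x' (cob (comul D) y y1 y2 (bin (\<one> (snd ?y')) y1 y2 ?y' (bin ?i ?x' ?y' ?s ?L)))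
    = cob (comul D) y y1 y2 (bin (\<one> (snd ?x')) x1 x2 ?x' (bin (\<one> (snd ?y')) y1 y2 ?y' (bin ?i ?x' ?y' ?s ?L)))"
    using a L by (intro cob_bin_comm) simp_all
  also have "?i = interchange V (snd x1) (snd x2) (snd y1) (snd y2)" using w by simp
  also have "bin (\<one> (snd ?x')) x1 x2 ?x' (bin (\<one> (snd ?y')) y1 y2 ?y' (bin (interchange V (snd x1) (snd x2) (snd y1) (snd y2)) ?x' ?y' ?s ?L)) =
    bin (\<one> (snd t1)) x1 y1 t1 (bin (\<one> (snd t2)) x2 y2 t2 (bin (\<one> (snd ?s)) t1 t2 ?s ?L))"
    using a L by (intro bin_interchange[where q = ?q and r = ?p]) simp_all
  also have "bin (\<one> (snd ?s)) t1 t2 ?s ?L = K"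
    using a by (subst bin_cob[where p = "\<one> ?T" and q = "\<one> ?T"]) (auto simp: sub_id)
  finally show ?thesis using w by simp
qed

lemma bin_tensor_counit:
  assumes "is_comonoid V C" "is_comonoid V D" "snd x = ccar C" "snd y = ccar D" "snd t = ccar C \<otimes> ccar D"
    "val K" "x \<noteq> y" "x \<notin> fst K" "y \<notin> fst K" "t \<notin> fst K"
  shows "bin (\<one> (ccar C \<otimes> ccar D)) x y t (del (\<lambda>\<^sub>I \<I> \<cdot> (counit C \<otimes>\<^sub>a counit D)) t K) = del (counit C) x (del (counit D) y K)"
  by (rule bin_del) (use assms comonoid_types[OF assms(1)] comonoid_types[OF assms(2)] in auto)

text \<open>Once every wire of type C \<otimes> D is taken apart, coassociativity and the counit
  laws hold in C and in D separately. The factors of the wire n are the wires n + 10 and n +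
  20.\<close>

lemma tensor_is_comonoid:
  assumes C: "is_comonoid V C" "is_comonoid V D"
  shows "is_comonoid V (tensor_comonoid V C D)"
proof -
  note ty = comonoid_types[OF C(1)] comonoid_types[OF C(2)] tensor_comul[OF C]
  let ?X = "ccar C" and ?Y = "ccar D"
  let ?T = "?X \<otimes> ?Y" and ?D = "comul (tensor_comonoid V C D)" and ?e = "\<lambda>\<^sub>I \<I> \<cdot> (counit C \<otimes>\<^sub>a counit D)"
  let ?p = "\<lambda>n. bin (\<one> ?T) (n + 10, ?X) (n + 20, ?Y) (n, ?T)"
  let ?dC = "\<lambda>i j k. cob (comul C) (i + 10, ?X) (j + 10, ?X) (k + 10, ?X)"
  let ?dD = "\<lambda>i j k. cob (comul D) (i + 20, ?Y) (j + 20, ?Y) (k + 20, ?Y)"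
  let ?dT = "\<lambda>i j k. cob ?D (i, ?T) (j, ?T) (k, ?T)"
  show ?thesis
  proof (rule comonoidI[where X = ?T])
    fix K assume K: "val K" "fst K = {(2, ?T), (3, ?T), (4, ?T)}"
    have "?p 0 (?dT 0 1 4 (?dT 1 2 3 K)) = ?dC 0 1 4 (?dD 0 1 4 (?p 1 (?p 4 (?dT 1 2 3 K))))"
      using ty K by (intro bin_tensor_comul C) auto
    also have "?p 4 (?dT 1 2 3 K) = ?dT 1 2 3 (?p 4 K)"
      using ty K by (intro cob_bin_comm) auto
    also have "?p 1 (?dT 1 2 3 (?p 4 K)) = ?dC 1 2 3 (?dD 1 2 3 (?p 2 (?p 3 (?p 4 K))))"
      using ty K by (intro bin_tensor_comul C) auto
    also have "?dD 0 1 4 (?dC 1 2 3 (?dD 1 2 3 (?p 2 (?p 3 (?p 4 K))))) = ?dC 1 2 3 (?dD 0 1 4 (?dD 1 2 3 (?p 2 (?p 3 (?p 4 K)))))"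
      using ty K by (intro cob_cob_comm) auto
    also have "?dD 0 1 4 (?dD 1 2 3 (?p 2 (?p 3 (?p 4 K)))) = ?dD 0 2 5 (?dD 5 3 4 (?p 2 (?p 3 (?p 4 K))))"
      using ty K by (intro cob_coassoc C) auto
    also have "?dC 0 1 4 (?dC 1 2 3 (?dD 0 2 5 (?dD 5 3 4 (?p 2 (?p 3 (?p 4 K)))))) =
       ?dC 0 2 5 (?dC 5 3 4 (?dD 0 2 5 (?dD 5 3 4 (?p 2 (?p 3 (?p 4 K))))))"
      using ty K by (intro cob_coassoc C) auto
    finally have l: "?p 0 (?dT 0 1 4 (?dT 1 2 3 K)) = \<dots>" .
    have "?p 0 (?dT 0 2 5 (?dT 5 3 4 K)) = ?dC 0 2 5 (?dD 0 2 5 (?p 2 (?p 5 (?dT 5 3 4 K))))"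
      using ty K by (intro bin_tensor_comul C) auto
    also have "?p 5 (?dT 5 3 4 K) = ?dC 5 3 4 (?dD 5 3 4 (?p 3 (?p 4 K)))"
      using ty K by (intro bin_tensor_comul C) auto
    also have "?p 2 (?dC 5 3 4 (?dD 5 3 4 (?p 3 (?p 4 K)))) = ?dC 5 3 4 (?p 2 (?dD 5 3 4 (?p 3 (?p 4 K))))"
      using ty K by (intro cob_bin_comm) auto
    also have "?p 2 (?dD 5 3 4 (?p 3 (?p 4 K))) = ?dD 5 3 4 (?p 2 (?p 3 (?p 4 K)))"
      using ty K by (intro cob_bin_comm) auto
    also have "?dD 0 2 5 (?dC 5 3 4 (?dD 5 3 4 (?p 2 (?p 3 (?p 4 K))))) = ?dC 5 3 4 (?dD 0 2 5 (?dD 5 3 4 (?p 2 (?p 3 (?p 4 K)))))"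
      using ty K by (intro cob_cob_comm) auto
    finally have "?p 0 (?dT 0 1 4 (?dT 1 2 3 K)) = ?p 0 (?dT 0 2 5 (?dT 5 3 4 K))" using l by simp
    then have e: "bin (\<one> ?T) (10, ?X) (20, ?Y) (0, ?T) (?dT 0 1 4 (?dT 1 2 3 K)) =
      bin (\<one> ?T) (10, ?X) (20, ?Y) (0, ?T) (?dT 0 2 5 (?dT 5 3 4 K))" by simp
    show "?dT 0 1 4 (?dT 1 2 3 K) = ?dT 0 2 5 (?dT 5 3 4 K)"
      by (rule bin_inject[OF e]) (use ty K in auto)
  next
    fix K assume K: "val K" "fst K = {(1, ?T)}"
    have r: "?p 0 (sub (\<one> ?T) (0, ?T) (1, ?T) K) = bin (\<one> ?T) (10, ?X) (20, ?Y) (1, ?T) K"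
      using ty K by (simp add: bin_sub)
    have "?p 0 (?dT 0 2 1 (del ?e (2, ?T) K)) = ?dC 0 2 1 (?dD 0 2 1 (?p 2 (?p 1 (del ?e (2, ?T) K))))"
      using ty K by (intro bin_tensor_comul C) auto
    also have "?p 1 (del ?e (2, ?T) K) = del ?e (2, ?T) (?p 1 K)"
      using ty K by (intro del_bin_comm) auto
    also have "?p 2 (del ?e (2, ?T) (?p 1 K)) = del (counit C) (12, ?X) (del (counit D) (22, ?Y) (?p 1 K))"
      using ty K by (subst bin_tensor_counit[OF C]) auto
    also have "?dD 0 2 1 (del (counit C) (12, ?X) (del (counit D) (22, ?Y) (?p 1 K))) = del (counit C) (12, ?X) (?dD 0 2 1 (del (counit D) (22, ?Y) (?p 1 K)))"
      using ty K by (intro cob_del_comm[symmetric]) auto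
    also have "?dC 0 2 1 \<dots> = bin (\<one> ?T) (10, ?X) (20, ?Y) (1, ?T) K"
      using ty K by (simp add: cob_counit[OF C(1)] cob_counit[OF C(2)] sub_bin1 sub_bin2)
    finally have e: "bin (\<one> ?T) (10, ?X) (20, ?Y) (0, ?T) (?dT 0 2 1 (del (counit (tensor_comonoid V C D)) (2, ?T) K)) =
      bin (\<one> ?T) (10, ?X) (20, ?Y) (0, ?T) (sub (\<one> ?T) (0, ?T) (1, ?T) K)" using r by simp
    show "?dT 0 2 1 (del (counit (tensor_comonoid V C D)) (2, ?T) K) = sub (\<one> ?T) (0, ?T) (1, ?T) K"
      by (rule bin_inject[OF e]) (use ty K in auto)
    have "?p 0 (?dT 0 1 2 (del ?e (2, ?T) K)) = ?dC 0 1 2 (?dD 0 1 2 (?p 1 (?p 2 (del ?e (2, ?T) K))))"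
      using ty K by (intro bin_tensor_comul C) auto
    also have "?p 2 (del ?e (2, ?T) K) = del (counit C) (12, ?X) (del (counit D) (22, ?Y) K)"
      using ty K by (subst bin_tensor_counit[OF C]) auto
    also have "?p 1 (del (counit C) (12, ?X) (del (counit D) (22, ?Y) K)) = del (counit C) (12, ?X) (del (counit D) (22, ?Y) (?p 1 K))"
      using ty K by (simp add: del_bin_comm)
    also have "?dD 0 1 2 (del (counit C) (12, ?X) (del (counit D) (22, ?Y) (?p 1 K))) = del (counit C) (12, ?X) (?dD 0 1 2 (del (counit D) (22, ?Y) (?p 1 K)))"
      using ty K by (intro cob_del_comm[symmetric]) auto
    also have "?dC 0 1 2 \<dots> = bin (\<one> ?T) (10, ?X) (20, ?Y) (1, ?T) K"
      using ty K by (simp add: cob_counit[OF C(1)] cob_counit[OF C(2)] sub_bin1 sub_bin2)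
    finally have e: "bin (\<one> ?T) (10, ?X) (20, ?Y) (0, ?T) (?dT 0 1 2 (del (counit (tensor_comonoid V C D)) (2, ?T) K)) =
      bin (\<one> ?T) (10, ?X) (20, ?Y) (0, ?T) (sub (\<one> ?T) (0, ?T) (1, ?T) K)" using r by simp
    show "?dT 0 1 2 (del (counit (tensor_comonoid V C D)) (2, ?T) K) = sub (\<one> ?T) (0, ?T) (1, ?T) K"
      by (rule bin_inject[OF e]) (use ty K in auto)
  qed (use ty in auto)
qed

section \<open>The unit comonoid and the co-opposite comonoid\<close>

lemma unit_comonoid_simps [simp]:
  "ccar (unit_comonoid V) = \<I>" "comul (unit_comonoid V) = lun' \<I>" "counit (unit_comonoid V) = \<one> \<I>"
  by (simp_all add: unit_comonoid_def)

lemma unit_is_comonoid: "is_comonoid V (unit_comonoid V)"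
proof -
  have "\<alpha> \<I> \<I> \<I> \<cdot> (lun' \<I> \<otimes>\<^sub>a \<one> \<I>) \<cdot> lun' \<I> = (\<alpha> \<I> \<I> \<I> \<cdot> (lun' \<I> \<otimes>\<^sub>a \<one> \<I>)) \<cdot> lun' \<I>" by simp
  also have "\<dots> = (\<one> \<I> \<otimes>\<^sub>a lun' \<I>) \<cdot> lun' \<I>"
    using lun'_nat[of "lun' \<I>"] by (subst lun'_assc) auto
  finally show ?thesis by (simp add: is_comonoid_def lun_unit_eq[symmetric])
qed

definition cop :: "('o, 'a) comonoid_obj \<Rightarrow> ('o, 'a) comonoid_obj" where
  "cop C = \<lparr>ccar = ccar C, comul = \<sigma> (ccar C) (ccar C) \<cdot> comul C, counit = counit C\<rparr>"

lemma cop_simps [simp]: "ccar (cop C) = ccar C" "counit (cop C) = counit C"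
  by (simp_all add: cop_def)

lemma cob_cop:
  assumes "is_comonoid V C" "snd x = ccar C" "snd y = ccar C" "snd z = ccar C" "val K" "x \<in> fst K" "y \<in> fst K" "x \<noteq> y"
    "z \<notin> fst K - {x, y}"
  shows "cob (comul (cop C)) z x y K = cob (comul C) z y x K"
  using assms cob_sym[of "comul C" z y x K] comonoid_types[OF assms(1)] by (auto simp: cop_def insert_commute)

text \<open>By \<open>cob_cop\<close> the two outputs only exchange their names, and coassociativity
  read with its three outputs in reverse order is coassociativity again.\<close>

lemma cop_is_comonoid:
  assumes C: "is_comonoid V C"
  shows "is_comonoid V (cop C)"
proof (rule comonoidI[where X = "ccar C"])
  note ty = comonoid_types[OF C]
  let ?X = "ccar C" and ?D = "comul (cop C)"
  show t: "comul (cop C) \<in> Hom V ?X (?X \<otimes> ?X)" using ty by (simp add: cop_def)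
  show "counit (cop C) \<in> Hom V ?X \<I>" using ty by simp
  fix K assume K: "val K" "fst K = {(2, ?X), (3, ?X), (4, ?X)}"
  have "cob ?D (0, ?X) (1, ?X) (4, ?X) (cob ?D (1, ?X) (2, ?X) (3, ?X) K)
     = cob (comul C) (0, ?X) (4, ?X) (1, ?X) (cob (comul C) (1, ?X) (3, ?X) (2, ?X) K)"
    using ty K t by (simp add: cob_cop[OF C])
  also have "\<dots> = cob (comul C) (0, ?X) (5, ?X) (2, ?X) (cob (comul C) (5, ?X) (4, ?X) (3, ?X) K)"
    using ty K by (intro cob_coassoc[OF C, symmetric]) auto
  also have "\<dots> = cob ?D (0, ?X) (2, ?X) (5, ?X) (cob ?D (5, ?X) (3, ?X) (4, ?X) K)"
    using ty K t by (simp add: cob_cop[OF C])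
  finally show "cob ?D (0, ?X) (1, ?X) (4, ?X) (cob ?D (1, ?X) (2, ?X) (3, ?X) K) = \<dots>" .
next
  note ty = comonoid_types[OF C]
  let ?X = "ccar C" and ?D = "comul (cop C)"
  fix K assume K: "val K" "fst K = {(1, ?X)}"
  show "cob ?D (0, ?X) (2, ?X) (1, ?X) (del (counit (cop C)) (2, ?X) K) = sub (\<one> ?X) (0, ?X) (1, ?X) K"
    "cob ?D (0, ?X) (1, ?X) (2, ?X) (del (counit (cop C)) (2, ?X) K) = sub (\<one> ?X) (0, ?X) (1, ?X) K"
    using ty K by (simp_all add: cob_cop[OF C] cob_counit[OF C])
qed (use comonoid_types[OF C] in auto)

section \<open>Closure properties of comonoid morphisms\<close>

lemma comonoid_hom_cmp:
  assumes "is_comonoid V C" "is_comonoid V D" "is_comonoid V E" "f \<in> comonoid_homs V C D" "g \<in> comonoid_homs V D E"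
  shows "g \<cdot> f \<in> comonoid_homs V C E"
proof -
  note t = comonoid_types[OF assms(1)] comonoid_types[OF assms(2)] comonoid_types[OF assms(3)]
    comonoid_hom_types[OF assms(4)] comonoid_hom_types[OF assms(5)]
  have f: "comul D \<cdot> f = (f \<otimes>\<^sub>a f) \<cdot> comul C" "counit D \<cdot> f = counit C"
    and g: "comul E \<cdot> g = (g \<otimes>\<^sub>a g) \<cdot> comul D" "counit E \<cdot> g = counit D"
    using assms(4,5) by (auto simp: comonoid_homs_def)
  have "comul E \<cdot> (g \<cdot> f) = (comul E \<cdot> g) \<cdot> f" using t by simp
  also have "\<dots> = (g \<otimes>\<^sub>a g) \<cdot> (comul D \<cdot> f)" unfolding g using t by simp
  also have "\<dots> = ((g \<cdot> f) \<otimes>\<^sub>a (g \<cdot> f)) \<cdot> comul C" unfolding f using t by simp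
  finally have 1: "comul E \<cdot> (g \<cdot> f) = ((g \<cdot> f) \<otimes>\<^sub>a (g \<cdot> f)) \<cdot> comul C" .
  have "counit E \<cdot> (g \<cdot> f) = (counit E \<cdot> g) \<cdot> f" using t by simp
  also have "\<dots> = counit C" unfolding g f ..
  finally show ?thesis using 1 t by (simp add: comonoid_homs_def)
qed

lemma comonoid_hom_ident: "is_comonoid V C \<Longrightarrow> \<one> (ccar C) \<in> comonoid_homs V C C"
  using comonoid_types[of C] by (simp add: comonoid_homs_def)

lemma comonoid_hom_tens:
  assumes C: "is_comonoid V C" "is_comonoid V D" "is_comonoid V C'" "is_comonoid V D'"
    and f: "f \<in> comonoid_homs V C C'" "g \<in> comonoid_homs V D D'"
  shows "f \<otimes>\<^sub>a g \<in> comonoid_homs V (tensor_comonoid V C D) (tensor_comonoid V C' D')"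
proof -
  note ty = comonoid_types[OF C(1)] comonoid_types[OF C(2)] comonoid_types[OF C(3)] comonoid_types[OF C(4)]
    tensor_comul[OF C(1,2)] tensor_comul[OF C(3,4)] comonoid_hom_types[OF f(1)] comonoid_hom_types[OF f(2)]
  let ?C = "ccar C" and ?D = "ccar D" and ?C' = "ccar C'" and ?D' = "ccar D'"
  let ?X = "?C \<otimes> ?D" and ?Y = "?C' \<otimes> ?D'"
  let ?f = "\<lambda>i j. sub f (i + 10, ?C) (j + 30, ?C')" and ?g = "\<lambda>i j. sub g (i + 20, ?D) (j + 40, ?D')"
  let ?fg = "\<lambda>i j. sub (f \<otimes>\<^sub>a g) (i, ?X) (j, ?Y)"
  let ?p = "\<lambda>n. bin (\<one> ?X) (n + 10, ?C) (n + 20, ?D) (n, ?X)" and ?q = "\<lambda>n. bin (\<one> ?Y) (n + 30, ?C') (n + 40, ?D') (n, ?Y)"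
  show ?thesis
  proof (rule comonoid_homI[where X = ?X and Y = ?Y])
    fix K assume K: "val K" "fst K = {(3, ?Y), (4, ?Y)}"
    \<comment> \<open>On wires taken apart, f \<otimes> g acts by \<open>f\<close> on the first
      factor and by \<open>g\<close> on the second.\<close>
    have pq: "?p i (?fg i j L) = ?f i j (?g i j (?q j L))"
      if "val L" "(j, ?Y) \<in> fst L" "set [(i, ?X), (i + 10, ?C), (i + 20, ?D), (j + 30, ?C'), (j + 40, ?D')] \<inter> (fst L - {(j, ?Y)}) = {}" "i < 10" "j < 10" for i j L
    proof -
      have "?p i (?fg i j L) = bin (f \<otimes>\<^sub>a g) (i + 10, ?C) (i + 20, ?D) (j, ?Y) L"
        using ty that by (subst bin_sub) auto
      also have "\<dots> = ?f i j (?g i j (bin (\<one> (snd (j, ?Y))) (j + 30, ?C') (j + 40, ?D') (j, ?Y) L))"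
        using ty that by (intro bin_tens) auto
      finally show ?thesis by simp
    qed
    let ?M = "?q 3 (?q 4 K)"
    have s1: "?p 0 (?fg 0 1 (cob (comul (tensor_comonoid V C' D')) (1, ?Y) (3, ?Y) (4, ?Y) K)) =
      ?f 0 1 (?g 0 1 (?q 1 (cob (comul (tensor_comonoid V C' D')) (1, ?Y) (3, ?Y) (4, ?Y) K)))"
      using ty K by (intro pq) auto
    have s2: "?q 1 (cob (comul (tensor_comonoid V C' D')) (1, ?Y) (3, ?Y) (4, ?Y) K) =
      cob (comul C') (31, ?C') (33, ?C') (34, ?C') (cob (comul D') (41, ?D') (43, ?D') (44, ?D') ?M)"
      using ty K bin_tensor_comul[OF C(3,4), of "(31, ?C')" "(33, ?C')" "(34, ?C')" "(41, ?D')" "(43, ?D')" "(44, ?D')" "(1, ?Y)" "(3, ?Y)" "(4, ?Y)" K] by simp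
    have s3: "?g 0 1 (cob (comul C') (31, ?C') (33, ?C') (34, ?C') (cob (comul D') (41, ?D') (43, ?D') (44, ?D') ?M)) =
      cob (comul C') (31, ?C') (33, ?C') (34, ?C') (?g 0 1 (cob (comul D') (41, ?D') (43, ?D') (44, ?D') ?M))"
      using ty K by (intro cob_sub_comm) auto
    have s4: "?g 0 1 (cob (comul D') (41, ?D') (43, ?D') (44, ?D') ?M) =
      cob (comul D) (20, ?D) (25, ?D) (26, ?D) (?g 5 3 (?g 6 4 ?M))"
      using ty K sub_cob_hom[OF C(2,4) f(2), of "(20, ?D)" "(41, ?D')" "(43, ?D')" "(44, ?D')" "(25, ?D)" "(26, ?D)" ?M] by simp
    have s5: "?f 0 1 (cob (comul C') (31, ?C') (33, ?C') (34, ?C') (cob (comul D) (20, ?D) (25, ?D) (26, ?D) (?g 5 3 (?g 6 4 ?M)))) =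
      cob (comul C) (10, ?C) (15, ?C) (16, ?C) (?f 5 3 (?f 6 4 (cob (comul D) (20, ?D) (25, ?D) (26, ?D) (?g 5 3 (?g 6 4 ?M)))))"
      using ty K sub_cob_hom[OF C(1,3) f(1), of "(10, ?C)" "(31, ?C')" "(33, ?C')" "(34, ?C')" "(15, ?C)" "(16, ?C)" "(cob (comul D) (20, ?D) (25, ?D) (26, ?D) (?g 5 3 (?g 6 4 ?M)))"] by simp
    have s6: "\<dots> = cob (comul C) (10, ?C) (15, ?C) (16, ?C) (cob (comul D) (20, ?D) (25, ?D) (26, ?D) (?f 5 3 (?g 5 3 (?q 3 (?f 6 4 (?g 6 4 (?q 4 K)))))))"
      using ty K by (simp add: comms)
    have s7: "?f 6 4 (?g 6 4 (?q 4 K)) = ?p 6 (?fg 6 4 K)"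
      using ty K by (intro pq[symmetric]) auto
    have s8: "?f 5 3 (?g 5 3 (?q 3 (?p 6 (?fg 6 4 K)))) = ?p 5 (?fg 5 3 (?p 6 (?fg 6 4 K)))"
      using ty K by (intro pq[symmetric]) auto
    have s9: "?fg 5 3 (?p 6 (?fg 6 4 K)) = ?p 6 (?fg 5 3 (?fg 6 4 K))"
      using ty K by (intro sub_bin_comm[symmetric]) auto
    have s10: "cob (comul C) (10, ?C) (15, ?C) (16, ?C) (cob (comul D) (20, ?D) (25, ?D) (26, ?D) (?p 5 (?p 6 (?fg 5 3 (?fg 6 4 K))))) =
      ?p 0 (cob (comul (tensor_comonoid V C D)) (0, ?X) (5, ?X) (6, ?X) (?fg 5 3 (?fg 6 4 K)))"
      using ty K bin_tensor_comul[OF C(1,2), of "(10, ?C)" "(15, ?C)" "(16, ?C)" "(20, ?D)" "(25, ?D)" "(26, ?D)" "(0, ?X)" "(5, ?X)" "(6, ?X)" "?fg 5 3 (?fg 6 4 K)"] by simp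
    have e0: "?p 0 (?fg 0 1 (cob (comul (tensor_comonoid V C' D')) (1, ?Y) (3, ?Y) (4, ?Y) K)) =
       ?p 0 (cob (comul (tensor_comonoid V C D)) (0, ?X) (5, ?X) (6, ?X) (?fg 5 3 (?fg 6 4 K)))"
      by (unfold s1, unfold s2, unfold s3, unfold s4, unfold s5, unfold s6, unfold s7, unfold s8, unfold s9, unfold s10, rule refl)
    show "?fg 0 1 (cob (comul (tensor_comonoid V C' D')) (1, ?Y) (3, ?Y) (4, ?Y) K) =
       cob (comul (tensor_comonoid V C D)) (0, ?X) (5, ?X) (6, ?X) (?fg 5 3 (?fg 6 4 K))"
      by (rule bin_inject[OF e0]) (use ty K in auto)
  next
    fix K assume K: "val K" "fst K = {}"
    have h: "counit C' \<cdot> f = counit C" "counit D' \<cdot> g = counit D" using f by (auto simp: comonoid_homs_def)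
    show "?fg 0 1 (del (counit (tensor_comonoid V C' D')) (1, ?Y) K) = del (counit (tensor_comonoid V C D)) (0, ?X) K"
      using ty K by (subst sub_del) (auto simp: h)
  qed (use ty tensor_is_comonoid C in auto)
qed

text \<open>This is needed because \<open>comonoid_hom_eqI\<close> compares comonoid morphisms only,
  and one side of the associativity law for P contains an associator. On wires taken apart
  completely the associator is invisible, by \<open>as\<close>, and both sides split the three
  factors independently.\<close>

lemma comonoid_hom_assc:
  assumes C: "is_comonoid V C" "is_comonoid V D" "is_comonoid V E"
  shows "\<alpha> (ccar C) (ccar D) (ccar E) \<in> comonoid_homs V (tensor_comonoid V (tensor_comonoid V C D) E)
     (tensor_comonoid V C (tensor_comonoid V D E))"
proof -
  note CD = tensor_is_comonoid[OF C(1,2)] and DE = tensor_is_comonoid[OF C(2,3)]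
  note ty = comonoid_types[OF C(1)] comonoid_types[OF C(2)] comonoid_types[OF C(3)]
    tensor_comul[OF C(1,2)] tensor_comul[OF C(2,3)] tensor_comul[OF C(1) DE] tensor_comul[OF CD C(3)]
  let ?C = "ccar C" and ?D = "ccar D" and ?E = "ccar E"
  let ?U = "?C \<otimes> ?D" and ?W = "?D \<otimes> ?E" let ?X = "?U \<otimes> ?E" and ?Y = "?C \<otimes> ?W" and ?a = "\<alpha> ?C ?D ?E"
  let ?dX = "comul (tensor_comonoid V (tensor_comonoid V C D) E)" and ?dY = "comul (tensor_comonoid V C (tensor_comonoid V D E))"
  let ?cd = "\<lambda>n. bin (\<one> ?U) (n + 10, ?C) (n + 20, ?D) (n + 30, ?U)"
  let ?de = "\<lambda>n. bin (\<one> ?W) (n + 20, ?D) (n + 40, ?E) (n + 50, ?W)"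
  let ?ue = "\<lambda>n. bin (\<one> ?X) (n + 30, ?U) (n + 40, ?E) (n, ?X)"
  let ?cw = "\<lambda>n m. bin (\<one> ?Y) (n + 10, ?C) (n + 50, ?W) (m, ?Y)"
  let ?dc = "cob (comul C) (10, ?C) (15, ?C) (16, ?C)" and ?dd = "cob (comul D) (20, ?D) (25, ?D) (26, ?D)" and ?dE = "cob (comul E) (40, ?E) (45, ?E) (46, ?E)"
  have as: "?cd n (?ue n (sub ?a (n, ?X) (m, ?Y) L)) = ?de n (?cw n m L)"
    if "val L" "(m, ?Y) \<in> fst L" "n < 10" "m < 10"
      "set [(n, ?X), (n + 10, ?C), (n + 20, ?D), (n + 30, ?U), (n + 40, ?E), (n + 50, ?W)] \<inter> (fst L - {(m, ?Y)}) = {}" for n m L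
  proof -
    have s1: "?ue n (sub ?a (n, ?X) (m, ?Y) L) = bin ?a (n + 30, ?U) (n + 40, ?E) (m, ?Y) L"
      using ty that by (subst bin_sub) auto
    have s2: "?cd n \<dots> = ?de n (?cw n m L)"
      using ty that by (intro bin_bin_assoc) auto
    show "?cd n (?ue n (sub ?a (n, ?X) (m, ?Y) L)) = ?de n (?cw n m L)"
      by (unfold s1, unfold s2, rule refl)
  qed
  show ?thesis
  proof (rule comonoid_homI[where X = ?X and Y = ?Y])
    fix K assume K: "val K" "fst K = {(3, ?Y), (4, ?Y)}"
    have s1: "?cd 0 (?ue 0 (sub ?a (0, ?X) (1, ?Y) (cob ?dY (1, ?Y) (3, ?Y) (4, ?Y) K))) = ?de 0 (?cw 0 1 (cob ?dY (1, ?Y) (3, ?Y) (4, ?Y) K))"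
      using ty K by (intro as) auto
    have s2: "?cw 0 1 (cob ?dY (1, ?Y) (3, ?Y) (4, ?Y) K) = ?dc (cob (comul (tensor_comonoid V D E)) (50, ?W) (55, ?W) (56, ?W) (?cw 5 3 (?cw 6 4 K)))"
      using ty K bin_tensor_comul[OF C(1) DE, of "(10, ?C)" "(15, ?C)" "(16, ?C)" "(50, ?W)" "(55, ?W)" "(56, ?W)" "(1, ?Y)" "(3, ?Y)" "(4, ?Y)" K] by simp
    have s3: "?de 0 \<dots> = ?dc (?de 0 (cob (comul (tensor_comonoid V D E)) (50, ?W) (55, ?W) (56, ?W) (?cw 5 3 (?cw 6 4 K))))"
      using ty K by (intro cob_bin_comm) auto
    have s4: "?de 0 (cob (comul (tensor_comonoid V D E)) (50, ?W) (55, ?W) (56, ?W) (?cw 5 3 (?cw 6 4 K))) = ?dd (?dE (?de 5 (?de 6 (?cw 5 3 (?cw 6 4 K)))))"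
      using ty K bin_tensor_comul[OF C(2,3), of "(20, ?D)" "(25, ?D)" "(26, ?D)" "(40, ?E)" "(45, ?E)" "(46, ?E)" "(50, ?W)" "(55, ?W)" "(56, ?W)" "?cw 5 3 (?cw 6 4 K)"] by simp
    have s5: "?de 6 (?cw 5 3 (?cw 6 4 K)) = ?cw 5 3 (?de 6 (?cw 6 4 K))"
      using ty K by (intro bin_bin_comm) auto
    have s6: "?de 6 (?cw 6 4 K) = ?cd 6 (?ue 6 (sub ?a (6, ?X) (4, ?Y) K))"
      using ty K by (intro as[symmetric]) auto
    have s7: "?de 5 (?cw 5 3 \<dots>) = ?cd 5 (?ue 5 (sub ?a (5, ?X) (3, ?Y) (?cd 6 (?ue 6 (sub ?a (6, ?X) (4, ?Y) K)))))"
      using ty K by (intro as[symmetric]) auto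
    have l: "?cd 0 (?ue 0 (sub ?a (0, ?X) (1, ?Y) (cob ?dY (1, ?Y) (3, ?Y) (4, ?Y) K))) =
      ?dc (?dd (?dE (?cd 5 (?ue 5 (sub ?a (5, ?X) (3, ?Y) (?cd 6 (?ue 6 (sub ?a (6, ?X) (4, ?Y) K))))))))"
      by (unfold s1, unfold s2, unfold s3, unfold s4, unfold s5, unfold s6, unfold s7, rule refl)
    let ?N = "sub ?a (5, ?X) (3, ?Y) (sub ?a (6, ?X) (4, ?Y) K)"
    have s1: "?ue 0 (cob ?dX (0, ?X) (5, ?X) (6, ?X) ?N) = cob (comul (tensor_comonoid V C D)) (30, ?U) (35, ?U) (36, ?U) (?dE (?ue 5 (?ue 6 ?N)))"
      using ty K bin_tensor_comul[OF CD C(3), of "(30, ?U)" "(35, ?U)" "(36, ?U)" "(40, ?E)" "(45, ?E)" "(46, ?E)" "(0, ?X)" "(5, ?X)" "(6, ?X)" ?N] by simp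
    have s2: "?cd 0 \<dots> = ?dc (?dd (?cd 5 (?cd 6 (?dE (?ue 5 (?ue 6 ?N))))))"
      using ty K bin_tensor_comul[OF C(1,2), of "(10, ?C)" "(15, ?C)" "(16, ?C)" "(20, ?D)" "(25, ?D)" "(26, ?D)" "(30, ?U)" "(35, ?U)" "(36, ?U)" "?dE (?ue 5 (?ue 6 ?N))"] by simp
    have s3: "?cd 6 (?dE (?ue 5 (?ue 6 ?N))) = ?dE (?cd 6 (?ue 5 (?ue 6 ?N)))"
      using ty K by (intro cob_bin_comm) auto
    have s4: "?cd 5 (?dE (?cd 6 (?ue 5 (?ue 6 ?N)))) = ?dE (?cd 5 (?cd 6 (?ue 5 (?ue 6 ?N))))"
      using ty K by (intro cob_bin_comm) auto
    have s5: "?cd 6 (?ue 5 (?ue 6 ?N)) = ?ue 5 (?cd 6 (?ue 6 ?N))"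
      using ty K by (intro bin_bin_comm) auto
    have s6: "?ue 6 ?N = sub ?a (5, ?X) (3, ?Y) (?ue 6 (sub ?a (6, ?X) (4, ?Y) K))"
      using ty K by (intro sub_bin_comm) auto
    have s7: "?cd 6 \<dots> = sub ?a (5, ?X) (3, ?Y) (?cd 6 (?ue 6 (sub ?a (6, ?X) (4, ?Y) K)))"
      using ty K by (intro sub_bin_comm) auto
    have e: "?cd 0 (?ue 0 (sub ?a (0, ?X) (1, ?Y) (cob ?dY (1, ?Y) (3, ?Y) (4, ?Y) K))) = ?cd 0 (?ue 0 (cob ?dX (0, ?X) (5, ?X) (6, ?X) ?N))"
      by (unfold s1, unfold s2, unfold s3, unfold s4, unfold s5, unfold s6, unfold s7, unfold l, rule refl)
    have e: "?ue 0 (sub ?a (0, ?X) (1, ?Y) (cob ?dY (1, ?Y) (3, ?Y) (4, ?Y) K)) = ?ue 0 (cob ?dX (0, ?X) (5, ?X) (6, ?X) ?N)"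
      by (rule bin_inject[OF e]) (use ty K in auto)
    show "sub ?a (0, ?X) (1, ?Y) (cob ?dY (1, ?Y) (3, ?Y) (4, ?Y) K) = cob ?dX (0, ?X) (5, ?X) (6, ?X) ?N"
      by (rule bin_inject[OF e]) (use ty K in auto)
  next
    fix K assume K: "val K" "fst K = {}"
    let ?eX = "counit (tensor_comonoid V (tensor_comonoid V C D) E)" and ?eY = "counit (tensor_comonoid V C (tensor_comonoid V D E))"
    have s1: "?cd 0 (?ue 0 (sub ?a (0, ?X) (1, ?Y) (del ?eY (1, ?Y) K))) = ?de 0 (?cw 0 1 (del ?eY (1, ?Y) K))"
      using ty K by (intro as) auto
    have s2: "?cw 0 1 (del ?eY (1, ?Y) K) = del (counit C) (10, ?C) (del (counit (tensor_comonoid V D E)) (50, ?W) K)"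
      using ty K bin_tensor_counit[OF C(1) DE, of "(10, ?C)" "(50, ?W)" "(1, ?Y)" K] by simp
    have s3: "?de 0 \<dots> = del (counit C) (10, ?C) (?de 0 (del (counit (tensor_comonoid V D E)) (50, ?W) K))"
      using ty K by (intro del_bin_comm) auto
    have s4: "?de 0 (del (counit (tensor_comonoid V D E)) (50, ?W) K) = del (counit D) (20, ?D) (del (counit E) (40, ?E) K)"
      using ty K bin_tensor_counit[OF C(2,3), of "(20, ?D)" "(40, ?E)" "(50, ?W)" K] by simp
    have s5: "del (counit C) (10, ?C) \<dots> = ?cd 0 (del (counit (tensor_comonoid V C D)) (30, ?U) (del (counit E) (40, ?E) K))"
      using ty K bin_tensor_counit[OF C(1,2), of "(10, ?C)" "(20, ?D)" "(30, ?U)" "del (counit E) (40, ?E) K"] by simp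
    have s6: "del (counit (tensor_comonoid V C D)) (30, ?U) (del (counit E) (40, ?E) K) = ?ue 0 (del ?eX (0, ?X) K)"
      using ty K bin_tensor_counit[OF CD C(3), of "(30, ?U)" "(40, ?E)" "(0, ?X)" K] by simp
    have e: "?cd 0 (?ue 0 (sub ?a (0, ?X) (1, ?Y) (del ?eY (1, ?Y) K))) = ?cd 0 (?ue 0 (del ?eX (0, ?X) K))"
      by (unfold s1, unfold s2, unfold s3, unfold s4, unfold s5, unfold s6, rule refl)
    have e: "?ue 0 (sub ?a (0, ?X) (1, ?Y) (del ?eY (1, ?Y) K)) = ?ue 0 (del ?eX (0, ?X) K)"
      by (rule bin_inject[OF e]) (use ty K in auto)
    show "sub ?a (0, ?X) (1, ?Y) (del ?eY (1, ?Y) K) = del ?eX (0, ?X) K"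
      by (rule bin_inject[OF e]) (use ty K in auto)
  qed (use ty tensor_is_comonoid C CD DE in auto)
qed

text \<open>The inverse unitors start at C, which allows the unit laws of P to be compared as
  comonoid endomorphisms of P. The unit wire is closed with \<open>nul\<close>, and closing it
  before or after it is split makes no difference, by \<open>ni\<close>.\<close>

lemma comonoid_hom_unit':
  assumes C: "is_comonoid V C"
  shows "lun' (ccar C) \<in> comonoid_homs V C (tensor_comonoid V (unit_comonoid V) C)"
    "run' (ccar C) \<in> comonoid_homs V C (tensor_comonoid V C (unit_comonoid V))"
proof -
  let ?I = "unit_comonoid V" and ?C = "ccar C"
  note I = unit_is_comonoid
  note ty = comonoid_types[OF C] tensor_comul[OF I C] tensor_comul[OF C I]
  let ?L = "\<I> \<otimes> ?C" and ?R = "?C \<otimes> \<I>"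
  let ?n = "\<lambda>i. nul (\<one> \<I>) (i, \<I>)"
  have ni: "?n 11 (cob (lun' \<I>) (11, \<I>) (13, \<I>) (14, \<I>) K) = ?n 13 (?n 14 K)"
    if "val K" "(11, \<I>) \<notin> fst K" "(13, \<I>) \<in> fst K" "(14, \<I>) \<in> fst K" for K
    using that by (intro nul_cob) auto
  show "lun' ?C \<in> comonoid_homs V C (tensor_comonoid V ?I C)"
  proof (rule comonoid_homI[where X = ?C and Y = ?L])
    have l: "sub (lun' ?C) (i, ?C) (j, ?L) K = ?n k (bin (\<one> ?L) (k, \<I>) (i, ?C) (j, ?L) K)"
      if "val K" "(j, ?L) \<in> fst K" "k \<noteq> i" "(i, ?C) \<notin> fst K - {(j, ?L)}" "(k, \<I>) \<notin> fst K - {(j, ?L)}" for i j k K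
      using that ty by (subst nul_bin1) auto
    fix K assume K: "val K" "fst K = {(3, ?L), (4, ?L)}"
    let ?D = "comul (tensor_comonoid V ?I C)"
    have s1: "sub (lun' ?C) (0, ?C) (1, ?L) (cob ?D (1, ?L) (3, ?L) (4, ?L) K) = ?n 11 (bin (\<one> ?L) (11, \<I>) (0, ?C) (1, ?L) (cob ?D (1, ?L) (3, ?L) (4, ?L) K))"
      using ty K by (intro l) auto
    have s2: "bin (\<one> ?L) (11, \<I>) (0, ?C) (1, ?L) (cob ?D (1, ?L) (3, ?L) (4, ?L) K) =
       cob (lun' \<I>) (11, \<I>) (13, \<I>) (14, \<I>) (cob (comul C) (0, ?C) (5, ?C) (6, ?C) (bin (\<one> ?L) (13, \<I>) (5, ?C) (3, ?L) (bin (\<one> ?L) (14, \<I>) (6, ?C) (4, ?L) K)))"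
      using ty K bin_tensor_comul[OF I C, of "(11, \<I>)" "(13, \<I>)" "(14, \<I>)" "(0, ?C)" "(5, ?C)" "(6, ?C)" "(1, ?L)" "(3, ?L)" "(4, ?L)" K] by simp
    have s3: "?n 11 \<dots> = ?n 13 (?n 14 (cob (comul C) (0, ?C) (5, ?C) (6, ?C) (bin (\<one> ?L) (13, \<I>) (5, ?C) (3, ?L) (bin (\<one> ?L) (14, \<I>) (6, ?C) (4, ?L) K))))"
      using ty K by (intro ni) auto
    have s4: "\<dots> = cob (comul C) (0, ?C) (5, ?C) (6, ?C) (?n 13 (bin (\<one> ?L) (13, \<I>) (5, ?C) (3, ?L) (?n 14 (bin (\<one> ?L) (14, \<I>) (6, ?C) (4, ?L) K))))"
      using ty K by (simp add: cob_nul_comm bin_nul_comm)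
    have s5: "?n 14 (bin (\<one> ?L) (14, \<I>) (6, ?C) (4, ?L) K) = sub (lun' ?C) (6, ?C) (4, ?L) K"
      using ty K by (intro l[symmetric]) auto
    have s6: "?n 13 (bin (\<one> ?L) (13, \<I>) (5, ?C) (3, ?L) \<dots>) = sub (lun' ?C) (5, ?C) (3, ?L) \<dots>"
      using ty K by (intro l[symmetric]) auto
    show "sub (lun' ?C) (0, ?C) (1, ?L) (cob ?D (1, ?L) (3, ?L) (4, ?L) K) =
      cob (comul C) (0, ?C) (5, ?C) (6, ?C) (sub (lun' ?C) (5, ?C) (3, ?L) (sub (lun' ?C) (6, ?C) (4, ?L) K))"
      by (unfold s1, unfold s2, unfold s3, unfold s4, unfold s5, unfold s6, rule refl)
  next
    fix K assume K: "val K" "fst K = {}"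
    have "(\<lambda>\<^sub>I \<I> \<cdot> (\<one> \<I> \<otimes>\<^sub>a counit C)) \<cdot> lun' ?C = counit C"
      using lun_nat[of "counit C"] ty by (simp del: cmp_assoc') simp
    then show "sub (lun' ?C) (0, ?C) (1, ?L) (del (counit (tensor_comonoid V ?I C)) (1, ?L) K) = del (counit C) (0, ?C) K"
      using ty K by (subst sub_del) auto
  qed (use ty tensor_is_comonoid C I in auto)
  show "run' ?C \<in> comonoid_homs V C (tensor_comonoid V C ?I)"
  proof (rule comonoid_homI[where X = ?C and Y = ?R])
    have r: "sub (run' ?C) (i, ?C) (j, ?R) K = ?n k (bin (\<one> ?R) (i, ?C) (k, \<I>) (j, ?R) K)"
      if "val K" "(j, ?R) \<in> fst K" "k \<noteq> i" "(i, ?C) \<notin> fst K - {(j, ?R)}" "(k, \<I>) \<notin> fst K - {(j, ?R)}" for i j k K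
      using that ty by (subst nul_bin2) auto
    fix K assume K: "val K" "fst K = {(3, ?R), (4, ?R)}"
    let ?D = "comul (tensor_comonoid V C ?I)"
    have s1: "sub (run' ?C) (0, ?C) (1, ?R) (cob ?D (1, ?R) (3, ?R) (4, ?R) K) = ?n 11 (bin (\<one> ?R) (0, ?C) (11, \<I>) (1, ?R) (cob ?D (1, ?R) (3, ?R) (4, ?R) K))"
      using ty K by (intro r) auto
    have s2: "bin (\<one> ?R) (0, ?C) (11, \<I>) (1, ?R) (cob ?D (1, ?R) (3, ?R) (4, ?R) K) =
       cob (comul C) (0, ?C) (5, ?C) (6, ?C) (cob (lun' \<I>) (11, \<I>) (13, \<I>) (14, \<I>) (bin (\<one> ?R) (5, ?C) (13, \<I>) (3, ?R) (bin (\<one> ?R) (6, ?C) (14, \<I>) (4, ?R) K)))"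
      using ty K bin_tensor_comul[OF C I, of "(0, ?C)" "(5, ?C)" "(6, ?C)" "(11, \<I>)" "(13, \<I>)" "(14, \<I>)" "(1, ?R)" "(3, ?R)" "(4, ?R)" K] by simp
    have s3: "?n 11 \<dots> = cob (comul C) (0, ?C) (5, ?C) (6, ?C) (?n 11 (cob (lun' \<I>) (11, \<I>) (13, \<I>) (14, \<I>) (bin (\<one> ?R) (5, ?C) (13, \<I>) (3, ?R) (bin (\<one> ?R) (6, ?C) (14, \<I>) (4, ?R) K))))"
      using ty K by (intro cob_nul_comm) auto
    have s4: "?n 11 (cob (lun' \<I>) (11, \<I>) (13, \<I>) (14, \<I>) (bin (\<one> ?R) (5, ?C) (13, \<I>) (3, ?R) (bin (\<one> ?R) (6, ?C) (14, \<I>) (4, ?R) K))) =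
      ?n 13 (?n 14 (bin (\<one> ?R) (5, ?C) (13, \<I>) (3, ?R) (bin (\<one> ?R) (6, ?C) (14, \<I>) (4, ?R) K)))"
      using ty K by (intro ni) auto
    have s5: "\<dots> = ?n 13 (bin (\<one> ?R) (5, ?C) (13, \<I>) (3, ?R) (?n 14 (bin (\<one> ?R) (6, ?C) (14, \<I>) (4, ?R) K)))"
      using ty K by (simp add: bin_nul_comm)
    have s6: "?n 14 (bin (\<one> ?R) (6, ?C) (14, \<I>) (4, ?R) K) = sub (run' ?C) (6, ?C) (4, ?R) K"
      using ty K by (intro r[symmetric]) auto
    have s7: "?n 13 (bin (\<one> ?R) (5, ?C) (13, \<I>) (3, ?R) \<dots>) = sub (run' ?C) (5, ?C) (3, ?R) \<dots>"
      using ty K by (intro r[symmetric]) auto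
    show "sub (run' ?C) (0, ?C) (1, ?R) (cob ?D (1, ?R) (3, ?R) (4, ?R) K) =
      cob (comul C) (0, ?C) (5, ?C) (6, ?C) (sub (run' ?C) (5, ?C) (3, ?R) (sub (run' ?C) (6, ?C) (4, ?R) K))"
      by (unfold s1, unfold s2, unfold s3, unfold s4, unfold s5, unfold s6, unfold s7, rule refl)
  next
    fix K assume K: "val K" "fst K = {}"
    have "(\<rho>\<^sub>I \<I> \<cdot> (counit C \<otimes>\<^sub>a \<one> \<I>)) \<cdot> run' ?C = counit C"
      using run_nat[of "counit C"] ty by (simp del: cmp_assoc') simp
    then show "sub (run' ?C) (0, ?C) (1, ?R) (del (counit (tensor_comonoid V C ?I)) (1, ?R) K) = del (counit C) (0, ?C) K"
      using ty K by (subst sub_del) (auto simp: lun_unit_eq)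
  qed (use ty tensor_is_comonoid C I in auto)
qed

text \<open>The transpose of a monoid morphism from A to the convolution monoid [C, B], see
  \<open>monoid_homs_convolution_iff\<close>. In Sweedler form: \<phi>(a b \<otimes> c) = \<phi>(a
  \<otimes> c1) \<phi>(b \<otimes> c2) and \<phi>(1 \<otimes> c) = \<epsilon>(c) 1.\<close>

definition measuring :: "('o, 'a) monoid_obj \<Rightarrow> ('o, 'a) comonoid_obj \<Rightarrow> ('o, 'a) monoid_obj \<Rightarrow> 'a \<Rightarrow> bool" where
  "measuring A C B \<phi> \<longleftrightarrow>
     \<phi> \<in> Hom V (mcar A \<otimes> ccar C) (mcar B) \<and>
     \<phi> \<cdot> (mul A \<otimes>\<^sub>a \<one> (ccar C)) =
       mul B \<cdot> (\<phi> \<otimes>\<^sub>a \<phi>) \<cdot> interchange V (mcar A) (mcar A) (ccar C) (ccar C) \<cdot> (\<one> (mcar A \<otimes> mcar A) \<otimes>\<^sub>a comul C) \<and>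
     \<phi> \<cdot> (one A \<otimes>\<^sub>a \<one> (ccar C)) = one B \<cdot> \<lambda>\<^sub>I \<I> \<cdot> (\<one> \<I> \<otimes>\<^sub>a counit C)"

lemma measuring_types:
  assumes "measuring A C B \<phi>"
  shows "\<phi> \<in> Arr V" "src V \<phi> = mcar A \<otimes> ccar C" "tgt V \<phi> = mcar B"
  using assms by (auto simp: measuring_def)

lemma bin_bin_mul:
  assumes "is_monoid V A" "C \<in> Obj V" "\<phi> \<in> Hom V (mcar A \<otimes> C) (snd b)"
    and w: "snd h = mcar A" "snd k = mcar A" "snd l = mcar A" "snd u = mcar A \<otimes> mcar A" "snd c = C"
    and K: "val K" "b \<in> fst K" "distinct [h, k, l, u, c, b]" "distinct [b, c, u, l, k, h]" "set [h, k, l, u, c] \<inter> fst K = {}"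
  shows "bin (\<one> (mcar A \<otimes> mcar A)) h k u (bin (\<phi> \<cdot> (mul A \<otimes>\<^sub>a \<one> C)) u c b K) = bin (mul A) h k l (bin \<phi> l c b K)"
proof -
  note a = monoid_types[OF assms(1)] assms
  have "bin (\<phi> \<cdot> (mul A \<otimes>\<^sub>a \<one> C)) u c b K = bin (\<phi> \<cdot> (mul A \<otimes>\<^sub>a \<one> (snd c))) u c b K" using w by simp
  also have "\<dots> = sub (mul A) u l (bin \<phi> l c b K)"
    using a by (intro sub_bin1[symmetric]) simp_all
  finally have e: "bin (\<phi> \<cdot> (mul A \<otimes>\<^sub>a \<one> C)) u c b K = sub (mul A) u l (bin \<phi> l c b K)" .
  have "bin (\<one> (mcar A \<otimes> mcar A)) h k u (sub (mul A) u l (bin \<phi> l c b K)) =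
    bin (mul A \<cdot> \<one> (mcar A \<otimes> mcar A)) h k l (bin \<phi> l c b K)"
    using a by (intro bin_sub) simp_all
  then show ?thesis unfolding e using a by simp
qed

text \<open>The interchange pairs \<open>h\<close> with \<open>c1\<close> and \<open>k\<close> with
  \<open>c2\<close>. This is the common core of convolution, where the comonoid C is split
  (\<open>bin_bin_convolution\<close>), and of the product of P, where H is split
  (\<open>bin_\<psi>\<close>).\<close>

lemma bin_interchange_mul:
  assumes \<phi>: "\<phi> \<in> Hom V (snd h \<otimes> snd c1) (snd b1)" "\<psi> \<in> Hom V (snd k \<otimes> snd c2) (snd b2)" "m \<in> Hom V (snd b1 \<otimes> snd b2) (snd b)"
    and o: "snd h \<in> Obj V" "snd k \<in> Obj V" "snd c1 \<in> Obj V" "snd c2 \<in> Obj V"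
    and w: "snd u = snd h \<otimes> snd k" "snd c = snd c1 \<otimes> snd c2"
    and K: "val K" "b \<in> fst K" "distinct [h, k, u, c, c1, c2, b, b1, b2]" "distinct [b2, b1, b, c2, c1, c, u, k, h]"
      "set [h, k, u, c, c1, c2, b1, b2] \<inter> fst K = {}"
  shows "bin (\<one> (snd u)) h k u (bin (\<one> (snd c)) c1 c2 c (bin (m \<cdot> (\<phi> \<otimes>\<^sub>a \<psi>) \<cdot> interchange V (snd h) (snd k) (snd c1) (snd c2)) u c b K)) =
    bin \<phi> h c1 b1 (bin \<psi> k c2 b2 (bin m b1 b2 b K))"
proof -
  let ?i = "interchange V (snd h) (snd k) (snd c1) (snd c2)" and ?R = "m \<cdot> (\<phi> \<otimes>\<^sub>a \<psi>)" and ?S = "(snd h \<otimes> snd c1) \<otimes> (snd k \<otimes> snd c2)"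
  have o': "snd b \<in> Obj V" "snd b1 \<in> Obj V" "snd b2 \<in> Obj V"
    using \<phi> tgt_in_Obj[of \<phi>] tgt_in_Obj[of \<psi>] tgt_in_Obj[of m] by auto
  obtain n where n: "\<And>m X. n \<le> m \<Longrightarrow> (m, X) \<notin> fst K \<union> {h, k, u, c, c1, c2, b, b1, b2}"
    using fresh_wires[of "fst K \<union> {h, k, u, c, c1, c2, b, b1, b2}"] val_finite[OF K(1)] by auto
  let ?s = "(n + 1, ?S)" and ?w1 = "(n + 2, snd h \<otimes> snd c1)" and ?w2 = "(n + 3, snd k \<otimes> snd c2)"
    and ?s' = "(n + 4, snd b1 \<otimes> snd b2)" and ?q = "(n + 5, snd k \<otimes> (snd c1 \<otimes> snd c2))" and ?r = "(n + 6, snd k \<otimes> snd c1)"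
  have nn: "?s \<notin> fst K \<union> {h, k, u, c, c1, c2, b, b1, b2}"
    "?w1 \<notin> fst K \<union> {h, k, u, c, c1, c2, b, b1, b2}" "?w2 \<notin> fst K \<union> {h, k, u, c, c1, c2, b, b1, b2}"
    "?s' \<notin> fst K \<union> {h, k, u, c, c1, c2, b, b1, b2}" "?q \<notin> fst K \<union> {h, k, u, c, c1, c2, b, b1, b2}"
    "?r \<notin> fst K \<union> {h, k, u, c, c1, c2, b, b1, b2}"
    by (intro n, simp)+
  have nn': "\<forall>v \<in> {h, k, u, c, c1, c2, b, b1, b2}. v \<noteq> ?s \<and> v \<noteq> ?w1 \<and> v \<noteq> ?w2 \<and> v \<noteq> ?s' \<and> v \<noteq> ?q \<and> v \<noteq> ?r"
    using nn by blast
  note a = \<phi> o o' w K nn nn'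
  have s1: "bin (m \<cdot> (\<phi> \<otimes>\<^sub>a \<psi>) \<cdot> ?i) u c b K = bin (?R \<cdot> ?i) u c b K"
    using a by simp
  have s2: "\<dots> = bin ?i u c ?s (sub ?R ?s b K)"
    using a by (intro bin_sub[symmetric]) simp_all
  have s3: "bin (\<one> (snd u)) h k u (bin (\<one> (snd c)) c1 c2 c (bin ?i u c ?s (sub ?R ?s b K))) =
     bin (\<one> (snd ?w1)) h c1 ?w1 (bin (\<one> (snd ?w2)) k c2 ?w2 (bin (\<one> (snd ?s)) ?w1 ?w2 ?s (sub ?R ?s b K)))"
    using a by (intro bin_interchange[where q = ?q and r = ?r]) simp_all
  have s4: "bin (\<one> (snd ?s)) ?w1 ?w2 ?s (sub ?R ?s b K) = bin ?R ?w1 ?w2 b K"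
    using a by (subst bin_sub) simp_all
  have s5: "bin ?R ?w1 ?w2 b K = bin (\<phi> \<otimes>\<^sub>a \<psi>) ?w1 ?w2 ?s' (sub m ?s' b K)"
    using a by (intro bin_sub[symmetric]) simp_all
  have s6: "\<dots> = sub \<phi> ?w1 b1 (sub \<psi> ?w2 b2 (bin (\<one> (snd ?s')) b1 b2 ?s' (sub m ?s' b K)))"
    using a by (intro bin_tens) simp_all
  have s7: "bin (\<one> (snd ?s')) b1 b2 ?s' (sub m ?s' b K) = bin m b1 b2 b K"
    using a by (subst bin_sub) simp_all
  have s8: "bin (\<one> (snd ?w2)) k c2 ?w2 (sub \<phi> ?w1 b1 (sub \<psi> ?w2 b2 (bin m b1 b2 b K))) =
    sub \<phi> ?w1 b1 (bin (\<one> (snd ?w2)) k c2 ?w2 (sub \<psi> ?w2 b2 (bin m b1 b2 b K)))"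
    using a by (intro sub_bin_comm) simp_all
  have s9: "bin (\<one> (snd ?w2)) k c2 ?w2 (sub \<psi> ?w2 b2 (bin m b1 b2 b K)) = bin \<psi> k c2 b2 (bin m b1 b2 b K)"
    using a by (subst bin_sub) simp_all
  have s10: "bin (\<one> (snd ?w1)) h c1 ?w1 (sub \<phi> ?w1 b1 (bin \<psi> k c2 b2 (bin m b1 b2 b K))) = bin \<phi> h c1 b1 (bin \<psi> k c2 b2 (bin m b1 b2 b K))"
    using a by (subst bin_sub) simp_all
  show "bin (\<one> (snd u)) h k u (bin (\<one> (snd c)) c1 c2 c (bin (m \<cdot> (\<phi> \<otimes>\<^sub>a \<psi>) \<cdot> ?i) u c b K)) =
    bin \<phi> h c1 b1 (bin \<psi> k c2 b2 (bin m b1 b2 b K))"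
    by (unfold s1, unfold s2, unfold s3, unfold s4, unfold s5, unfold s6, unfold s7, unfold s8, unfold s9, unfold s10, rule refl)
qed

lemma bin_bin_convolution:
  assumes A: "A \<in> Obj V" and C: "is_comonoid V C" and B: "is_monoid V B" and \<phi>: "\<phi> \<in> Hom V (A \<otimes> ccar C) (mcar B)"
    and w: "snd h = A" "snd k = A" "snd u = A \<otimes> A" "snd c = ccar C" "snd c1 = ccar C" "snd c2 = ccar C"
      "snd b = mcar B" "snd b1 = mcar B" "snd b2 = mcar B"
    and K: "val K" "b \<in> fst K" "distinct [h, k, u, c, c1, c2, b, b1, b2]" "distinct [b2, b1, b, c2, c1, c, u, k, h]"
      "set [h, k, u, c, c1, c2, b1, b2] \<inter> fst K = {}"
  shows "bin (\<one> (A \<otimes> A)) h k u (bin (mul B \<cdot> (\<phi> \<otimes>\<^sub>a \<phi>) \<cdot> interchange V A A (ccar C) (ccar C) \<cdot> (\<one> (A \<otimes> A) \<otimes>\<^sub>a comul C)) u c b K) =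
    cob (comul C) c c1 c2 (bin \<phi> h c1 b1 (bin \<phi> k c2 b2 (bin (mul B) b1 b2 b K)))"
proof -
  note ty = comonoid_types[OF C] monoid_types[OF B]
  let ?C = "ccar C" and ?m = "mul B"
  let ?i = "interchange V A A ?C ?C" let ?R = "?m \<cdot> (\<phi> \<otimes>\<^sub>a \<phi>) \<cdot> ?i"
  obtain n where n: "\<And>m X. n \<le> m \<Longrightarrow> (m, X) \<notin> fst K \<union> {h, k, u, c, c1, c2, b, b1, b2}"
    using fresh_wires[of "fst K \<union> {h, k, u, c, c1, c2, b, b1, b2}"] val_finite[OF K(1)] by auto
  let ?c' = "(n, ?C \<otimes> ?C)"
  have nn: "?c' \<notin> fst K \<union> {h, k, u, c, c1, c2, b, b1, b2}" by (intro n, simp)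
  have nn': "\<forall>v \<in> {h, k, u, c, c1, c2, b, b1, b2}. v \<noteq> ?c'" using nn by blast
  note a = ty A \<phi> w K nn nn'
  have s1: "bin (?m \<cdot> (\<phi> \<otimes>\<^sub>a \<phi>) \<cdot> ?i \<cdot> (\<one> (A \<otimes> A) \<otimes>\<^sub>a comul C)) u c b K = bin (?R \<cdot> (\<one> (snd u) \<otimes>\<^sub>a comul C)) u c b K"
    using a by simp
  have s2: "\<dots> = sub (comul C) c ?c' (bin ?R u ?c' b K)"
    using a by (intro sub_bin2[symmetric]) simp_all
  have s3: "\<dots> = cob (comul C) c c1 c2 (bin (\<one> (snd ?c')) c1 c2 ?c' (bin ?R u ?c' b K))"
    using a by (intro sub_cob_bin) simp_all
  have s4: "bin (\<one> (A \<otimes> A)) h k u (cob (comul C) c c1 c2 (bin (\<one> (snd ?c')) c1 c2 ?c' (bin ?R u ?c' b K))) =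
     cob (comul C) c c1 c2 (bin (\<one> (A \<otimes> A)) h k u (bin (\<one> (snd ?c')) c1 c2 ?c' (bin ?R u ?c' b K)))"
    using a by (intro cob_bin_comm) simp_all
  have s5: "bin (\<one> (A \<otimes> A)) h k u (bin (\<one> (snd ?c')) c1 c2 ?c' (bin ?R u ?c' b K)) = bin \<phi> h c1 b1 (bin \<phi> k c2 b2 (bin ?m b1 b2 b K))"
    using a bin_interchange_mul[of \<phi> h c1 b1 \<phi> k c2 b2 ?m b u ?c' K] by simp
  show "bin (\<one> (A \<otimes> A)) h k u (bin (mul B \<cdot> (\<phi> \<otimes>\<^sub>a \<phi>) \<cdot> interchange V A A (ccar C) (ccar C) \<cdot> (\<one> (A \<otimes> A) \<otimes>\<^sub>a comul C)) u c b K) =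
    cob (comul C) c c1 c2 (bin \<phi> h c1 b1 (bin \<phi> k c2 b2 (bin (mul B) b1 b2 b K)))"
    by (unfold s1, unfold s2, unfold s3, unfold s4, unfold s5, rule refl)
qed

lemma bin_measuring_mul:
  assumes M: "measuring A C B \<phi>" "is_monoid V A" "is_comonoid V C" "is_monoid V B"
    and w: "snd h = mcar A" "snd k = mcar A" "snd l = mcar A" "snd c = ccar C" "snd c1 = ccar C" "snd c2 = ccar C"
      "snd b = mcar B" "snd b1 = mcar B" "snd b2 = mcar B"
    and K: "val K" "b \<in> fst K" "distinct [h, k, l, c, c1, c2, b, b1, b2]" "set [h, k, l, c, c1, c2, b1, b2] \<inter> fst K = {}"
  shows "bin (mul A) h k l (bin \<phi> l c b K) =
    cob (comul C) c c1 c2 (bin \<phi> h c1 b1 (bin \<phi> k c2 b2 (bin (mul B) b1 b2 b K)))"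
proof -
  note ty = monoid_types[OF M(2)] comonoid_types[OF M(3)] monoid_types[OF M(4)] measuring_types[OF M(1)]
  obtain n where n: "\<And>m X. n \<le> m \<Longrightarrow> (m, X) \<notin> fst K \<union> {h, k, l, c, c1, c2, b, b1, b2}"
    using fresh_wires[of "fst K \<union> {h, k, l, c, c1, c2, b, b1, b2}"] val_finite[OF K(1)] by auto
  let ?u = "(n, mcar A \<otimes> mcar A)"
  have nn: "?u \<notin> fst K \<union> {h, k, l, c, c1, c2, b, b1, b2}" by (intro n, simp)
  have nn': "\<forall>v \<in> {h, k, l, c, c1, c2, b, b1, b2}. v \<noteq> ?u" using nn by blast
  have d: "distinct [b2, b1, b, c2, c1, c, l, k, h]" using K(3) by auto
  have "bin (mul A) h k l (bin \<phi> l c b K) = bin (\<one> (mcar A \<otimes> mcar A)) h k ?u (bin (\<phi> \<cdot> (mul A \<otimes>\<^sub>a \<one> (ccar C))) ?u c b K)"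
    using ty w K nn nn' d M by (intro bin_bin_mul[symmetric]) simp_all
  also have "\<phi> \<cdot> (mul A \<otimes>\<^sub>a \<one> (ccar C)) =
       mul B \<cdot> (\<phi> \<otimes>\<^sub>a \<phi>) \<cdot> interchange V (mcar A) (mcar A) (ccar C) (ccar C) \<cdot> (\<one> (mcar A \<otimes> mcar A) \<otimes>\<^sub>a comul C)"
    using M(1) by (simp only: measuring_def)
  also have "bin (\<one> (mcar A \<otimes> mcar A)) h k ?u (bin \<dots> ?u c b K) =
    cob (comul C) c c1 c2 (bin \<phi> h c1 b1 (bin \<phi> k c2 b2 (bin (mul B) b1 b2 b K)))"
    using ty w K nn nn' d M by (intro bin_bin_convolution) simp_all
  finally show ?thesis .
qed

lemma nul_measuring_one:
  assumes M: "measuring A C B \<phi>" "is_monoid V A" "is_comonoid V C" "is_monoid V B"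
    and w: "snd h = mcar A" "snd c = ccar C" "snd b = mcar B"
    and K: "val K" "b \<in> fst K" "h \<noteq> c" "h \<notin> fst K - {b}" "c \<notin> fst K - {b}"
  shows "nul (one A) h (bin \<phi> h c b K) = del (counit C) c (nul (one B) b K)"
proof -
  note ty = monoid_types[OF M(2)] comonoid_types[OF M(3)] monoid_types[OF M(4)] measuring_types[OF M(1)]
  have "\<phi> \<cdot> (one A \<otimes>\<^sub>a \<one> (ccar C)) \<cdot> lun' (ccar C) = (\<phi> \<cdot> (one A \<otimes>\<^sub>a \<one> (ccar C))) \<cdot> lun' (ccar C)"
    using ty by simp
  also have "\<dots> = (one B \<cdot> \<lambda>\<^sub>I \<I> \<cdot> (\<one> \<I> \<otimes>\<^sub>a counit C)) \<cdot> lun' (ccar C)" using M(1) by (simp only: measuring_def)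
  also have "\<dots> = one B \<cdot> (\<lambda>\<^sub>I \<I> \<cdot> (\<one> \<I> \<otimes>\<^sub>a counit C)) \<cdot> lun' (ccar C)" using ty by simp
  also have "\<dots> = one B \<cdot> counit C" using lun_nat[of "counit C"] ty by simp
  finally have e: "\<phi> \<cdot> (one A \<otimes>\<^sub>a \<one> (ccar C)) \<cdot> lun' (ccar C) = one B \<cdot> counit C" .
  have "nul (one A) h (bin \<phi> h c b K) = sub (\<phi> \<cdot> (one A \<otimes>\<^sub>a \<one> (snd c)) \<cdot> lun' (snd c)) c b K"
    using ty w K by (intro nul_bin1) auto
  also have "\<dots> = sub (one B \<cdot> counit C) c b K" using e w by simp
  also have "\<dots> = del (counit C) c (nul (one B) b K)"
    using ty w K by (intro sub_via_unit) auto
  finally show ?thesis .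
qed

text \<open>Converse to \<open>bin_measuring_mul\<close> and \<open>nul_measuring_one\<close>; the
  source (X \<otimes> X) \<otimes> Y is taken apart in two steps with \<open>bin_inject\<close>.
  Among the fixed names, 10 to 12 belong to A, 13 to 15 to C, and 9, 16, 17 to B.\<close>

lemma measuringI:
  assumes A: "is_monoid V A" "mcar A = X" and C: "is_comonoid V C" "ccar C = Y" and B: "is_monoid V B" "mcar B = Z"
    and \<phi>: "\<phi> \<in> Hom V (X \<otimes> Y) Z"
    and m: "\<And>K. val K \<Longrightarrow> fst K = {(9, Z)} \<Longrightarrow> bin (mul A) (10, X) (11, X) (12, X) (bin \<phi> (12, X) (13, Y) (9, Z) K) =
      cob (comul C) (13, Y) (14, Y) (15, Y) (bin \<phi> (10, X) (14, Y) (16, Z) (bin \<phi> (11, X) (15, Y) (17, Z)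
        (bin (mul B) (16, Z) (17, Z) (9, Z) K)))"
    and u: "\<And>K. val K \<Longrightarrow> fst K = {(9, Z)} \<Longrightarrow> nul (one A) (10, X) (bin \<phi> (10, X) (13, Y) (9, Z) K) =
      del (counit C) (13, Y) (nul (one B) (9, Z) K)"
  shows "measuring A C B \<phi>"
proof -
  note ty = monoid_types[OF A(1)] comonoid_types[OF C(1)] monoid_types[OF B(1)] \<phi> A(2) C(2) B(2)
  let ?f = "\<phi> \<cdot> (mul A \<otimes>\<^sub>a \<one> Y)"
  let ?g = "mul B \<cdot> (\<phi> \<otimes>\<^sub>a \<phi>) \<cdot> interchange V X X Y Y \<cdot> (\<one> (X \<otimes> X) \<otimes>\<^sub>a comul C)"
  have "?f = ?g"
  proof (rule eq_by_sub[where X = "(X \<otimes> X) \<otimes> Y" and Z = Z and m = 0 and n = 9])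
    fix K assume K: "val K" "fst K = {(9, Z)}"
    have "bin (\<one> (X \<otimes> X)) (10, X) (11, X) (18, X \<otimes> X) (bin ?f (18, X \<otimes> X) (13, Y) (9, Z) K) =
      bin (mul A) (10, X) (11, X) (12, X) (bin \<phi> (12, X) (13, Y) (9, Z) K)"
      using ty K bin_bin_mul[OF A(1), of Y \<phi> "(9, Z)" "(10, X)" "(11, X)" "(12, X)" "(18, X \<otimes> X)" "(13, Y)" K] by simp
    also have "\<dots> = cob (comul C) (13, Y) (14, Y) (15, Y) (bin \<phi> (10, X) (14, Y) (16, Z) (bin \<phi> (11, X) (15, Y) (17, Z)
        (bin (mul B) (16, Z) (17, Z) (9, Z) K)))" by (rule m[OF K])
    also have "\<dots> = bin (\<one> (X \<otimes> X)) (10, X) (11, X) (18, X \<otimes> X) (bin ?g (18, X \<otimes> X) (13, Y) (9, Z) K)"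
      using ty K bin_bin_convolution[OF _ C(1) B(1), of X \<phi> "(10, X)" "(11, X)" "(18, X \<otimes> X)" "(13, Y)" "(14, Y)" "(15, Y)" "(9, Z)" "(16, Z)" "(17, Z)" K] by simp
    finally have e: "bin (\<one> (X \<otimes> X)) (10, X) (11, X) (18, X \<otimes> X) (bin ?f (18, X \<otimes> X) (13, Y) (9, Z) K) =
      bin (\<one> (X \<otimes> X)) (10, X) (11, X) (18, X \<otimes> X) (bin ?g (18, X \<otimes> X) (13, Y) (9, Z) K)" .
    have e: "bin ?f (18, X \<otimes> X) (13, Y) (9, Z) K = bin ?g (18, X \<otimes> X) (13, Y) (9, Z) K"
      by (rule bin_inject[OF e]) (use ty K in auto)
    have e: "bin (\<one> ((X \<otimes> X) \<otimes> Y)) (18, X \<otimes> X) (13, Y) (0, (X \<otimes> X) \<otimes> Y) (sub ?f (0, (X \<otimes> X) \<otimes> Y) (9, Z) K) =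
      bin (\<one> ((X \<otimes> X) \<otimes> Y)) (18, X \<otimes> X) (13, Y) (0, (X \<otimes> X) \<otimes> Y) (sub ?g (0, (X \<otimes> X) \<otimes> Y) (9, Z) K)"
    proof -
      have s: "bin (\<one> ((X \<otimes> X) \<otimes> Y)) (18, X \<otimes> X) (13, Y) (0, (X \<otimes> X) \<otimes> Y) (sub f (0, (X \<otimes> X) \<otimes> Y) (9, Z) K) = bin f (18, X \<otimes> X) (13, Y) (9, Z) K"
        if "f \<in> Hom V ((X \<otimes> X) \<otimes> Y) Z" for f
        using ty K that by (subst bin_sub) auto
      have "?f \<in> Hom V ((X \<otimes> X) \<otimes> Y) Z" "?g \<in> Hom V ((X \<otimes> X) \<otimes> Y) Z" using ty by auto
      then show ?thesis using e s by simp
    qed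
    show "sub ?f (0, (X \<otimes> X) \<otimes> Y) (9, Z) K = sub ?g (0, (X \<otimes> X) \<otimes> Y) (9, Z) K"
      by (rule bin_inject[OF e]) (use ty K in auto)
  qed (use ty in auto)
  moreover have "\<phi> \<cdot> (one A \<otimes>\<^sub>a \<one> Y) = one B \<cdot> \<lambda>\<^sub>I \<I> \<cdot> (\<one> \<I> \<otimes>\<^sub>a counit C)"
  proof -
    \<comment> \<open>The unit law has the source I \<otimes> Y; composition with the inverse unitor
      makes it an equation between arrows out of Y.\<close>
    have e: "\<phi> \<cdot> (one A \<otimes>\<^sub>a \<one> Y) \<cdot> lun' Y = one B \<cdot> counit C"
    proof (rule eq_by_sub[where X = Y and Z = Z and m = 13 and n = 9])
      fix K assume K: "val K" "fst K = {(9, Z)}"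
      have "sub (\<phi> \<cdot> (one A \<otimes>\<^sub>a \<one> Y) \<cdot> lun' Y) (13, Y) (9, Z) K = nul (one A) (10, X) (bin \<phi> (10, X) (13, Y) (9, Z) K)"
        using ty K nul_bin1[of "one A" "(10, X)" \<phi> "(13, Y)" "(9, Z)" K] by simp
      also have "\<dots> = del (counit C) (13, Y) (nul (one B) (9, Z) K)" by (rule u[OF K])
      also have "\<dots> = sub (one B \<cdot> counit C) (13, Y) (9, Z) K"
        using ty K by (intro sub_via_unit[symmetric]) auto
      finally show "sub (\<phi> \<cdot> (one A \<otimes>\<^sub>a \<one> Y) \<cdot> lun' Y) (13, Y) (9, Z) K = sub (one B \<cdot> counit C) (13, Y) (9, Z) K" .
    qed (use ty in auto)
    have "\<phi> \<cdot> (one A \<otimes>\<^sub>a \<one> Y) = (\<phi> \<cdot> (one A \<otimes>\<^sub>a \<one> Y) \<cdot> lun' Y) \<cdot> \<lambda>\<^sub>I Y"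
      using ty by auto
    also have "\<dots> = one B \<cdot> \<lambda>\<^sub>I \<I> \<cdot> (\<one> \<I> \<otimes>\<^sub>a counit C)"
      unfolding e using lun_nat[of "counit C"] ty by auto
    finally show ?thesis .
  qed
  ultimately show ?thesis unfolding measuring_def using ty by simp
qed

section \<open>Internal homs and the uncurried convolution structure\<close>

lemma transp_simps:
  assumes "f \<in> Hom V (Z \<otimes> X) Y" "Z \<in> Obj V" "X \<in> Obj V"
  shows "transp V Z X Y f \<in> Arr V" "src V (transp V Z X Y f) = Z" "tgt V (transp V Z X Y f) = ihom V X Y"
    "ev V X Y \<cdot> (transp V Z X Y f \<otimes>\<^sub>a \<one> X) = f"
proof -
  have "Y \<in> Obj V" using assms tgt_in_Obj[of f] by auto
  then have "\<exists>!g. g \<in> Hom V Z (ihom V X Y) \<and> ev V X Y \<cdot> (g \<otimes>\<^sub>a \<one> X) = f"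
    using ev_universal[OF assms(3) _ assms(2,1)] by blast
  from theI'[OF this] show "transp V Z X Y f \<in> Arr V" "src V (transp V Z X Y f) = Z" "tgt V (transp V Z X Y f) = ihom V X Y"
    "ev V X Y \<cdot> (transp V Z X Y f \<otimes>\<^sub>a \<one> X) = f"
    unfolding transp_def by auto
qed

lemma ev_simps [simp]:
  assumes "X \<in> Obj V" "Y \<in> Obj V"
  shows "ev V X Y \<in> Arr V" "src V (ev V X Y) = ihom V X Y \<otimes> X" "tgt V (ev V X Y) = Y"
  using ev_in_Hom[OF assms] by auto

lemma ev_inject:
  assumes "ev V X Y \<cdot> (g \<otimes>\<^sub>a \<one> X) = ev V X Y \<cdot> (g' \<otimes>\<^sub>a \<one> X)" "g \<in> Hom V Z (ihom V X Y)" "g' \<in> Hom V Z (ihom V X Y)"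
    "X \<in> Obj V" "Y \<in> Obj V" "Z \<in> Obj V"
  shows "g = g'"
proof -
  have "ev V X Y \<cdot> (g \<otimes>\<^sub>a \<one> X) \<in> Hom V (Z \<otimes> X) Y" using assms by auto
  from ev_universal[OF assms(4-6) this] show ?thesis using assms(1-3) by metis
qed

lemma ihom_arr_simps:
  assumes "f \<in> Hom V X' X" "g \<in> Hom V Y Y'"
  shows "ihom_arr V f g \<in> Arr V" "src V (ihom_arr V f g) = ihom V X Y" "tgt V (ihom_arr V f g) = ihom V X' Y'"
    "ev V X' Y' \<cdot> (ihom_arr V f g \<otimes>\<^sub>a \<one> X') = g \<cdot> ev V X Y \<cdot> (\<one> (ihom V X Y) \<otimes>\<^sub>a f)"
proof -
  have o: "X \<in> Obj V" "X' \<in> Obj V" "Y \<in> Obj V" "Y' \<in> Obj V"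
    using assms src_in_Obj[of f] tgt_in_Obj[of f] src_in_Obj[of g] tgt_in_Obj[of g] by auto
  have "g \<cdot> ev V X Y \<cdot> (\<one> (ihom V X Y) \<otimes>\<^sub>a f) \<in> Hom V (ihom V X Y \<otimes> X') Y'" using assms o by auto
  from transp_simps[OF this] o assms
  show "ihom_arr V f g \<in> Arr V" "src V (ihom_arr V f g) = ihom V X Y" "tgt V (ihom_arr V f g) = ihom V X' Y'"
    "ev V X' Y' \<cdot> (ihom_arr V f g \<otimes>\<^sub>a \<one> X') = g \<cdot> ev V X Y \<cdot> (\<one> (ihom V X Y) \<otimes>\<^sub>a f)"
    unfolding ihom_arr_def by auto
qed

lemma ihom_tensor_simps:
  assumes "X \<in> Obj V" "Y \<in> Obj V" "X' \<in> Obj V" "Y' \<in> Obj V"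
  shows "ihom_tensor V X Y X' Y' \<in> Arr V" "src V (ihom_tensor V X Y X' Y') = ihom V X Y \<otimes> ihom V X' Y'"
    "tgt V (ihom_tensor V X Y X' Y') = ihom V (X \<otimes> X') (Y \<otimes> Y')"
    "ev V (X \<otimes> X') (Y \<otimes> Y') \<cdot> (ihom_tensor V X Y X' Y' \<otimes>\<^sub>a \<one> (X \<otimes> X')) =
      (ev V X Y \<otimes>\<^sub>a ev V X' Y') \<cdot> interchange V (ihom V X Y) (ihom V X' Y') X X'"
proof -
  have "(ev V X Y \<otimes>\<^sub>a ev V X' Y') \<cdot> interchange V (ihom V X Y) (ihom V X' Y') X X' \<in>
    Hom V ((ihom V X Y \<otimes> ihom V X' Y') \<otimes> (X \<otimes> X')) (Y \<otimes> Y')" using assms by auto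
  from transp_simps[OF this] assms
  show "ihom_tensor V X Y X' Y' \<in> Arr V" "src V (ihom_tensor V X Y X' Y') = ihom V X Y \<otimes> ihom V X' Y'"
    "tgt V (ihom_tensor V X Y X' Y') = ihom V (X \<otimes> X') (Y \<otimes> Y')"
    "ev V (X \<otimes> X') (Y \<otimes> Y') \<cdot> (ihom_tensor V X Y X' Y' \<otimes>\<^sub>a \<one> (X \<otimes> X')) =
      (ev V X Y \<otimes>\<^sub>a ev V X' Y') \<cdot> interchange V (ihom V X Y) (ihom V X' Y') X X'"
    unfolding ihom_tensor_def by auto
qed

lemma interchange_nat:
  assumes "f \<in> Arr V" "g \<in> Arr V" "h \<in> Arr V" "k \<in> Arr V"
  shows "interchange V (tgt V f) (tgt V g) (tgt V h) (tgt V k) \<cdot> ((f \<otimes>\<^sub>a g) \<otimes>\<^sub>a (h \<otimes>\<^sub>a k)) =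
    ((f \<otimes>\<^sub>a h) \<otimes>\<^sub>a (g \<otimes>\<^sub>a k)) \<cdot> interchange V (src V f) (src V g) (src V h) (src V k)"
proof -
  have s: "interchange V W X Y Z = asc' W Y (X \<otimes> Z) \<cdot> (\<one> W \<otimes>\<^sub>a swap X Y Z) \<cdot> \<alpha> W X (Y \<otimes> Z)" for W X Y Z
    by (simp add: interchange_def swap_def)
  let ?a = "asc' (tgt V f) (tgt V h) (tgt V g \<otimes> tgt V k)" and ?a' = "\<alpha> (src V f) (src V g) (src V h \<otimes> src V k)"
  have "interchange V (tgt V f) (tgt V g) (tgt V h) (tgt V k) \<cdot> ((f \<otimes>\<^sub>a g) \<otimes>\<^sub>a (h \<otimes>\<^sub>a k)) =
    ?a \<cdot> (\<one> (tgt V f) \<otimes>\<^sub>a swap (tgt V g) (tgt V h) (tgt V k)) \<cdot> (\<alpha> (tgt V f) (tgt V g) (tgt V h \<otimes> tgt V k) \<cdot> ((f \<otimes>\<^sub>a g) \<otimes>\<^sub>a (h \<otimes>\<^sub>a k)))"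
    unfolding s using assms by simp
  also have "\<dots> = ?a \<cdot> (f \<otimes>\<^sub>a (swap (tgt V g) (tgt V h) (tgt V k) \<cdot> (g \<otimes>\<^sub>a (h \<otimes>\<^sub>a k)))) \<cdot> ?a'"
    using assc_nat[of f g "h \<otimes>\<^sub>a k"] assms by simp
  also have "\<dots> = (?a \<cdot> (f \<otimes>\<^sub>a (h \<otimes>\<^sub>a (g \<otimes>\<^sub>a k)))) \<cdot> (\<one> (src V f) \<otimes>\<^sub>a swap (src V g) (src V h) (src V k)) \<cdot> ?a'"
    unfolding swap_nat[OF assms(2-4)] using assms by simp
  also have "?a \<cdot> (f \<otimes>\<^sub>a (h \<otimes>\<^sub>a (g \<otimes>\<^sub>a k))) = ((f \<otimes>\<^sub>a h) \<otimes>\<^sub>a (g \<otimes>\<^sub>a k)) \<cdot> asc' (src V f) (src V h) (src V g \<otimes> src V k)"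
    using asc'_nat[of f h "g \<otimes>\<^sub>a k"] assms by simp
  finally show ?thesis unfolding s using assms by simp
qed

text \<open>Each layer of the definition, \<open>ihom_arr\<close> and \<open>ihom_tensor\<close>, is
  a transpose and therefore disappears under evaluation. Naturality of the interchange then moves
  \<open>f\<close> and \<open>g\<close> next to the evaluations.\<close>

lemma ev_convolution_mul:
  assumes C: "is_comonoid V C" and B: "is_monoid V B" and f: "f \<in> Hom V X (ihom V (ccar C) (mcar B))" "g \<in> Hom V Y (ihom V (ccar C) (mcar B))"
  shows "mul (convolution_monoid V C B) \<in> Hom V (ihom V (ccar C) (mcar B) \<otimes> ihom V (ccar C) (mcar B)) (ihom V (ccar C) (mcar B))"
    "ev V (ccar C) (mcar B) \<cdot> ((mul (convolution_monoid V C B) \<cdot> (f \<otimes>\<^sub>a g)) \<otimes>\<^sub>a \<one> (ccar C)) =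
      mul B \<cdot> ((ev V (ccar C) (mcar B) \<cdot> (f \<otimes>\<^sub>a \<one> (ccar C))) \<otimes>\<^sub>a (ev V (ccar C) (mcar B) \<cdot> (g \<otimes>\<^sub>a \<one> (ccar C)))) \<cdot>
        interchange V X Y (ccar C) (ccar C) \<cdot> (\<one> (X \<otimes> Y) \<otimes>\<^sub>a comul C)"
proof -
  note ty = comonoid_types[OF C] monoid_types[OF B]
  have o: "X \<in> Obj V" "Y \<in> Obj V" using f src_in_Obj[of f] src_in_Obj[of g] by auto
  let ?C = "ccar C" and ?B = "mcar B" let ?H = "ihom V ?C ?B" and ?e = "ev V ?C ?B"
  let ?t = "ihom_tensor V ?C ?B ?C ?B" and ?a = "ihom_arr V (comul C) (mul B)" and ?E = "ev V (?C \<otimes> ?C) (?B \<otimes> ?B)"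
  have t: "?t \<in> Arr V" "src V ?t = ?H \<otimes> ?H" "tgt V ?t = ihom V (?C \<otimes> ?C) (?B \<otimes> ?B)"
    "?E \<cdot> (?t \<otimes>\<^sub>a \<one> (?C \<otimes> ?C)) = (?e \<otimes>\<^sub>a ?e) \<cdot> interchange V ?H ?H ?C ?C"
    using ihom_tensor_simps[of ?C ?B ?C ?B] ty by auto
  have a: "?a \<in> Arr V" "src V ?a = ihom V (?C \<otimes> ?C) (?B \<otimes> ?B)" "tgt V ?a = ?H"
    "?e \<cdot> (?a \<otimes>\<^sub>a \<one> ?C) = mul B \<cdot> ?E \<cdot> (\<one> (ihom V (?C \<otimes> ?C) (?B \<otimes> ?B)) \<otimes>\<^sub>a comul C)"
    using ihom_arr_simps[of "comul C" ?C "?C \<otimes> ?C" "mul B" "?B \<otimes> ?B" ?B] ty by auto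
  have m: "mul (convolution_monoid V C B) = ?a \<cdot> ?t" by (simp add: convolution_monoid_def)
  show "mul (convolution_monoid V C B) \<in> Hom V (?H \<otimes> ?H) ?H" unfolding m using a t by auto
  have "?e \<cdot> ((mul (convolution_monoid V C B) \<cdot> (f \<otimes>\<^sub>a g)) \<otimes>\<^sub>a \<one> ?C) = (?e \<cdot> (?a \<otimes>\<^sub>a \<one> ?C)) \<cdot> ((?t \<cdot> (f \<otimes>\<^sub>a g)) \<otimes>\<^sub>a \<one> ?C)"
    unfolding m using a(1-3) t(1-3) ty f o by simp
  also have "\<dots> = mul B \<cdot> (?E \<cdot> (?t \<otimes>\<^sub>a \<one> (?C \<otimes> ?C))) \<cdot> ((f \<otimes>\<^sub>a g) \<otimes>\<^sub>a comul C)"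
    unfolding a(4) using a(1-3) t(1-3) ty f o by simp
  also have "\<dots> = mul B \<cdot> (?e \<otimes>\<^sub>a ?e) \<cdot> (interchange V ?H ?H ?C ?C \<cdot> ((f \<otimes>\<^sub>a g) \<otimes>\<^sub>a (\<one> ?C \<otimes>\<^sub>a \<one> ?C))) \<cdot> (\<one> (X \<otimes> Y) \<otimes>\<^sub>a comul C)"
    unfolding t(4) using ty f o by simp
  also have "\<dots> = mul B \<cdot> (?e \<otimes>\<^sub>a ?e) \<cdot> (((f \<otimes>\<^sub>a \<one> ?C) \<otimes>\<^sub>a (g \<otimes>\<^sub>a \<one> ?C)) \<cdot> interchange V X Y ?C ?C) \<cdot> (\<one> (X \<otimes> Y) \<otimes>\<^sub>a comul C)"
    using interchange_nat[of f g "\<one> ?C" "\<one> ?C"] ty f o by simp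
  also have "\<dots> = mul B \<cdot> ((?e \<cdot> (f \<otimes>\<^sub>a \<one> ?C)) \<otimes>\<^sub>a (?e \<cdot> (g \<otimes>\<^sub>a \<one> ?C))) \<cdot> interchange V X Y ?C ?C \<cdot> (\<one> (X \<otimes> Y) \<otimes>\<^sub>a comul C)"
    using ty f o by simp
  finally show "?e \<cdot> ((mul (convolution_monoid V C B) \<cdot> (f \<otimes>\<^sub>a g)) \<otimes>\<^sub>a \<one> ?C) = \<dots>" .
qed

lemma ev_convolution_one:
  assumes C: "is_comonoid V C" and B: "is_monoid V B"
  shows "one (convolution_monoid V C B) \<in> Hom V \<I> (ihom V (ccar C) (mcar B))"
    "ev V (ccar C) (mcar B) \<cdot> (one (convolution_monoid V C B) \<otimes>\<^sub>a \<one> (ccar C)) = one B \<cdot> \<lambda>\<^sub>I \<I> \<cdot> (\<one> \<I> \<otimes>\<^sub>a counit C)"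
proof -
  note ty = comonoid_types[OF C] monoid_types[OF B]
  let ?C = "ccar C" and ?B = "mcar B" let ?H = "ihom V ?C ?B" and ?e = "ev V ?C ?B"
  let ?t = "transp V \<I> \<I> \<I> (\<lambda>\<^sub>I \<I>)" and ?a = "ihom_arr V (counit C) (one B)" and ?E = "ev V \<I> \<I>"
  have t: "?t \<in> Arr V" "src V ?t = \<I>" "tgt V ?t = ihom V \<I> \<I>" "?E \<cdot> (?t \<otimes>\<^sub>a \<one> \<I>) = \<lambda>\<^sub>I \<I>"
    using transp_simps[of "\<lambda>\<^sub>I \<I>" \<I> \<I> \<I>] by auto
  have a: "?a \<in> Arr V" "src V ?a = ihom V \<I> \<I>" "tgt V ?a = ?H"
    "?e \<cdot> (?a \<otimes>\<^sub>a \<one> ?C) = one B \<cdot> ?E \<cdot> (\<one> (ihom V \<I> \<I>) \<otimes>\<^sub>a counit C)"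
    using ihom_arr_simps[of "counit C" ?C \<I> "one B" \<I> ?B] ty by auto
  have m: "one (convolution_monoid V C B) = ?a \<cdot> ?t" by (simp add: convolution_monoid_def)
  show "one (convolution_monoid V C B) \<in> Hom V \<I> ?H" unfolding m using a t by auto
  have "?e \<cdot> (one (convolution_monoid V C B) \<otimes>\<^sub>a \<one> ?C) = (?e \<cdot> (?a \<otimes>\<^sub>a \<one> ?C)) \<cdot> (?t \<otimes>\<^sub>a \<one> ?C)"
    unfolding m using a(1-3) t(1-3) ty by simp
  also have "\<dots> = one B \<cdot> (?E \<cdot> (?t \<otimes>\<^sub>a \<one> \<I>)) \<cdot> (\<one> \<I> \<otimes>\<^sub>a counit C)"
    unfolding a(4) using a(1-3) t(1-3) ty by simp
  finally show "?e \<cdot> (one (convolution_monoid V C B) \<otimes>\<^sub>a \<one> ?C) = one B \<cdot> \<lambda>\<^sub>I \<I> \<cdot> (\<one> \<I> \<otimes>\<^sub>a counit C)" unfolding t(4) .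
qed

text \<open>Arrows into an internal hom agree as soon as their evaluations do, so each of the two
  equations for a monoid morphism is equivalent to its uncurried form, and these are the measuring
  laws.\<close>

lemma monoid_homs_convolution_iff:
  assumes A: "is_monoid V A" and C: "is_comonoid V C" and B: "is_monoid V B" and f: "f \<in> Hom V (mcar A) (ihom V (ccar C) (mcar B))"
  shows "f \<in> monoid_homs V A (convolution_monoid V C B) \<longleftrightarrow> measuring A C B (ev V (ccar C) (mcar B) \<cdot> (f \<otimes>\<^sub>a \<one> (ccar C)))"
proof -
  note ty = monoid_types[OF A] comonoid_types[OF C] monoid_types[OF B]
  let ?C = "ccar C" and ?B = "mcar B" and ?A = "mcar A" let ?e = "ev V ?C ?B" and ?M = "convolution_monoid V C B"
  have c: "mcar ?M = ihom V ?C ?B" by (simp add: convolution_monoid_def)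
  note m = ev_convolution_mul[OF C B f f] and j = ev_convolution_one[OF C B]
  have "f \<cdot> mul A = mul ?M \<cdot> (f \<otimes>\<^sub>a f) \<longleftrightarrow> ?e \<cdot> ((f \<cdot> mul A) \<otimes>\<^sub>a \<one> ?C) = ?e \<cdot> ((mul ?M \<cdot> (f \<otimes>\<^sub>a f)) \<otimes>\<^sub>a \<one> ?C)" (is "?l = ?r")
  proof
    assume r: ?r
    show ?l by (rule ev_inject[OF r, where Z = "?A \<otimes> ?A"]) (use ty f m(1) in auto)
  qed simp
  also have "?e \<cdot> ((f \<cdot> mul A) \<otimes>\<^sub>a \<one> ?C) = (?e \<cdot> (f \<otimes>\<^sub>a \<one> ?C)) \<cdot> (mul A \<otimes>\<^sub>a \<one> ?C)" using ty f by simp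
  finally have 1: "f \<cdot> mul A = mul ?M \<cdot> (f \<otimes>\<^sub>a f) \<longleftrightarrow> (?e \<cdot> (f \<otimes>\<^sub>a \<one> ?C)) \<cdot> (mul A \<otimes>\<^sub>a \<one> ?C) = ?e \<cdot> ((mul ?M \<cdot> (f \<otimes>\<^sub>a f)) \<otimes>\<^sub>a \<one> ?C)" .
  have "f \<cdot> one A = one ?M \<longleftrightarrow> ?e \<cdot> ((f \<cdot> one A) \<otimes>\<^sub>a \<one> ?C) = ?e \<cdot> (one ?M \<otimes>\<^sub>a \<one> ?C)" (is "?l = ?r")
  proof
    assume r: ?r
    show ?l by (rule ev_inject[OF r, where Z = \<I>]) (use ty f j(1) in auto)
  qed simp
  also have "?e \<cdot> ((f \<cdot> one A) \<otimes>\<^sub>a \<one> ?C) = (?e \<cdot> (f \<otimes>\<^sub>a \<one> ?C)) \<cdot> (one A \<otimes>\<^sub>a \<one> ?C)" using ty f by simp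
  finally have 2: "f \<cdot> one A = one ?M \<longleftrightarrow> (?e \<cdot> (f \<otimes>\<^sub>a \<one> ?C)) \<cdot> (one A \<otimes>\<^sub>a \<one> ?C) = ?e \<cdot> (one ?M \<otimes>\<^sub>a \<one> ?C)" .
  have "?e \<cdot> (f \<otimes>\<^sub>a \<one> ?C) \<in> Hom V (?A \<otimes> ?C) ?B" using ty f by auto
  then show ?thesis unfolding monoid_homs_def measuring_def mem_Collect_eq c m(2)[symmetric] j(2)[symmetric]
    using f 1 2 by blast
qed

lemma eq_by_bin:
  assumes "f \<in> Hom V (X \<otimes> Y) Z" "g \<in> Hom V (X \<otimes> Y) Z" "X \<in> Obj V" "Y \<in> Obj V"
    and e: "\<And>K. val K \<Longrightarrow> fst K = {(9, Z)} \<Longrightarrow> bin f (10, X) (11, Y) (9, Z) K = bin g (10, X) (11, Y) (9, Z) K"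
  shows "f = g"
proof (rule eq_by_sub[where X = "X \<otimes> Y" and Z = Z and m = 0 and n = 9])
  fix K assume K: "val K" "fst K = {(9, Z)}"
  have s: "bin (\<one> (X \<otimes> Y)) (10, X) (11, Y) (0, X \<otimes> Y) (sub h (0, X \<otimes> Y) (9, Z) K) = bin h (10, X) (11, Y) (9, Z) K"
    if "h \<in> Hom V (X \<otimes> Y) Z" for h
    using assms(3,4) K that by (subst bin_sub) auto
  have i: "bin (\<one> (X \<otimes> Y)) (10, X) (11, Y) (0, X \<otimes> Y) (sub f (0, X \<otimes> Y) (9, Z) K) =
    bin (\<one> (X \<otimes> Y)) (10, X) (11, Y) (0, X \<otimes> Y) (sub g (0, X \<otimes> Y) (9, Z) K)"
    unfolding s[OF assms(1)] s[OF assms(2)] by (rule e[OF K])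
  show "sub f (0, X \<otimes> Y) (9, Z) K = sub g (0, X \<otimes> Y) (9, Z) K"
    by (rule bin_inject[OF i]) (use assms K in auto)
qed (use assms in auto)

text \<open>Applied to \<open>bmul H\<close> this is the bimonoid axiom: the product h k splits into
  h1 k1 \<otimes> h2 k2.\<close>

lemma bin_cob_hom:
  assumes C: "is_comonoid V C" "is_comonoid V D" "is_comonoid V E" and m: "m \<in> comonoid_homs V (tensor_comonoid V C D) E"
    and w: "snd x = ccar C" "snd x1 = ccar C" "snd x2 = ccar C" "snd y = ccar D" "snd y1 = ccar D" "snd y2 = ccar D"
      "snd z = ccar E" "snd z1 = ccar E" "snd z2 = ccar E"
    and K: "val K" "z1 \<in> fst K" "z2 \<in> fst K" "distinct [x, y, z, x1, x2, y1, y2, z1, z2]"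
      "set [x, y, z, x1, x2, y1, y2] \<inter> fst K = {}"
  shows "bin m x y z (cob (comul E) z z1 z2 K) =
    cob (comul C) x x1 x2 (cob (comul D) y y1 y2 (bin m x1 y1 z1 (bin m x2 y2 z2 K)))"
proof -
  note ty = comonoid_types[OF C(1)] comonoid_types[OF C(2)] comonoid_types[OF C(3)] tensor_comul[OF C(1,2)] comonoid_hom_types[OF m]
  let ?T = "ccar C \<otimes> ccar D" and ?W = "{x, y, z, x1, x2, y1, y2, z1, z2}"
  obtain n where n: "\<And>m X. n \<le> m \<Longrightarrow> (m, X) \<notin> fst K \<union> ?W"
    using fresh_wires[of "fst K \<union> ?W"] val_finite[OF K(1)] by auto
  let ?t = "(n, ?T)" and ?t1 = "(n + 1, ?T)" and ?t2 = "(n + 2, ?T)"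
  have nn: "?t \<notin> fst K \<union> ?W" "?t1 \<notin> fst K \<union> ?W" "?t2 \<notin> fst K \<union> ?W" by (intro n, simp)+
  have nn': "\<forall>v \<in> ?W. v \<noteq> ?t \<and> v \<noteq> ?t1 \<and> v \<noteq> ?t2" using nn by blast
  have d: "distinct [z2, z1, y2, y1, x2, x1, z, y, x]" using K(4) by auto
  note a = ty w K nn nn' d
  have s1: "bin m x y z (cob (comul E) z z1 z2 K) = bin (m \<cdot> \<one> ?T) x y z (cob (comul E) z z1 z2 K)"
    using a by simp
  have s2: "bin (m \<cdot> \<one> ?T) x y z (cob (comul E) z z1 z2 K) = bin (\<one> ?T) x y ?t (sub m ?t z (cob (comul E) z z1 z2 K))"
    using a by (intro bin_sub[symmetric]) simp_all
  have s3: "sub m ?t z (cob (comul E) z z1 z2 K) = cob (comul (tensor_comonoid V C D)) ?t ?t1 ?t2 (sub m ?t1 z1 (sub m ?t2 z2 K))"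
    using a by (intro sub_cob_hom tensor_is_comonoid C m) simp_all
  have s4: "bin (\<one> ?T) x y ?t (cob (comul (tensor_comonoid V C D)) ?t ?t1 ?t2 (sub m ?t1 z1 (sub m ?t2 z2 K))) =
    cob (comul C) x x1 x2 (cob (comul D) y y1 y2 (bin (\<one> ?T) x1 y1 ?t1 (bin (\<one> ?T) x2 y2 ?t2 (sub m ?t1 z1 (sub m ?t2 z2 K)))))"
    using a by (intro bin_tensor_comul C) simp_all
  have s5: "bin (\<one> ?T) x2 y2 ?t2 (sub m ?t1 z1 (sub m ?t2 z2 K)) = sub m ?t1 z1 (bin (\<one> ?T) x2 y2 ?t2 (sub m ?t2 z2 K))"
    using a by (intro sub_bin_comm) simp_all
  have s6: "bin (\<one> ?T) x2 y2 ?t2 (sub m ?t2 z2 K) = bin m x2 y2 z2 K"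
    using a by (subst bin_sub) simp_all
  have s7: "bin (\<one> ?T) x1 y1 ?t1 (sub m ?t1 z1 (bin m x2 y2 z2 K)) = bin m x1 y1 z1 (bin m x2 y2 z2 K)"
    using a by (subst bin_sub) simp_all
  show ?thesis
    by (unfold s1, unfold s2, unfold s3, unfold s4, unfold s5, unfold s6, unfold s7, rule refl)
qed

lemma bin_del_hom:
  assumes C: "is_comonoid V C" "is_comonoid V D" "is_comonoid V E" and m: "m \<in> comonoid_homs V (tensor_comonoid V C D) E"
    and w: "snd x = ccar C" "snd y = ccar D" "snd z = ccar E"
    and K: "val K" "x \<noteq> y" "x \<notin> fst K" "y \<notin> fst K" "z \<notin> fst K"
  shows "bin m x y z (del (counit E) z K) = del (counit C) x (del (counit D) y K)"
  using comonoid_types[OF C(1)] comonoid_types[OF C(2)] comonoid_types[OF C(3)] comonoid_hom_types[OF m] m w K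
  by (intro bin_del) (auto simp: comonoid_homs_def)

lemma nul_cob_hom:
  assumes "is_comonoid V E" "i \<in> comonoid_homs V (unit_comonoid V) E"
    and w: "snd z = ccar E" "snd x = ccar E" "snd y = ccar E" "val K" "x \<in> fst K" "y \<in> fst K" "x \<noteq> y" "z \<notin> fst K - {x, y}"
  shows "nul i z (cob (comul E) z x y K) = nul i x (nul i y K)"
  by (rule nul_cob) (use assms comonoid_types[OF assms(1)] in \<open>auto simp: comonoid_homs_def\<close>)

lemma nul_del_hom:
  assumes "is_comonoid V E" "i \<in> comonoid_homs V (unit_comonoid V) E" "snd z = ccar E" "val K" "z \<notin> fst K"
  shows "nul i z (del (counit E) z K) = K"
  by (rule nul_del) (use assms comonoid_types[OF assms(1)] in \<open>auto simp: comonoid_homs_def\<close>)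

text \<open>From (a b)(c d) to (a c)(b d): \<open>b\<close> is commuted with the product c d and
  then back past \<open>d\<close>. This rearrangement makes the product of two measurings a
  measuring in \<open>\<psi>_measuring\<close>.\<close>

lemma bin_medial:
  assumes M: "is_commutative_monoid V M"
    and w: "snd a = mcar M" "snd b = mcar M" "snd c = mcar M" "snd d = mcar M" "snd x = mcar M" "snd y = mcar M"
      "snd x' = mcar M" "snd y' = mcar M" "snd z = mcar M"
    and K: "val K" "z \<in> fst K" "distinct [a, b, c, d, x, y, x', y', z]" "set [a, b, c, d, x, y, x', y'] \<inter> fst K = {}"
  shows "bin (mul M) a b x (bin (mul M) c d y (bin (mul M) x y z K)) =
    bin (mul M) a c x' (bin (mul M) b d y' (bin (mul M) x' y' z K))"
proof -
  have M': "is_monoid V M" using M by (simp add: is_commutative_monoid_def)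
  note ty = monoid_types[OF M']
  let ?m = "mul M" and ?W = "{a, b, c, d, x, y, x', y', z}"
  obtain n where n: "\<And>m X. n \<le> m \<Longrightarrow> (m, X) \<notin> fst K \<union> ?W"
    using fresh_wires[of "fst K \<union> ?W"] val_finite[OF K(1)] by auto
  let ?v = "(n, mcar M)"
  have nn: "?v \<notin> fst K \<union> ?W" by (intro n, simp)
  have nn': "\<forall>w \<in> ?W. w \<noteq> ?v" using nn by blast
  have d: "distinct [z, y', x', y, x, d, c, b, a]" using K(3) by auto
  note t = ty w K nn nn' d
  have s1: "bin ?m a b x (bin ?m c d y (bin ?m x y z K)) = bin ?m c d y (bin ?m a b x (bin ?m x y z K))"
    using t by (intro bin_bin_comm) simp_all
  have s2: "bin ?m a b x (bin ?m x y z K) = bin ?m b y ?v (bin ?m a ?v z K)"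
    using t by (intro bin_assoc M') simp_all
  have s3: "bin ?m b y ?v (bin ?m a ?v z K) = bin ?m y b ?v (bin ?m a ?v z K)"
    using t by (intro bin_comm M) simp_all
  have s4: "bin ?m c d y (bin ?m y b ?v (bin ?m a ?v z K)) = bin ?m d b y' (bin ?m c y' ?v (bin ?m a ?v z K))"
    using t by (intro bin_assoc M') simp_all
  have s5: "bin ?m c y' ?v (bin ?m a ?v z K) = bin ?m a c x' (bin ?m x' y' z K)"
    using t by (intro bin_assoc[symmetric] M') simp_all
  have s6: "bin ?m d b y' (bin ?m a c x' (bin ?m x' y' z K)) = bin ?m b d y' (bin ?m a c x' (bin ?m x' y' z K))"
    using t by (intro bin_comm M) simp_all
  have s7: "bin ?m b d y' (bin ?m a c x' (bin ?m x' y' z K)) = bin ?m a c x' (bin ?m b d y' (bin ?m x' y' z K))"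
    using t by (intro bin_bin_comm) simp_all
  show ?thesis
    by (unfold s1, unfold s2, unfold s3, unfold s4, unfold s5, unfold s6, unfold s7, rule refl)
qed

lemma bin_sub_right:
  assumes "f \<in> Hom V (A \<otimes> X) Z" "g \<in> Hom V Y X" "A \<in> Obj V" "val K" "(9, Z) \<in> fst K"
    "distinct [i, j, k]" "set [(i, A), (j, X), (k, Y)] \<inter> (fst K - {(9, Z)}) = {}"
  shows "bin (f \<cdot> (\<one> A \<otimes>\<^sub>a g)) (i, A) (k, Y) (9, Z) K = sub g (k, Y) (j, X) (bin f (i, A) (j, X) (9, Z) K)"
proof -
  have "bin (f \<cdot> (\<one> (snd (i, A)) \<otimes>\<^sub>a g)) (i, A) (k, Y) (9, Z) K = sub g (k, Y) (j, X) (bin f (i, A) (j, X) (9, Z) K)"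
    using assms by (intro sub_bin2[symmetric]) auto
  then show ?thesis by simp
qed

text \<open>A comonoid morphism \<open>g\<close> carries the splitting of D to that of C, so the
  measuring law is preserved by substitution. With the universal measuring for \<phi>, every
  comonoid morphism into P becomes a measuring.\<close>

lemma measuring_cmp_hom:
  assumes A: "is_monoid V A" and C: "is_comonoid V C" "is_comonoid V D" and B: "is_monoid V B"
    and M: "measuring A D B \<phi>" and g: "g \<in> comonoid_homs V C D"
  shows "measuring A C B (\<phi> \<cdot> (\<one> (mcar A) \<otimes>\<^sub>a g))"
proof (rule measuringI[where X = "mcar A" and Y = "ccar C" and Z = "mcar B"])
  note ty = monoid_types[OF A] comonoid_types[OF C(1)] comonoid_types[OF C(2)] monoid_types[OF B] measuring_types[OF M] comonoid_hom_types[OF g]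
  let ?A = "mcar A" and ?C = "ccar C" and ?D = "ccar D" and ?B = "mcar B"
  let ?f = "\<phi> \<cdot> (\<one> ?A \<otimes>\<^sub>a g)"
  have r: "bin ?f (i, ?A) (k, ?C) b K = sub g (k, ?C) (j, ?D) (bin \<phi> (i, ?A) (j, ?D) b K)"
    if "val K" "b \<in> fst K" "snd b = ?B" "distinct [i, j, k]" "set [(i, ?A), (j, ?D), (k, ?C)] \<inter> fst K = {}" for i j k b K
  proof -
    have "bin (\<phi> \<cdot> (\<one> (snd (i, ?A)) \<otimes>\<^sub>a g)) (i, ?A) (k, ?C) b K = sub g (k, ?C) (j, ?D) (bin \<phi> (i, ?A) (j, ?D) b K)"
      using ty that by (intro sub_bin2[symmetric]) auto
    then show ?thesis by simp
  qed
  show "?f \<in> Hom V (?A \<otimes> ?C) ?B" using ty by auto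
  {
    fix K assume K: "val K" "fst K = {(9, ?B)}"
    let ?m = "bin (mul B) (16, ?B) (17, ?B) (9, ?B) K"
    have s1: "bin ?f (12, ?A) (13, ?C) (9, ?B) K = sub g (13, ?C) (23, ?D) (bin \<phi> (12, ?A) (23, ?D) (9, ?B) K)"
      using ty K by (intro r) auto
    have s2: "bin (mul A) (10, ?A) (11, ?A) (12, ?A) (sub g (13, ?C) (23, ?D) (bin \<phi> (12, ?A) (23, ?D) (9, ?B) K)) =
      sub g (13, ?C) (23, ?D) (bin (mul A) (10, ?A) (11, ?A) (12, ?A) (bin \<phi> (12, ?A) (23, ?D) (9, ?B) K))"
      using ty K by (intro sub_bin_comm) auto
    have s3: "bin (mul A) (10, ?A) (11, ?A) (12, ?A) (bin \<phi> (12, ?A) (23, ?D) (9, ?B) K) =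
      cob (comul D) (23, ?D) (24, ?D) (25, ?D) (bin \<phi> (10, ?A) (24, ?D) (16, ?B) (bin \<phi> (11, ?A) (25, ?D) (17, ?B) ?m))"
      using ty K by (intro bin_measuring_mul M A B C) auto
    have s4: "sub g (13, ?C) (23, ?D) (cob (comul D) (23, ?D) (24, ?D) (25, ?D) (bin \<phi> (10, ?A) (24, ?D) (16, ?B) (bin \<phi> (11, ?A) (25, ?D) (17, ?B) ?m))) =
      cob (comul C) (13, ?C) (14, ?C) (15, ?C) (sub g (14, ?C) (24, ?D) (sub g (15, ?C) (25, ?D) (bin \<phi> (10, ?A) (24, ?D) (16, ?B) (bin \<phi> (11, ?A) (25, ?D) (17, ?B) ?m))))"
      using ty K by (intro sub_cob_hom C g) auto
    have s5: "sub g (15, ?C) (25, ?D) (bin \<phi> (10, ?A) (24, ?D) (16, ?B) (bin \<phi> (11, ?A) (25, ?D) (17, ?B) ?m)) =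
      bin \<phi> (10, ?A) (24, ?D) (16, ?B) (sub g (15, ?C) (25, ?D) (bin \<phi> (11, ?A) (25, ?D) (17, ?B) ?m))"
      using ty K by (intro sub_bin_comm[symmetric]) auto
    have s6: "sub g (15, ?C) (25, ?D) (bin \<phi> (11, ?A) (25, ?D) (17, ?B) ?m) = bin ?f (11, ?A) (15, ?C) (17, ?B) ?m"
      using ty K by (intro r[symmetric]) auto
    have s7: "sub g (14, ?C) (24, ?D) (bin \<phi> (10, ?A) (24, ?D) (16, ?B) (bin ?f (11, ?A) (15, ?C) (17, ?B) ?m)) =
      bin ?f (10, ?A) (14, ?C) (16, ?B) (bin ?f (11, ?A) (15, ?C) (17, ?B) ?m)"
      using ty K by (intro r[symmetric]) auto
    show "bin (mul A) (10, ?A) (11, ?A) (12, ?A) (bin ?f (12, ?A) (13, ?C) (9, ?B) K) =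
      cob (comul C) (13, ?C) (14, ?C) (15, ?C) (bin ?f (10, ?A) (14, ?C) (16, ?B) (bin ?f (11, ?A) (15, ?C) (17, ?B) ?m))"
      by (unfold s1, unfold s2, unfold s3, unfold s4, unfold s5, unfold s6, unfold s7, rule refl)
  next
    fix K assume K: "val K" "fst K = {(9, ?B)}"
    have s1: "bin ?f (10, ?A) (13, ?C) (9, ?B) K = sub g (13, ?C) (23, ?D) (bin \<phi> (10, ?A) (23, ?D) (9, ?B) K)"
      using ty K by (intro r) auto
    have s2: "nul (one A) (10, ?A) (sub g (13, ?C) (23, ?D) (bin \<phi> (10, ?A) (23, ?D) (9, ?B) K)) =
      sub g (13, ?C) (23, ?D) (nul (one A) (10, ?A) (bin \<phi> (10, ?A) (23, ?D) (9, ?B) K))"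
      using ty K by (intro sub_nul_comm) auto
    have s3: "nul (one A) (10, ?A) (bin \<phi> (10, ?A) (23, ?D) (9, ?B) K) = del (counit D) (23, ?D) (nul (one B) (9, ?B) K)"
      using ty K by (intro nul_measuring_one M A B C) auto
    have s4: "sub g (13, ?C) (23, ?D) (del (counit D) (23, ?D) (nul (one B) (9, ?B) K)) = del (counit C) (13, ?C) (nul (one B) (9, ?B) K)"
      using ty K by (intro sub_del_hom C g) auto
    show "nul (one A) (10, ?A) (bin ?f (10, ?A) (13, ?C) (9, ?B) K) = del (counit C) (13, ?C) (nul (one B) (9, ?B) K)"
      by (unfold s1, unfold s2, unfold s3, unfold s4, rule refl)
  }
qed (use assms in auto)

end

section \<open>The universal measuring and its universal property\<close>

locale universal_measuring_comonoid = symmetric_monoidal_closed_category V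
  for V :: "('o, 'a) smc_category" (structure) +
  fixes A B :: "('o, 'a) monoid_obj" and P :: "('o, 'a) comonoid_obj" and \<Phi> :: "('o, 'a) comonoid_obj \<Rightarrow> 'a \<Rightarrow> 'a"
  assumes A: "is_monoid V A" and B: "is_monoid V B" and U: "is_universal_measuring_comonoid V A B P \<Phi>"
begin

text \<open>The universal measuring A \<otimes> P \<rightarrow> B, which is \<eta> uncurried. The
  structure of P is described, and equations between comonoid morphisms into P are tested, by
  composing with it.\<close>

definition "e = ev V (ccar P) (mcar B) \<cdot> (universal_measuring V A B P \<Phi> \<otimes>\<^sub>a \<one> (ccar P))"

lemma P: "is_comonoid V P"
  using U by (simp add: is_universal_measuring_comonoid_def)

lemma bij_\<Phi>: "is_comonoid V C \<Longrightarrow> bij_betw (\<Phi> C) (monoid_homs V A (convolution_monoid V C B)) (comonoid_homs V C P)"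
  using U unfolding is_universal_measuring_comonoid_def by blast

lemma \<eta>:
  shows "universal_measuring V A B P \<Phi> \<in> monoid_homs V A (convolution_monoid V P B)"
    "\<Phi> P (universal_measuring V A B P \<Phi>) = \<one> (ccar P)"
proof -
  have "\<one> (ccar P) \<in> \<Phi> P ` monoid_homs V A (convolution_monoid V P B)"
    using bij_\<Phi>[OF P] comonoid_hom_ident[OF P] by (simp add: bij_betw_def)
  from inv_into_into[OF this] f_inv_into_f[OF this]
  show "universal_measuring V A B P \<Phi> \<in> monoid_homs V A (convolution_monoid V P B)"
    "\<Phi> P (universal_measuring V A B P \<Phi>) = \<one> (ccar P)" unfolding universal_measuring_def by auto
qed

lemma monoid_homs_types:
  assumes "f \<in> monoid_homs V A (convolution_monoid V C B)"
  shows "f \<in> Hom V (mcar A) (ihom V (ccar C) (mcar B))"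
  using assms by (simp add: monoid_homs_def convolution_monoid_def)

lemma e_measuring: "measuring A P B e"
  using monoid_homs_convolution_iff[OF A P B monoid_homs_types[OF \<eta>(1)]] \<eta>(1) by (simp add: e_def)

text \<open>Naturality of \<Phi> at \<open>g\<close>, evaluated on \<eta>: since \<Phi> sends \<eta>
  to the identity of P, it sends [g, 1] \<eta> to g. Uncurrying [g, 1] \<eta> gives e (1 \<otimes>
  g).\<close>

lemma ihom_arr_\<eta>:
  assumes C: "is_comonoid V C" and g: "g \<in> comonoid_homs V C P"
  defines "f \<equiv> ihom_arr V g (\<one> (mcar B)) \<cdot> universal_measuring V A B P \<Phi>"
  shows "f \<in> Hom V (mcar A) (ihom V (ccar C) (mcar B))"
    "ev V (ccar C) (mcar B) \<cdot> (f \<otimes>\<^sub>a \<one> (ccar C)) = e \<cdot> (\<one> (mcar A) \<otimes>\<^sub>a g)"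
    "f \<in> monoid_homs V A (convolution_monoid V C B)" "\<Phi> C f = g"
proof -
  let ?\<eta> = "universal_measuring V A B P \<Phi>" and ?C = "ccar C" and ?P = "ccar P" and ?B = "mcar B"
  note ty = comonoid_types[OF C] comonoid_types[OF P] monoid_types[OF A] monoid_types[OF B] comonoid_hom_types[OF g]
    monoid_homs_types[OF \<eta>(1)]
  have a: "ihom_arr V g (\<one> ?B) \<in> Arr V" "src V (ihom_arr V g (\<one> ?B)) = ihom V ?P ?B" "tgt V (ihom_arr V g (\<one> ?B)) = ihom V ?C ?B"
    "ev V ?C ?B \<cdot> (ihom_arr V g (\<one> ?B) \<otimes>\<^sub>a \<one> ?C) = \<one> ?B \<cdot> ev V ?P ?B \<cdot> (\<one> (ihom V ?P ?B) \<otimes>\<^sub>a g)"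
    using ihom_arr_simps[of g ?C ?P "\<one> ?B" ?B ?B] ty by auto
  show f: "f \<in> Hom V (mcar A) (ihom V ?C ?B)" unfolding f_def using a ty by auto
  have "ev V ?C ?B \<cdot> (f \<otimes>\<^sub>a \<one> ?C) = (ev V ?C ?B \<cdot> (ihom_arr V g (\<one> ?B) \<otimes>\<^sub>a \<one> ?C)) \<cdot> (?\<eta> \<otimes>\<^sub>a \<one> ?C)"
    unfolding f_def using a(1-3) ty by auto
  also have "\<dots> = e \<cdot> (\<one> (mcar A) \<otimes>\<^sub>a g)"
    unfolding a(4) e_def using ty by auto
  finally show e: "ev V ?C ?B \<cdot> (f \<otimes>\<^sub>a \<one> ?C) = e \<cdot> (\<one> (mcar A) \<otimes>\<^sub>a g)" .
  show "f \<in> monoid_homs V A (convolution_monoid V C B)"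
    unfolding monoid_homs_convolution_iff[OF A C B f] e by (rule measuring_cmp_hom[OF A C P B e_measuring g])
  have "\<Phi> C f = \<Phi> P ?\<eta> \<cdot> g"
    using U C P g \<eta>(1) unfolding is_universal_measuring_comonoid_def f_def by blast
  then show "\<Phi> C f = g" using ty by (simp add: \<eta>(2))
qed

text \<open>By injectivity of \<Phi>, the morphism \<open>f\<close> is [\<Phi> C f, 1] \<eta>, the
  preimage found in \<open>ihom_arr_\<eta>\<close>. Uncurrying recovers the measuring from the
  comonoid morphism.\<close>

lemma \<Phi>_hom:
  assumes C: "is_comonoid V C" and f: "f \<in> monoid_homs V A (convolution_monoid V C B)"
  shows "\<Phi> C f \<in> comonoid_homs V C P" "e \<cdot> (\<one> (mcar A) \<otimes>\<^sub>a \<Phi> C f) = ev V (ccar C) (mcar B) \<cdot> (f \<otimes>\<^sub>a \<one> (ccar C))"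
proof -
  show g: "\<Phi> C f \<in> comonoid_homs V C P" using bij_\<Phi>[OF C] f by (auto simp: bij_betw_def)
  have "ihom_arr V (\<Phi> C f) (\<one> (mcar B)) \<cdot> universal_measuring V A B P \<Phi> = f"
    using bij_\<Phi>[OF C] f ihom_arr_\<eta>(3,4)[OF C g] unfolding bij_betw_def inj_on_def by blast
  then show "e \<cdot> (\<one> (mcar A) \<otimes>\<^sub>a \<Phi> C f) = ev V (ccar C) (mcar B) \<cdot> (f \<otimes>\<^sub>a \<one> (ccar C))"
    using ihom_arr_\<eta>(2)[OF C g] by simp
qed

lemma e_types: "e \<in> Arr V" "src V e = mcar A \<otimes> ccar P" "tgt V e = mcar B"
  using measuring_types[OF e_measuring] .

text \<open>Uniqueness in the universal property. Since it concerns comonoid morphisms only, the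
  monoid laws of P begin by exhibiting both sides as such, and the antipode laws have to pass
  through a quotient comonoid.\<close>

lemma comonoid_hom_eqI:
  assumes C: "is_comonoid V C" and g: "g \<in> comonoid_homs V C P" "g' \<in> comonoid_homs V C P"
    and eq: "\<And>K. val K \<Longrightarrow> fst K = {(9, mcar B)} \<Longrightarrow>
      sub g (11, ccar C) (12, ccar P) (bin e (10, mcar A) (12, ccar P) (9, mcar B) K) =
      sub g' (11, ccar C) (12, ccar P) (bin e (10, mcar A) (12, ccar P) (9, mcar B) K)"
  shows "g = g'"
proof -
  note ty = comonoid_types[OF C] comonoid_types[OF P] monoid_types[OF A] monoid_types[OF B] e_types
    comonoid_hom_types[OF g(1)] comonoid_hom_types[OF g(2)]
  have "e \<cdot> (\<one> (mcar A) \<otimes>\<^sub>a g) = e \<cdot> (\<one> (mcar A) \<otimes>\<^sub>a g')"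
  proof (rule eq_by_bin[where X = "mcar A" and Y = "ccar C" and Z = "mcar B"])
    fix K assume K: "val K" "fst K = {(9, mcar B)}"
    show "bin (e \<cdot> (\<one> (mcar A) \<otimes>\<^sub>a g)) (10, mcar A) (11, ccar C) (9, mcar B) K = bin (e \<cdot> (\<one> (mcar A) \<otimes>\<^sub>a g')) (10, mcar A) (11, ccar C) (9, mcar B) K"
      using eq[OF K] ty K bin_sub_right[of e "mcar A" "ccar P" "mcar B" g "ccar C" K 10 12 11] bin_sub_right[of e "mcar A" "ccar P" "mcar B" g' "ccar C" K 10 12 11]
      by simp
  qed (use ty in auto)
  then have e: "ev V (ccar C) (mcar B) \<cdot> ((ihom_arr V g (\<one> (mcar B)) \<cdot> universal_measuring V A B P \<Phi>) \<otimes>\<^sub>a \<one> (ccar C)) =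
    ev V (ccar C) (mcar B) \<cdot> ((ihom_arr V g' (\<one> (mcar B)) \<cdot> universal_measuring V A B P \<Phi>) \<otimes>\<^sub>a \<one> (ccar C))"
    by (simp only: ihom_arr_\<eta>(2)[OF C g(1)] ihom_arr_\<eta>(2)[OF C g(2)])
  have "ihom_arr V g (\<one> (mcar B)) \<cdot> universal_measuring V A B P \<Phi> = ihom_arr V g' (\<one> (mcar B)) \<cdot> universal_measuring V A B P \<Phi>"
    by (rule ev_inject[OF e ihom_arr_\<eta>(1)[OF C g(1)] ihom_arr_\<eta>(1)[OF C g(2)]
      comonoid_types(1)[OF C] monoid_types(1)[OF B] monoid_types(1)[OF A]])
  from arg_cong[OF this, of "\<Phi> C"] show ?thesis by (simp only: ihom_arr_\<eta>(4)[OF C g(1)] ihom_arr_\<eta>(4)[OF C g(2)])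
qed

lemma measuring_factors:
  assumes C: "is_comonoid V C" and \<phi>: "measuring A C B \<phi>"
  obtains g where "g \<in> comonoid_homs V C P" "e \<cdot> (\<one> (mcar A) \<otimes>\<^sub>a g) = \<phi>"
proof -
  note ty = comonoid_types[OF C] monoid_types[OF A] monoid_types[OF B] measuring_types[OF \<phi>]
  let ?f = "transp V (mcar A) (ccar C) (mcar B) \<phi>"
  have f: "?f \<in> Hom V (mcar A) (ihom V (ccar C) (mcar B))" "ev V (ccar C) (mcar B) \<cdot> (?f \<otimes>\<^sub>a \<one> (ccar C)) = \<phi>"
    using transp_simps[of \<phi> "mcar A" "ccar C" "mcar B"] ty by auto
  then have "?f \<in> monoid_homs V A (convolution_monoid V C B)" using monoid_homs_convolution_iff[OF A C B f(1)] \<phi> by simp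
  from \<Phi>_hom[OF C this] f(2) that show ?thesis by simp
qed

end

lemma monoid_of_simps [simp]: "mcar (monoid_of H) = bcar H" "mul (monoid_of H) = bmul H" "one (monoid_of H) = bone H"
  by (simp_all add: monoid_of_def)

lemma comonoid_of_simps [simp]: "ccar (comonoid_of H) = bcar H" "comul (comonoid_of H) = bcomul H" "counit (comonoid_of H) = bcounit H"
  by (simp_all add: comonoid_of_def)

section \<open>The bimonoid structure\<close>

locale universal_measuring_bimonoid = universal_measuring_comonoid V "monoid_of H" B P \<Phi>
  for V :: "('o, 'a) smc_category" (structure)
    and H :: "('o, 'a) bimonoid_obj" and B :: "('o, 'a) monoid_obj" and P :: "('o, 'a) comonoid_obj"
    and \<Phi> :: "('o, 'a) comonoid_obj \<Rightarrow> 'a \<Rightarrow> 'a" +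
  assumes H: "is_bimonoid V H" and Bc: "is_commutative_monoid V B"
begin

definition "mP = bmul (measuring_bimonoid V H B P \<Phi>)"
definition "iP = bone (measuring_bimonoid V H B P \<Phi>)"

text \<open>In Sweedler form \<psi>(h \<otimes> (p \<otimes> q)) = e(h1 \<otimes> p) e(h2 \<otimes>
  q), while \<chi> is \<epsilon>(h) 1 up to a unitor. These are the monoid morphisms that define the
  product and the unit of P, uncurried; see \<open>mP\<close> and \<open>iP\<close>.\<close>

definition "\<psi> = mul B \<cdot> (e \<otimes>\<^sub>a e) \<cdot> interchange V (bcar H) (bcar H) (ccar P) (ccar P) \<cdot> (bcomul H \<otimes>\<^sub>a \<one> (ccar P \<otimes> ccar P))"
definition "\<chi> = one B \<cdot> bcounit H \<cdot> \<rho>\<^sub>I (bcar H)"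

lemma Hc: "is_comonoid V (comonoid_of H)"
  using H by (simp add: is_bimonoid_def)

lemma H_mul_hom: "bmul H \<in> comonoid_homs V (tensor_comonoid V (comonoid_of H) (comonoid_of H)) (comonoid_of H)"
  using H by (simp add: is_bimonoid_def)

lemma H_one_hom: "bone H \<in> comonoid_homs V (unit_comonoid V) (comonoid_of H)"
  using H by (simp add: is_bimonoid_def)

lemmas types = monoid_types[OF A, unfolded monoid_of_simps] comonoid_types[OF Hc, unfolded comonoid_of_simps]
  comonoid_types[OF P] monoid_types[OF B] e_types[unfolded monoid_of_simps] tensor_comul[OF P P]

lemmas H_mul_cob = bin_cob_hom[OF Hc Hc Hc H_mul_hom, unfolded comonoid_of_simps]
lemmas H_mul_del = bin_del_hom[OF Hc Hc Hc H_mul_hom, unfolded comonoid_of_simps]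
lemmas H_one_cob = nul_cob_hom[OF Hc H_one_hom, unfolded comonoid_of_simps]
lemmas H_one_del = nul_del_hom[OF Hc H_one_hom, unfolded comonoid_of_simps]
lemmas e_mul = bin_measuring_mul[OF e_measuring A P B, unfolded monoid_of_simps]
lemmas e_one = nul_measuring_one[OF e_measuring A P B, unfolded monoid_of_simps]
lemmas H_coassoc = cob_coassoc[OF Hc, unfolded comonoid_of_simps]
lemmas H_counit = cob_counit[OF Hc, unfolded comonoid_of_simps]

lemma \<psi>_types: "\<psi> \<in> Arr V" "src V \<psi> = bcar H \<otimes> (ccar P \<otimes> ccar P)" "tgt V \<psi> = mcar B"
  unfolding \<psi>_def using types by auto

lemma \<chi>_types: "\<chi> \<in> Arr V" "src V \<chi> = bcar H \<otimes> \<I>" "tgt V \<chi> = mcar B"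
  unfolding \<chi>_def using types by auto

lemma bin_\<psi>:
  assumes w: "snd h = bcar H" "snd h1 = bcar H" "snd h2 = bcar H" "snd p = ccar P" "snd q = ccar P" "snd t = ccar P \<otimes> ccar P"
      "snd b = mcar B" "snd b1 = mcar B" "snd b2 = mcar B"
    and K: "val K" "b \<in> fst K" "distinct [h, h1, h2, p, q, t, b, b1, b2]" "set [h, h1, h2, p, q, t, b1, b2] \<inter> fst K = {}"
  shows "bin (\<one> (ccar P \<otimes> ccar P)) p q t (bin \<psi> h t b K) =
    cob (bcomul H) h h1 h2 (bin e h1 p b1 (bin e h2 q b2 (bin (mul B) b1 b2 b K)))"
proof -
  let ?W = "{h, h1, h2, p, q, t, b, b1, b2}" and ?X = "bcar H" and ?P = "ccar P"
  let ?i = "interchange V ?X ?X ?P ?P" let ?R = "mul B \<cdot> (e \<otimes>\<^sub>a e) \<cdot> ?i"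
  obtain n where n: "\<And>m X. n \<le> m \<Longrightarrow> (m, X) \<notin> fst K \<union> ?W"
    using fresh_wires[of "fst K \<union> ?W"] val_finite[OF K(1)] by auto
  let ?h = "(n, ?X \<otimes> ?X)"
  have nn: "?h \<notin> fst K \<union> ?W" by (intro n, simp)
  have nn': "\<forall>v \<in> ?W. v \<noteq> ?h" using nn by blast
  have d: "distinct [b2, b1, b, t, q, p, h2, h1, h]" using K(3) by auto
  note a = types w K nn nn' d
  have s1: "bin \<psi> h t b K = bin (?R \<cdot> (bcomul H \<otimes>\<^sub>a \<one> (snd t))) h t b K"
    using a by (simp add: \<psi>_def)
  have s2: "bin (?R \<cdot> (bcomul H \<otimes>\<^sub>a \<one> (snd t))) h t b K = sub (bcomul H) h ?h (bin ?R ?h t b K)"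
    using a by (intro sub_bin1[symmetric]) simp_all
  have s3: "sub (bcomul H) h ?h (bin ?R ?h t b K) = cob (bcomul H) h h1 h2 (bin (\<one> (snd ?h)) h1 h2 ?h (bin ?R ?h t b K))"
    using a by (intro sub_cob_bin) simp_all
  have s4: "bin (\<one> (?P \<otimes> ?P)) p q t (cob (bcomul H) h h1 h2 (bin (\<one> (snd ?h)) h1 h2 ?h (bin ?R ?h t b K))) =
    cob (bcomul H) h h1 h2 (bin (\<one> (?P \<otimes> ?P)) p q t (bin (\<one> (snd ?h)) h1 h2 ?h (bin ?R ?h t b K)))"
    using a by (intro cob_bin_comm) simp_all
  have s5: "bin (\<one> (?P \<otimes> ?P)) p q t (bin (\<one> (snd ?h)) h1 h2 ?h (bin ?R ?h t b K)) =
    bin (\<one> (snd ?h)) h1 h2 ?h (bin (\<one> (?P \<otimes> ?P)) p q t (bin ?R ?h t b K))"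
    using a by (intro bin_bin_comm) simp_all
  have s6: "bin (\<one> (snd ?h)) h1 h2 ?h (bin (\<one> (?P \<otimes> ?P)) p q t (bin ?R ?h t b K)) =
    bin e h1 p b1 (bin e h2 q b2 (bin (mul B) b1 b2 b K))"
    using a bin_interchange_mul[of e h1 p b1 e h2 q b2 "mul B" b ?h t K] by simp
  show ?thesis
    by (unfold s1, unfold s2, unfold s3, unfold s4, unfold s5, unfold s6, rule refl)
qed

lemma nul_\<chi>:
  assumes "snd h = bcar H" "snd i = \<I>" "snd b = mcar B" "val K" "b \<in> fst K" "h \<noteq> i" "h \<notin> fst K - {b}" "i \<notin> fst K - {b}"
  shows "nul (\<one> \<I>) i (bin \<chi> h i b K) = del (bcounit H) h (nul (one B) b K)"
proof -
  have "nul (\<one> \<I>) i (bin \<chi> h i b K) = sub (\<chi> \<cdot> (\<one> (snd h) \<otimes>\<^sub>a \<one> \<I>) \<cdot> run' (snd h)) h b K"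
    using types assms \<chi>_types by (intro nul_bin2) auto
  also have "\<chi> \<cdot> (\<one> (snd h) \<otimes>\<^sub>a \<one> \<I>) \<cdot> run' (snd h) = one B \<cdot> bcounit H"
    using types assms by (simp add: \<chi>_def)
  also have "sub (one B \<cdot> bcounit H) h b K = del (bcounit H) h (nul (one B) b K)"
    using types assms by (intro sub_via_unit) auto
  finally show ?thesis .
qed

text \<open>As h k splits into h1 k1 \<otimes> h2 k2, the left side is e(h1 \<otimes> p1) e(k1
  \<otimes> p2) e(h2 \<otimes> q1) e(k2 \<otimes> q2). The right side, \<psi> at h with p1, q1 times
  \<psi> at k with p2, q2, has the same four factors with the middle two exchanged.\<close>

lemma \<psi>_measuring: "measuring (monoid_of H) (tensor_comonoid V P P) B \<psi>"
proof (rule measuringI[where X = "bcar H" and Y = "ccar P \<otimes> ccar P" and Z = "mcar B"])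
  let ?X = "bcar H" and ?P = "ccar P" and ?B = "mcar B"
  let ?T = "?P \<otimes> ?P"
  let ?eb = "\<lambda>i j k. bin e (i, ?X) (j, ?P) (k, ?B)" and ?mb = "\<lambda>i j k. bin (mul B) (i, ?B) (j, ?B) (k, ?B)"
  let ?dh = "\<lambda>i j k. cob (bcomul H) (i, ?X) (j, ?X) (k, ?X)" and ?dp = "\<lambda>i j k. cob (comul P) (i, ?P) (j, ?P) (k, ?P)"
  let ?mh = "\<lambda>i j k. bin (bmul H) (i, ?X) (j, ?X) (k, ?X)" and ?pp = "\<lambda>i j k. bin (\<one> ?T) (i, ?P) (j, ?P) (k, ?T)"
  let ?ps = "\<lambda>i j k. bin \<psi> (i, ?X) (j, ?T) (k, ?B)" and ?dt = "\<lambda>i j k. cob (comul (tensor_comonoid V P P)) (i, ?T) (j, ?T) (k, ?T)"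
  note ty = types \<psi>_types
  fix K assume K: "val K" "fst K = {(9, ?B)}"
  have s1: "?pp 20 30 13 (?mh 10 11 12 (?ps 12 13 9 K)) = ?mh 10 11 12 (?pp 20 30 13 (?ps 12 13 9 K))"
    using ty K by (intro bin_bin_comm) auto
  have s2: "?pp 20 30 13 (?ps 12 13 9 K) = ?dh 12 40 41 (?eb 40 20 50 (?eb 41 30 51 (?mb 50 51 9 K)))"
    using ty K by (intro bin_\<psi>) auto
  have s3: "?mh 10 11 12 (?dh 12 40 41 (?eb 40 20 50 (?eb 41 30 51 (?mb 50 51 9 K)))) =
    ?dh 10 42 43 (?dh 11 44 45 (?mh 42 44 40 (?mh 43 45 41 (?eb 40 20 50 (?eb 41 30 51 (?mb 50 51 9 K))))))"
    using ty K by (intro H_mul_cob) auto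
  have s4: "?mh 43 45 41 (?eb 40 20 50 (?eb 41 30 51 (?mb 50 51 9 K))) = ?eb 40 20 50 (?mh 43 45 41 (?eb 41 30 51 (?mb 50 51 9 K)))"
    using ty K by (intro bin_bin_comm) auto
  have s5: "?mh 43 45 41 (?eb 41 30 51 (?mb 50 51 9 K)) = ?dp 30 31 32 (?eb 43 31 54 (?eb 45 32 55 (?mb 54 55 51 (?mb 50 51 9 K))))"
    using ty K by (intro e_mul) auto
  have s6: "?mh 42 44 40 (?eb 40 20 50 (?dp 30 31 32 (?eb 43 31 54 (?eb 45 32 55 (?mb 54 55 51 (?mb 50 51 9 K)))))) =
    ?dp 20 21 22 (?eb 42 21 52 (?eb 44 22 53 (?mb 52 53 50 (?dp 30 31 32 (?eb 43 31 54 (?eb 45 32 55 (?mb 54 55 51 (?mb 50 51 9 K))))))))"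
    using ty K by (intro e_mul) auto
  have s7: "?eb 42 21 52 (?eb 44 22 53 (?mb 52 53 50 (?dp 30 31 32 (?eb 43 31 54 (?eb 45 32 55 (?mb 54 55 51 (?mb 50 51 9 K))))))) =
    ?dp 30 31 32 (?eb 42 21 52 (?eb 44 22 53 (?mb 52 53 50 (?eb 43 31 54 (?eb 45 32 55 (?mb 54 55 51 (?mb 50 51 9 K)))))))"
    using ty K by (simp add: cob_bin_comm)
  have s8: "?mb 52 53 50 (?eb 43 31 54 (?eb 45 32 55 (?mb 54 55 51 (?mb 50 51 9 K)))) = ?eb 43 31 54 (?mb 52 53 50 (?eb 45 32 55 (?mb 54 55 51 (?mb 50 51 9 K))))"
    using ty K by (intro bin_bin_comm) auto
  have s9: "?mb 52 53 50 (?eb 45 32 55 (?mb 54 55 51 (?mb 50 51 9 K))) = ?eb 45 32 55 (?mb 52 53 50 (?mb 54 55 51 (?mb 50 51 9 K)))"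
    using ty K by (intro bin_bin_comm) auto
  \<comment> \<open>The wires 52 to 55 carry the four values of \<open>e\<close>; commutativity of B
    exchanges 53, which is e(k1 \<otimes> p2), with 54, which is e(h2 \<otimes> q1).\<close>
  have s10: "?mb 52 53 50 (?mb 54 55 51 (?mb 50 51 9 K)) = ?mb 52 54 16 (?mb 53 55 17 (?mb 16 17 9 K))"
    using ty K by (intro bin_medial Bc) auto
  have l: "?pp 20 30 13 (?mh 10 11 12 (?ps 12 13 9 K)) = ?dh 10 42 43 (?dh 11 44 45 (?dp 20 21 22 (?dp 30 31 32
     (?eb 42 21 52 (?eb 44 22 53 (?eb 43 31 54 (?eb 45 32 55 (?mb 52 54 16 (?mb 53 55 17 (?mb 16 17 9 K))))))))))"
    by (unfold s1, unfold s2, unfold s3, unfold s4, unfold s5, unfold s6, unfold s7, unfold s8, unfold s9, unfold s10, rule refl)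
  let ?Q = "?eb 42 21 52 (?eb 44 22 53 (?eb 43 31 54 (?eb 45 32 55 (?mb 52 54 16 (?mb 53 55 17 (?mb 16 17 9 K))))))"
  have dd: "?dp 20 21 22 (?dp 30 31 32 (?dh 10 42 43 (?dh 11 44 45 L))) = ?dh 10 42 43 (?dh 11 44 45 (?dp 20 21 22 (?dp 30 31 32 L)))"
    if "val L" "fst L = {(42, ?X), (43, ?X), (44, ?X), (45, ?X), (21, ?P), (22, ?P), (31, ?P), (32, ?P)}" for L
    using ty that by (simp add: cob_cob_comm)
  have s1: "?pp 20 30 13 (?dt 13 14 15 (?ps 10 14 16 (?ps 11 15 17 (?mb 16 17 9 K)))) =
    ?dp 20 21 22 (?dp 30 31 32 (?pp 21 31 14 (?pp 22 32 15 (?ps 10 14 16 (?ps 11 15 17 (?mb 16 17 9 K))))))"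
    using ty K by (intro bin_tensor_comul P) auto
  have s2: "?pp 22 32 15 (?ps 10 14 16 (?ps 11 15 17 (?mb 16 17 9 K))) = ?ps 10 14 16 (?pp 22 32 15 (?ps 11 15 17 (?mb 16 17 9 K)))"
    using ty K by (intro bin_bin_comm) auto
  have s3: "?pp 22 32 15 (?ps 11 15 17 (?mb 16 17 9 K)) = ?dh 11 44 45 (?eb 44 22 53 (?eb 45 32 55 (?mb 53 55 17 (?mb 16 17 9 K))))"
    using ty K by (intro bin_\<psi>) auto
  have s4: "?pp 21 31 14 (?ps 10 14 16 (?dh 11 44 45 (?eb 44 22 53 (?eb 45 32 55 (?mb 53 55 17 (?mb 16 17 9 K)))))) =
    ?dh 10 42 43 (?eb 42 21 52 (?eb 43 31 54 (?mb 52 54 16 (?dh 11 44 45 (?eb 44 22 53 (?eb 45 32 55 (?mb 53 55 17 (?mb 16 17 9 K))))))))"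
    using ty K by (intro bin_\<psi>) auto
  have s5: "?eb 42 21 52 (?eb 43 31 54 (?mb 52 54 16 (?dh 11 44 45 (?eb 44 22 53 (?eb 45 32 55 (?mb 53 55 17 (?mb 16 17 9 K))))))) =
    ?dh 11 44 45 (?eb 42 21 52 (?eb 43 31 54 (?mb 52 54 16 (?eb 44 22 53 (?eb 45 32 55 (?mb 53 55 17 (?mb 16 17 9 K)))))))"
    using ty K by (simp add: cob_bin_comm)
  have s6: "?mb 52 54 16 (?eb 44 22 53 (?eb 45 32 55 (?mb 53 55 17 (?mb 16 17 9 K)))) = ?eb 44 22 53 (?mb 52 54 16 (?eb 45 32 55 (?mb 53 55 17 (?mb 16 17 9 K))))"
    using ty K by (intro bin_bin_comm) auto
  have s7: "?mb 52 54 16 (?eb 45 32 55 (?mb 53 55 17 (?mb 16 17 9 K))) = ?eb 45 32 55 (?mb 52 54 16 (?mb 53 55 17 (?mb 16 17 9 K)))"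
    using ty K by (intro bin_bin_comm) auto
  have s8: "?eb 43 31 54 (?eb 44 22 53 (?eb 45 32 55 (?mb 52 54 16 (?mb 53 55 17 (?mb 16 17 9 K))))) = ?eb 44 22 53 (?eb 43 31 54 (?eb 45 32 55 (?mb 52 54 16 (?mb 53 55 17 (?mb 16 17 9 K)))))"
    using ty K by (intro bin_bin_comm) auto
  have s9: "?dp 20 21 22 (?dp 30 31 32 (?dh 10 42 43 (?dh 11 44 45 ?Q))) = ?dh 10 42 43 (?dh 11 44 45 (?dp 20 21 22 (?dp 30 31 32 ?Q)))"
    by (rule dd) (use ty K in auto)
  have e: "?pp 20 30 13 (?mh 10 11 12 (?ps 12 13 9 K)) = ?pp 20 30 13 (?dt 13 14 15 (?ps 10 14 16 (?ps 11 15 17 (?mb 16 17 9 K))))"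
    by (unfold s1, unfold s2, unfold s3, unfold s4, unfold s5, unfold s6, unfold s7, unfold s8, unfold s9, unfold l, rule refl)
  have "?mh 10 11 12 (?ps 12 13 9 K) = ?dt 13 14 15 (?ps 10 14 16 (?ps 11 15 17 (?mb 16 17 9 K)))"
    by (rule bin_inject[OF e]) (use ty K in auto)
  then show "bin (mul (monoid_of H)) (10, ?X) (11, ?X) (12, ?X) (?ps 12 13 9 K) = ?dt 13 14 15 (?ps 10 14 16 (?ps 11 15 17 (?mb 16 17 9 K)))"
    by (simp only: monoid_of_simps)
next
  let ?X = "bcar H" and ?P = "ccar P" and ?B = "mcar B"
  let ?T = "?P \<otimes> ?P" and ?j = "\<lambda>i. nul (one B) (i, ?B)" and ?c = "\<lambda>i. del (counit P) (i, ?P)"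
  let ?eb = "\<lambda>i j k. bin e (i, ?X) (j, ?P) (k, ?B)" and ?mb = "\<lambda>i j k. bin (mul B) (i, ?B) (j, ?B) (k, ?B)"
  let ?dh = "\<lambda>i j k. cob (bcomul H) (i, ?X) (j, ?X) (k, ?X)" and ?i = "\<lambda>i. nul (bone H) (i, ?X)"
  let ?pp = "\<lambda>i j k. bin (\<one> ?T) (i, ?P) (j, ?P) (k, ?T)" and ?ps = "\<lambda>i j k. bin \<psi> (i, ?X) (j, ?T) (k, ?B)"
  let ?ct = "del (counit (tensor_comonoid V P P)) (13, ?T)"
  note ty = types \<psi>_types
  fix K assume K: "val K" "fst K = {(9, ?B)}"
  have s1: "?pp 20 30 13 (?i 10 (?ps 10 13 9 K)) = ?i 10 (?pp 20 30 13 (?ps 10 13 9 K))"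
    using ty K by (intro bin_nul_comm[symmetric]) auto
  have s2: "?pp 20 30 13 (?ps 10 13 9 K) = ?dh 10 40 41 (?eb 40 20 50 (?eb 41 30 51 (?mb 50 51 9 K)))"
    using ty K by (intro bin_\<psi>) auto
  have s3: "?i 10 (?dh 10 40 41 (?eb 40 20 50 (?eb 41 30 51 (?mb 50 51 9 K)))) = ?i 40 (?i 41 (?eb 40 20 50 (?eb 41 30 51 (?mb 50 51 9 K))))"
    using ty K by (intro H_one_cob) auto
  have s4: "?i 41 (?eb 40 20 50 (?eb 41 30 51 (?mb 50 51 9 K))) = ?eb 40 20 50 (?i 41 (?eb 41 30 51 (?mb 50 51 9 K)))"
    using ty K by (intro bin_nul_comm) auto
  have s5: "?i 41 (?eb 41 30 51 (?mb 50 51 9 K)) = ?c 30 (?j 51 (?mb 50 51 9 K))"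
    using ty K by (intro e_one) auto
  have s6: "?j 51 (?mb 50 51 9 K) = sub (\<one> ?B) (50, ?B) (9, ?B) K"
    using ty K by (intro bin_unit[OF B]) auto
  have s7: "?i 40 (?eb 40 20 50 (?c 30 (sub (\<one> ?B) (50, ?B) (9, ?B) K))) = ?c 20 (?j 50 (?c 30 (sub (\<one> ?B) (50, ?B) (9, ?B) K)))"
    using ty K by (intro e_one) auto
  have s8: "?j 50 (?c 30 (sub (\<one> ?B) (50, ?B) (9, ?B) K)) = ?c 30 (?j 50 (sub (\<one> ?B) (50, ?B) (9, ?B) K))"
    using ty K by (intro del_nul_comm) auto
  have s9: "?j 50 (sub (\<one> ?B) (50, ?B) (9, ?B) K) = ?j 9 K"
    using ty K by (subst nul_sub) auto
  have l: "?pp 20 30 13 (?i 10 (?ps 10 13 9 K)) = ?c 20 (?c 30 (?j 9 K))"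
    by (unfold s1, unfold s2, unfold s3, unfold s4, unfold s5, unfold s6, unfold s7, unfold s8, unfold s9, rule refl)
  have r: "?pp 20 30 13 (?ct (?j 9 K)) = ?c 20 (?c 30 (?j 9 K))"
    using ty K bin_tensor_counit[OF P P, of "(20, ?P)" "(30, ?P)" "(13, ?T)" "?j 9 K"] by simp
  have e: "?pp 20 30 13 (?i 10 (?ps 10 13 9 K)) = ?pp 20 30 13 (?ct (?j 9 K))" by (simp only: l r)
  have "?i 10 (?ps 10 13 9 K) = ?ct (?j 9 K)"
    by (rule bin_inject[OF e]) (use ty K in auto)
  then show "nul (one (monoid_of H)) (10, ?X) (?ps 10 13 9 K) = ?ct (?j 9 K)"
    by (simp only: monoid_of_simps)
qed (use A B tensor_is_comonoid[OF P P] \<psi>_types in auto)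

text \<open>The counit of the bimonoid H is multiplicative and takes 1 to 1, and so does
  \<epsilon>(h) 1 with values in B. The wire of type I is removed from both sides with
  \<open>nul_inject\<close>.\<close>

lemma \<chi>_measuring: "measuring (monoid_of H) (unit_comonoid V) B \<chi>"
proof (rule measuringI[where X = "bcar H" and Y = \<I> and Z = "mcar B"])
  let ?X = "bcar H" and ?B = "mcar B"
  let ?n = "\<lambda>i. nul (\<one> \<I>) (i, \<I>)" and ?c = "\<lambda>i j. bin \<chi> (i, ?X) (j, \<I>)" and ?j = "\<lambda>i. nul (one B) (i, ?B)" and ?e = "\<lambda>i. del (bcounit H) (i, ?X)"
  note ty = types \<chi>_types
  {
    fix K assume K: "val K" "fst K = {(9, ?B)}"
    let ?M = "bin (mul B) (16, ?B) (17, ?B) (9, ?B) K"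
    have s1: "?n 13 (bin (bmul H) (10, ?X) (11, ?X) (12, ?X) (?c 12 13 (9, ?B) K)) = bin (bmul H) (10, ?X) (11, ?X) (12, ?X) (?n 13 (?c 12 13 (9, ?B) K))"
      using ty K by (intro bin_nul_comm) auto
    have s2: "?n 13 (?c 12 13 (9, ?B) K) = ?e 12 (?j 9 K)"
      using ty K by (intro nul_\<chi>) auto
    have s3: "bin (bmul H) (10, ?X) (11, ?X) (12, ?X) (?e 12 (?j 9 K)) = ?e 10 (?e 11 (?j 9 K))"
      using ty K by (intro H_mul_del) auto
    have l: "?n 13 (bin (bmul H) (10, ?X) (11, ?X) (12, ?X) (?c 12 13 (9, ?B) K)) = ?e 10 (?e 11 (?j 9 K))"
      by (unfold s1, unfold s2, unfold s3, rule refl)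
    have s1: "?n 13 (cob (lun' \<I>) (13, \<I>) (14, \<I>) (15, \<I>) (?c 10 14 (16, ?B) (?c 11 15 (17, ?B) ?M))) =
      ?n 14 (?n 15 (?c 10 14 (16, ?B) (?c 11 15 (17, ?B) ?M)))"
      using ty K by (intro nul_cob) auto
    have s2: "?n 15 (?c 10 14 (16, ?B) (?c 11 15 (17, ?B) ?M)) = ?c 10 14 (16, ?B) (?n 15 (?c 11 15 (17, ?B) ?M))"
      using ty K by (intro bin_nul_comm) auto
    have s3: "?n 15 (?c 11 15 (17, ?B) ?M) = ?e 11 (?j 17 ?M)"
      using ty K by (intro nul_\<chi>) auto
    have s4: "?n 14 (?c 10 14 (16, ?B) (?e 11 (?j 17 ?M))) = ?e 10 (?j 16 (?e 11 (?j 17 ?M)))"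
      using ty K by (intro nul_\<chi>) auto
    have s5: "?j 16 (?e 11 (?j 17 ?M)) = ?e 11 (?j 16 (?j 17 ?M))"
      using ty K by (intro del_nul_comm) auto
    have s6: "?j 17 ?M = sub (\<one> ?B) (16, ?B) (9, ?B) K"
      using ty K by (intro bin_unit[OF B]) auto
    have s7: "?j 16 (sub (\<one> ?B) (16, ?B) (9, ?B) K) = ?j 9 K"
      using ty K by (subst nul_sub) auto
    have r: "?n 13 (cob (lun' \<I>) (13, \<I>) (14, \<I>) (15, \<I>) (?c 10 14 (16, ?B) (?c 11 15 (17, ?B) ?M))) = ?e 10 (?e 11 (?j 9 K))"
      by (unfold s1, unfold s2, unfold s3, unfold s4, unfold s5, unfold s6, unfold s7, rule refl)
    have e: "?n 13 (bin (bmul H) (10, ?X) (11, ?X) (12, ?X) (?c 12 13 (9, ?B) K)) =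
      ?n 13 (cob (lun' \<I>) (13, \<I>) (14, \<I>) (15, \<I>) (?c 10 14 (16, ?B) (?c 11 15 (17, ?B) ?M)))" by (simp only: l r)
    have "bin (bmul H) (10, ?X) (11, ?X) (12, ?X) (?c 12 13 (9, ?B) K) = cob (lun' \<I>) (13, \<I>) (14, \<I>) (15, \<I>) (?c 10 14 (16, ?B) (?c 11 15 (17, ?B) ?M))"
      by (rule nul_inject[OF e]) (use ty K in auto)
    then show "bin (mul (monoid_of H)) (10, ?X) (11, ?X) (12, ?X) (?c 12 13 (9, ?B) K) =
      cob (comul (unit_comonoid V)) (13, \<I>) (14, \<I>) (15, \<I>) (?c 10 14 (16, ?B) (?c 11 15 (17, ?B) ?M))"
      by (simp only: monoid_of_simps unit_comonoid_simps)
  next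
    fix K assume K: "val K" "fst K = {(9, ?B)}"
    have s1: "?n 13 (nul (bone H) (10, ?X) (?c 10 13 (9, ?B) K)) = nul (bone H) (10, ?X) (?n 13 (?c 10 13 (9, ?B) K))"
      using ty K by (intro nul_nul_comm) auto
    have s2: "?n 13 (?c 10 13 (9, ?B) K) = ?e 10 (?j 9 K)"
      using ty K by (intro nul_\<chi>) auto
    have s3: "nul (bone H) (10, ?X) (?e 10 (?j 9 K)) = ?j 9 K"
      using ty K by (intro H_one_del) auto
    have l: "?n 13 (nul (bone H) (10, ?X) (?c 10 13 (9, ?B) K)) = ?j 9 K"
      by (unfold s1, unfold s2, unfold s3, rule refl)
    have r: "?n 13 (del (\<one> \<I>) (13, \<I>) (?j 9 K)) = ?j 9 K"
      using ty K by (intro nul_del) auto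
    have e: "?n 13 (nul (bone H) (10, ?X) (?c 10 13 (9, ?B) K)) = ?n 13 (del (\<one> \<I>) (13, \<I>) (?j 9 K))" by (simp only: l r)
    have "nul (bone H) (10, ?X) (?c 10 13 (9, ?B) K) = del (\<one> \<I>) (13, \<I>) (?j 9 K)"
      by (rule nul_inject[OF e]) (use ty K in auto)
    then show "nul (one (monoid_of H)) (10, ?X) (?c 10 13 (9, ?B) K) = del (counit (unit_comonoid V)) (13, \<I>) (?j 9 K)"
      by (simp only: monoid_of_simps unit_comonoid_simps)
  }
qed (use A B unit_is_comonoid \<chi>_types in auto)

text \<open>The arrow to which \<open>measuring_bimonoid\<close> applies \<Phi> is uncurried layer
  by layer and becomes \<psi>. Since \<psi> is a measuring, \<Phi> turns it into a comonoid
  morphism.\<close>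

lemma mP: "mP \<in> comonoid_homs V (tensor_comonoid V P P) P" "e \<cdot> (\<one> (bcar H) \<otimes>\<^sub>a mP) = \<psi>"
proof -
  let ?\<eta> = "universal_measuring V (monoid_of H) B P \<Phi>" and ?P = "ccar P" and ?B = "mcar B" and ?X = "bcar H"
  let ?T = "?P \<otimes> ?P" let ?t = "ihom_tensor V ?P ?B ?P ?B" and ?a = "ihom_arr V (\<one> ?T) (mul B)" and ?E = "ev V ?T (?B \<otimes> ?B)"
  let ?f = "?a \<cdot> ?t \<cdot> (?\<eta> \<otimes>\<^sub>a ?\<eta>) \<cdot> bcomul H" and ?e = "ev V ?P ?B" and ?H = "ihom V ?P ?B"
  have \<eta>t: "?\<eta> \<in> Hom V ?X ?H" using monoid_homs_types[OF \<eta>(1)] by simp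
  note ty = types \<eta>t
  have t: "?t \<in> Arr V" "src V ?t = ?H \<otimes> ?H" "tgt V ?t = ihom V ?T (?B \<otimes> ?B)"
    "?E \<cdot> (?t \<otimes>\<^sub>a \<one> ?T) = (?e \<otimes>\<^sub>a ?e) \<cdot> interchange V ?H ?H ?P ?P"
    using ihom_tensor_simps[of ?P ?B ?P ?B] ty by auto
  have a: "?a \<in> Arr V" "src V ?a = ihom V ?T (?B \<otimes> ?B)" "tgt V ?a = ihom V ?T ?B"
    "ev V ?T ?B \<cdot> (?a \<otimes>\<^sub>a \<one> ?T) = mul B \<cdot> ?E \<cdot> (\<one> (ihom V ?T (?B \<otimes> ?B)) \<otimes>\<^sub>a \<one> ?T)"
    using ihom_arr_simps[of "\<one> ?T" ?T ?T "mul B" "?B \<otimes> ?B" ?B] ty by auto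
  have f: "?f \<in> Hom V ?X (ihom V ?T ?B)" using a(1-3) t(1-3) ty by auto
  have "ev V ?T ?B \<cdot> (?f \<otimes>\<^sub>a \<one> ?T) = (ev V ?T ?B \<cdot> (?a \<otimes>\<^sub>a \<one> ?T)) \<cdot> ((?t \<cdot> (?\<eta> \<otimes>\<^sub>a ?\<eta>) \<cdot> bcomul H) \<otimes>\<^sub>a \<one> ?T)"
    using a(1-3) t(1-3) ty by auto
  also have "\<dots> = mul B \<cdot> (?E \<cdot> (?t \<otimes>\<^sub>a \<one> ?T)) \<cdot> (((?\<eta> \<otimes>\<^sub>a ?\<eta>) \<cdot> bcomul H) \<otimes>\<^sub>a \<one> ?T)"
    unfolding a(4) using a(1-3) t(1-3) ty by auto
  also have "\<dots> = mul B \<cdot> (?e \<otimes>\<^sub>a ?e) \<cdot> (interchange V ?H ?H ?P ?P \<cdot> ((?\<eta> \<otimes>\<^sub>a ?\<eta>) \<otimes>\<^sub>a (\<one> ?P \<otimes>\<^sub>a \<one> ?P))) \<cdot> (bcomul H \<otimes>\<^sub>a \<one> ?T)"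
    unfolding t(4) using ty by auto
  also have "interchange V ?H ?H ?P ?P \<cdot> ((?\<eta> \<otimes>\<^sub>a ?\<eta>) \<otimes>\<^sub>a (\<one> ?P \<otimes>\<^sub>a \<one> ?P)) =
     ((?\<eta> \<otimes>\<^sub>a \<one> ?P) \<otimes>\<^sub>a (?\<eta> \<otimes>\<^sub>a \<one> ?P)) \<cdot> interchange V ?X ?X ?P ?P"
    using interchange_nat[of ?\<eta> ?\<eta> "\<one> ?P" "\<one> ?P"] ty by auto
  also have "mul B \<cdot> (?e \<otimes>\<^sub>a ?e) \<cdot> (((?\<eta> \<otimes>\<^sub>a \<one> ?P) \<otimes>\<^sub>a (?\<eta> \<otimes>\<^sub>a \<one> ?P)) \<cdot> interchange V ?X ?X ?P ?P) \<cdot> (bcomul H \<otimes>\<^sub>a \<one> ?T) = \<psi>"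
    unfolding \<psi>_def e_def using ty by auto
  finally have e: "ev V ?T ?B \<cdot> (?f \<otimes>\<^sub>a \<one> ?T) = \<psi>" .
  have m: "mP = \<Phi> (tensor_comonoid V P P) ?f" by (simp add: mP_def measuring_bimonoid_def Let_def)
  have "?f \<in> monoid_homs V (monoid_of H) (convolution_monoid V (tensor_comonoid V P P) B)"
    using monoid_homs_convolution_iff[OF A tensor_is_comonoid[OF P P] B, of ?f] f e \<psi>_measuring by simp
  from \<Phi>_hom[OF tensor_is_comonoid[OF P P] this] e
  show "mP \<in> comonoid_homs V (tensor_comonoid V P P) P" "e \<cdot> (\<one> (bcar H) \<otimes>\<^sub>a mP) = \<psi>"
    unfolding m by simp_all
qed

lemma iP: "iP \<in> comonoid_homs V (unit_comonoid V) P" "e \<cdot> (\<one> (bcar H) \<otimes>\<^sub>a iP) = \<chi>"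
proof -
  let ?B = "mcar B" and ?X = "bcar H"
  let ?t = "transp V ?B \<I> ?B (\<rho>\<^sub>I ?B)" let ?f = "?t \<cdot> one B \<cdot> bcounit H"
  note ty = types
  have t: "?t \<in> Arr V" "src V ?t = ?B" "tgt V ?t = ihom V \<I> ?B" "ev V \<I> ?B \<cdot> (?t \<otimes>\<^sub>a \<one> \<I>) = \<rho>\<^sub>I ?B"
    using transp_simps[of "\<rho>\<^sub>I ?B" ?B \<I> ?B] ty by auto
  have f: "?f \<in> Hom V ?X (ihom V \<I> ?B)" using t(1-3) ty by auto
  have "ev V \<I> ?B \<cdot> (?f \<otimes>\<^sub>a \<one> \<I>) = (ev V \<I> ?B \<cdot> (?t \<otimes>\<^sub>a \<one> \<I>)) \<cdot> ((one B \<cdot> bcounit H) \<otimes>\<^sub>a \<one> \<I>)"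
    using t(1-3) ty by auto
  also have "\<dots> = \<chi>" unfolding t(4) \<chi>_def using run_nat[of "one B \<cdot> bcounit H"] ty by simp
  finally have e: "ev V \<I> ?B \<cdot> (?f \<otimes>\<^sub>a \<one> \<I>) = \<chi>" .
  have m: "iP = \<Phi> (unit_comonoid V) ?f" by (simp add: iP_def measuring_bimonoid_def Let_def)
  have "?f \<in> monoid_homs V (monoid_of H) (convolution_monoid V (unit_comonoid V) B)"
    using monoid_homs_convolution_iff[OF A unit_is_comonoid B, of ?f] f e \<chi>_measuring by simp
  from \<Phi>_hom[OF unit_is_comonoid this] e
  show "iP \<in> comonoid_homs V (unit_comonoid V) P" "e \<cdot> (\<one> (bcar H) \<otimes>\<^sub>a iP) = \<chi>"
    unfolding m by simp_all
qed

lemma mP_types: "mP \<in> Arr V" "src V mP = ccar P \<otimes> ccar P" "tgt V mP = ccar P"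
  and iP_types: "iP \<in> Arr V" "src V iP = \<I>" "tgt V iP = ccar P"
  using comonoid_hom_types[OF mP(1)] comonoid_hom_types[OF iP(1)] by auto

text \<open>Trades a product in P for a splitting in H: e(h \<otimes> p q) = e(h1 \<otimes> p) e(h2
  \<otimes> q). With this rule and \<open>e_iP\<close>, calculations in P under \<open>e\<close>
  become calculations in H and B.\<close>

lemma e_mP:
  assumes w: "snd h = bcar H" "snd h1 = bcar H" "snd h2 = bcar H" "snd p = ccar P" "snd q = ccar P" "snd x = ccar P"
      "snd b = mcar B" "snd b1 = mcar B" "snd b2 = mcar B"
    and K: "val K" "b \<in> fst K" "distinct [h, h1, h2, p, q, x, b, b1, b2]" "set [h, h1, h2, p, q, x, b1, b2] \<inter> fst K = {}"
  shows "bin mP p q x (bin e h x b K) = cob (bcomul H) h h1 h2 (bin e h1 p b1 (bin e h2 q b2 (bin (mul B) b1 b2 b K)))"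
proof -
  let ?W = "{h, h1, h2, p, q, x, b, b1, b2}" and ?T = "ccar P \<otimes> ccar P"
  obtain n where n: "\<And>m X. n \<le> m \<Longrightarrow> (m, X) \<notin> fst K \<union> ?W"
    using fresh_wires[of "fst K \<union> ?W"] val_finite[OF K(1)] by auto
  let ?t = "(n, ?T)"
  have nn: "?t \<notin> fst K \<union> ?W" by (intro n, simp)
  have nn': "\<forall>v \<in> ?W. v \<noteq> ?t" using nn by blast
  have d: "distinct [b2, b1, b, x, q, p, h2, h1, h]" using K(3) by auto
  note a = types mP_types \<psi>_types w K nn nn' d
  have s1: "bin mP p q x (bin e h x b K) = bin (mP \<cdot> \<one> ?T) p q x (bin e h x b K)"
    using a by simp
  have s2: "bin (mP \<cdot> \<one> ?T) p q x (bin e h x b K) = bin (\<one> ?T) p q ?t (sub mP ?t x (bin e h x b K))"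
    using a by (intro bin_sub[symmetric]) simp_all
  have s3: "sub mP ?t x (bin e h x b K) = bin (e \<cdot> (\<one> (snd h) \<otimes>\<^sub>a mP)) h ?t b K"
    using a by (intro sub_bin2) simp_all
  have s4: "e \<cdot> (\<one> (snd h) \<otimes>\<^sub>a mP) = \<psi>" using mP(2) w by simp
  have s5: "bin (\<one> ?T) p q ?t (bin \<psi> h ?t b K) = cob (bcomul H) h h1 h2 (bin e h1 p b1 (bin e h2 q b2 (bin (mul B) b1 b2 b K)))"
    using a by (intro bin_\<psi>) simp_all
  show ?thesis
    by (unfold s1, unfold s2, unfold s3, unfold s4, unfold s5, rule refl)
qed

lemma e_iP:
  assumes w: "snd h = bcar H" "snd x = ccar P" "snd b = mcar B"
    and K: "val K" "b \<in> fst K" "distinct [h, x, b]" "set [h, x] \<inter> fst K = {}"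
  shows "nul iP x (bin e h x b K) = del (bcounit H) h (nul (one B) b K)"
proof -
  let ?W = "{h, x, b}"
  obtain n where n: "\<And>m X. n \<le> m \<Longrightarrow> (m, X) \<notin> fst K \<union> ?W"
    using fresh_wires[of "fst K \<union> ?W"] val_finite[OF K(1)] by auto
  let ?t = "(n, \<I>)"
  have nn: "?t \<notin> fst K \<union> ?W" by (intro n, simp)
  have nn': "\<forall>v \<in> ?W. v \<noteq> ?t" using nn by blast
  have d: "distinct [b, x, h]" using K(3) by auto
  note a = types iP_types \<chi>_types w K nn nn' d
  have s1: "nul iP x (bin e h x b K) = nul (iP \<cdot> \<one> \<I>) x (bin e h x b K)"
    using a by simp
  have s2: "nul (iP \<cdot> \<one> \<I>) x (bin e h x b K) = nul (\<one> \<I>) ?t (sub iP ?t x (bin e h x b K))"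
    using a by (intro nul_sub[symmetric]) simp_all
  have s3: "sub iP ?t x (bin e h x b K) = bin (e \<cdot> (\<one> (snd h) \<otimes>\<^sub>a iP)) h ?t b K"
    using a by (intro sub_bin2) simp_all
  have s4: "e \<cdot> (\<one> (snd h) \<otimes>\<^sub>a iP) = \<chi>" using iP(2) w by simp
  have s5: "nul (\<one> \<I>) ?t (bin \<chi> h ?t b K) = del (bcounit H) h (nul (one B) b K)"
    using a by (intro nul_\<chi>) simp_all
  show ?thesis
    by (unfold s1, unfold s2, unfold s3, unfold s4, unfold s5, rule refl)
qed

text \<open>Both sides are comonoid morphisms out of (P \<otimes> P) \<otimes> P, and composition
  with \<open>e\<close> gives e(h1 \<otimes> p) e(h2 \<otimes> q) e(h3 \<otimes> r) in the two
  bracketings. Equality follows from coassociativity of H and associativity of B.\<close>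

lemma mP_assoc: "mP \<cdot> (mP \<otimes>\<^sub>a \<one> (ccar P)) = mP \<cdot> (\<one> (ccar P) \<otimes>\<^sub>a mP) \<cdot> \<alpha> (ccar P) (ccar P) (ccar P)"
proof (rule comonoid_hom_eqI)
  let ?X = "bcar H" and ?P = "ccar P" and ?B = "mcar B"
  let ?T = "?P \<otimes> ?P" let ?Y = "?T \<otimes> ?P"
  let ?g = "mP \<cdot> (mP \<otimes>\<^sub>a \<one> ?P)" and ?g' = "mP \<cdot> (\<one> ?P \<otimes>\<^sub>a mP) \<cdot> \<alpha> ?P ?P ?P"
  let ?PP = "tensor_comonoid V P P"
  note PP = tensor_is_comonoid[OF P P]
  show "is_comonoid V (tensor_comonoid V ?PP P)" by (rule tensor_is_comonoid[OF PP P])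
  show "?g \<in> comonoid_homs V (tensor_comonoid V ?PP P) P"
    by (rule comonoid_hom_cmp[OF tensor_is_comonoid[OF PP P] PP P comonoid_hom_tens[OF PP P P P mP(1) comonoid_hom_ident[OF P]] mP(1)])
  have "mP \<cdot> (\<one> ?P \<otimes>\<^sub>a mP) \<in> comonoid_homs V (tensor_comonoid V P ?PP) P"
    by (rule comonoid_hom_cmp[OF tensor_is_comonoid[OF P PP] PP P comonoid_hom_tens[OF P PP P P comonoid_hom_ident[OF P] mP(1)] mP(1)])
  from comonoid_hom_cmp[OF tensor_is_comonoid[OF PP P] tensor_is_comonoid[OF P PP] P comonoid_hom_assc[OF P P P] this]
  show "?g' \<in> comonoid_homs V (tensor_comonoid V ?PP P) P" using types mP_types by simp
  note ty = types mP_types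
  let ?eb = "\<lambda>i j k. bin e (i, ?X) (j, ?P) (k, ?B)" and ?mb = "\<lambda>i j k. bin (mul B) (i, ?B) (j, ?B) (k, ?B)"
  let ?dh = "\<lambda>i j k. cob (bcomul H) (i, ?X) (j, ?X) (k, ?X)" and ?mp = "\<lambda>i j k. bin mP (i, ?P) (j, ?P) (k, ?P)"
  let ?pp = "\<lambda>i j k. bin (\<one> ?T) (i, ?P) (j, ?P) (k, ?T)" and ?tp = "bin (\<one> ?Y) (24, ?T) (23, ?P) (11, ?Y)"
  fix K assume K: "val K" "fst K = {(9, ?B)}"
  let ?L = "?eb 10 12 9 K"
  have s1: "?tp (sub ?g (11, ?Y) (12, ?P) ?L) = bin (mP \<cdot> (mP \<otimes>\<^sub>a \<one> (snd (23::nat, ?P)))) (24, ?T) (23, ?P) (12, ?P) ?L"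
    using ty K by (subst bin_sub) auto
  have s2: "bin (mP \<cdot> (mP \<otimes>\<^sub>a \<one> (snd (23::nat, ?P)))) (24, ?T) (23, ?P) (12, ?P) ?L = sub mP (24, ?T) (25, ?P) (?mp 25 23 12 ?L)"
    using ty K by (intro sub_bin1[symmetric]) auto
  have s3: "?pp 21 22 24 (sub mP (24, ?T) (25, ?P) (?mp 25 23 12 ?L)) = ?mp 21 22 25 (?mp 25 23 12 ?L)"
    using ty K by (subst bin_sub) auto
  have s4: "?mp 25 23 12 ?L = ?dh 10 31 32 (?eb 31 25 41 (?eb 32 23 42 (?mb 41 42 9 K)))"
    using ty K by (intro e_mP) auto
  have s5: "?mp 21 22 25 (?dh 10 31 32 (?eb 31 25 41 (?eb 32 23 42 (?mb 41 42 9 K)))) = ?dh 10 31 32 (?mp 21 22 25 (?eb 31 25 41 (?eb 32 23 42 (?mb 41 42 9 K))))"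
    using ty K by (intro cob_bin_comm) auto
  have s6: "?mp 21 22 25 (?eb 31 25 41 (?eb 32 23 42 (?mb 41 42 9 K))) = ?dh 31 33 34 (?eb 33 21 43 (?eb 34 22 44 (?mb 43 44 41 (?eb 32 23 42 (?mb 41 42 9 K)))))"
    using ty K by (intro e_mP) auto
  have s7: "?mb 43 44 41 (?eb 32 23 42 (?mb 41 42 9 K)) = ?eb 32 23 42 (?mb 43 44 41 (?mb 41 42 9 K))"
    using ty K by (intro bin_bin_comm) auto
  have s8: "?mb 43 44 41 (?mb 41 42 9 K) = ?mb 44 42 45 (?mb 43 45 9 K)"
    using ty K by (intro bin_assoc B) auto
  have s9: "?dh 10 31 32 (?dh 31 33 34 (?eb 33 21 43 (?eb 34 22 44 (?eb 32 23 42 (?mb 44 42 45 (?mb 43 45 9 K)))))) =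
    ?dh 10 33 35 (?dh 35 34 32 (?eb 33 21 43 (?eb 34 22 44 (?eb 32 23 42 (?mb 44 42 45 (?mb 43 45 9 K))))))"
    using ty K by (intro H_coassoc) auto
  have l: "?pp 21 22 24 (?tp (sub ?g (11, ?Y) (12, ?P) ?L)) =
    ?dh 10 33 35 (?dh 35 34 32 (?eb 33 21 43 (?eb 34 22 44 (?eb 32 23 42 (?mb 44 42 45 (?mb 43 45 9 K))))))"
    by (unfold s1, unfold s2, unfold s3, unfold s4, unfold s5, unfold s6, unfold s7, unfold s8, unfold s9, rule refl)
  have s1: "?tp (sub ?g' (11, ?Y) (12, ?P) ?L) = bin ?g' (24, ?T) (23, ?P) (12, ?P) ?L"
    using ty K by (subst bin_sub) auto
  have s2: "?pp 21 22 24 (bin ?g' (24, ?T) (23, ?P) (12, ?P) ?L) = ?pp 22 23 26 (bin (mP \<cdot> (\<one> ?P \<otimes>\<^sub>a mP)) (21, ?P) (26, ?T) (12, ?P) ?L)"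
    using ty K by (intro bin_bin_assoc) auto
  have s3: "bin (mP \<cdot> (\<one> ?P \<otimes>\<^sub>a mP)) (21, ?P) (26, ?T) (12, ?P) ?L = bin (mP \<cdot> (\<one> (snd (21::nat, ?P)) \<otimes>\<^sub>a mP)) (21, ?P) (26, ?T) (12, ?P) ?L"
    by simp
  have s4: "bin (mP \<cdot> (\<one> (snd (21::nat, ?P)) \<otimes>\<^sub>a mP)) (21, ?P) (26, ?T) (12, ?P) ?L = sub mP (26, ?T) (27, ?P) (?mp 21 27 12 ?L)"
    using ty K by (intro sub_bin2[symmetric]) auto
  have s5: "?pp 22 23 26 (sub mP (26, ?T) (27, ?P) (?mp 21 27 12 ?L)) = ?mp 22 23 27 (?mp 21 27 12 ?L)"
    using ty K by (subst bin_sub) auto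
  have s6: "?mp 21 27 12 ?L = ?dh 10 33 35 (?eb 33 21 43 (?eb 35 27 45 (?mb 43 45 9 K)))"
    using ty K by (intro e_mP) auto
  have s7: "?mp 22 23 27 (?dh 10 33 35 (?eb 33 21 43 (?eb 35 27 45 (?mb 43 45 9 K)))) = ?dh 10 33 35 (?mp 22 23 27 (?eb 33 21 43 (?eb 35 27 45 (?mb 43 45 9 K))))"
    using ty K by (intro cob_bin_comm) auto
  have s8: "?mp 22 23 27 (?eb 33 21 43 (?eb 35 27 45 (?mb 43 45 9 K))) = ?eb 33 21 43 (?mp 22 23 27 (?eb 35 27 45 (?mb 43 45 9 K)))"
    using ty K by (intro bin_bin_comm) auto
  have s9: "?mp 22 23 27 (?eb 35 27 45 (?mb 43 45 9 K)) = ?dh 35 34 32 (?eb 34 22 44 (?eb 32 23 42 (?mb 44 42 45 (?mb 43 45 9 K))))"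
    using ty K by (intro e_mP) auto
  have s10: "?eb 33 21 43 (?dh 35 34 32 (?eb 34 22 44 (?eb 32 23 42 (?mb 44 42 45 (?mb 43 45 9 K))))) =
    ?dh 35 34 32 (?eb 33 21 43 (?eb 34 22 44 (?eb 32 23 42 (?mb 44 42 45 (?mb 43 45 9 K)))))"
    using ty K by (intro cob_bin_comm) auto
  have r: "?pp 21 22 24 (?tp (sub ?g' (11, ?Y) (12, ?P) ?L)) =
    ?dh 10 33 35 (?dh 35 34 32 (?eb 33 21 43 (?eb 34 22 44 (?eb 32 23 42 (?mb 44 42 45 (?mb 43 45 9 K))))))"
    by (unfold s1, unfold s2, unfold s3, unfold s4, unfold s5, unfold s6, unfold s7, unfold s8, unfold s9, unfold s10, rule refl)
  have e: "?pp 21 22 24 (?tp (sub ?g (11, ?Y) (12, ?P) ?L)) = ?pp 21 22 24 (?tp (sub ?g' (11, ?Y) (12, ?P) ?L))" by (simp only: l r)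
  have e: "?tp (sub ?g (11, ?Y) (12, ?P) ?L) = ?tp (sub ?g' (11, ?Y) (12, ?P) ?L)"
    by (rule bin_inject[OF e]) (use ty K in auto)
  have "sub ?g (11, ?Y) (12, ?P) ?L = sub ?g' (11, ?Y) (12, ?P) ?L"
    by (rule bin_inject[OF e]) (use ty K in auto)
  then show "sub ?g (11, ccar (tensor_comonoid V ?PP P)) (12, ?P) (bin e (10, mcar (monoid_of H)) (12, ?P) (9, ?B) K) =
    sub ?g' (11, ccar (tensor_comonoid V ?PP P)) (12, ?P) (bin e (10, mcar (monoid_of H)) (12, ?P) (9, ?B) K)"
    by (simp only: monoid_of_simps tensor_comonoid_simps)
qed

text \<open>Composed with an inverse unitor, each left side becomes a comonoid endomorphism of P, to
  be compared with the identity: e(h1 \<otimes> 1) e(h2 \<otimes> p) = \<epsilon>(h1) e(h2 \<otimes>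
  p) = e(h \<otimes> p), and symmetrically.\<close>

lemma mP_unit:
  "mP \<cdot> (iP \<otimes>\<^sub>a \<one> (ccar P)) = \<lambda>\<^sub>I (ccar P)" "mP \<cdot> (\<one> (ccar P) \<otimes>\<^sub>a iP) = \<rho>\<^sub>I (ccar P)"
proof -
  let ?X = "bcar H" and ?P = "ccar P" and ?B = "mcar B" and ?I = "unit_comonoid V"
  let ?g = "mP \<cdot> (iP \<otimes>\<^sub>a \<one> ?P) \<cdot> lun' ?P" and ?g' = "mP \<cdot> (\<one> ?P \<otimes>\<^sub>a iP) \<cdot> run' ?P"
  note PP = tensor_is_comonoid[OF P P] and IP = tensor_is_comonoid[OF unit_is_comonoid P] and PI = tensor_is_comonoid[OF P unit_is_comonoid]
  note ty = types mP_types iP_types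
  let ?eb = "\<lambda>i j k. bin e (i, ?X) (j, ?P) (k, ?B)" and ?mb = "\<lambda>i j k. bin (mul B) (i, ?B) (j, ?B) (k, ?B)"
  let ?dh = "\<lambda>i j k. cob (bcomul H) (i, ?X) (j, ?X) (k, ?X)" and ?mp = "\<lambda>i j k. bin mP (i, ?P) (j, ?P) (k, ?P)"
  let ?ip = "nul iP (21, ?P)" and ?j = "\<lambda>i. nul (one B) (i, ?B)" and ?e = "\<lambda>i. del (bcounit H) (i, ?X)"
  have g: "?g \<in> comonoid_homs V P P"
    by (rule comonoid_hom_cmp[OF P PP P comonoid_hom_cmp[OF P IP PP comonoid_hom_unit'(1)[OF P]
      comonoid_hom_tens[OF unit_is_comonoid P P P iP(1) comonoid_hom_ident[OF P]]] mP(1)])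
  have g': "?g' \<in> comonoid_homs V P P"
    by (rule comonoid_hom_cmp[OF P PP P comonoid_hom_cmp[OF P PI PP comonoid_hom_unit'(2)[OF P]
      comonoid_hom_tens[OF P unit_is_comonoid P P comonoid_hom_ident[OF P] iP(1)]] mP(1)])
  have "?g = \<one> ?P"
  proof (rule comonoid_hom_eqI[OF P g comonoid_hom_ident[OF P]])
    fix K assume K: "val K" "fst K = {(9, ?B)}"
    have s1: "sub ?g (11, ?P) (12, ?P) (?eb 10 12 9 K) = sub (mP \<cdot> (iP \<otimes>\<^sub>a \<one> (snd (11::nat, ?P))) \<cdot> lun' (snd (11::nat, ?P))) (11, ?P) (12, ?P) (?eb 10 12 9 K)"
      by simp
    have s2: "sub (mP \<cdot> (iP \<otimes>\<^sub>a \<one> (snd (11::nat, ?P))) \<cdot> lun' (snd (11::nat, ?P))) (11, ?P) (12, ?P) (?eb 10 12 9 K) = ?ip (?mp 21 11 12 (?eb 10 12 9 K))"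
      using ty K by (intro nul_bin1[symmetric]) auto
    have s3: "?mp 21 11 12 (?eb 10 12 9 K) = ?dh 10 31 32 (?eb 31 21 41 (?eb 32 11 42 (?mb 41 42 9 K)))"
      using ty K by (intro e_mP) auto
    have s4: "?ip (?dh 10 31 32 (?eb 31 21 41 (?eb 32 11 42 (?mb 41 42 9 K)))) = ?dh 10 31 32 (?ip (?eb 31 21 41 (?eb 32 11 42 (?mb 41 42 9 K))))"
      using ty K by (intro cob_nul_comm) auto
    have s5: "?ip (?eb 31 21 41 (?eb 32 11 42 (?mb 41 42 9 K))) = ?e 31 (?j 41 (?eb 32 11 42 (?mb 41 42 9 K)))"
      using ty K by (intro e_iP) auto
    have s6: "?j 41 (?eb 32 11 42 (?mb 41 42 9 K)) = ?eb 32 11 42 (?j 41 (?mb 41 42 9 K))"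
      using ty K by (intro bin_nul_comm) auto
    have s7: "?j 41 (?mb 41 42 9 K) = sub (\<one> ?B) (42, ?B) (9, ?B) K"
      using ty K by (intro bin_unit[OF B]) auto
    have s8: "?eb 32 11 42 (sub (\<one> ?B) (42, ?B) (9, ?B) K) = ?eb 32 11 9 K"
      using ty K by (subst bin_sub) auto
    have s9: "?dh 10 31 32 (?e 31 (?eb 32 11 9 K)) = sub (\<one> ?X) (10, ?X) (32, ?X) (?eb 32 11 9 K)"
      using ty K by (intro H_counit) auto
    have s10: "sub (\<one> ?X) (10, ?X) (32, ?X) (?eb 32 11 9 K) = ?eb 10 11 9 K"
      using ty K by (subst sub_bin1) auto
    have l: "sub ?g (11, ?P) (12, ?P) (?eb 10 12 9 K) = ?eb 10 11 9 K"
      by (unfold s1, unfold s2, unfold s3, unfold s4, unfold s5, unfold s6, unfold s7, unfold s8, unfold s9, unfold s10, rule refl)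
    have r: "sub (\<one> ?P) (11, ?P) (12, ?P) (?eb 10 12 9 K) = ?eb 10 11 9 K"
      using ty K by (subst sub_bin2) auto
    show "sub ?g (11, ?P) (12, ?P) (bin e (10, mcar (monoid_of H)) (12, ?P) (9, ?B) K) =
      sub (\<one> ?P) (11, ?P) (12, ?P) (bin e (10, mcar (monoid_of H)) (12, ?P) (9, ?B) K)"
      by (simp only: monoid_of_simps l r)
  qed
  then have "(mP \<cdot> (iP \<otimes>\<^sub>a \<one> ?P) \<cdot> lun' ?P) \<cdot> \<lambda>\<^sub>I ?P = \<lambda>\<^sub>I ?P" using ty by simp
  then show "mP \<cdot> (iP \<otimes>\<^sub>a \<one> ?P) = \<lambda>\<^sub>I ?P" using ty by simp
  have "?g' = \<one> ?P"
  proof (rule comonoid_hom_eqI[OF P g' comonoid_hom_ident[OF P]])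
    fix K assume K: "val K" "fst K = {(9, ?B)}"
    have s1: "sub ?g' (11, ?P) (12, ?P) (?eb 10 12 9 K) = sub (mP \<cdot> (\<one> (snd (11::nat, ?P)) \<otimes>\<^sub>a iP) \<cdot> run' (snd (11::nat, ?P))) (11, ?P) (12, ?P) (?eb 10 12 9 K)"
      by simp
    have s2: "sub (mP \<cdot> (\<one> (snd (11::nat, ?P)) \<otimes>\<^sub>a iP) \<cdot> run' (snd (11::nat, ?P))) (11, ?P) (12, ?P) (?eb 10 12 9 K) = ?ip (?mp 11 21 12 (?eb 10 12 9 K))"
      using ty K by (intro nul_bin2[symmetric]) auto
    have s3: "?mp 11 21 12 (?eb 10 12 9 K) = ?dh 10 31 32 (?eb 31 11 41 (?eb 32 21 42 (?mb 41 42 9 K)))"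
      using ty K by (intro e_mP) auto
    have s4: "?ip (?dh 10 31 32 (?eb 31 11 41 (?eb 32 21 42 (?mb 41 42 9 K)))) = ?dh 10 31 32 (?ip (?eb 31 11 41 (?eb 32 21 42 (?mb 41 42 9 K))))"
      using ty K by (intro cob_nul_comm) auto
    have s5: "?ip (?eb 31 11 41 (?eb 32 21 42 (?mb 41 42 9 K))) = ?eb 31 11 41 (?ip (?eb 32 21 42 (?mb 41 42 9 K)))"
      using ty K by (intro bin_nul_comm) auto
    have s6: "?ip (?eb 32 21 42 (?mb 41 42 9 K)) = ?e 32 (?j 42 (?mb 41 42 9 K))"
      using ty K by (intro e_iP) auto
    have s7: "?j 42 (?mb 41 42 9 K) = sub (\<one> ?B) (41, ?B) (9, ?B) K"
      using ty K by (intro bin_unit[OF B]) auto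
    have s8: "?eb 31 11 41 (?e 32 (sub (\<one> ?B) (41, ?B) (9, ?B) K)) = ?e 32 (?eb 31 11 41 (sub (\<one> ?B) (41, ?B) (9, ?B) K))"
      using ty K by (intro del_bin_comm) auto
    have s9: "?eb 31 11 41 (sub (\<one> ?B) (41, ?B) (9, ?B) K) = ?eb 31 11 9 K"
      using ty K by (subst bin_sub) auto
    have s10: "?dh 10 31 32 (?e 32 (?eb 31 11 9 K)) = sub (\<one> ?X) (10, ?X) (31, ?X) (?eb 31 11 9 K)"
      using ty K by (intro H_counit) auto
    have s11: "sub (\<one> ?X) (10, ?X) (31, ?X) (?eb 31 11 9 K) = ?eb 10 11 9 K"
      using ty K by (subst sub_bin1) auto
    have l: "sub ?g' (11, ?P) (12, ?P) (?eb 10 12 9 K) = ?eb 10 11 9 K"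
      by (unfold s1, unfold s2, unfold s3, unfold s4, unfold s5, unfold s6, unfold s7, unfold s8, unfold s9, unfold s10, unfold s11, rule refl)
    have r: "sub (\<one> ?P) (11, ?P) (12, ?P) (?eb 10 12 9 K) = ?eb 10 11 9 K"
      using ty K by (subst sub_bin2) auto
    show "sub ?g' (11, ?P) (12, ?P) (bin e (10, mcar (monoid_of H)) (12, ?P) (9, ?B) K) =
      sub (\<one> ?P) (11, ?P) (12, ?P) (bin e (10, mcar (monoid_of H)) (12, ?P) (9, ?B) K)"
      by (simp only: monoid_of_simps l r)
  qed
  then have "(mP \<cdot> (\<one> ?P \<otimes>\<^sub>a iP) \<cdot> run' ?P) \<cdot> \<rho>\<^sub>I ?P = \<rho>\<^sub>I ?P" using ty by simp
  then show "mP \<cdot> (\<one> ?P \<otimes>\<^sub>a iP) = \<rho>\<^sub>I ?P" using ty by simp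
qed

lemma measuring_bimonoid_simps:
  "bcar (measuring_bimonoid V H B P \<Phi>) = ccar P" "bmul (measuring_bimonoid V H B P \<Phi>) = mP"
  "bone (measuring_bimonoid V H B P \<Phi>) = iP" "bcomul (measuring_bimonoid V H B P \<Phi>) = comul P"
  "bcounit (measuring_bimonoid V H B P \<Phi>) = counit P"
  by (simp_all add: mP_def iP_def) (simp_all add: measuring_bimonoid_def Let_def)

lemma comonoid_of_measuring_bimonoid: "comonoid_of (measuring_bimonoid V H B P \<Phi>) = P"
  by (simp add: comonoid_of_def measuring_bimonoid_simps)

lemma measuring_bimonoid_is_bimonoid: "is_bimonoid V (measuring_bimonoid V H B P \<Phi>)"
  unfolding is_bimonoid_def comonoid_of_measuring_bimonoid
  using P mP(1) iP(1) mP_types iP_types mP_assoc mP_unit comonoid_types[OF P]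
  by (simp add: is_monoid_def measuring_bimonoid_simps)

end

section \<open>Quotient comonoids\<close>

definition has_coequalizers :: "('o, 'a, 'm) category_scheme \<Rightarrow> bool" where
  "has_coequalizers C \<longleftrightarrow> (\<forall>X Y. \<forall>u \<in> Hom C X Y. \<forall>v \<in> Hom C X Y. \<exists>L \<pi>. \<pi> \<in> Hom C Y L \<and> cmp C \<pi> u = cmp C \<pi> v \<and>
     (\<forall>Z. \<forall>w \<in> Hom C Y Z. cmp C w u = cmp C w v \<longrightarrow> (\<exists>!m. m \<in> Hom C L Z \<and> cmp C m \<pi> = w)))"

text \<open>A coequalizer is a colimit over the category with two parallel arrows.
  \<open>cocomplete\<close> speaks of index categories made of elements of \<open>'u\<close>, so
  this category is built from four distinct elements of that type.\<close>

lemma (in category) cocomplete_has_coequalizers: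
  fixes \<kappa> :: "'u rel"
  assumes \<kappa>: "inaccessible \<kappa>" and C: "cocomplete \<kappa> C"
  shows "has_coequalizers C"
  unfolding has_coequalizers_def
proof (intro allI ballI)
  fix X Y u v assume u: "u \<in> Hom C X Y" and v: "v \<in> Hom C X Y"
  have XY: "X \<in> Obj C" "Y \<in> Obj C" using u src_in_Obj[of u] tgt_in_Obj[of u] by (auto simp: Hom_def)
  have n: "natLeq <o \<kappa>" "Card_order \<kappa>" using \<kappa> by (auto simp: inaccessible_def)
  have fin: "|A| <o \<kappa>" if "finite A" for A :: "'u set"
    using that n(1) finite_iff_ordLess_natLeq ordLess_transitive by blast
  \<comment> \<open>A finite type would make the field of \<kappa> finite, hence smaller than
    \<kappa>, although it has the cardinality of \<kappa>.\<close>
  have inf: "infinite (UNIV :: 'u set)"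
  proof
    assume "finite (UNIV :: 'u set)"
    then have "finite (Field \<kappa>)" by (rule finite_subset[OF subset_UNIV])
    then have "|Field \<kappa>| <o \<kappa>" by (rule fin)
    moreover have "|Field \<kappa>| =o \<kappa>" by (rule card_of_Field_ordIso[OF n(2)])
    ultimately show False using not_ordLess_ordIso by blast
  qed
  obtain a :: 'u where True by blast
  obtain b where b: "b \<notin> {a}" using ex_new_if_finite[OF inf, of "{a}"] by blast
  obtain f where f: "f \<notin> {a, b}" using ex_new_if_finite[OF inf, of "{a, b}"] by blast
  obtain g where g: "g \<notin> {a, b, f}" using ex_new_if_finite[OF inf, of "{a, b, f}"] by blast
  have d: "distinct [a, b, f, g]" using b f g by auto
  \<comment> \<open>\<open>a\<close> and \<open>b\<close> serve both as the objects and as their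
    identities; \<open>f\<close> and \<open>g\<close> are the arrows from \<open>a\<close> to
    \<open>b\<close>. If the first arrow of a composite is \<open>f\<close> or \<open>g\<close>, the
    second must be the identity \<open>b\<close>, and the composite is the first arrow.\<close>
  let ?J = "(\<lparr>Obj = {a, b}, Arr = {a, b, f, g}, src = (\<lambda>x. if x = b then b else a), tgt = (\<lambda>x. if x = a then a else b),
     ident = (\<lambda>x. x), cmp = (\<lambda>y x. if x = a \<or> x = b then y else x)\<rparr>) :: ('u, 'u) category"
  let ?Fo = "\<lambda>x. if x = a then X else Y"
  let ?Fa = "\<lambda>x. if x = a then \<one> X else if x = b then \<one> Y else if x = f then u else v"
  have u': "u \<in> Arr C" "src C u = X" "tgt C u = Y" and v': "v \<in> Arr C" "src C v = X" "tgt C v = Y"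
    using u v by (auto simp: Hom_def)
  have J: "category ?J"
    by unfold_locales (use d in \<open>auto simp: Hom_def split: if_splits\<close>)
  have d': "a \<noteq> b" "b \<noteq> a" "a \<noteq> f" "f \<noteq> a" "a \<noteq> g" "g \<noteq> a" "b \<noteq> f" "f \<noteq> b" "b \<noteq> g" "g \<noteq> b" "f \<noteq> g" "g \<noteq> f"
    using d by auto
  have F: "is_functor ?J C ?Fo ?Fa"
    unfolding is_functor_def
  proof (intro conjI allI ballI)
    fix i j k p q assume pq: "p \<in> Hom ?J i j" "q \<in> Hom ?J j k"
    then have "p = a \<or> p = b \<or> p = f \<or> p = g" "q = a \<or> q = b \<or> q = f \<or> q = g"
      "(if p = a then a else b) = (if q = b then b else a)" by (auto simp: Hom_def)
    then show "?Fa (cmp ?J q p) = ?Fa q \<cdot> ?Fa p"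
      by (elim disjE) (use d' u' v' XY in simp_all)
  qed (use d' u' v' XY in \<open>auto simp: Hom_def\<close>)
  obtain L c where L: "is_colimit ?J C ?Fo ?Fa L c"
    using C J F fin[of "{a, b}"] fin[of "{a, b, f, g}"] unfolding cocomplete_def by fastforce
  \<comment> \<open>A cocone is determined by its leg at \<open>b\<close>; the leg at
    \<open>a\<close> records that the two composites with \<open>u\<close> and \<open>v\<close>
    coincide.\<close>
  have co: "is_cocone ?J C ?Fo ?Fa L' c' \<longleftrightarrow> c' b \<in> Hom C Y L' \<and> c' a = c' b \<cdot> u \<and> c' a = c' b \<cdot> v" for L' c'
  proof
    assume "is_cocone ?J C ?Fo ?Fa L' c'"
    then show "c' b \<in> Hom C Y L' \<and> c' a = c' b \<cdot> u \<and> c' a = c' b \<cdot> v"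
      using d unfolding is_cocone_def by auto
  next
    assume "c' b \<in> Hom C Y L' \<and> c' a = c' b \<cdot> u \<and> c' a = c' b \<cdot> v"
    then have c: "c' b \<in> Arr C" "src C (c' b) = Y" "tgt C (c' b) = L'" and a: "c' a = c' b \<cdot> u" "c' a = c' b \<cdot> v"
      by (auto simp: Hom_def)
    have "L' \<in> Obj C" using c tgt_in_Obj by blast
    moreover have "c' a \<in> Arr C" "src C (c' a) = X" "tgt C (c' a) = L'" unfolding a(1) using c u' by auto
    ultimately show "is_cocone ?J C ?Fo ?Fa L' c'"
      unfolding is_cocone_def using d' c by (auto simp: Hom_def a[symmetric])
  qed
  show "\<exists>L \<pi>. \<pi> \<in> Hom C Y L \<and> \<pi> \<cdot> u = \<pi> \<cdot> v \<and>
     (\<forall>Z. \<forall>w \<in> Hom C Y Z. w \<cdot> u = w \<cdot> v \<longrightarrow> (\<exists>!m. m \<in> Hom C L Z \<and> m \<cdot> \<pi> = w))"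
  proof (intro exI conjI allI ballI impI)
    have c: "c b \<in> Hom C Y L" "c a = c b \<cdot> u" "c a = c b \<cdot> v"
      using L co unfolding is_colimit_def by blast+
    show "c b \<in> Hom C Y L" "c b \<cdot> u = c b \<cdot> v" using c by auto
    fix Z w assume w: "w \<in> Hom C Y Z" "w \<cdot> u = w \<cdot> v"
    let ?c' = "\<lambda>x. if x = a then w \<cdot> u else w"
    have "is_cocone ?J C ?Fo ?Fa Z ?c'" unfolding co using w d by auto
    then have "\<exists>!m. m \<in> Hom C L Z \<and> (\<forall>j \<in> Obj ?J. m \<cdot> c j = ?c' j)"
      using L unfolding is_colimit_def by blast
    moreover have "(\<forall>j \<in> Obj ?J. m \<cdot> c j = ?c' j) \<longleftrightarrow> m \<cdot> c b = w" if m: "m \<in> Hom C L Z" for m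
    proof
      assume "m \<cdot> c b = w"
      moreover have "m \<cdot> c a = (m \<cdot> c b) \<cdot> u" unfolding c(2) using m c(1) u' by (auto simp: Hom_def)
      ultimately show "\<forall>j \<in> Obj ?J. m \<cdot> c j = ?c' j" using d by auto
    qed (use d in auto)
    ultimately show "\<exists>!m. m \<in> Hom C L Z \<and> m \<cdot> c b = w" by (metis (no_types, lifting))
  qed
qed

context symmetric_monoidal_closed_category
begin

definition is_epi :: "'a \<Rightarrow> bool" where
  "is_epi \<pi> \<longleftrightarrow> (\<forall>m \<in> Arr V. \<forall>m' \<in> Arr V. src V m = tgt V \<pi> \<longrightarrow> src V m' = tgt V \<pi> \<longrightarrow> m \<cdot> \<pi> = m' \<cdot> \<pi> \<longrightarrow> m = m')"

text \<open>Tensoring with D has a right adjoint and so preserves epimorphisms: transposition moves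
  D into the target and leaves two arrows out of L, which \<pi> separates.\<close>

lemma coequalizer_tensor_epi:
  assumes \<pi>: "\<pi> \<in> Hom V E L" and epi: "is_epi \<pi>"
    and D: "D \<in> Obj V" and k: "k \<in> Hom V (L \<otimes> D) Z" "k' \<in> Hom V (L \<otimes> D) Z" "k \<cdot> (\<pi> \<otimes>\<^sub>a \<one> D) = k' \<cdot> (\<pi> \<otimes>\<^sub>a \<one> D)"
  shows "k = k'"
proof -
  have o: "E \<in> Obj V" "L \<in> Obj V" "Z \<in> Obj V" using \<pi> k(1) src_in_Obj[of \<pi>] tgt_in_Obj[of \<pi>] tgt_in_Obj[of k] by auto
  let ?t = "transp V L D Z k" and ?t' = "transp V L D Z k'"
  note t = transp_simps[OF k(1) o(2) D] and t' = transp_simps[OF k(2) o(2) D]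
  have "ev V D Z \<cdot> ((?t \<cdot> \<pi>) \<otimes>\<^sub>a \<one> D) = (ev V D Z \<cdot> (?t \<otimes>\<^sub>a \<one> D)) \<cdot> (\<pi> \<otimes>\<^sub>a \<one> D)"
    using t(1-3) \<pi> D o by simp
  also have "\<dots> = (ev V D Z \<cdot> (?t' \<otimes>\<^sub>a \<one> D)) \<cdot> (\<pi> \<otimes>\<^sub>a \<one> D)" by (simp only: t(4) t'(4) k(3))
  also have "\<dots> = ev V D Z \<cdot> ((?t' \<cdot> \<pi>) \<otimes>\<^sub>a \<one> D)"
    using t'(1-3) \<pi> D o by simp
  finally have e: "ev V D Z \<cdot> ((?t \<cdot> \<pi>) \<otimes>\<^sub>a \<one> D) = ev V D Z \<cdot> ((?t' \<cdot> \<pi>) \<otimes>\<^sub>a \<one> D)" .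
  have e2: "?t \<cdot> \<pi> = ?t' \<cdot> \<pi>"
    by (rule ev_inject[OF e, where Z = E]) (use t(1-3) t'(1-3) \<pi> D o in auto)
  have "?t = ?t'"
    by (rule epi[unfolded is_epi_def, rule_format, OF t(1) t'(1) _ _ e2]) (use t(2) t'(2) \<pi> in simp_all)
  then have "ev V D Z \<cdot> (?t \<otimes>\<^sub>a \<one> D) = ev V D Z \<cdot> (?t' \<otimes>\<^sub>a \<one> D)" by (simp only:)
  then show ?thesis by (simp only: t(4) t'(4))
qed

text \<open>Lets an equation about a quotient wire be verified before the passage to the quotient.
  Both contexts are brought to one order of wires, and \<open>coequalizer_tensor_epi\<close> is
  applied with the remaining wires as the tensor factor.\<close>

lemma sub_epi_inject:
  assumes \<pi>: "\<pi> \<in> Hom V (snd y) (snd x)"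
    and epi: "is_epi \<pi>"
    and e: "sub \<pi> y x K = sub \<pi> y x K'"
    and K: "val K" "val K'" "x \<in> fst K" "fst K' = fst K" "y \<notin> fst K"
  shows "K = K'"
proof -
  obtain ds k where k: "distinct (x # ds)" "wf (x # ds)" "k \<in> Arr V" "src V k = T (x # ds)" "K = mk (x # ds) k"
    "fst K = set (x # ds)" using val_cases1[OF K(1,3)] by blast
  obtain ds' k' where k': "distinct (x # ds')" "wf (x # ds')" "k' \<in> Arr V" "src V k' = T (x # ds')" "K' = mk (x # ds') k'"
    "fst K' = set (x # ds')" using val_cases1[OF K(2), of x] K(3,4) by auto
  have s: "set (x # ds') = set (x # ds)" using k(6) k'(6) K(4) by simp
  let ?c = "can (x # ds) (x # ds')" let ?k = "k' \<cdot> ?c"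
  have c: "?c \<in> Arr V" "src V ?c = T (x # ds)" "tgt V ?c = T (x # ds')"
    using can_simps[OF k(2,1) k'(1) s[symmetric]] by auto
  have K': "K' = mk (x # ds) ?k" unfolding k'(5) using k k' s by (intro mk_can[symmetric]) auto
  have kk: "?k \<in> Arr V" "src V ?k = T (x # ds)" "tgt V ?k = tgt V k'" using c k' by auto
  have o: "snd y \<in> Obj V" "T ds \<in> Obj V" using \<pi> src_in_Obj[of \<pi>] k by auto
  have y: "y \<notin> set ds" using K(5) k(6) by auto
  have "mk (y # ds) (k \<cdot> (\<pi> \<otimes>\<^sub>a \<one> (T ds))) = sub \<pi> y x K" "mk (y # ds) (?k \<cdot> (\<pi> \<otimes>\<^sub>a \<one> (T ds))) = sub \<pi> y x K'"
    unfolding K' k(5) using k kk \<pi> y by (auto intro!: sub_mk[symmetric] simp del: can.simps)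
  then have "mk (y # ds) (k \<cdot> (\<pi> \<otimes>\<^sub>a \<one> (T ds))) = mk (y # ds) (?k \<cdot> (\<pi> \<otimes>\<^sub>a \<one> (T ds)))" using e by simp
  then have eq: "k \<cdot> (\<pi> \<otimes>\<^sub>a \<one> (T ds)) = ?k \<cdot> (\<pi> \<otimes>\<^sub>a \<one> (T ds))"
    by (rule mk_inject) (use k(1-4) kk(1,2) \<pi> y o in \<open>simp_all del: can.simps cmp_assoc'\<close>)
  \<comment> \<open>The two arrows are not assumed to have the same target; the equation between
    their composites shows that they do.\<close>
  have "tgt V (k \<cdot> (\<pi> \<otimes>\<^sub>a \<one> (T ds))) = tgt V k" "tgt V (?k \<cdot> (\<pi> \<otimes>\<^sub>a \<one> (T ds))) = tgt V ?k"
    using k(1-4) kk(1,2) \<pi> o by (simp_all del: can.simps cmp_assoc')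
  then have "tgt V ?k = tgt V k" using eq by simp
  then show ?thesis unfolding k(5) K'
    by (intro arg_cong[where f = "mk (x # ds)"] coequalizer_tensor_epi[OF \<pi> epi o(2), where k = k and k' = ?k and Z = "tgt V k", OF _ _ eq]) (use k(1-4) kk(1,2) in \<open>simp_all del: can.simps cmp_assoc'\<close>)
qed

text \<open>The kernel pair of \<open>\<pi>\<close> is a coideal, so the coequalizer inherits the comonoid structure.\<close>

lemma coequalizer_comonoid:
  assumes E: "is_comonoid V E" and co: "has_coequalizers V"
    and u: "u \<in> Hom V X (ccar E)" and v: "v \<in> Hom V X (ccar E)" and c: "counit E \<cdot> u = counit E \<cdot> v"
    and d: "\<forall>L. \<forall>\<pi> \<in> Hom V (ccar E) L. \<pi> \<cdot> u = \<pi> \<cdot> v \<longrightarrow> (\<pi> \<otimes>\<^sub>a \<pi>) \<cdot> comul E \<cdot> u = (\<pi> \<otimes>\<^sub>a \<pi>) \<cdot> comul E \<cdot> v"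
  shows "\<exists>L \<pi>. is_comonoid V L \<and> \<pi> \<in> comonoid_homs V E L \<and> \<pi> \<cdot> u = \<pi> \<cdot> v \<and>
    (\<forall>Z. \<forall>w \<in> Hom V (ccar E) Z. w \<cdot> u = w \<cdot> v \<longrightarrow> (\<exists>!m. m \<in> Hom V (ccar L) Z \<and> m \<cdot> \<pi> = w))"
proof -
  let ?E = "ccar E" and ?D = "comul E" and ?c = "counit E"
  note ty = comonoid_types[OF E]
  from co[unfolded has_coequalizers_def, rule_format, OF u v]
  obtain L \<pi> where \<pi>: "\<pi> \<in> Hom V ?E L" "\<pi> \<cdot> u = \<pi> \<cdot> v"
    and un': "\<forall>Z. \<forall>w \<in> Hom V ?E Z. w \<cdot> u = w \<cdot> v \<longrightarrow> (\<exists>!m. m \<in> Hom V L Z \<and> m \<cdot> \<pi> = w)"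
    by (elim exE conjE)
  note un = un'[rule_format]
  have o: "X \<in> Obj V" "L \<in> Obj V" using u \<pi>(1) src_in_Obj[of u] tgt_in_Obj[of \<pi>] by auto
  have epi: "m = m'" if m: "m \<in> Hom V L Z" "m' \<in> Hom V L Z" "m \<cdot> \<pi> = m' \<cdot> \<pi>" for Z m m'
  proof -
    have 1: "m \<cdot> \<pi> \<in> Hom V ?E Z" using m \<pi>(1) by auto
    have "m \<cdot> \<pi> \<cdot> u = m \<cdot> \<pi> \<cdot> v" using \<pi>(2) by simp
    then have "(m \<cdot> \<pi>) \<cdot> u = (m \<cdot> \<pi>) \<cdot> v" using m(1) \<pi>(1) u v by simp
    from un[OF 1 this] show ?thesis using m by metis
  qed
  \<comment> \<open>The hypothesis \<open>d\<close>, applied to the coequalizer itself, says that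
    \<pi> \<otimes> \<pi> after the comultiplication of E does not distinguish \<open>u\<close> from
    \<open>v\<close>; hence it descends to \<delta>.\<close>
  have "((\<pi> \<otimes>\<^sub>a \<pi>) \<cdot> ?D) \<cdot> u = ((\<pi> \<otimes>\<^sub>a \<pi>) \<cdot> ?D) \<cdot> v" using d[rule_format, OF \<pi>] ty \<pi>(1) u v by simp
  then obtain \<delta> where \<delta>: "\<delta> \<in> Hom V L (L \<otimes> L)" "\<delta> \<cdot> \<pi> = (\<pi> \<otimes>\<^sub>a \<pi>) \<cdot> ?D"
    using un[of "(\<pi> \<otimes>\<^sub>a \<pi>) \<cdot> ?D" "L \<otimes> L"] ty \<pi>(1) by auto
  obtain \<gamma> where \<gamma>: "\<gamma> \<in> Hom V L \<I>" "\<gamma> \<cdot> \<pi> = ?c" using un[of ?c \<I>] c ty by auto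
  let ?L = "\<lparr>ccar = L, comul = \<delta>, counit = \<gamma>\<rparr>"
  note t = ty \<pi>(1) \<delta>(1) \<gamma>(1) o
  \<comment> \<open>As \<pi> can be cancelled on the right, the axioms for \<delta> and \<gamma>
    follow from those of E: composed with \<pi>, they turn into the structure of E followed by
    copies of \<pi>, by naturality of the constraints.\<close>
  have ass: "\<alpha> L L L \<cdot> (\<delta> \<otimes>\<^sub>a \<one> L) \<cdot> \<delta> = (\<one> L \<otimes>\<^sub>a \<delta>) \<cdot> \<delta>"
  proof (rule epi)
    have "(\<alpha> L L L \<cdot> (\<delta> \<otimes>\<^sub>a \<one> L) \<cdot> \<delta>) \<cdot> \<pi> = \<alpha> L L L \<cdot> (\<delta> \<otimes>\<^sub>a \<one> L) \<cdot> (\<delta> \<cdot> \<pi>)" using t by simp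
    also have "\<dots> = \<alpha> L L L \<cdot> ((\<delta> \<cdot> \<pi>) \<otimes>\<^sub>a \<pi>) \<cdot> ?D" using t by (simp add: \<delta>(2))
    also have "\<dots> = (\<alpha> L L L \<cdot> ((\<pi> \<otimes>\<^sub>a \<pi>) \<otimes>\<^sub>a \<pi>)) \<cdot> (?D \<otimes>\<^sub>a \<one> ?E) \<cdot> ?D" using t by (simp add: \<delta>(2))
    also have "\<alpha> L L L \<cdot> ((\<pi> \<otimes>\<^sub>a \<pi>) \<otimes>\<^sub>a \<pi>) = (\<pi> \<otimes>\<^sub>a (\<pi> \<otimes>\<^sub>a \<pi>)) \<cdot> \<alpha> ?E ?E ?E"
      using assc_nat[of \<pi> \<pi> \<pi>] t by simp
    also have "((\<pi> \<otimes>\<^sub>a (\<pi> \<otimes>\<^sub>a \<pi>)) \<cdot> \<alpha> ?E ?E ?E) \<cdot> (?D \<otimes>\<^sub>a \<one> ?E) \<cdot> ?D = (\<pi> \<otimes>\<^sub>a (\<pi> \<otimes>\<^sub>a \<pi>)) \<cdot> (\<alpha> ?E ?E ?E \<cdot> (?D \<otimes>\<^sub>a \<one> ?E) \<cdot> ?D)"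
      using t by simp
    also have "\<alpha> ?E ?E ?E \<cdot> (?D \<otimes>\<^sub>a \<one> ?E) \<cdot> ?D = (\<one> ?E \<otimes>\<^sub>a ?D) \<cdot> ?D" using E by (simp add: is_comonoid_def)
    also have "(\<pi> \<otimes>\<^sub>a (\<pi> \<otimes>\<^sub>a \<pi>)) \<cdot> (\<one> ?E \<otimes>\<^sub>a ?D) \<cdot> ?D = (\<pi> \<otimes>\<^sub>a (\<delta> \<cdot> \<pi>)) \<cdot> ?D" using t by (simp add: \<delta>(2))
    also have "\<dots> = (\<one> L \<otimes>\<^sub>a \<delta>) \<cdot> (\<delta> \<cdot> \<pi>)" using t by (simp add: \<delta>(2))
    also have "\<dots> = ((\<one> L \<otimes>\<^sub>a \<delta>) \<cdot> \<delta>) \<cdot> \<pi>" using t by simp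
    finally show "(\<alpha> L L L \<cdot> (\<delta> \<otimes>\<^sub>a \<one> L) \<cdot> \<delta>) \<cdot> \<pi> = ((\<one> L \<otimes>\<^sub>a \<delta>) \<cdot> \<delta>) \<cdot> \<pi>" .
  qed (use t in auto)
  have lu: "\<lambda>\<^sub>I L \<cdot> (\<gamma> \<otimes>\<^sub>a \<one> L) \<cdot> \<delta> = \<one> L"
  proof (rule epi)
    have "(\<lambda>\<^sub>I L \<cdot> (\<gamma> \<otimes>\<^sub>a \<one> L) \<cdot> \<delta>) \<cdot> \<pi> = \<lambda>\<^sub>I L \<cdot> (\<gamma> \<otimes>\<^sub>a \<one> L) \<cdot> (\<delta> \<cdot> \<pi>)" using t by simp
    also have "\<dots> = \<lambda>\<^sub>I L \<cdot> ((\<gamma> \<cdot> \<pi>) \<otimes>\<^sub>a \<pi>) \<cdot> ?D" using t by (simp add: \<delta>(2))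
    also have "\<dots> = (\<lambda>\<^sub>I L \<cdot> (\<one> \<I> \<otimes>\<^sub>a \<pi>)) \<cdot> (?c \<otimes>\<^sub>a \<one> ?E) \<cdot> ?D" using t by (simp add: \<gamma>(2))
    also have "\<lambda>\<^sub>I L \<cdot> (\<one> \<I> \<otimes>\<^sub>a \<pi>) = \<pi> \<cdot> \<lambda>\<^sub>I ?E" using lun_nat[of \<pi>] t by simp
    also have "(\<pi> \<cdot> \<lambda>\<^sub>I ?E) \<cdot> (?c \<otimes>\<^sub>a \<one> ?E) \<cdot> ?D = \<pi> \<cdot> (\<lambda>\<^sub>I ?E \<cdot> (?c \<otimes>\<^sub>a \<one> ?E) \<cdot> ?D)" using t by simp
    also have "\<dots> = \<one> L \<cdot> \<pi>" using E t by (simp add: is_comonoid_def)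
    finally show "(\<lambda>\<^sub>I L \<cdot> (\<gamma> \<otimes>\<^sub>a \<one> L) \<cdot> \<delta>) \<cdot> \<pi> = \<one> L \<cdot> \<pi>" .
  qed (use t in auto)
  have ru: "\<rho>\<^sub>I L \<cdot> (\<one> L \<otimes>\<^sub>a \<gamma>) \<cdot> \<delta> = \<one> L"
  proof (rule epi)
    have "(\<rho>\<^sub>I L \<cdot> (\<one> L \<otimes>\<^sub>a \<gamma>) \<cdot> \<delta>) \<cdot> \<pi> = \<rho>\<^sub>I L \<cdot> (\<one> L \<otimes>\<^sub>a \<gamma>) \<cdot> (\<delta> \<cdot> \<pi>)" using t by simp
    also have "\<dots> = \<rho>\<^sub>I L \<cdot> (\<pi> \<otimes>\<^sub>a (\<gamma> \<cdot> \<pi>)) \<cdot> ?D" using t by (simp add: \<delta>(2))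
    also have "\<dots> = (\<rho>\<^sub>I L \<cdot> (\<pi> \<otimes>\<^sub>a \<one> \<I>)) \<cdot> (\<one> ?E \<otimes>\<^sub>a ?c) \<cdot> ?D" using t by (simp add: \<gamma>(2))
    also have "\<rho>\<^sub>I L \<cdot> (\<pi> \<otimes>\<^sub>a \<one> \<I>) = \<pi> \<cdot> \<rho>\<^sub>I ?E" using run_nat[of \<pi>] t by simp
    also have "(\<pi> \<cdot> \<rho>\<^sub>I ?E) \<cdot> (\<one> ?E \<otimes>\<^sub>a ?c) \<cdot> ?D = \<pi> \<cdot> (\<rho>\<^sub>I ?E \<cdot> (\<one> ?E \<otimes>\<^sub>a ?c) \<cdot> ?D)" using t by simp
    also have "\<dots> = \<one> L \<cdot> \<pi>" using E t by (simp add: is_comonoid_def)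
    finally show "(\<rho>\<^sub>I L \<cdot> (\<one> L \<otimes>\<^sub>a \<gamma>) \<cdot> \<delta>) \<cdot> \<pi> = \<one> L \<cdot> \<pi>" .
  qed (use t in auto)
  have L: "is_comonoid V ?L" using ass lu ru t by (simp add: is_comonoid_def)
  have h: "\<pi> \<in> comonoid_homs V E ?L" using t \<delta>(2) \<gamma>(2) by (simp add: comonoid_homs_def)
  show ?thesis
    by (rule exI[of _ ?L], rule exI[of _ \<pi>]) (use L h \<pi>(2) un' in \<open>simp only: comonoid_obj.simps simp_thms\<close>)
qed

end

context universal_measuring_comonoid
begin

text \<open>Uniqueness once more, for cases where the composites with \<open>e\<close> are known to
  agree as arrows.\<close>

lemma comonoid_hom_eqI':
  assumes C: "is_comonoid V C" and g: "g \<in> comonoid_homs V C P" "g' \<in> comonoid_homs V C P"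
    and eq: "e \<cdot> (\<one> (mcar A) \<otimes>\<^sub>a g) = e \<cdot> (\<one> (mcar A) \<otimes>\<^sub>a g')"
  shows "g = g'"
proof -
  have "ev V (ccar C) (mcar B) \<cdot> ((ihom_arr V g (\<one> (mcar B)) \<cdot> universal_measuring V A B P \<Phi>) \<otimes>\<^sub>a \<one> (ccar C)) =
    ev V (ccar C) (mcar B) \<cdot> ((ihom_arr V g' (\<one> (mcar B)) \<cdot> universal_measuring V A B P \<Phi>) \<otimes>\<^sub>a \<one> (ccar C))"
    by (simp only: ihom_arr_\<eta>(2)[OF C g(1)] ihom_arr_\<eta>(2)[OF C g(2)] eq)
  from ev_inject[OF this ihom_arr_\<eta>(1)[OF C g(1)] ihom_arr_\<eta>(1)[OF C g(2)]
      comonoid_types(1)[OF C] monoid_types(1)[OF B] monoid_types(1)[OF A]]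
  show ?thesis using ihom_arr_\<eta>(4)[OF C g(1)] ihom_arr_\<eta>(4)[OF C g(2)] by metis
qed

text \<open>
  Neither \<open>u\<close> nor \<open>v\<close> need be a comonoid morphism, so the universal property of \<open>P\<close> does not apply
  to \<open>\<theta> \<cdot> u\<close> and \<open>\<theta> \<cdot> v\<close>; it applies to the factorization of the measuring \<open>e \<cdot> (\<one> \<otimes> \<theta>)\<close> through the
  coequalizer of \<open>u\<close> and \<open>v\<close>.
\<close>

lemma comonoid_hom_coequalizes:
  assumes E: "is_comonoid V E" and co: "has_coequalizers V" and \<theta>: "\<theta> \<in> comonoid_homs V E P"
    and u: "u \<in> Hom V X (ccar E)" and v: "v \<in> Hom V X (ccar E)" and c: "counit E \<cdot> u = counit E \<cdot> v"
    and d: "\<forall>L. \<forall>\<pi> \<in> Hom V (ccar E) L. \<pi> \<cdot> u = \<pi> \<cdot> v \<longrightarrow> (\<pi> \<otimes>\<^sub>a \<pi>) \<cdot> comul E \<cdot> u = (\<pi> \<otimes>\<^sub>a \<pi>) \<cdot> comul E \<cdot> v"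
    and eq: "e \<cdot> (\<one> (mcar A) \<otimes>\<^sub>a (\<theta> \<cdot> u)) = e \<cdot> (\<one> (mcar A) \<otimes>\<^sub>a (\<theta> \<cdot> v))"
  shows "\<theta> \<cdot> u = \<theta> \<cdot> v"
proof -
  obtain L \<pi> where L: "is_comonoid V L" "\<pi> \<in> comonoid_homs V E L" "\<pi> \<cdot> u = \<pi> \<cdot> v"
    and un: "\<forall>Z. \<forall>w \<in> Hom V (ccar E) Z. w \<cdot> u = w \<cdot> v \<longrightarrow> (\<exists>!m. m \<in> Hom V (ccar L) Z \<and> m \<cdot> \<pi> = w)"
    using coequalizer_comonoid[OF E co u v c d] by (elim exE conjE)
  note t\<pi> = comonoid_hom_types[OF L(2)]
  have ex: "\<exists>m. m \<in> Hom V (ccar L) Z \<and> m \<cdot> \<pi> = w" if "w \<in> Hom V (ccar E) Z" "w \<cdot> u = w \<cdot> v" for Z w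
    using un that by blast
  have "m = m'" if m: "m \<in> Hom V (ccar L) Z" "m' \<in> Hom V (ccar L) Z" "m \<cdot> \<pi> = m' \<cdot> \<pi>" for Z m m'
  proof -
    have 1: "m \<cdot> \<pi> \<in> Hom V (ccar E) Z" using m t\<pi> by auto
    have "m \<cdot> \<pi> \<cdot> u = m \<cdot> \<pi> \<cdot> v" using L(3) by simp
    then have "(m \<cdot> \<pi>) \<cdot> u = (m \<cdot> \<pi>) \<cdot> v" using m(1) t\<pi> u v by simp
    from un[rule_format, OF 1 this] show ?thesis using m by metis
  qed
  note ep = this
  have epi: "is_epi \<pi>" unfolding is_epi_def
  proof (intro ballI impI)
    fix m m' assume m: "m \<in> Arr V" "m' \<in> Arr V" "src V m = tgt V \<pi>" "src V m' = tgt V \<pi>" and eq: "m \<cdot> \<pi> = m' \<cdot> \<pi>"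
    have "tgt V m = tgt V (m \<cdot> \<pi>)" using m t\<pi> by simp
    also have "\<dots> = tgt V m'" unfolding eq using m t\<pi> by simp
    finally show "m = m'" using m t\<pi> by (intro ep[OF _ _ eq, of "tgt V m"]) simp_all
  qed
  let ?A = "mcar A" and ?B = "mcar B" and ?E = "ccar E" and ?L = "ccar L" and ?P = "ccar P"
  note t\<theta> = comonoid_hom_types[OF \<theta>]
  have o: "X \<in> Obj V" using u src_in_Obj[of u] by auto
  note ty = monoid_types[OF A] monoid_types[OF B] comonoid_types[OF E] comonoid_types[OF L(1)] comonoid_types[OF P] e_types t\<pi> t\<theta> o u v
  let ?\<phi> = "e \<cdot> (\<one> ?A \<otimes>\<^sub>a \<theta>)"
  have \<phi>: "measuring A E B ?\<phi>" by (rule measuring_cmp_hom[OF A E P B e_measuring \<theta>])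
  note \<phi>t = measuring_types[OF \<phi>]
  have \<phi>uv: "?\<phi> \<cdot> (\<one> ?A \<otimes>\<^sub>a u) = ?\<phi> \<cdot> (\<one> ?A \<otimes>\<^sub>a v)" using eq ty by simp
  \<comment> \<open>Only arrows out of E descend along \<pi>. The tensor factor A is therefore moved
    into the target: \<open>?w\<close> goes from E to [A, B] and is the transpose of the measuring
    with its factors exchanged.\<close>
  let ?w = "transp V ?E ?A ?B (?\<phi> \<cdot> \<sigma> ?E ?A)"
  have "?\<phi> \<cdot> \<sigma> ?E ?A \<in> Hom V (?E \<otimes> ?A) ?B" using \<phi>t ty by (simp del: cmp_assoc')
  note w = transp_simps[OF this]
  have w: "?w \<in> Arr V" "src V ?w = ?E" "tgt V ?w = ihom V ?A ?B" "ev V ?A ?B \<cdot> (?w \<otimes>\<^sub>a \<one> ?A) = ?\<phi> \<cdot> \<sigma> ?E ?A"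
    using w ty by auto
  have wf: "ev V ?A ?B \<cdot> ((?w \<cdot> f) \<otimes>\<^sub>a \<one> ?A) = (?\<phi> \<cdot> (\<one> ?A \<otimes>\<^sub>a f)) \<cdot> \<sigma> X ?A" if f: "f \<in> Hom V X ?E" for f
  proof -
    have "ev V ?A ?B \<cdot> ((?w \<cdot> f) \<otimes>\<^sub>a \<one> ?A) = (ev V ?A ?B \<cdot> (?w \<otimes>\<^sub>a \<one> ?A)) \<cdot> (f \<otimes>\<^sub>a \<one> ?A)" using w(1-3) ty f by simp
    also have "\<dots> = ?\<phi> \<cdot> (\<sigma> ?E ?A \<cdot> (f \<otimes>\<^sub>a \<one> ?A))" unfolding w(4) using \<phi>t ty f by simp
    also have "\<sigma> ?E ?A \<cdot> (f \<otimes>\<^sub>a \<one> ?A) = (\<one> ?A \<otimes>\<^sub>a f) \<cdot> \<sigma> X ?A" using sym_nat[of f "\<one> ?A"] ty f by simp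
    finally show ?thesis using \<phi>t ty f by simp
  qed
  have e1: "ev V ?A ?B \<cdot> ((?w \<cdot> u) \<otimes>\<^sub>a \<one> ?A) = ev V ?A ?B \<cdot> ((?w \<cdot> v) \<otimes>\<^sub>a \<one> ?A)"
    unfolding wf[OF u] wf[OF v] \<phi>uv ..
  have "?w \<cdot> u = ?w \<cdot> v"
    by (rule ev_inject[OF e1, where Z = X]) (use w(1-3) ty in auto)
  then obtain m where m: "m \<in> Hom V ?L (ihom V ?A ?B)" "m \<cdot> \<pi> = ?w" using ex[of ?w "ihom V ?A ?B"] w by auto
  \<comment> \<open>Transposing back the factorization of \<open>?w\<close> gives the descended map
    on A \<otimes> L.\<close>
  define \<phi>' where "\<phi>' = ev V ?A ?B \<cdot> (m \<otimes>\<^sub>a \<one> ?A) \<cdot> \<sigma> ?A ?L"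
  have \<phi>'t: "\<phi>' \<in> Arr V" "src V \<phi>' = ?A \<otimes> ?L" "tgt V \<phi>' = ?B" unfolding \<phi>'_def using m(1) ty by auto
  have "\<phi>' \<cdot> (\<one> ?A \<otimes>\<^sub>a \<pi>) = ev V ?A ?B \<cdot> (m \<otimes>\<^sub>a \<one> ?A) \<cdot> (\<sigma> ?A ?L \<cdot> (\<one> ?A \<otimes>\<^sub>a \<pi>))" unfolding \<phi>'_def using m(1) ty by simp
  also have "\<sigma> ?A ?L \<cdot> (\<one> ?A \<otimes>\<^sub>a \<pi>) = (\<pi> \<otimes>\<^sub>a \<one> ?A) \<cdot> \<sigma> ?A ?E" using sym_nat[of "\<one> ?A" \<pi>] ty by simp
  also have "ev V ?A ?B \<cdot> (m \<otimes>\<^sub>a \<one> ?A) \<cdot> ((\<pi> \<otimes>\<^sub>a \<one> ?A) \<cdot> \<sigma> ?A ?E) = (ev V ?A ?B \<cdot> ((m \<cdot> \<pi>) \<otimes>\<^sub>a \<one> ?A)) \<cdot> \<sigma> ?A ?E" using m(1) ty by simp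
  also have "\<dots> = ?\<phi>" unfolding m(2) w(4) using \<phi>t ty by simp
  finally have \<phi>'\<pi>: "\<phi>' \<cdot> (\<one> ?A \<otimes>\<^sub>a \<pi>) = ?\<phi>" .
  have r: "sub \<pi> (k, ?E) (j, ?L) (bin \<phi>' (i, ?A) (j, ?L) b K) = bin ?\<phi> (i, ?A) (k, ?E) b K"
    if "val K" "b \<in> fst K" "snd b = ?B" "distinct [i, j, k]" "set [(i, ?A), (j, ?L), (k, ?E)] \<inter> fst K = {}" for i j k b K
  proof -
    have "sub \<pi> (k, ?E) (j, ?L) (bin \<phi>' (i, ?A) (j, ?L) b K) = bin (\<phi>' \<cdot> (\<one> (snd (i, ?A)) \<otimes>\<^sub>a \<pi>)) (i, ?A) (k, ?E) b K"
      using ty \<phi>'t that by (intro sub_bin2) auto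
    then show ?thesis by (simp only: snd_conv \<phi>'\<pi>)
  qed
  have \<pi>L: "\<pi> \<in> Hom V (snd (23::nat, ?E)) (snd (13::nat, ?L))" using t\<pi> by simp
  \<comment> \<open>Each law for \<phi>' is composed with \<pi> on the wire of type L. As \<pi> is a
    comonoid morphism, it becomes the law for \<open>?\<phi>\<close>, and
    \<open>sub_epi_inject\<close> removes \<pi> again.\<close>
  have "measuring A L B \<phi>'"
  proof (rule measuringI[where X = ?A and Y = ?L and Z = ?B])
    fix K assume K: "val K" "fst K = {(9, ?B)}"
    let ?M = "bin (mul B) (16, ?B) (17, ?B) (9, ?B) K"
    have s1: "sub \<pi> (23, ?E) (13, ?L) (bin (mul A) (10, ?A) (11, ?A) (12, ?A) (bin \<phi>' (12, ?A) (13, ?L) (9, ?B) K)) =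
      bin (mul A) (10, ?A) (11, ?A) (12, ?A) (sub \<pi> (23, ?E) (13, ?L) (bin \<phi>' (12, ?A) (13, ?L) (9, ?B) K))"
      using ty \<phi>'t K by (intro sub_bin_comm[symmetric]) auto
    have s2: "sub \<pi> (23, ?E) (13, ?L) (bin \<phi>' (12, ?A) (13, ?L) (9, ?B) K) = bin ?\<phi> (12, ?A) (23, ?E) (9, ?B) K"
      using ty K by (intro r) auto
    have s3: "bin (mul A) (10, ?A) (11, ?A) (12, ?A) (bin ?\<phi> (12, ?A) (23, ?E) (9, ?B) K) =
      cob (comul E) (23, ?E) (24, ?E) (25, ?E) (bin ?\<phi> (10, ?A) (24, ?E) (16, ?B) (bin ?\<phi> (11, ?A) (25, ?E) (17, ?B) ?M))"
      using ty K by (intro bin_measuring_mul[OF \<phi> A E B]) auto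
    have l: "sub \<pi> (23, ?E) (13, ?L) (bin (mul A) (10, ?A) (11, ?A) (12, ?A) (bin \<phi>' (12, ?A) (13, ?L) (9, ?B) K)) =
      cob (comul E) (23, ?E) (24, ?E) (25, ?E) (bin ?\<phi> (10, ?A) (24, ?E) (16, ?B) (bin ?\<phi> (11, ?A) (25, ?E) (17, ?B) ?M))"
      by (unfold s1, unfold s2, unfold s3, rule refl)
    have s1: "sub \<pi> (23, ?E) (13, ?L) (cob (comul L) (13, ?L) (14, ?L) (15, ?L) (bin \<phi>' (10, ?A) (14, ?L) (16, ?B) (bin \<phi>' (11, ?A) (15, ?L) (17, ?B) ?M))) =
      cob (comul E) (23, ?E) (24, ?E) (25, ?E) (sub \<pi> (24, ?E) (14, ?L) (sub \<pi> (25, ?E) (15, ?L) (bin \<phi>' (10, ?A) (14, ?L) (16, ?B) (bin \<phi>' (11, ?A) (15, ?L) (17, ?B) ?M))))"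
      using ty \<phi>'t K by (intro sub_cob_hom E L) auto
    have s2: "sub \<pi> (25, ?E) (15, ?L) (bin \<phi>' (10, ?A) (14, ?L) (16, ?B) (bin \<phi>' (11, ?A) (15, ?L) (17, ?B) ?M)) =
      bin \<phi>' (10, ?A) (14, ?L) (16, ?B) (sub \<pi> (25, ?E) (15, ?L) (bin \<phi>' (11, ?A) (15, ?L) (17, ?B) ?M))"
      using ty \<phi>'t K by (intro sub_bin_comm[symmetric]) auto
    have s3: "sub \<pi> (25, ?E) (15, ?L) (bin \<phi>' (11, ?A) (15, ?L) (17, ?B) ?M) = bin ?\<phi> (11, ?A) (25, ?E) (17, ?B) ?M"
      using ty K by (intro r) auto
    have s4: "sub \<pi> (24, ?E) (14, ?L) (bin \<phi>' (10, ?A) (14, ?L) (16, ?B) (bin ?\<phi> (11, ?A) (25, ?E) (17, ?B) ?M)) = bin ?\<phi> (10, ?A) (24, ?E) (16, ?B) (bin ?\<phi> (11, ?A) (25, ?E) (17, ?B) ?M)"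
      using ty \<phi>t K by (intro r) (auto simp del: cmp_assoc')
    have rr: "sub \<pi> (23, ?E) (13, ?L) (cob (comul L) (13, ?L) (14, ?L) (15, ?L) (bin \<phi>' (10, ?A) (14, ?L) (16, ?B) (bin \<phi>' (11, ?A) (15, ?L) (17, ?B) ?M))) =
      cob (comul E) (23, ?E) (24, ?E) (25, ?E) (bin ?\<phi> (10, ?A) (24, ?E) (16, ?B) (bin ?\<phi> (11, ?A) (25, ?E) (17, ?B) ?M))"
      by (unfold s1, unfold s2, unfold s3, unfold s4, rule refl)
    have e0: "sub \<pi> (23, ?E) (13, ?L) (bin (mul A) (10, ?A) (11, ?A) (12, ?A) (bin \<phi>' (12, ?A) (13, ?L) (9, ?B) K)) =
      sub \<pi> (23, ?E) (13, ?L) (cob (comul L) (13, ?L) (14, ?L) (15, ?L) (bin \<phi>' (10, ?A) (14, ?L) (16, ?B) (bin \<phi>' (11, ?A) (15, ?L) (17, ?B) ?M)))"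
      by (simp only: l rr)
    show "bin (mul A) (10, ?A) (11, ?A) (12, ?A) (bin \<phi>' (12, ?A) (13, ?L) (9, ?B) K) =
      cob (comul L) (13, ?L) (14, ?L) (15, ?L) (bin \<phi>' (10, ?A) (14, ?L) (16, ?B) (bin \<phi>' (11, ?A) (15, ?L) (17, ?B) ?M))"
      by (rule sub_epi_inject[OF \<pi>L epi e0]) (use ty \<phi>'t K in auto)
  next
    fix K assume K: "val K" "fst K = {(9, ?B)}"
    have s1: "sub \<pi> (23, ?E) (13, ?L) (nul (one A) (10, ?A) (bin \<phi>' (10, ?A) (13, ?L) (9, ?B) K)) =
      nul (one A) (10, ?A) (sub \<pi> (23, ?E) (13, ?L) (bin \<phi>' (10, ?A) (13, ?L) (9, ?B) K))"
      using ty \<phi>'t K by (intro sub_nul_comm[symmetric]) auto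
    have s2: "sub \<pi> (23, ?E) (13, ?L) (bin \<phi>' (10, ?A) (13, ?L) (9, ?B) K) = bin ?\<phi> (10, ?A) (23, ?E) (9, ?B) K"
      using ty K by (intro r) auto
    have s3: "nul (one A) (10, ?A) (bin ?\<phi> (10, ?A) (23, ?E) (9, ?B) K) = del (counit E) (23, ?E) (nul (one B) (9, ?B) K)"
      using ty K by (intro nul_measuring_one[OF \<phi> A E B]) auto
    have l: "sub \<pi> (23, ?E) (13, ?L) (nul (one A) (10, ?A) (bin \<phi>' (10, ?A) (13, ?L) (9, ?B) K)) = del (counit E) (23, ?E) (nul (one B) (9, ?B) K)"
      by (unfold s1, unfold s2, unfold s3, rule refl)
    have rr: "sub \<pi> (23, ?E) (13, ?L) (del (counit L) (13, ?L) (nul (one B) (9, ?B) K)) = del (counit E) (23, ?E) (nul (one B) (9, ?B) K)"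
      using ty K by (intro sub_del_hom E L) auto
    have e0: "sub \<pi> (23, ?E) (13, ?L) (nul (one A) (10, ?A) (bin \<phi>' (10, ?A) (13, ?L) (9, ?B) K)) =
      sub \<pi> (23, ?E) (13, ?L) (del (counit L) (13, ?L) (nul (one B) (9, ?B) K))" by (simp only: l rr)
    show "nul (one A) (10, ?A) (bin \<phi>' (10, ?A) (13, ?L) (9, ?B) K) = del (counit L) (13, ?L) (nul (one B) (9, ?B) K)"
      by (rule sub_epi_inject[OF \<pi>L epi e0]) (use ty \<phi>'t K in auto)
  qed (use A B L \<phi>'t in auto)
  then obtain \<theta>' where \<theta>': "\<theta>' \<in> comonoid_homs V L P" "e \<cdot> (\<one> ?A \<otimes>\<^sub>a \<theta>') = \<phi>'"
    using measuring_factors[OF L(1)] by blast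
  note t\<theta>' = comonoid_hom_types[OF \<theta>'(1)]
  have "e \<cdot> (\<one> ?A \<otimes>\<^sub>a (\<theta>' \<cdot> \<pi>)) = (e \<cdot> (\<one> ?A \<otimes>\<^sub>a \<theta>')) \<cdot> (\<one> ?A \<otimes>\<^sub>a \<pi>)" using ty t\<theta>' by simp
  also have "\<dots> = ?\<phi>" by (simp only: \<theta>'(2) \<phi>'\<pi>)
  \<comment> \<open>Both sides are comonoid morphisms from E to P, so uniqueness applies to them,
    whereas it could not be applied to their composites with \<open>u\<close> and
    \<open>v\<close>.\<close>
  finally have "\<theta>' \<cdot> \<pi> = \<theta>"
    by (intro comonoid_hom_eqI'[OF E comonoid_hom_cmp[OF E L(1) P L(2) \<theta>'(1)] \<theta>])
  then have \<theta>1: "\<theta> = \<theta>' \<cdot> \<pi>" ..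
  have "\<theta> \<cdot> u = \<theta>' \<cdot> (\<pi> \<cdot> u)" unfolding \<theta>1 using ty t\<theta>' by simp
  also have "\<dots> = \<theta>' \<cdot> (\<pi> \<cdot> v)" by (simp only: L(3))
  also have "\<dots> = \<theta> \<cdot> v" unfolding \<theta>1 using ty t\<theta>' by simp
  finally show ?thesis .
qed

end

section \<open>The antipode\<close>

locale universal_measuring_hopf = universal_measuring_bimonoid V H B P \<Phi>
  for V :: "('o, 'a) smc_category" (structure)
    and H :: "('o, 'a) bimonoid_obj" and B :: "('o, 'a) monoid_obj" and P :: "('o, 'a) comonoid_obj"
    and \<Phi> :: "('o, 'a) comonoid_obj \<Rightarrow> 'a \<Rightarrow> 'a" +
  fixes s :: 'a
  assumes s: "is_antipode V H s" and co: "has_coequalizers V"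
begin

section \<open>Properties of the antipode of H\<close>

lemma s_types: "s \<in> Arr V" "src V s = bcar H" "tgt V s = bcar H"
  using s by (auto simp: is_antipode_def)

lemma antipode_left:
  assumes w: "snd h = bcar H" "snd h1 = bcar H" "snd h2 = bcar H" "snd h1' = bcar H" "snd l = bcar H"
    and K: "val K" "l \<in> fst K" "distinct [h, h1, h2, h1', l]" "set [h, h1, h2, h1'] \<inter> fst K = {}"
  shows "cob (bcomul H) h h1 h2 (sub s h1 h1' (bin (bmul H) h1' h2 l K)) = del (bcounit H) h (nul (bone H) l K)"
proof -
  have d: "distinct [l, h1', h2, h1, h]" using K(3) by auto
  note a = types s_types w K d
  have s1: "sub s h1 h1' (bin (bmul H) h1' h2 l K) = bin (bmul H \<cdot> (s \<otimes>\<^sub>a \<one> (snd h2))) h1 h2 l K"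
    using a by (intro sub_bin1) simp_all
  have s2: "cob (bcomul H) h h1 h2 (bin (bmul H \<cdot> (s \<otimes>\<^sub>a \<one> (snd h2))) h1 h2 l K) =
    sub ((bmul H \<cdot> (s \<otimes>\<^sub>a \<one> (snd h2))) \<cdot> bcomul H) h l K"
    using a by (intro cob_bin) simp_all
  have s3: "(bmul H \<cdot> (s \<otimes>\<^sub>a \<one> (snd h2))) \<cdot> bcomul H = bone H \<cdot> bcounit H"
    using s a by (simp add: is_antipode_def)
  have s4: "sub (bone H \<cdot> bcounit H) h l K = del (bcounit H) h (nul (bone H) l K)"
    using a by (intro sub_via_unit) simp_all
  show ?thesis
    by (unfold s1, unfold s2, unfold s3, unfold s4, rule refl)
qed

lemma antipode_right:
  assumes w: "snd h = bcar H" "snd h1 = bcar H" "snd h2 = bcar H" "snd h2' = bcar H" "snd l = bcar H"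
    and K: "val K" "l \<in> fst K" "distinct [h, h1, h2, h2', l]" "set [h, h1, h2, h2'] \<inter> fst K = {}"
  shows "cob (bcomul H) h h1 h2 (sub s h2 h2' (bin (bmul H) h1 h2' l K)) = del (bcounit H) h (nul (bone H) l K)"
proof -
  have d: "distinct [l, h2', h2, h1, h]" using K(3) by auto
  note a = types s_types w K d
  have s1: "sub s h2 h2' (bin (bmul H) h1 h2' l K) = bin (bmul H \<cdot> (\<one> (snd h1) \<otimes>\<^sub>a s)) h1 h2 l K"
    using a by (intro sub_bin2) simp_all
  have s2: "cob (bcomul H) h h1 h2 (bin (bmul H \<cdot> (\<one> (snd h1) \<otimes>\<^sub>a s)) h1 h2 l K) =
    sub ((bmul H \<cdot> (\<one> (snd h1) \<otimes>\<^sub>a s)) \<cdot> bcomul H) h l K"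
    using a by (intro cob_bin) simp_all
  have s3: "(bmul H \<cdot> (\<one> (snd h1) \<otimes>\<^sub>a s)) \<cdot> bcomul H = bone H \<cdot> bcounit H"
    using s a by (simp add: is_antipode_def)
  have s4: "sub (bone H \<cdot> bcounit H) h l K = del (bcounit H) h (nul (bone H) l K)"
    using a by (intro sub_via_unit) simp_all
  show ?thesis
    by (unfold s1, unfold s2, unfold s3, unfold s4, rule refl)
qed

text \<open>The antipode law at the unit, which splits into 1 \<otimes> 1: s(1) = s(1) 1 =
  \<epsilon>(1) 1 = 1.\<close>

lemma antipode_one: "s \<cdot> bone H = bone H"
proof (rule eq_by_sub[where X = \<I> and Z = "bcar H" and m = 0 and n = 9])
  let ?X = "bcar H"
  note ty = types s_types
  let ?i = "\<lambda>n. nul (bone H) (n, ?X)" and ?m = "\<lambda>i j k. bin (bmul H) (i, ?X) (j, ?X) (k, ?X)"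
  fix K assume K: "val K" "fst K = {(9, ?X)}"
  have z: "sub f (0, \<I>) (9, ?X) K = del (\<one> \<I>) (0, \<I>) (nul f (9, ?X) K)" if "f \<in> Hom V \<I> ?X" for f
    using K that sub_via_unit[of "\<one> \<I>" "(0, \<I>)" f "(9, ?X)" K] by simp
  have s1: "nul (s \<cdot> bone H) (9, ?X) K = ?i 11 (sub s (11, ?X) (9, ?X) K)"
    using ty K by (intro nul_sub[symmetric]) auto
  have s2: "sub s (11, ?X) (9, ?X) K = sub s (11, ?X) (13, ?X) (sub (\<one> ?X) (13, ?X) (9, ?X) K)"
    using ty K by (subst sub_sub) auto
  have s3: "sub (\<one> ?X) (13, ?X) (9, ?X) K = ?i 12 (?m 13 12 9 K)"
    using ty K bin_unit(2)[OF A, of "(12, ?X)" "(13, ?X)" "(9, ?X)" K] by simp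
  have s4: "sub s (11, ?X) (13, ?X) (?i 12 (?m 13 12 9 K)) = ?i 12 (sub s (11, ?X) (13, ?X) (?m 13 12 9 K))"
    using ty K by (intro sub_nul_comm[symmetric]) auto
  have s5: "?i 11 (?i 12 (sub s (11, ?X) (13, ?X) (?m 13 12 9 K))) = ?i 10 (cob (bcomul H) (10, ?X) (11, ?X) (12, ?X) (sub s (11, ?X) (13, ?X) (?m 13 12 9 K)))"
    using ty K by (intro H_one_cob[symmetric]) auto
  have s6: "cob (bcomul H) (10, ?X) (11, ?X) (12, ?X) (sub s (11, ?X) (13, ?X) (?m 13 12 9 K)) = del (bcounit H) (10, ?X) (?i 9 K)"
    using ty K by (intro antipode_left) auto
  have s7: "?i 10 (del (bcounit H) (10, ?X) (?i 9 K)) = ?i 9 K"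
    using ty K by (intro H_one_del) auto
  have "nul (s \<cdot> bone H) (9, ?X) K = ?i 9 K"
    by (unfold s1, unfold s2, unfold s3, unfold s4, unfold s5, unfold s6, unfold s7, rule refl)
  then show "sub (s \<cdot> bone H) (0, \<I>) (9, ?X) K = sub (bone H) (0, \<I>) (9, ?X) K"
    using ty z by simp
qed (use types s_types in auto)

text \<open>Applying \<epsilon> to s(h1) h2 = \<epsilon>(h) 1 gives \<epsilon>(s(h1)) \<epsilon>(h2)
  = \<epsilon>(h), and the left side is \<epsilon>(s(h)) by the counit law.\<close>

lemma antipode_counit: "bcounit H \<cdot> s = bcounit H"
proof -
  note ty = types s_types
  have m: "bcounit H \<cdot> bmul H = \<lambda>\<^sub>I \<I> \<cdot> (bcounit H \<otimes>\<^sub>a bcounit H)" "bcounit H \<cdot> bone H = \<one> \<I>"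
    using H_mul_hom H_one_hom by (auto simp: comonoid_homs_def)
  have u: "\<rho>\<^sub>I (bcar H) \<cdot> (\<one> (bcar H) \<otimes>\<^sub>a bcounit H) \<cdot> bcomul H = \<one> (bcar H)"
    using Hc by (simp add: is_comonoid_def)
  have a: "bmul H \<cdot> (s \<otimes>\<^sub>a \<one> (bcar H)) \<cdot> bcomul H = bone H \<cdot> bcounit H"
    using s by (simp add: is_antipode_def)
  have "bcounit H = (bcounit H \<cdot> bone H) \<cdot> bcounit H" unfolding m using ty by simp
  also have "\<dots> = bcounit H \<cdot> (bmul H \<cdot> (s \<otimes>\<^sub>a \<one> (bcar H)) \<cdot> bcomul H)" unfolding a using ty by simp
  also have "\<dots> = (bcounit H \<cdot> bmul H) \<cdot> (s \<otimes>\<^sub>a \<one> (bcar H)) \<cdot> bcomul H" using ty by simp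
  also have "\<dots> = (\<rho>\<^sub>I \<I> \<cdot> ((bcounit H \<cdot> s) \<otimes>\<^sub>a \<one> \<I>)) \<cdot> (\<one> (bcar H) \<otimes>\<^sub>a bcounit H) \<cdot> bcomul H"
    unfolding m using ty by (simp add: lun_unit_eq)
  also have "\<rho>\<^sub>I \<I> \<cdot> ((bcounit H \<cdot> s) \<otimes>\<^sub>a \<one> \<I>) = (bcounit H \<cdot> s) \<cdot> \<rho>\<^sub>I (bcar H)"
    using run_nat[of "bcounit H \<cdot> s"] ty by simp
  also have "((bcounit H \<cdot> s) \<cdot> \<rho>\<^sub>I (bcar H)) \<cdot> (\<one> (bcar H) \<otimes>\<^sub>a bcounit H) \<cdot> bcomul H =
    (bcounit H \<cdot> s) \<cdot> (\<rho>\<^sub>I (bcar H) \<cdot> (\<one> (bcar H) \<otimes>\<^sub>a bcounit H) \<cdot> bcomul H)" using ty by simp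
  also have "\<dots> = bcounit H \<cdot> s" unfolding u using ty by simp
  finally show ?thesis by simp
qed

text \<open>
  Both sides are convolution inverses of \<open>\<mu>\<close>; they are compared through
  \<open>s(h\<^sub>1 k\<^sub>1) (h\<^sub>2 k\<^sub>2) (s(k\<^sub>3) s(h\<^sub>3))\<close>.
\<close>

lemma antipode_anti: "s \<cdot> bmul H = bmul H \<cdot> (s \<otimes>\<^sub>a s) \<cdot> \<sigma> (bcar H) (bcar H)"
proof (rule eq_by_bin[where X = "bcar H" and Y = "bcar H" and Z = "bcar H"])
  let ?X = "bcar H"
  note ty = types s_types
  let ?i = "\<lambda>n. nul (bone H) (n, ?X)" and ?m = "\<lambda>i j k. bin (bmul H) (i, ?X) (j, ?X) (k, ?X)"
    and ?d = "\<lambda>i j k. cob (bcomul H) (i, ?X) (j, ?X) (k, ?X)" and ?e = "\<lambda>n. del (bcounit H) (n, ?X)"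
    and ?s = "\<lambda>i j. sub s (i, ?X) (j, ?X)" and ?r = "\<lambda>i j. sub (\<one> ?X) (i, ?X) (j, ?X)"
  fix K assume K: "val K" "fst K = {(9, ?X)}"
  have ma: "?m i j u (?m u k n L) = ?m j k v (?m i v n L)"
    if "val L" "(n, ?X) \<in> fst L" "distinct [i, j, k]" "u \<noteq> k" "v \<noteq> i" "set [(i, ?X), (j, ?X), (k, ?X), (u, ?X), (v, ?X)] \<inter> (fst L - {(n, ?X)}) = {}" for i j k u v n L
  proof -
    have "bin (mul (monoid_of H)) (i, ?X) (j, ?X) (u, ?X) (bin (mul (monoid_of H)) (u, ?X) (k, ?X) (n, ?X) L) =
      bin (mul (monoid_of H)) (j, ?X) (k, ?X) (v, ?X) (bin (mul (monoid_of H)) (i, ?X) (v, ?X) (n, ?X) L)"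
      using that ty by (intro bin_assoc A) auto
    then show ?thesis by simp
  qed
  have mu: "?i i (?m i k n L) = ?r k n L" "?i i (?m k i n L) = ?r k n L"
    if "val L" "(n, ?X) \<in> fst L" "i \<noteq> k" "set [(i, ?X), (k, ?X)] \<inter> (fst L - {(n, ?X)}) = {}" for i k n L
    using that ty bin_unit[OF A, of "(i, ?X)" "(k, ?X)" "(n, ?X)" L] by auto
  \<comment> \<open>The wires 13, 14, 15 are h1, h2, h3 and 23, 24, 25 are k1, k2, k3.
    \<open>?W\<close> is the triple product with its first two factors multiplied first;
    \<open>?Q\<close> contains the last factor s(k3) s(h3), on the wire 31.\<close>
  let ?Q = "?s 25 27 (?s 15 17 (?m 27 17 31 (?m 30 31 9 K)))"
  let ?W = "?d 10 12 15 (?d 12 13 14 (?d 11 22 25 (?d 22 23 24 (?m 13 23 28 (?m 14 24 29 (?s 28 18 (?m 18 29 30 ?Q)))))))"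
  have s1: "?d 12 13 14 (?d 11 22 25 (?d 22 23 24 (?m 13 23 28 (?m 14 24 29 (?s 28 18 (?m 18 29 30 ?Q)))))) =
    ?d 11 22 25 (?d 12 13 14 (?d 22 23 24 (?m 13 23 28 (?m 14 24 29 (?s 28 18 (?m 18 29 30 ?Q))))))"
    using ty K by (intro cob_cob_comm) auto
  \<comment> \<open>The splittings of h and k recombine into the splitting of the product h k, so
    the antipode law collapses the first two factors.\<close>
  have s2: "?d 12 13 14 (?d 22 23 24 (?m 13 23 28 (?m 14 24 29 (?s 28 18 (?m 18 29 30 ?Q))))) = ?m 12 22 26 (?d 26 28 29 (?s 28 18 (?m 18 29 30 ?Q)))"
    using ty K by (intro H_mul_cob[symmetric]) auto
  have s3: "?d 26 28 29 (?s 28 18 (?m 18 29 30 ?Q)) = ?e 26 (?i 30 ?Q)"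
    using ty K by (intro antipode_left) auto
  have s4: "?m 12 22 26 (?e 26 (?i 30 ?Q)) = ?e 12 (?e 22 (?i 30 ?Q))"
    using ty K by (intro H_mul_del) auto
  have s5: "?i 30 ?Q = ?s 25 27 (?i 30 (?s 15 17 (?m 27 17 31 (?m 30 31 9 K))))"
    using ty K by (intro sub_nul_comm) auto
  have s6: "?i 30 (?s 15 17 (?m 27 17 31 (?m 30 31 9 K))) = ?s 15 17 (?i 30 (?m 27 17 31 (?m 30 31 9 K)))"
    using ty K by (intro sub_nul_comm) auto
  have s7: "?i 30 (?m 27 17 31 (?m 30 31 9 K)) = ?m 27 17 31 (?i 30 (?m 30 31 9 K))"
    using ty K by (intro bin_nul_comm) auto
  have s8: "?i 30 (?m 30 31 9 K) = ?r 31 9 K"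
    using ty K by (intro mu) auto
  have s9: "?m 27 17 31 (?r 31 9 K) = ?m 27 17 9 K"
    using ty K by (subst bin_sub) auto
  have s10: "?d 11 22 25 (?e 12 (?e 22 (?s 25 27 (?s 15 17 (?m 27 17 9 K))))) = ?e 12 (?d 11 22 25 (?e 22 (?s 25 27 (?s 15 17 (?m 27 17 9 K)))))"
    using ty K by (intro cob_del_comm[symmetric]) auto
  have s11: "?d 11 22 25 (?e 22 (?s 25 27 (?s 15 17 (?m 27 17 9 K)))) = ?r 11 25 (?s 25 27 (?s 15 17 (?m 27 17 9 K)))"
    using ty K by (intro H_counit) auto
  have s12: "?d 10 12 15 (?e 12 (?r 11 25 (?s 25 27 (?s 15 17 (?m 27 17 9 K))))) = ?r 10 15 (?r 11 25 (?s 25 27 (?s 15 17 (?m 27 17 9 K))))"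
    using ty K by (intro H_counit) auto
  have s13: "?r 11 25 (?s 25 27 (?s 15 17 (?m 27 17 9 K))) = ?s 11 27 (?s 15 17 (?m 27 17 9 K))"
    using ty K by (subst sub_sub) auto
  have s14: "?r 10 15 (?s 11 27 (?s 15 17 (?m 27 17 9 K))) = ?s 11 27 (?r 10 15 (?s 15 17 (?m 27 17 9 K)))"
    using ty K by (intro sub_sub_comm) auto
  have s15: "?r 10 15 (?s 15 17 (?m 27 17 9 K)) = ?s 10 17 (?m 27 17 9 K)"
    using ty K by (subst sub_sub) auto
  have w1: "?W = ?s 11 27 (?s 10 17 (?m 27 17 9 K))"
    by (unfold s1, unfold s2, unfold s3, unfold s4, unfold s5, unfold s6, unfold s7, unfold s8, unfold s9, unfold s10, unfold s11, unfold s12, unfold s13, unfold s14, unfold s15, rule refl)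
  let ?Y = "?m 13 23 28 (?s 28 18 (?m 18 34 9 K))"
  have s1: "?m 18 29 30 ?Q = ?s 25 27 (?m 18 29 30 (?s 15 17 (?m 27 17 31 (?m 30 31 9 K))))"
    using ty K by (intro sub_bin_comm) auto
  have s2: "?m 18 29 30 (?s 15 17 (?m 27 17 31 (?m 30 31 9 K))) = ?s 15 17 (?m 18 29 30 (?m 27 17 31 (?m 30 31 9 K)))"
    using ty K by (intro sub_bin_comm) auto
  have s3: "?m 18 29 30 (?m 27 17 31 (?m 30 31 9 K)) = ?m 27 17 31 (?m 18 29 30 (?m 30 31 9 K))"
    using ty K by (intro bin_bin_comm) auto
  have s4: "?m 18 29 30 (?m 30 31 9 K) = ?m 29 31 34 (?m 18 34 9 K)"
    using ty K by (intro ma) auto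
  have s5: "?s 28 18 (?s 25 27 (?s 15 17 (?m 27 17 31 (?m 29 31 34 (?m 18 34 9 K))))) =
    ?s 25 27 (?s 28 18 (?s 15 17 (?m 27 17 31 (?m 29 31 34 (?m 18 34 9 K)))))"
    using ty K by (intro sub_sub_comm) auto
  have s6: "?s 28 18 (?s 15 17 (?m 27 17 31 (?m 29 31 34 (?m 18 34 9 K)))) =
    ?s 15 17 (?s 28 18 (?m 27 17 31 (?m 29 31 34 (?m 18 34 9 K))))"
    using ty K by (intro sub_sub_comm) auto
  have s7: "?s 28 18 (?m 27 17 31 (?m 29 31 34 (?m 18 34 9 K))) = ?m 27 17 31 (?s 28 18 (?m 29 31 34 (?m 18 34 9 K)))"
    using ty K by (intro sub_bin_comm[symmetric]) auto
  have s8: "?s 28 18 (?m 29 31 34 (?m 18 34 9 K)) = ?m 29 31 34 (?s 28 18 (?m 18 34 9 K))"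
    using ty K by (intro sub_bin_comm[symmetric]) auto
  have s9: "?m 14 24 29 (?s 25 27 (?s 15 17 (?m 27 17 31 (?m 29 31 34 (?s 28 18 (?m 18 34 9 K)))))) =
    ?s 25 27 (?m 14 24 29 (?s 15 17 (?m 27 17 31 (?m 29 31 34 (?s 28 18 (?m 18 34 9 K))))))"
    using ty K by (intro sub_bin_comm) auto
  have s10: "?m 14 24 29 (?s 15 17 (?m 27 17 31 (?m 29 31 34 (?s 28 18 (?m 18 34 9 K))))) =
    ?s 15 17 (?m 14 24 29 (?m 27 17 31 (?m 29 31 34 (?s 28 18 (?m 18 34 9 K)))))"
    using ty K by (intro sub_bin_comm) auto
  have s11: "?m 14 24 29 (?m 27 17 31 (?m 29 31 34 (?s 28 18 (?m 18 34 9 K)))) = ?m 27 17 31 (?m 14 24 29 (?m 29 31 34 (?s 28 18 (?m 18 34 9 K))))"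
    using ty K by (intro bin_bin_comm) auto
  have s12: "?m 14 24 29 (?m 29 31 34 (?s 28 18 (?m 18 34 9 K))) = ?m 24 31 35 (?m 14 35 34 (?s 28 18 (?m 18 34 9 K)))"
    using ty K by (intro ma) auto
  have s13: "?m 27 17 31 (?m 24 31 35 (?m 14 35 34 (?s 28 18 (?m 18 34 9 K)))) = ?m 24 27 36 (?m 36 17 35 (?m 14 35 34 (?s 28 18 (?m 18 34 9 K))))"
    using ty K by (intro ma[symmetric]) auto
  \<comment> \<open>Reassociation brings k2 next to s(k3), so that these collapse first and h2 s(h3)
    afterwards.\<close>
  have q: "?m 14 24 29 (?s 28 18 (?m 18 29 30 ?Q)) =
    ?s 25 27 (?s 15 17 (?m 24 27 36 (?m 36 17 35 (?m 14 35 34 (?s 28 18 (?m 18 34 9 K))))))"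
    by (unfold s1, unfold s2, unfold s3, unfold s4, unfold s5, unfold s6, unfold s7, unfold s8, unfold s9, unfold s10, unfold s11, unfold s12, unfold s13, rule refl)
  let ?Z = "?m 36 17 35 (?m 14 35 34 (?m 13 23 28 (?s 28 18 (?m 18 34 9 K))))"
  have s1: "?m 13 23 28 (?s 25 27 (?s 15 17 (?m 24 27 36 (?m 36 17 35 (?m 14 35 34 (?s 28 18 (?m 18 34 9 K))))))) = ?s 25 27 (?m 13 23 28 (?s 15 17 (?m 24 27 36 (?m 36 17 35 (?m 14 35 34 (?s 28 18 (?m 18 34 9 K)))))))"
    using ty K by (intro sub_bin_comm) auto
  have s2: "?m 13 23 28 (?s 15 17 (?m 24 27 36 (?m 36 17 35 (?m 14 35 34 (?s 28 18 (?m 18 34 9 K)))))) = ?s 15 17 (?m 13 23 28 (?m 24 27 36 (?m 36 17 35 (?m 14 35 34 (?s 28 18 (?m 18 34 9 K))))))"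
    using ty K by (intro sub_bin_comm) auto
  have s3: "?m 13 23 28 (?m 24 27 36 (?m 36 17 35 (?m 14 35 34 (?s 28 18 (?m 18 34 9 K))))) =
    ?m 24 27 36 (?m 13 23 28 (?m 36 17 35 (?m 14 35 34 (?s 28 18 (?m 18 34 9 K)))))"
    using ty K by (intro bin_bin_comm) auto
  have s4: "?m 13 23 28 (?m 36 17 35 (?m 14 35 34 (?s 28 18 (?m 18 34 9 K)))) = ?m 36 17 35 (?m 13 23 28 (?m 14 35 34 (?s 28 18 (?m 18 34 9 K))))"
    using ty K by (intro bin_bin_comm) auto
  have s5: "?m 13 23 28 (?m 14 35 34 (?s 28 18 (?m 18 34 9 K))) = ?m 14 35 34 (?m 13 23 28 (?s 28 18 (?m 18 34 9 K)))"
    using ty K by (intro bin_bin_comm) auto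
  have s6: "?s 25 27 (?s 15 17 (?m 24 27 36 ?Z)) = ?s 15 17 (?s 25 27 (?m 24 27 36 ?Z))"
    using ty K by (intro sub_sub_comm) auto
  have s7: "?d 11 22 25 (?d 22 23 24 (?s 15 17 (?s 25 27 (?m 24 27 36 ?Z)))) = ?d 11 23 22 (?d 22 24 25 (?s 15 17 (?s 25 27 (?m 24 27 36 ?Z))))"
    using ty K by (intro H_coassoc) auto
  have s8: "?d 22 24 25 (?s 15 17 (?s 25 27 (?m 24 27 36 ?Z))) = ?s 15 17 (?d 22 24 25 (?s 25 27 (?m 24 27 36 ?Z)))"
    using ty K by (intro cob_sub_comm[symmetric]) auto
  have s9: "?d 22 24 25 (?s 25 27 (?m 24 27 36 ?Z)) = ?e 22 (?i 36 ?Z)"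
    using ty K by (intro antipode_right) auto
  have s10: "?i 36 ?Z = ?r 17 35 (?m 14 35 34 ?Y)"
    using ty K by (intro mu) auto
  have s11: "?s 15 17 (?e 22 (?r 17 35 (?m 14 35 34 ?Y))) = ?e 22 (?s 15 17 (?r 17 35 (?m 14 35 34 ?Y)))"
    using ty K by (intro del_sub_comm) auto
  have s12: "?s 15 17 (?r 17 35 (?m 14 35 34 ?Y)) = ?s 15 35 (?m 14 35 34 ?Y)"
    using ty K by (subst sub_sub) auto
  have s13: "?d 11 23 22 (?e 22 (?s 15 35 (?m 14 35 34 ?Y))) = ?r 11 23 (?s 15 35 (?m 14 35 34 ?Y))"
    using ty K by (intro H_counit) auto
  have s14: "?d 10 12 15 (?d 12 13 14 (?r 11 23 (?s 15 35 (?m 14 35 34 ?Y)))) = ?d 10 13 12 (?d 12 14 15 (?r 11 23 (?s 15 35 (?m 14 35 34 ?Y))))"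
    using ty K by (intro H_coassoc) auto
  have s15: "?d 12 14 15 (?r 11 23 (?s 15 35 (?m 14 35 34 ?Y))) = ?r 11 23 (?d 12 14 15 (?s 15 35 (?m 14 35 34 ?Y)))"
    using ty K by (intro cob_sub_comm[symmetric]) auto
  have s16: "?d 12 14 15 (?s 15 35 (?m 14 35 34 ?Y)) = ?e 12 (?i 34 ?Y)"
    using ty K by (intro antipode_right) auto
  have s17: "?i 34 ?Y = ?m 13 23 28 (?i 34 (?s 28 18 (?m 18 34 9 K)))"
    using ty K by (intro bin_nul_comm) auto
  have s18: "?i 34 (?s 28 18 (?m 18 34 9 K)) = ?s 28 18 (?i 34 (?m 18 34 9 K))"
    using ty K by (intro sub_nul_comm) auto
  have s19: "?i 34 (?m 18 34 9 K) = ?r 18 9 K"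
    using ty K by (intro mu) auto
  have s20: "?s 28 18 (?r 18 9 K) = ?s 28 9 K"
    using ty K by (subst sub_sub) auto
  have s21: "?r 11 23 (?e 12 (?m 13 23 28 (?s 28 9 K))) = ?e 12 (?r 11 23 (?m 13 23 28 (?s 28 9 K)))"
    using ty K by (intro del_sub_comm) auto
  have s22: "?d 10 13 12 (?e 12 (?r 11 23 (?m 13 23 28 (?s 28 9 K)))) = ?r 10 13 (?r 11 23 (?m 13 23 28 (?s 28 9 K)))"
    using ty K by (intro H_counit) auto
  have s23: "?r 11 23 (?m 13 23 28 (?s 28 9 K)) = ?m 13 11 28 (?s 28 9 K)"
    using ty K by (subst sub_bin2) auto
  have s24: "?r 10 13 (?m 13 11 28 (?s 28 9 K)) = ?m 10 11 28 (?s 28 9 K)"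
    using ty K by (subst sub_bin1) auto
  have s25: "?m 10 11 28 (?s 28 9 K) = bin (s \<cdot> bmul H) (10, ?X) (11, ?X) (9, ?X) K"
    using ty K by (subst bin_sub) auto
  have w2: "?d 10 12 15 (?d 12 13 14 (?d 11 22 25 (?d 22 23 24 (?m 13 23 28 (?s 25 27 (?s 15 17 (?m 24 27 36 (?m 36 17 35 (?m 14 35 34 (?s 28 18 (?m 18 34 9 K)))))))))))
     = bin (s \<cdot> bmul H) (10, ?X) (11, ?X) (9, ?X) K"
    by (unfold s1, unfold s2, unfold s3, unfold s4, unfold s5, unfold s6, unfold s7, unfold s8, unfold s9, unfold s10, unfold s11, unfold s12, unfold s13, unfold s14, unfold s15, unfold s16, unfold s17, unfold s18, unfold s19, unfold s20, unfold s21, unfold s22, unfold s23, unfold s24, unfold s25, rule refl)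
  have w3: "?s 11 27 (?s 10 17 (?m 27 17 9 K)) = bin (bmul H \<cdot> (s \<otimes>\<^sub>a s) \<cdot> \<sigma> ?X ?X) (10, ?X) (11, ?X) (9, ?X) K"
    using ty K bin_sym[of "bmul H \<cdot> (s \<otimes>\<^sub>a s)" "(11, ?X)" "(10, ?X)" "(9, ?X)" K] by (simp add: sub_bin1 sub_bin2)
  show "bin (s \<cdot> bmul H) (10, ?X) (11, ?X) (9, ?X) K = bin (bmul H \<cdot> (s \<otimes>\<^sub>a s) \<cdot> \<sigma> ?X ?X) (10, ?X) (11, ?X) (9, ?X) K"
    unfolding w2[symmetric] w3[symmetric] w1[symmetric] q ..
qed (use types s_types in auto)

lemma bin_mul_antipode:
  assumes w: "snd h = bcar H" "snd k = bcar H" "snd h' = bcar H" "snd k' = bcar H" "snd l = bcar H" "snd x = bcar H"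
    and K: "val K" "x \<in> fst K" "distinct [h, k, h', k', l, x]" "set [h, k, h', k', l] \<inter> fst K = {}"
  shows "bin (bmul H) h k l (sub s l x K) = sub s k k' (sub s h h' (bin (bmul H) k' h' x K))"
proof -
  have d: "distinct [x, l, k', h', k, h]" using K(3) by auto
  note a = types s_types w K d
  let ?f = "bmul H \<cdot> (s \<otimes>\<^sub>a s)"
  have s1: "bin (bmul H) h k l (sub s l x K) = bin (s \<cdot> bmul H) h k x K"
    using a by (intro bin_sub) simp_all
  have s2: "s \<cdot> bmul H = ?f \<cdot> \<sigma> (snd h) (snd k)"
    using a antipode_anti by simp
  have s3: "bin (?f \<cdot> \<sigma> (snd h) (snd k)) h k x K = bin ?f k h x K"
    using a by (intro bin_sym[symmetric]) simp_all
  have s4: "bin ?f k h x K = bin ((bmul H \<cdot> (\<one> (snd k') \<otimes>\<^sub>a s)) \<cdot> (s \<otimes>\<^sub>a \<one> (snd h))) k h x K"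
    using a by simp
  have s5: "bin ((bmul H \<cdot> (\<one> (snd k') \<otimes>\<^sub>a s)) \<cdot> (s \<otimes>\<^sub>a \<one> (snd h))) k h x K = sub s k k' (bin (bmul H \<cdot> (\<one> (snd k') \<otimes>\<^sub>a s)) k' h x K)"
    using a by (intro sub_bin1[symmetric]) simp_all
  have s6: "bin (bmul H \<cdot> (\<one> (snd k') \<otimes>\<^sub>a s)) k' h x K = sub s h h' (bin (bmul H) k' h' x K)"
    using a by (intro sub_bin2[symmetric]) simp_all
  show ?thesis
    by (unfold s1, unfold s2, unfold s3, unfold s4, unfold s5, unfold s6, rule refl)
qed

text \<open>By \<open>antipode_anti\<close>, e(s(h k) \<otimes> p) = e(s(k) s(h) \<otimes> p) =
  e(s(k) \<otimes> p1) e(s(h) \<otimes> p2). Commutativity of B restores the order of h and k; what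
  remains reversed is the splitting of p, which accounts for the co-opposite comonoid.\<close>

lemma e_antipode_measuring: "measuring (monoid_of H) (cop P) B (e \<cdot> (s \<otimes>\<^sub>a \<one> (ccar P)))"
proof (rule measuringI[where X = "bcar H" and Y = "ccar P" and Z = "mcar B"])
  let ?X = "bcar H" and ?P = "ccar P" and ?B = "mcar B"
  let ?f = "e \<cdot> (s \<otimes>\<^sub>a \<one> ?P)"
  note ty = types s_types
  let ?s = "\<lambda>i j. sub s (i, ?X) (j, ?X)" and ?eb = "\<lambda>i j k. bin e (i, ?X) (j, ?P) (k, ?B)"
  have r: "bin ?f (i, ?X) (k, ?P) (n, ?B) K = ?s i j (?eb j k n K)"
    if "val K" "(n, ?B) \<in> fst K" "set [(i, ?X), (j, ?X), (k, ?P)] \<inter> (fst K - {(n, ?B)}) = {}" "distinct [i, j, k]" for i j k n K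
  proof -
    have "bin (e \<cdot> (s \<otimes>\<^sub>a \<one> (snd (k, ?P)))) (i, ?X) (k, ?P) (n, ?B) K = ?s i j (?eb j k n K)"
      using ty that by (intro sub_bin1[symmetric]) auto
    then show ?thesis by simp
  qed
  have ft: "?f \<in> Arr V" "src V ?f = ?X \<otimes> ?P" "tgt V ?f = ?B" using ty by auto
  {
    fix K assume K: "val K" "fst K = {(9, ?B)}"
    let ?M = "bin (mul B) (16, ?B) (17, ?B) (9, ?B) K" and ?M' = "bin (mul B) (17, ?B) (16, ?B) (9, ?B) K"
    have s1: "bin ?f (12, ?X) (13, ?P) (9, ?B) K = ?s 12 22 (?eb 22 13 9 K)"
      using ty K by (intro r) auto
    have s2: "bin (bmul H) (10, ?X) (11, ?X) (12, ?X) (?s 12 22 (?eb 22 13 9 K)) = ?s 11 21 (?s 10 20 (bin (bmul H) (21, ?X) (20, ?X) (22, ?X) (?eb 22 13 9 K)))"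
      using ty K by (intro bin_mul_antipode) auto
    have s3: "bin (bmul H) (21, ?X) (20, ?X) (22, ?X) (?eb 22 13 9 K) = cob (comul P) (13, ?P) (15, ?P) (14, ?P) (?eb 21 15 17 (?eb 20 14 16 ?M'))"
      using ty K by (intro e_mul) auto
    have s4: "?M' = ?M"
      using ty K by (intro bin_comm Bc) auto
    have s5: "?eb 21 15 17 (?eb 20 14 16 ?M) = ?eb 20 14 16 (?eb 21 15 17 ?M)"
      using ty K by (intro bin_bin_comm) auto
    have s6: "?s 10 20 (cob (comul P) (13, ?P) (15, ?P) (14, ?P) (?eb 20 14 16 (?eb 21 15 17 ?M))) = cob (comul P) (13, ?P) (15, ?P) (14, ?P) (?s 10 20 (?eb 20 14 16 (?eb 21 15 17 ?M)))"
      using ty K by (intro cob_sub_comm) auto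
    have s7: "?s 11 21 (cob (comul P) (13, ?P) (15, ?P) (14, ?P) (?s 10 20 (?eb 20 14 16 (?eb 21 15 17 ?M)))) = cob (comul P) (13, ?P) (15, ?P) (14, ?P) (?s 11 21 (?s 10 20 (?eb 20 14 16 (?eb 21 15 17 ?M))))"
      using ty K by (intro cob_sub_comm) auto
    have s8: "?s 11 21 (?s 10 20 (?eb 20 14 16 (?eb 21 15 17 ?M))) = ?s 10 20 (?s 11 21 (?eb 20 14 16 (?eb 21 15 17 ?M)))"
      using ty K by (intro sub_sub_comm) auto
    have s9: "?s 11 21 (?eb 20 14 16 (?eb 21 15 17 ?M)) = ?eb 20 14 16 (?s 11 21 (?eb 21 15 17 ?M))"
      using ty K by (intro sub_bin_comm[symmetric]) auto
    have s10: "?s 11 21 (?eb 21 15 17 ?M) = bin ?f (11, ?X) (15, ?P) (17, ?B) ?M"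
      using ty K by (intro r[symmetric]) auto
    have s11: "?s 10 20 (?eb 20 14 16 (bin ?f (11, ?X) (15, ?P) (17, ?B) ?M)) = bin ?f (10, ?X) (14, ?P) (16, ?B) (bin ?f (11, ?X) (15, ?P) (17, ?B) ?M)"
      using ty K ft by (intro r[symmetric]) (auto simp del: cmp_assoc')
    have s12: "cob (comul P) (13, ?P) (15, ?P) (14, ?P) (bin ?f (10, ?X) (14, ?P) (16, ?B) (bin ?f (11, ?X) (15, ?P) (17, ?B) ?M)) =
      cob (comul (cop P)) (13, ?P) (14, ?P) (15, ?P) (bin ?f (10, ?X) (14, ?P) (16, ?B) (bin ?f (11, ?X) (15, ?P) (17, ?B) ?M))"
      using ty K ft by (intro cob_cop[OF P, symmetric]) (auto simp del: cmp_assoc')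
    have "bin (bmul H) (10, ?X) (11, ?X) (12, ?X) (bin ?f (12, ?X) (13, ?P) (9, ?B) K) =
      cob (comul (cop P)) (13, ?P) (14, ?P) (15, ?P) (bin ?f (10, ?X) (14, ?P) (16, ?B) (bin ?f (11, ?X) (15, ?P) (17, ?B) ?M))"
      by (unfold s1, unfold s2, unfold s3, unfold s4, unfold s5, unfold s6, unfold s7, unfold s8, unfold s9, unfold s10, unfold s11, unfold s12, rule refl)
    then show "bin (mul (monoid_of H)) (10, ?X) (11, ?X) (12, ?X) (bin ?f (12, ?X) (13, ?P) (9, ?B) K) =
      cob (comul (cop P)) (13, ?P) (14, ?P) (15, ?P) (bin ?f (10, ?X) (14, ?P) (16, ?B) (bin ?f (11, ?X) (15, ?P) (17, ?B) ?M))"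
      by (simp only: monoid_of_simps)
  next
    fix K assume K: "val K" "fst K = {(9, ?B)}"
    have s1: "bin ?f (10, ?X) (13, ?P) (9, ?B) K = ?s 10 20 (?eb 20 13 9 K)"
      using ty K by (intro r) auto
    have s2: "nul (bone H) (10, ?X) (?s 10 20 (?eb 20 13 9 K)) = nul (s \<cdot> bone H) (20, ?X) (?eb 20 13 9 K)"
      using ty K by (intro nul_sub) auto
    have s3: "s \<cdot> bone H = bone H" by (rule antipode_one)
    have s4: "nul (bone H) (20, ?X) (?eb 20 13 9 K) = del (counit P) (13, ?P) (nul (one B) (9, ?B) K)"
      using ty K by (intro e_one) auto
    have "nul (bone H) (10, ?X) (bin ?f (10, ?X) (13, ?P) (9, ?B) K) = del (counit P) (13, ?P) (nul (one B) (9, ?B) K)"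
      by (unfold s1, unfold s2, unfold s3, unfold s4, rule refl)
    then show "nul (one (monoid_of H)) (10, ?X) (bin ?f (10, ?X) (13, ?P) (9, ?B) K) = del (counit (cop P)) (13, ?P) (nul (one B) (9, ?B) K)"
      by (simp only: monoid_of_simps cop_simps)
  }
qed (use A B cop_is_comonoid[OF P] types s_types in auto)

text \<open>The antipode of P. At most one comonoid morphism satisfies the condition, by
  \<open>comonoid_hom_eqI'\<close>, so the choice is harmless. The source \<open>cop P\<close>
  expresses that the antipode reverses comultiplication.\<close>

definition "t = (SOME t. t \<in> comonoid_homs V (cop P) P \<and> e \<cdot> (\<one> (bcar H) \<otimes>\<^sub>a t) = e \<cdot> (s \<otimes>\<^sub>a \<one> (ccar P)))"

lemma t: "t \<in> comonoid_homs V (cop P) P" "e \<cdot> (\<one> (bcar H) \<otimes>\<^sub>a t) = e \<cdot> (s \<otimes>\<^sub>a \<one> (ccar P))"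
proof -
  have "\<exists>t. t \<in> comonoid_homs V (cop P) P \<and> e \<cdot> (\<one> (bcar H) \<otimes>\<^sub>a t) = e \<cdot> (s \<otimes>\<^sub>a \<one> (ccar P))"
    using measuring_factors[OF cop_is_comonoid[OF P] e_antipode_measuring] by (metis monoid_of_simps(1))
  from someI_ex[OF this] show "t \<in> comonoid_homs V (cop P) P" "e \<cdot> (\<one> (bcar H) \<otimes>\<^sub>a t) = e \<cdot> (s \<otimes>\<^sub>a \<one> (ccar P))"
    unfolding t_def by auto
qed

lemma t_types: "t \<in> Arr V" "src V t = ccar P" "tgt V t = ccar P"
  using comonoid_hom_types[OF t(1)] by auto

text \<open>Trades \<open>t\<close> on P for \<open>s\<close> on H under the universal
  measuring.\<close>

lemma sub_t_e:
  assumes w: "snd h = bcar H" "snd h' = bcar H" "snd q = ccar P" "snd q' = ccar P" "snd b = mcar B"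
    and K: "val K" "b \<in> fst K" "distinct [h, h', q, q', b]" "set [h, h', q, q'] \<inter> (fst K - {b}) = {}"
  shows "sub t q q' (bin e h q' b K) = sub s h h' (bin e h' q b K)"
proof -
  have d: "distinct [b, q', q, h', h]" using K(3) by auto
  note a = types s_types t_types w K d
  have "sub t q q' (bin e h q' b K) = bin (e \<cdot> (\<one> (snd h) \<otimes>\<^sub>a t)) h q b K"
    using a by (intro sub_bin2) auto
  also have "e \<cdot> (\<one> (snd h) \<otimes>\<^sub>a t) = e \<cdot> (s \<otimes>\<^sub>a \<one> (snd q))" using t(2) w by simp
  also have "bin (e \<cdot> (s \<otimes>\<^sub>a \<one> (snd q))) h q b K = sub s h h' (bin e h' q b K)"
    using a by (intro sub_bin1[symmetric]) auto
  finally show ?thesis .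
qed

text \<open>The unit comonoid is cocommutative because the symmetry of I with itself is the
  identity, a consequence of \<open>lun_sym\<close> and \<open>lun_unit_eq\<close>.\<close>

lemma iP_cop: "iP \<in> comonoid_homs V (unit_comonoid V) (cop P)"
proof -
  note ty = types iP_types
  have s1: "\<sigma> \<I> \<I> = \<one> (\<I> \<otimes> \<I>)"
    by (rule iso_cancel_left[OF lun_iso[of \<I>]]) (use lun_sym[of \<I>] lun_unit_eq in auto)
  have i: "comul P \<cdot> iP = (iP \<otimes>\<^sub>a iP) \<cdot> lun' \<I>" "counit P \<cdot> iP = \<one> \<I>"
    using iP(1) by (auto simp: comonoid_homs_def)
  have "(\<sigma> (ccar P) (ccar P) \<cdot> comul P) \<cdot> iP = (\<sigma> (ccar P) (ccar P) \<cdot> (iP \<otimes>\<^sub>a iP)) \<cdot> lun' \<I>"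
    using ty i(1) by simp
  also have "\<sigma> (ccar P) (ccar P) \<cdot> (iP \<otimes>\<^sub>a iP) = iP \<otimes>\<^sub>a iP"
    using sym_nat[of iP iP] ty s1 by simp
  finally show ?thesis using i ty unfolding comonoid_homs_def by (simp add: cop_def)
qed

text \<open>e(h \<otimes> t(1)) = e(s(h) \<otimes> 1) = \<epsilon>(s(h)) 1 = \<epsilon>(h) 1 = e(h
  \<otimes> 1), and both arrows are comonoid morphisms out of the unit comonoid.\<close>

lemma t_iP: "t \<cdot> iP = iP"
proof (rule comonoid_hom_eqI'[OF unit_is_comonoid])
  note ty = types s_types t_types iP_types
  show "t \<cdot> iP \<in> comonoid_homs V (unit_comonoid V) P"
    by (rule comonoid_hom_cmp[OF unit_is_comonoid cop_is_comonoid[OF P] P iP_cop t(1)])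
  show "iP \<in> comonoid_homs V (unit_comonoid V) P" by (rule iP(1))
  have "e \<cdot> (\<one> (bcar H) \<otimes>\<^sub>a (t \<cdot> iP)) = (e \<cdot> (\<one> (bcar H) \<otimes>\<^sub>a t)) \<cdot> (\<one> (bcar H) \<otimes>\<^sub>a iP)" using ty by simp
  also have "\<dots> = (e \<cdot> (\<one> (bcar H) \<otimes>\<^sub>a iP)) \<cdot> (s \<otimes>\<^sub>a \<one> \<I>)" unfolding t(2) using ty by simp
  also have "\<dots> = one B \<cdot> bcounit H \<cdot> (\<rho>\<^sub>I (bcar H) \<cdot> (s \<otimes>\<^sub>a \<one> \<I>))" unfolding iP(2) \<chi>_def using ty by simp
  also have "\<rho>\<^sub>I (bcar H) \<cdot> (s \<otimes>\<^sub>a \<one> \<I>) = s \<cdot> \<rho>\<^sub>I (bcar H)" using run_nat[of s] ty by simp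
  also have "one B \<cdot> bcounit H \<cdot> (s \<cdot> \<rho>\<^sub>I (bcar H)) = one B \<cdot> (bcounit H \<cdot> s) \<cdot> \<rho>\<^sub>I (bcar H)" using ty by simp
  also have "\<dots> = e \<cdot> (\<one> (bcar H) \<otimes>\<^sub>a iP)" unfolding antipode_counit iP(2) \<chi>_def ..
  finally show "e \<cdot> (\<one> (mcar (monoid_of H)) \<otimes>\<^sub>a (t \<cdot> iP)) = e \<cdot> (\<one> (mcar (monoid_of H)) \<otimes>\<^sub>a iP)" by (simp only: monoid_of_simps)
qed

end

section \<open>The coideal condition for the two parallel arrows\<close>

context symmetric_monoidal_closed_category
begin

lemma nul_nul_bin:
  assumes "i \<in> Hom V \<I> (snd x)" "j \<in> Hom V \<I> (snd y)" "f \<in> Hom V (snd x \<otimes> snd y) (snd z)" "val K" "z \<in> fst K" "x \<noteq> y"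
    "x \<notin> fst K - {z}" "y \<notin> fst K - {z}"
  shows "nul i x (nul j y (bin f x y z K)) = nul (f \<cdot> (i \<otimes>\<^sub>a j) \<cdot> lun' \<I>) z K"
proof -
  have o: "snd x \<in> Obj V" "snd y \<in> Obj V" using assms(1,2) tgt_in_Obj[of i] tgt_in_Obj[of j] by auto
  note a = assms o
  have l: "lun' (snd y) \<cdot> j = (\<one> \<I> \<otimes>\<^sub>a j) \<cdot> lun' \<I>" using lun'_nat[of j] a by simp
  have "nul i x (nul j y (bin f x y z K)) = nul j y (nul i x (bin f x y z K))"
    by (rule nul_nul_comm) (use a in auto)
  also have "nul i x (bin f x y z K) = sub (f \<cdot> (i \<otimes>\<^sub>a \<one> (snd y)) \<cdot> lun' (snd y)) y z K"
    by (rule nul_bin1) (use a in auto)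
  also have "nul j y (sub (f \<cdot> (i \<otimes>\<^sub>a \<one> (snd y)) \<cdot> lun' (snd y)) y z K) = nul ((f \<cdot> (i \<otimes>\<^sub>a \<one> (snd y)) \<cdot> lun' (snd y)) \<cdot> j) z K"
    by (rule nul_sub) (use a in auto)
  also have "(f \<cdot> (i \<otimes>\<^sub>a \<one> (snd y)) \<cdot> lun' (snd y)) \<cdot> j = f \<cdot> (i \<otimes>\<^sub>a j) \<cdot> lun' \<I>"
    using a l by simp
  finally show ?thesis .
qed

text \<open>Supplies the counit hypothesis of \<open>comonoid_hom_coequalizes\<close>. Since
  \<open>cop C\<close> has the counit of C, the statement serves for C \<otimes> C with either
  factor reversed.\<close>

lemma tensor_counit_comul:
  assumes C: "is_comonoid V C" and i: "i \<in> comonoid_homs V (unit_comonoid V) C"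
  shows "(\<lambda>\<^sub>I \<I> \<cdot> (counit C \<otimes>\<^sub>a counit C)) \<cdot> comul C = counit C"
    "(\<lambda>\<^sub>I \<I> \<cdot> (counit C \<otimes>\<^sub>a counit C)) \<cdot> (i \<otimes>\<^sub>a i) \<cdot> lun' \<I> \<cdot> counit C = counit C"
proof -
  note ty = comonoid_types[OF C] comonoid_hom_types[OF i, simplified]
  have i: "counit C \<cdot> i = \<one> \<I>" using i by (simp add: comonoid_homs_def)
  have u: "\<lambda>\<^sub>I (ccar C) \<cdot> (counit C \<otimes>\<^sub>a \<one> (ccar C)) \<cdot> comul C = \<one> (ccar C)"
    using C by (simp add: is_comonoid_def)
  have "(\<lambda>\<^sub>I \<I> \<cdot> (counit C \<otimes>\<^sub>a counit C)) \<cdot> comul C = (\<lambda>\<^sub>I \<I> \<cdot> (\<one> \<I> \<otimes>\<^sub>a counit C)) \<cdot> (counit C \<otimes>\<^sub>a \<one> (ccar C)) \<cdot> comul C"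
    using ty by simp
  also have "\<lambda>\<^sub>I \<I> \<cdot> (\<one> \<I> \<otimes>\<^sub>a counit C) = counit C \<cdot> \<lambda>\<^sub>I (ccar C)"
    using lun_nat[of "counit C"] ty by simp
  also have "(counit C \<cdot> \<lambda>\<^sub>I (ccar C)) \<cdot> (counit C \<otimes>\<^sub>a \<one> (ccar C)) \<cdot> comul C =
    counit C \<cdot> (\<lambda>\<^sub>I (ccar C) \<cdot> (counit C \<otimes>\<^sub>a \<one> (ccar C)) \<cdot> comul C)" using ty by simp
  also have "\<dots> = counit C" unfolding u using ty by simp
  finally show "(\<lambda>\<^sub>I \<I> \<cdot> (counit C \<otimes>\<^sub>a counit C)) \<cdot> comul C = counit C" .
  show "(\<lambda>\<^sub>I \<I> \<cdot> (counit C \<otimes>\<^sub>a counit C)) \<cdot> (i \<otimes>\<^sub>a i) \<cdot> lun' \<I> \<cdot> counit C = counit C"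
    using ty i by simp
qed

text \<open>The relation imposed by \<pi> in the form in which it is applied: for neighbouring
  Sweedler components, \<pi>(c1 \<otimes> c2) is replaced by \<epsilon>(c) times the constant
  \<pi>(1 \<otimes> 1).\<close>

lemma cob_nul_coequal:
  assumes C: "is_comonoid V C" and i: "i \<in> comonoid_homs V (unit_comonoid V) C" and p: "\<pi> \<in> Hom V (ccar C \<otimes> ccar C) (snd l)"
    and eq: "\<pi> \<cdot> comul C = \<pi> \<cdot> (i \<otimes>\<^sub>a i) \<cdot> lun' \<I> \<cdot> counit C"
    and w: "snd x = ccar C" "snd y = ccar C" "snd z = ccar C" "val K" "l \<in> fst K" "x \<noteq> y" "x \<notin> fst K - {l}" "y \<notin> fst K - {l}" "z \<notin> fst K - {l}"
  shows "cob (comul C) z x y (bin \<pi> x y l K) = del (counit C) z (nul (\<pi> \<cdot> (i \<otimes>\<^sub>a i) \<cdot> lun' \<I>) l K)"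
proof -
  note a = comonoid_types[OF C] comonoid_hom_types[OF i, simplified] p w
  have "cob (comul C) z x y (bin \<pi> x y l K) = sub (\<pi> \<cdot> comul C) z l K"
    by (rule cob_bin) (use a in auto)
  also have "\<pi> \<cdot> comul C = (\<pi> \<cdot> (i \<otimes>\<^sub>a i) \<cdot> lun' \<I>) \<cdot> counit C" unfolding eq using a by simp
  also have "sub ((\<pi> \<cdot> (i \<otimes>\<^sub>a i) \<cdot> lun' \<I>) \<cdot> counit C) z l K = del (counit C) z (nul (\<pi> \<cdot> (i \<otimes>\<^sub>a i) \<cdot> lun' \<I>) l K)"
    by (rule sub_via_unit) (use a in auto)
  finally show ?thesis .
qed

text \<open>The splitting of c1 \<otimes> c2 is (c1 \<otimes> c4) \<otimes> (c2 \<otimes> c3). By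
  \<open>cob_nul_coequal\<close> the factor \<pi>(c2 \<otimes> c3) becomes constant, the counit law
  makes c1 and c4 neighbours, and the other factor collapses in turn. On the second arrow both
  factors are the same constant at once, because \<open>i\<close> is grouplike.\<close>

lemma coideal_right:
  assumes C: "is_comonoid V C" and i: "i \<in> comonoid_homs V (unit_comonoid V) C" and p: "\<pi> \<in> Hom V (ccar C \<otimes> ccar C) L"
    and eq: "\<pi> \<cdot> comul C = \<pi> \<cdot> (i \<otimes>\<^sub>a i) \<cdot> lun' \<I> \<cdot> counit C"
  shows "(\<pi> \<otimes>\<^sub>a \<pi>) \<cdot> comul (tensor_comonoid V C (cop C)) \<cdot> comul C =
    (\<pi> \<otimes>\<^sub>a \<pi>) \<cdot> comul (tensor_comonoid V C (cop C)) \<cdot> (i \<otimes>\<^sub>a i) \<cdot> lun' \<I> \<cdot> counit C"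
proof (rule eq_by_sub[where X = "ccar C" and Z = "L \<otimes> L" and m = 0 and n = 9])
  let ?C = "ccar C" and ?E = "tensor_comonoid V C (cop C)" and ?v = "(i \<otimes>\<^sub>a i) \<cdot> lun' \<I> \<cdot> counit C" and ?T = "ccar C \<otimes> ccar C"
  have pL: "\<pi> \<in> Arr V" "src V \<pi> = ?T" "tgt V \<pi> = L" "L \<in> Obj V" using p tgt_in_Obj[of \<pi>] by auto
  note cC = cop_is_comonoid[OF C]
  note ty = comonoid_types[OF C] comonoid_types[OF cC, simplified] comonoid_hom_types[OF i, simplified] pL tensor_comul[OF C cC, simplified]
  show "(\<pi> \<otimes>\<^sub>a \<pi>) \<cdot> comul ?E \<cdot> comul C \<in> Hom V ?C (L \<otimes> L)" "(\<pi> \<otimes>\<^sub>a \<pi>) \<cdot> comul ?E \<cdot> ?v \<in> Hom V ?C (L \<otimes> L)"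
    using ty by auto
  let ?d = "\<lambda>i j k. cob (comul C) (i, ?C) (j, ?C) (k, ?C)" and ?c = "\<lambda>j. del (counit C) (j, ?C)"
    and ?p = "\<lambda>i j k. bin \<pi> (i, ?C) (j, ?C) (k, L)" and ?b = "\<lambda>i j k. bin (\<one> ?T) (i, ?C) (j, ?C) (k, ?T)"
    and ?s = "\<lambda>i j. sub \<pi> (i, ?T) (j, L)" and ?i = "\<lambda>j. nul i (j, ?C)" and ?g = "\<lambda>j. nul (\<pi> \<cdot> (i \<otimes>\<^sub>a i) \<cdot> lun' \<I>) (j, L)"
  fix K0 assume K0: "val K0" "fst K0 = {(9, L \<otimes> L)}"
  define K where "K = bin (\<one> (L \<otimes> L)) (5, L) (6, L) (9, L \<otimes> L) K0"
  have K: "val K" "fst K = {(5, L), (6, L)}" unfolding K_def using K0 ty by auto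
  \<comment> \<open>\<open>?Y\<close> is the common part of both sides, with one wire of type C
    \<otimes> C into which either arrow remains to be substituted.\<close>
  let ?Y = "cob (comul ?E) (1, ?T) (3, ?T) (4, ?T) (?s 3 5 (?s 4 6 K))"
  have Y: "?Y = sub ((\<pi> \<otimes>\<^sub>a \<pi>) \<cdot> comul ?E) (1, ?T) (9, L \<otimes> L) K0"
  proof -
    have "cob (comul ?E) (1, ?T) (3, ?T) (4, ?T) (?s 3 5 (?s 4 6 K)) = cob ((\<pi> \<otimes>\<^sub>a \<one> (snd (4::nat, ?T))) \<cdot> comul ?E) (1, ?T) (5, L) (4, ?T) (?s 4 6 K)"
      using ty K by (intro cob_sub1) auto
    also have "\<dots> = cob ((\<one> (snd (5::nat, L)) \<otimes>\<^sub>a \<pi>) \<cdot> (\<pi> \<otimes>\<^sub>a \<one> (snd (4::nat, ?T))) \<cdot> comul ?E) (1, ?T) (5, L) (6, L) K"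
      using ty K by (intro cob_sub2) auto
    also have "\<dots> = cob ((\<pi> \<otimes>\<^sub>a \<pi>) \<cdot> comul ?E) (1, ?T) (5, L) (6, L) K" using ty by simp
    also have "\<dots> = sub (\<one> (L \<otimes> L) \<cdot> ((\<pi> \<otimes>\<^sub>a \<pi>) \<cdot> comul ?E)) (1, ?T) (9, L \<otimes> L) K0"
      unfolding K_def using ty K0 by (intro cob_bin) auto
    finally show ?thesis using ty by simp
  qed
  have Yty: "val ?Y" "fst ?Y = {(1, ?T)}" using ty K by auto
  let ?R = "?p 13 15 5 (?p 14 16 6 K)"
  have s1: "?b 11 12 1 ?Y = ?d 11 13 14 (cob (comul (cop C)) (12, ?C) (15, ?C) (16, ?C) (?b 13 15 3 (?b 14 16 4 (?s 3 5 (?s 4 6 K)))))"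
    using ty K bin_tensor_comul[OF C cC, of "(11, ?C)" "(13, ?C)" "(14, ?C)" "(12, ?C)" "(15, ?C)" "(16, ?C)" "(1, ?T)" "(3, ?T)" "(4, ?T)" "?s 3 5 (?s 4 6 K)"] by auto
  have s2: "?b 14 16 4 (?s 3 5 (?s 4 6 K)) = ?s 3 5 (?b 14 16 4 (?s 4 6 K))"
    using ty K by (intro sub_bin_comm) auto
  have s3: "?b 14 16 4 (?s 4 6 K) = ?p 14 16 6 K"
    using ty K by (subst bin_sub) auto
  have s4: "?b 13 15 3 (?s 3 5 (?p 14 16 6 K)) = ?R"
    using ty K by (subst bin_sub) auto
  have s5: "cob (comul (cop C)) (12, ?C) (15, ?C) (16, ?C) ?R = ?d 12 16 15 ?R"
    using ty K by (intro cob_cop C) auto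
  have W: "?b 11 12 1 ?Y = ?d 11 13 14 (?d 12 16 15 ?R)"
    by (unfold s1, unfold s2, unfold s3, unfold s4, unfold s5, rule refl)
  note m = cob_nul_coequal[OF C i _ eq]
  have s1: "?d 0 11 12 (?d 11 13 14 (?d 12 16 15 ?R)) = ?d 0 13 17 (?d 17 14 12 (?d 12 16 15 ?R))"
    using ty K by (intro cob_coassoc C) auto
  \<comment> \<open>Coassociativity makes the inner components, the wires 14 and 16, the two halves
    of a single wire 18.\<close>
  have s2: "?d 17 14 12 (?d 12 16 15 ?R) = ?d 17 18 15 (?d 18 14 16 ?R)"
    using ty K by (intro cob_coassoc[symmetric] C) auto
  have s3: "?d 18 14 16 ?R = ?p 13 15 5 (?d 18 14 16 (?p 14 16 6 K))"
    using ty K by (intro cob_bin_comm[symmetric]) auto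
  have s4: "?d 18 14 16 (?p 14 16 6 K) = ?c 18 (?g 6 K)"
    using ty K by (intro m) auto
  have s5: "?p 13 15 5 (?c 18 (?g 6 K)) = ?c 18 (?p 13 15 5 (?g 6 K))"
    using ty K by (intro del_bin_comm) auto
  have s6: "?d 17 18 15 (?c 18 (?p 13 15 5 (?g 6 K))) = sub (\<one> ?C) (17, ?C) (15, ?C) (?p 13 15 5 (?g 6 K))"
    using ty K by (intro cob_counit C) auto
  have s7: "sub (\<one> ?C) (17, ?C) (15, ?C) (?p 13 15 5 (?g 6 K)) = ?p 13 17 5 (?g 6 K)"
    using ty K by (subst sub_bin2) auto
  have s8: "?d 0 13 17 (?p 13 17 5 (?g 6 K)) = ?c 0 (?g 5 (?g 6 K))"
    using ty K by (intro m) auto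
  have l: "?d 0 11 12 (?d 11 13 14 (?d 12 16 15 ?R)) = ?c 0 (?g 5 (?g 6 K))"
    by (unfold s1, unfold s2, unfold s3, unfold s4, unfold s5, unfold s6, unfold s7, unfold s8, rule refl)
  have s1: "?i 12 (?d 11 13 14 (?d 12 16 15 ?R)) = ?d 11 13 14 (?i 12 (?d 12 16 15 ?R))"
    using ty K by (intro cob_nul_comm) auto
  have s2: "?i 12 (?d 12 16 15 ?R) = ?i 16 (?i 15 ?R)"
    using ty K by (intro nul_cob_hom C i) auto
  have s3: "?i 11 (?d 11 13 14 (?i 16 (?i 15 ?R))) = ?i 13 (?i 14 (?i 16 (?i 15 ?R)))"
    using ty K by (intro nul_cob_hom C i) auto
  have s4: "?i 16 (?i 15 ?R) = ?i 15 (?i 16 ?R)"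
    using ty K by (intro nul_nul_comm) auto
  have s5: "?i 14 (?i 15 (?i 16 ?R)) = ?i 15 (?i 14 (?i 16 ?R))"
    using ty K by (intro nul_nul_comm) auto
  have s6: "?i 16 ?R = ?p 13 15 5 (?i 16 (?p 14 16 6 K))"
    using ty K by (intro bin_nul_comm) auto
  have s7: "?i 14 (?p 13 15 5 (?i 16 (?p 14 16 6 K))) = ?p 13 15 5 (?i 14 (?i 16 (?p 14 16 6 K)))"
    using ty K by (intro bin_nul_comm) auto
  have s8: "?i 14 (?i 16 (?p 14 16 6 K)) = ?g 6 K"
    using ty K by (intro nul_nul_bin) auto
  have s9: "?i 13 (?i 15 (?p 13 15 5 (?g 6 K))) = ?g 5 (?g 6 K)"
    using ty K by (intro nul_nul_bin) auto
  have r: "?i 11 (?i 12 (?d 11 13 14 (?d 12 16 15 ?R))) = ?g 5 (?g 6 K)"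
    by (unfold s1, unfold s2, unfold s3, unfold s4, unfold s5, unfold s6, unfold s7, unfold s8, unfold s9, rule refl)
  have Y': "sub ((\<pi> \<otimes>\<^sub>a \<pi>) \<cdot> comul ?E \<cdot> f) (0, ?C) (9, L \<otimes> L) K0 = sub f (0, ?C) (1, ?T) ?Y" if "f \<in> Hom V ?C ?T" for f
  proof -
    have "sub f (0, ?C) (1, ?T) (sub ((\<pi> \<otimes>\<^sub>a \<pi>) \<cdot> comul ?E) (1, ?T) (9, L \<otimes> L) K0) = sub (((\<pi> \<otimes>\<^sub>a \<pi>) \<cdot> comul ?E) \<cdot> f) (0, ?C) (9, L \<otimes> L) K0"
      using ty K0 that by (intro sub_sub) auto
    then show ?thesis unfolding Y using ty that by simp
  qed
  have dY: "sub (comul C) (0, ?C) (1, ?T) Y = ?d 0 11 12 (?b 11 12 1 Y)"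
    and vY: "nul (\<one> ?T \<cdot> (i \<otimes>\<^sub>a i) \<cdot> lun' \<I>) (1, ?T) Y = ?i 11 (?i 12 (?b 11 12 1 Y))"
    and cY: "sub (((i \<otimes>\<^sub>a i) \<cdot> lun' \<I>) \<cdot> counit C) (0, ?C) (1, ?T) Y = ?c 0 (nul ((i \<otimes>\<^sub>a i) \<cdot> lun' \<I>) (1, ?T) Y)"
    if "val Y" "fst Y = {(1, ?T)}" for Y
    using ty that cob_bin[of "comul C" "(0, ?C)" "(11, ?C)" "(12, ?C)" "\<one> ?T" "(1, ?T)" Y]
      nul_nul_bin[of i "(11, ?C)" i "(12, ?C)" "\<one> ?T" "(1, ?T)" Y]
      sub_via_unit[of "counit C" "(0, ?C)" "(i \<otimes>\<^sub>a i) \<cdot> lun' \<I>" "(1, ?T)" Y] by auto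
  have L: "sub (comul C) (0, ?C) (1, ?T) ?Y = ?c 0 (?g 5 (?g 6 K))" by (simp only: dY[OF Yty] W l)
  have "sub ?v (0, ?C) (1, ?T) ?Y = sub (((i \<otimes>\<^sub>a i) \<cdot> lun' \<I>) \<cdot> counit C) (0, ?C) (1, ?T) ?Y" using ty by simp
  also have "\<dots> = ?c 0 (nul ((i \<otimes>\<^sub>a i) \<cdot> lun' \<I>) (1, ?T) ?Y)"
    by (rule cY[OF Yty])
  also have "nul ((i \<otimes>\<^sub>a i) \<cdot> lun' \<I>) (1, ?T) ?Y = nul (\<one> ?T \<cdot> (i \<otimes>\<^sub>a i) \<cdot> lun' \<I>) (1, ?T) ?Y" using ty by simp
  also have "\<dots> = ?i 11 (?i 12 (?b 11 12 1 ?Y))"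
    by (rule vY[OF Yty])
  also have "\<dots> = ?g 5 (?g 6 K)" by (simp only: W r)
  finally have R: "sub ?v (0, ?C) (1, ?T) ?Y = ?c 0 (?g 5 (?g 6 K))" .
  have "sub (comul C) (0, ?C) (1, ?T) ?Y = sub ?v (0, ?C) (1, ?T) ?Y" by (simp only: L R)
  then show "sub ((\<pi> \<otimes>\<^sub>a \<pi>) \<cdot> comul ?E \<cdot> comul C) (0, ?C) (9, L \<otimes> L) K0 = sub ((\<pi> \<otimes>\<^sub>a \<pi>) \<cdot> comul ?E \<cdot> ?v) (0, ?C) (9, L \<otimes> L) K0"
    using Y'[of "comul C"] Y'[of ?v] ty by simp
qed

text \<open>The argument of \<open>coideal_right\<close> with the first factor reversed: now c1
  \<otimes> c2 splits into (c2 \<otimes> c3) \<otimes> (c1 \<otimes> c4), so the inner pair lies in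
  the first factor.\<close>

lemma coideal_left:
  assumes C: "is_comonoid V C" and i: "i \<in> comonoid_homs V (unit_comonoid V) C" and p: "\<pi> \<in> Hom V (ccar C \<otimes> ccar C) L"
    and eq: "\<pi> \<cdot> comul C = \<pi> \<cdot> (i \<otimes>\<^sub>a i) \<cdot> lun' \<I> \<cdot> counit C"
  shows "(\<pi> \<otimes>\<^sub>a \<pi>) \<cdot> comul (tensor_comonoid V (cop C) C) \<cdot> comul C =
    (\<pi> \<otimes>\<^sub>a \<pi>) \<cdot> comul (tensor_comonoid V (cop C) C) \<cdot> (i \<otimes>\<^sub>a i) \<cdot> lun' \<I> \<cdot> counit C"
proof (rule eq_by_sub[where X = "ccar C" and Z = "L \<otimes> L" and m = 0 and n = 9])
  let ?C = "ccar C" and ?E = "tensor_comonoid V (cop C) C" and ?v = "(i \<otimes>\<^sub>a i) \<cdot> lun' \<I> \<cdot> counit C" and ?T = "ccar C \<otimes> ccar C"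
  have pL: "\<pi> \<in> Arr V" "src V \<pi> = ?T" "tgt V \<pi> = L" "L \<in> Obj V" using p tgt_in_Obj[of \<pi>] by auto
  note cC = cop_is_comonoid[OF C]
  note ty = comonoid_types[OF C] comonoid_types[OF cC, simplified] comonoid_hom_types[OF i, simplified] pL tensor_comul[OF cC C, simplified]
  show "(\<pi> \<otimes>\<^sub>a \<pi>) \<cdot> comul ?E \<cdot> comul C \<in> Hom V ?C (L \<otimes> L)" "(\<pi> \<otimes>\<^sub>a \<pi>) \<cdot> comul ?E \<cdot> ?v \<in> Hom V ?C (L \<otimes> L)"
    using ty by auto
  let ?d = "\<lambda>i j k. cob (comul C) (i, ?C) (j, ?C) (k, ?C)" and ?c = "\<lambda>j. del (counit C) (j, ?C)"
    and ?p = "\<lambda>i j k. bin \<pi> (i, ?C) (j, ?C) (k, L)" and ?b = "\<lambda>i j k. bin (\<one> ?T) (i, ?C) (j, ?C) (k, ?T)"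
    and ?s = "\<lambda>i j. sub \<pi> (i, ?T) (j, L)" and ?i = "\<lambda>j. nul i (j, ?C)" and ?g = "\<lambda>j. nul (\<pi> \<cdot> (i \<otimes>\<^sub>a i) \<cdot> lun' \<I>) (j, L)"
  fix K0 assume K0: "val K0" "fst K0 = {(9, L \<otimes> L)}"
  define K where "K = bin (\<one> (L \<otimes> L)) (5, L) (6, L) (9, L \<otimes> L) K0"
  have K: "val K" "fst K = {(5, L), (6, L)}" unfolding K_def using K0 ty by auto
  let ?Y = "cob (comul ?E) (1, ?T) (3, ?T) (4, ?T) (?s 3 5 (?s 4 6 K))"
  have Y: "?Y = sub ((\<pi> \<otimes>\<^sub>a \<pi>) \<cdot> comul ?E) (1, ?T) (9, L \<otimes> L) K0"
  proof -
    have "cob (comul ?E) (1, ?T) (3, ?T) (4, ?T) (?s 3 5 (?s 4 6 K)) = cob ((\<pi> \<otimes>\<^sub>a \<one> (snd (4::nat, ?T))) \<cdot> comul ?E) (1, ?T) (5, L) (4, ?T) (?s 4 6 K)"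
      using ty K by (intro cob_sub1) auto
    also have "\<dots> = cob ((\<one> (snd (5::nat, L)) \<otimes>\<^sub>a \<pi>) \<cdot> (\<pi> \<otimes>\<^sub>a \<one> (snd (4::nat, ?T))) \<cdot> comul ?E) (1, ?T) (5, L) (6, L) K"
      using ty K by (intro cob_sub2) auto
    also have "\<dots> = cob ((\<pi> \<otimes>\<^sub>a \<pi>) \<cdot> comul ?E) (1, ?T) (5, L) (6, L) K" using ty by simp
    also have "\<dots> = sub (\<one> (L \<otimes> L) \<cdot> ((\<pi> \<otimes>\<^sub>a \<pi>) \<cdot> comul ?E)) (1, ?T) (9, L \<otimes> L) K0"
      unfolding K_def using ty K0 by (intro cob_bin) auto
    finally show ?thesis using ty by simp
  qed
  have Yty: "val ?Y" "fst ?Y = {(1, ?T)}" using ty K by auto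
  let ?R = "?p 13 15 5 (?p 14 16 6 K)"
  have s1: "?b 11 12 1 ?Y = cob (comul (cop C)) (11, ?C) (13, ?C) (14, ?C) (?d 12 15 16 (?b 13 15 3 (?b 14 16 4 (?s 3 5 (?s 4 6 K)))))"
    using ty K bin_tensor_comul[OF cC C, of "(11, ?C)" "(13, ?C)" "(14, ?C)" "(12, ?C)" "(15, ?C)" "(16, ?C)" "(1, ?T)" "(3, ?T)" "(4, ?T)" "?s 3 5 (?s 4 6 K)"] by auto
  have s2: "?b 14 16 4 (?s 3 5 (?s 4 6 K)) = ?s 3 5 (?b 14 16 4 (?s 4 6 K))"
    using ty K by (intro sub_bin_comm) auto
  have s3: "?b 14 16 4 (?s 4 6 K) = ?p 14 16 6 K"
    using ty K by (subst bin_sub) auto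
  have s4: "?b 13 15 3 (?s 3 5 (?p 14 16 6 K)) = ?R"
    using ty K by (subst bin_sub) auto
  have s5: "cob (comul (cop C)) (11, ?C) (13, ?C) (14, ?C) (?d 12 15 16 ?R) = ?d 11 14 13 (?d 12 15 16 ?R)"
    using ty K by (intro cob_cop C) auto
  have W: "?b 11 12 1 ?Y = ?d 11 14 13 (?d 12 15 16 ?R)"
    by (unfold s1, unfold s2, unfold s3, unfold s4, unfold s5, rule refl)
  note m = cob_nul_coequal[OF C i _ eq]
  have s1: "?d 0 11 12 (?d 11 14 13 (?d 12 15 16 ?R)) = ?d 0 14 17 (?d 17 13 12 (?d 12 15 16 ?R))"
    using ty K by (intro cob_coassoc C) auto
  have s2: "?d 17 13 12 (?d 12 15 16 ?R) = ?d 17 18 16 (?d 18 13 15 ?R)"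
    using ty K by (intro cob_coassoc[symmetric] C) auto
  have s3: "?d 18 13 15 ?R = ?c 18 (?g 5 (?p 14 16 6 K))"
    using ty K by (intro m) auto
  have s4: "?g 5 (?p 14 16 6 K) = ?p 14 16 6 (?g 5 K)"
    using ty K by (intro bin_nul_comm) auto
  have s5: "?d 17 18 16 (?c 18 (?p 14 16 6 (?g 5 K))) = sub (\<one> ?C) (17, ?C) (16, ?C) (?p 14 16 6 (?g 5 K))"
    using ty K by (intro cob_counit C) auto
  have s6: "sub (\<one> ?C) (17, ?C) (16, ?C) (?p 14 16 6 (?g 5 K)) = ?p 14 17 6 (?g 5 K)"
    using ty K by (subst sub_bin2) auto
  have s7: "?d 0 14 17 (?p 14 17 6 (?g 5 K)) = ?c 0 (?g 6 (?g 5 K))"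
    using ty K by (intro m) auto
  have s8: "?g 6 (?g 5 K) = ?g 5 (?g 6 K)"
    using ty K by (intro nul_nul_comm) auto
  have l: "?d 0 11 12 (?d 11 14 13 (?d 12 15 16 ?R)) = ?c 0 (?g 5 (?g 6 K))"
    by (unfold s1, unfold s2, unfold s3, unfold s4, unfold s5, unfold s6, unfold s7, unfold s8, rule refl)
  have s1: "?i 12 (?d 11 14 13 (?d 12 15 16 ?R)) = ?d 11 14 13 (?i 12 (?d 12 15 16 ?R))"
    using ty K by (intro cob_nul_comm) auto
  have s2: "?i 12 (?d 12 15 16 ?R) = ?i 15 (?i 16 ?R)"
    using ty K by (intro nul_cob_hom C i) auto
  have s3: "?i 11 (?d 11 14 13 (?i 15 (?i 16 ?R))) = ?i 14 (?i 13 (?i 15 (?i 16 ?R)))"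
    using ty K by (intro nul_cob_hom C i) auto
  have s4: "?i 14 (?i 13 (?i 15 (?i 16 ?R))) = ?i 13 (?i 14 (?i 15 (?i 16 ?R)))"
    using ty K by (intro nul_nul_comm) auto
  have s5: "?i 14 (?i 15 (?i 16 ?R)) = ?i 15 (?i 14 (?i 16 ?R))"
    using ty K by (intro nul_nul_comm) auto
  have s6: "?i 16 ?R = ?p 13 15 5 (?i 16 (?p 14 16 6 K))"
    using ty K by (intro bin_nul_comm) auto
  have s7: "?i 14 (?p 13 15 5 (?i 16 (?p 14 16 6 K))) = ?p 13 15 5 (?i 14 (?i 16 (?p 14 16 6 K)))"
    using ty K by (intro bin_nul_comm) auto
  have s8: "?i 14 (?i 16 (?p 14 16 6 K)) = ?g 6 K"
    using ty K by (intro nul_nul_bin) auto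
  have s9: "?i 13 (?i 15 (?p 13 15 5 (?g 6 K))) = ?g 5 (?g 6 K)"
    using ty K by (intro nul_nul_bin) auto
  have r: "?i 11 (?i 12 (?d 11 14 13 (?d 12 15 16 ?R))) = ?g 5 (?g 6 K)"
    by (unfold s1, unfold s2, unfold s3, unfold s4, unfold s5, unfold s6, unfold s7, unfold s8, unfold s9, rule refl)
  have Y': "sub ((\<pi> \<otimes>\<^sub>a \<pi>) \<cdot> comul ?E \<cdot> f) (0, ?C) (9, L \<otimes> L) K0 = sub f (0, ?C) (1, ?T) ?Y" if "f \<in> Hom V ?C ?T" for f
  proof -
    have "sub f (0, ?C) (1, ?T) (sub ((\<pi> \<otimes>\<^sub>a \<pi>) \<cdot> comul ?E) (1, ?T) (9, L \<otimes> L) K0) = sub (((\<pi> \<otimes>\<^sub>a \<pi>) \<cdot> comul ?E) \<cdot> f) (0, ?C) (9, L \<otimes> L) K0"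
      using ty K0 that by (intro sub_sub) auto
    then show ?thesis unfolding Y using ty that by simp
  qed
  have dY: "sub (comul C) (0, ?C) (1, ?T) Y = ?d 0 11 12 (?b 11 12 1 Y)"
    and vY: "nul (\<one> ?T \<cdot> (i \<otimes>\<^sub>a i) \<cdot> lun' \<I>) (1, ?T) Y = ?i 11 (?i 12 (?b 11 12 1 Y))"
    and cY: "sub (((i \<otimes>\<^sub>a i) \<cdot> lun' \<I>) \<cdot> counit C) (0, ?C) (1, ?T) Y = ?c 0 (nul ((i \<otimes>\<^sub>a i) \<cdot> lun' \<I>) (1, ?T) Y)"
    if "val Y" "fst Y = {(1, ?T)}" for Y
    using ty that cob_bin[of "comul C" "(0, ?C)" "(11, ?C)" "(12, ?C)" "\<one> ?T" "(1, ?T)" Y]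
      nul_nul_bin[of i "(11, ?C)" i "(12, ?C)" "\<one> ?T" "(1, ?T)" Y]
      sub_via_unit[of "counit C" "(0, ?C)" "(i \<otimes>\<^sub>a i) \<cdot> lun' \<I>" "(1, ?T)" Y] by auto
  have L: "sub (comul C) (0, ?C) (1, ?T) ?Y = ?c 0 (?g 5 (?g 6 K))" by (simp only: dY[OF Yty] W l)
  have "sub ?v (0, ?C) (1, ?T) ?Y = sub (((i \<otimes>\<^sub>a i) \<cdot> lun' \<I>) \<cdot> counit C) (0, ?C) (1, ?T) ?Y" using ty by simp
  also have "\<dots> = ?c 0 (nul ((i \<otimes>\<^sub>a i) \<cdot> lun' \<I>) (1, ?T) ?Y)"
    by (rule cY[OF Yty])
  also have "nul ((i \<otimes>\<^sub>a i) \<cdot> lun' \<I>) (1, ?T) ?Y = nul (\<one> ?T \<cdot> (i \<otimes>\<^sub>a i) \<cdot> lun' \<I>) (1, ?T) ?Y" using ty by simp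
  also have "\<dots> = ?i 11 (?i 12 (?b 11 12 1 ?Y))"
    by (rule vY[OF Yty])
  also have "\<dots> = ?g 5 (?g 6 K)" by (simp only: W r)
  finally have R: "sub ?v (0, ?C) (1, ?T) ?Y = ?c 0 (?g 5 (?g 6 K))" .
  have "sub (comul C) (0, ?C) (1, ?T) ?Y = sub ?v (0, ?C) (1, ?T) ?Y" by (simp only: L R)
  then show "sub ((\<pi> \<otimes>\<^sub>a \<pi>) \<cdot> comul ?E \<cdot> comul C) (0, ?C) (9, L \<otimes> L) K0 = sub ((\<pi> \<otimes>\<^sub>a \<pi>) \<cdot> comul ?E \<cdot> ?v) (0, ?C) (9, L \<otimes> L) K0"
    using Y'[of "comul C"] Y'[of ?v] ty by simp
qed

end

section \<open>The convolution products of t with the identity\<close>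

context universal_measuring_hopf
begin

lemma bin_e_unit_counit:
  assumes K: "val K" "fst K = {(9, mcar B)}"
  shows "bin (e \<cdot> (\<one> (bcar H) \<otimes>\<^sub>a (iP \<cdot> counit P))) (10, bcar H) (11, ccar P) (9, mcar B) K =
    del (bcounit H) (10, bcar H) (del (counit P) (11, ccar P) (nul (one B) (9, mcar B) K))"
proof -
  let ?X = "bcar H" and ?P = "ccar P" and ?B = "mcar B"
  let ?L = "bin e (10, ?X) (12, ?P) (9, ?B) K"
  note ty = types iP_types
  have s1: "bin (e \<cdot> (\<one> ?X \<otimes>\<^sub>a (iP \<cdot> counit P))) (10, ?X) (11, ?P) (9, ?B) K = sub (iP \<cdot> counit P) (11, ?P) (12, ?P) ?L"
    using ty K by (intro bin_sub_right) auto
  have s2: "sub (iP \<cdot> counit P) (11, ?P) (12, ?P) ?L = del (counit P) (11, ?P) (nul iP (12, ?P) ?L)"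
    using ty K by (intro sub_via_unit) auto
  have s3: "nul iP (12, ?P) ?L = del (bcounit H) (10, ?X) (nul (one B) (9, ?B) K)"
    using ty K by (intro e_iP) auto
  have s4: "del (counit P) (11, ?P) (del (bcounit H) (10, ?X) (nul (one B) (9, ?B) K)) =
    del (bcounit H) (10, ?X) (del (counit P) (11, ?P) (nul (one B) (9, ?B) K))"
    using ty K by (intro del_del_comm) auto
  show ?thesis
    by (unfold s1, unfold s2, unfold s3, unfold s4, rule refl)
qed

text \<open>e(h \<otimes> p1 t(p2)) = e(h1 \<otimes> p1) e(h2 \<otimes> t(p2)) = e(h1 \<otimes> p1)
  e(s(h2) \<otimes> p2) = e(h1 s(h2) \<otimes> p) = \<epsilon>(h) \<epsilon>(p) 1. The third
  equality is the measuring law read backwards.\<close>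

lemma e_convolution_right:
  "e \<cdot> (\<one> (bcar H) \<otimes>\<^sub>a (mP \<cdot> (\<one> (ccar P) \<otimes>\<^sub>a t) \<cdot> comul P)) = e \<cdot> (\<one> (bcar H) \<otimes>\<^sub>a (iP \<cdot> counit P))"
proof (rule eq_by_bin[where X = "bcar H" and Y = "ccar P" and Z = "mcar B"])
  let ?X = "bcar H" and ?P = "ccar P" and ?B = "mcar B"
  let ?g = "mP \<cdot> (\<one> ?P \<otimes>\<^sub>a t) \<cdot> comul P"
  note ty = types mP_types iP_types t_types s_types
  let ?eb = "\<lambda>i j k. bin e (i, ?X) (j, ?P) (k, ?B)" and ?mh = "\<lambda>i j k. bin (bmul H) (i, ?X) (j, ?X) (k, ?X)"
  let ?dh = "\<lambda>i j k. cob (bcomul H) (i, ?X) (j, ?X) (k, ?X)" and ?mp = "\<lambda>i j k. bin mP (i, ?P) (j, ?P) (k, ?P)"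
  let ?d = "\<lambda>i j k. cob (comul P) (i, ?P) (j, ?P) (k, ?P)" and ?t = "sub t (22, ?P) (23, ?P)" and ?s = "sub s (32, ?X) (33, ?X)"
  fix K assume K: "val K" "fst K = {(9, ?B)}"
  let ?L = "?eb 10 12 9 K" and ?M = "bin (mul B) (41, ?B) (42, ?B) (9, ?B) K" and ?J = "nul (one B) (9, ?B) K"
  have s1: "bin (e \<cdot> (\<one> ?X \<otimes>\<^sub>a ?g)) (10, ?X) (11, ?P) (9, ?B) K = sub ?g (11, ?P) (12, ?P) ?L"
    using ty K by (intro bin_sub_right) auto
  have s2: "sub ?g (11, ?P) (12, ?P) ?L = sub ((mP \<cdot> (\<one> (snd (21::nat, ?P)) \<otimes>\<^sub>a t)) \<cdot> comul P) (11, ?P) (12, ?P) ?L"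
    using ty by simp
  have s3: "sub ((mP \<cdot> (\<one> (snd (21::nat, ?P)) \<otimes>\<^sub>a t)) \<cdot> comul P) (11, ?P) (12, ?P) ?L = ?d 11 21 22 (bin (mP \<cdot> (\<one> (snd (21::nat, ?P)) \<otimes>\<^sub>a t)) (21, ?P) (22, ?P) (12, ?P) ?L)"
    using ty K by (intro cob_bin[symmetric]) auto
  have s4: "bin (mP \<cdot> (\<one> (snd (21::nat, ?P)) \<otimes>\<^sub>a t)) (21, ?P) (22, ?P) (12, ?P) ?L = ?t (?mp 21 23 12 ?L)"
    using ty K by (intro sub_bin2[symmetric]) auto
  have s5: "?mp 21 23 12 ?L = ?dh 10 31 32 (?eb 31 21 41 (?eb 32 23 42 ?M))"
    using ty K by (intro e_mP) auto
  have s6: "?t (?dh 10 31 32 (?eb 31 21 41 (?eb 32 23 42 ?M))) = ?dh 10 31 32 (?t (?eb 31 21 41 (?eb 32 23 42 ?M)))"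
    using ty K by (intro cob_sub_comm) auto
  have s7: "?t (?eb 31 21 41 (?eb 32 23 42 ?M)) = ?eb 31 21 41 (?t (?eb 32 23 42 ?M))"
    using ty K by (intro sub_bin_comm[symmetric]) auto
  have s8: "?t (?eb 32 23 42 ?M) = ?s (?eb 33 22 42 ?M)"
    using ty K by (intro sub_t_e) auto
  have s9: "?eb 31 21 41 (?s (?eb 33 22 42 ?M)) = ?s (?eb 31 21 41 (?eb 33 22 42 ?M))"
    using ty K by (intro sub_bin_comm) auto
  have s10: "?d 11 21 22 (?dh 10 31 32 (?s (?eb 31 21 41 (?eb 33 22 42 ?M)))) = ?dh 10 31 32 (?d 11 21 22 (?s (?eb 31 21 41 (?eb 33 22 42 ?M))))"
    using ty K by (intro cob_cob_comm) auto
  have s11: "?d 11 21 22 (?s (?eb 31 21 41 (?eb 33 22 42 ?M))) = ?s (?d 11 21 22 (?eb 31 21 41 (?eb 33 22 42 ?M)))"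
    using ty K by (intro cob_sub_comm[symmetric]) auto
  have s12: "?d 11 21 22 (?eb 31 21 41 (?eb 33 22 42 ?M)) = ?mh 31 33 34 (?eb 34 11 9 K)"
    using ty K by (intro e_mul[symmetric]) auto
  have s13: "?dh 10 31 32 (?s (?mh 31 33 34 (?eb 34 11 9 K))) = del (bcounit H) (10, ?X) (nul (bone H) (34, ?X) (?eb 34 11 9 K))"
    using ty K by (intro antipode_right) auto
  have s14: "nul (bone H) (34, ?X) (?eb 34 11 9 K) = del (counit P) (11, ?P) ?J"
    using ty K by (intro e_one) auto
  have l: "bin (e \<cdot> (\<one> ?X \<otimes>\<^sub>a ?g)) (10, ?X) (11, ?P) (9, ?B) K = del (bcounit H) (10, ?X) (del (counit P) (11, ?P) ?J)"
    by (unfold s1, unfold s2, unfold s3, unfold s4, unfold s5, unfold s6, unfold s7, unfold s8, unfold s9, unfold s10, unfold s11, unfold s12, unfold s13, unfold s14, rule refl)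
  show "bin (e \<cdot> (\<one> ?X \<otimes>\<^sub>a ?g)) (10, ?X) (11, ?P) (9, ?B) K = bin (e \<cdot> (\<one> ?X \<otimes>\<^sub>a (iP \<cdot> counit P))) (10, ?X) (11, ?P) (9, ?B) K"
    by (simp only: l bin_e_unit_counit[OF K])
qed (use types mP_types iP_types t_types in auto)

text \<open>e(h \<otimes> t(p1) p2) = e(s(h1) \<otimes> p1) e(h2 \<otimes> p2) = e(s(h1) h2
  \<otimes> p) = \<epsilon>(h) \<epsilon>(p) 1, again with the measuring law read backwards.\<close>

lemma e_convolution_left:
  "e \<cdot> (\<one> (bcar H) \<otimes>\<^sub>a (mP \<cdot> (t \<otimes>\<^sub>a \<one> (ccar P)) \<cdot> comul P)) = e \<cdot> (\<one> (bcar H) \<otimes>\<^sub>a (iP \<cdot> counit P))"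
proof (rule eq_by_bin[where X = "bcar H" and Y = "ccar P" and Z = "mcar B"])
  let ?X = "bcar H" and ?P = "ccar P" and ?B = "mcar B"
  let ?g = "mP \<cdot> (t \<otimes>\<^sub>a \<one> ?P) \<cdot> comul P"
  note ty = types mP_types iP_types t_types s_types
  let ?eb = "\<lambda>i j k. bin e (i, ?X) (j, ?P) (k, ?B)" and ?mh = "\<lambda>i j k. bin (bmul H) (i, ?X) (j, ?X) (k, ?X)"
  let ?dh = "\<lambda>i j k. cob (bcomul H) (i, ?X) (j, ?X) (k, ?X)" and ?mp = "\<lambda>i j k. bin mP (i, ?P) (j, ?P) (k, ?P)"
  let ?d = "\<lambda>i j k. cob (comul P) (i, ?P) (j, ?P) (k, ?P)" and ?t = "sub t (22, ?P) (23, ?P)" and ?s = "sub s (32, ?X) (33, ?X)"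
  fix K assume K: "val K" "fst K = {(9, ?B)}"
  let ?L = "?eb 10 12 9 K" and ?M = "bin (mul B) (42, ?B) (41, ?B) (9, ?B) K" and ?J = "nul (one B) (9, ?B) K"
  have s1: "bin (e \<cdot> (\<one> ?X \<otimes>\<^sub>a ?g)) (10, ?X) (11, ?P) (9, ?B) K = sub ?g (11, ?P) (12, ?P) ?L"
    using ty K by (intro bin_sub_right) auto
  have s2: "sub ?g (11, ?P) (12, ?P) ?L = sub ((mP \<cdot> (t \<otimes>\<^sub>a \<one> (snd (21::nat, ?P)))) \<cdot> comul P) (11, ?P) (12, ?P) ?L"
    using ty by simp
  have s3: "sub ((mP \<cdot> (t \<otimes>\<^sub>a \<one> (snd (21::nat, ?P)))) \<cdot> comul P) (11, ?P) (12, ?P) ?L = ?d 11 22 21 (bin (mP \<cdot> (t \<otimes>\<^sub>a \<one> (snd (21::nat, ?P)))) (22, ?P) (21, ?P) (12, ?P) ?L)"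
    using ty K by (intro cob_bin[symmetric]) auto
  have s4: "bin (mP \<cdot> (t \<otimes>\<^sub>a \<one> (snd (21::nat, ?P)))) (22, ?P) (21, ?P) (12, ?P) ?L = ?t (?mp 23 21 12 ?L)"
    using ty K by (intro sub_bin1[symmetric]) auto
  have s5: "?mp 23 21 12 ?L = ?dh 10 32 31 (?eb 32 23 42 (?eb 31 21 41 ?M))"
    using ty K by (intro e_mP) auto
  have s6: "?t (?dh 10 32 31 (?eb 32 23 42 (?eb 31 21 41 ?M))) = ?dh 10 32 31 (?t (?eb 32 23 42 (?eb 31 21 41 ?M)))"
    using ty K by (intro cob_sub_comm) auto
  have s7: "?t (?eb 32 23 42 (?eb 31 21 41 ?M)) = ?s (?eb 33 22 42 (?eb 31 21 41 ?M))"
    using ty K by (intro sub_t_e) auto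
  have s8: "?d 11 22 21 (?dh 10 32 31 (?s (?eb 33 22 42 (?eb 31 21 41 ?M)))) = ?dh 10 32 31 (?d 11 22 21 (?s (?eb 33 22 42 (?eb 31 21 41 ?M))))"
    using ty K by (intro cob_cob_comm) auto
  have s9: "?d 11 22 21 (?s (?eb 33 22 42 (?eb 31 21 41 ?M))) = ?s (?d 11 22 21 (?eb 33 22 42 (?eb 31 21 41 ?M)))"
    using ty K by (intro cob_sub_comm[symmetric]) auto
  have s10: "?d 11 22 21 (?eb 33 22 42 (?eb 31 21 41 ?M)) = ?mh 33 31 34 (?eb 34 11 9 K)"
    using ty K by (intro e_mul[symmetric]) auto
  have s11: "?dh 10 32 31 (?s (?mh 33 31 34 (?eb 34 11 9 K))) = del (bcounit H) (10, ?X) (nul (bone H) (34, ?X) (?eb 34 11 9 K))"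
    using ty K by (intro antipode_left) auto
  have s12: "nul (bone H) (34, ?X) (?eb 34 11 9 K) = del (counit P) (11, ?P) ?J"
    using ty K by (intro e_one) auto
  have l: "bin (e \<cdot> (\<one> ?X \<otimes>\<^sub>a ?g)) (10, ?X) (11, ?P) (9, ?B) K = del (bcounit H) (10, ?X) (del (counit P) (11, ?P) ?J)"
    by (unfold s1, unfold s2, unfold s3, unfold s4, unfold s5, unfold s6, unfold s7, unfold s8, unfold s9, unfold s10, unfold s11, unfold s12, rule refl)
  show "bin (e \<cdot> (\<one> ?X \<otimes>\<^sub>a ?g)) (10, ?X) (11, ?P) (9, ?B) K = bin (e \<cdot> (\<one> ?X \<otimes>\<^sub>a (iP \<cdot> counit P))) (10, ?X) (11, ?P) (9, ?B) K"
    by (simp only: l bin_e_unit_counit[OF K])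
qed (use types mP_types iP_types t_types in auto)

lemma mP_iP_iP:
  "mP \<cdot> (iP \<otimes>\<^sub>a iP) \<cdot> lun' \<I> = iP"
proof -
  note ty = types mP_types iP_types
  have "mP \<cdot> (iP \<otimes>\<^sub>a iP) \<cdot> lun' \<I> = (mP \<cdot> (iP \<otimes>\<^sub>a \<one> (ccar P))) \<cdot> (\<one> \<I> \<otimes>\<^sub>a iP) \<cdot> lun' \<I>" using ty by simp
  also have "\<dots> = (\<lambda>\<^sub>I (ccar P) \<cdot> (\<one> \<I> \<otimes>\<^sub>a iP)) \<cdot> lun' \<I>" unfolding mP_unit using ty by simp
  also have "\<lambda>\<^sub>I (ccar P) \<cdot> (\<one> \<I> \<otimes>\<^sub>a iP) = iP \<cdot> \<lambda>\<^sub>I \<I>" using lun_nat[of iP] ty by simp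
  finally show ?thesis using ty by simp
qed

text \<open>\<open>comonoid_hom_coequalizes\<close> removes \<open>e\<close> from
  \<open>e_convolution_right\<close>. It applies because \<open>?\<theta>\<close>, with
  \<open>cop P\<close> as its second factor, is a comonoid morphism, even though its composite with
  the comultiplication need not be one. The arrow \<open>?v\<close> is designed so that t(1) = 1 and
  1 1 = 1 take it to the unit after the counit.\<close>

lemma t_convolution_right: "mP \<cdot> (\<one> (ccar P) \<otimes>\<^sub>a t) \<cdot> comul P = iP \<cdot> counit P"
proof -
  let ?E = "tensor_comonoid V P (cop P)" and ?\<theta> = "mP \<cdot> (\<one> (ccar P) \<otimes>\<^sub>a t)" and ?v = "(iP \<otimes>\<^sub>a iP) \<cdot> lun' \<I> \<cdot> counit P"
  note cP = cop_is_comonoid[OF P]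
  note E = tensor_is_comonoid[OF P cP]
  note ty = types mP_types iP_types t_types
  have v: "?\<theta> \<cdot> ?v = iP \<cdot> counit P"
  proof -
    have "?\<theta> \<cdot> ?v = (mP \<cdot> (iP \<otimes>\<^sub>a (t \<cdot> iP)) \<cdot> lun' \<I>) \<cdot> counit P" using ty by simp
    then show ?thesis by (simp only: t_iP mP_iP_iP)
  qed
  have "?\<theta> \<cdot> comul P = ?\<theta> \<cdot> ?v"
  proof (rule comonoid_hom_coequalizes[OF E co])
    show "?\<theta> \<in> comonoid_homs V ?E P"
      by (rule comonoid_hom_cmp[OF E tensor_is_comonoid[OF P P] P comonoid_hom_tens[OF P cP P P comonoid_hom_ident[OF P] t(1)] mP(1)])
    show "\<forall>L. \<forall>\<pi> \<in> Hom V (ccar ?E) L. \<pi> \<cdot> comul P = \<pi> \<cdot> ?v \<longrightarrow> (\<pi> \<otimes>\<^sub>a \<pi>) \<cdot> comul ?E \<cdot> comul P = (\<pi> \<otimes>\<^sub>a \<pi>) \<cdot> comul ?E \<cdot> ?v"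
      using coideal_right[OF P iP(1)] by (simp only: tensor_comonoid_simps cop_simps) blast
    show "counit ?E \<cdot> comul P = counit ?E \<cdot> ?v"
      by (simp only: tensor_comonoid_simps cop_simps tensor_counit_comul[OF P iP(1)])
    show "e \<cdot> (\<one> (mcar (monoid_of H)) \<otimes>\<^sub>a (?\<theta> \<cdot> comul P)) = e \<cdot> (\<one> (mcar (monoid_of H)) \<otimes>\<^sub>a (?\<theta> \<cdot> ?v))"
      unfolding v using e_convolution_right ty by simp
  qed (use ty in auto)
  then show ?thesis unfolding v using ty by simp
qed

text \<open>The mirror image: \<open>t\<close> acts on the first factor, so the reversed
  comultiplication stands there and \<open>coideal_left\<close> provides the quotient.\<close>

lemma t_convolution_left: "mP \<cdot> (t \<otimes>\<^sub>a \<one> (ccar P)) \<cdot> comul P = iP \<cdot> counit P"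
proof -
  let ?E = "tensor_comonoid V (cop P) P" and ?\<theta> = "mP \<cdot> (t \<otimes>\<^sub>a \<one> (ccar P))" and ?v = "(iP \<otimes>\<^sub>a iP) \<cdot> lun' \<I> \<cdot> counit P"
  note cP = cop_is_comonoid[OF P]
  note E = tensor_is_comonoid[OF cP P]
  note ty = types mP_types iP_types t_types
  have v: "?\<theta> \<cdot> ?v = iP \<cdot> counit P"
  proof -
    have "?\<theta> \<cdot> ?v = (mP \<cdot> ((t \<cdot> iP) \<otimes>\<^sub>a iP) \<cdot> lun' \<I>) \<cdot> counit P" using ty by simp
    then show ?thesis by (simp only: t_iP mP_iP_iP)
  qed
  have "?\<theta> \<cdot> comul P = ?\<theta> \<cdot> ?v"
  proof (rule comonoid_hom_coequalizes[OF E co])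
    show "?\<theta> \<in> comonoid_homs V ?E P"
      by (rule comonoid_hom_cmp[OF E tensor_is_comonoid[OF P P] P comonoid_hom_tens[OF cP P P P t(1) comonoid_hom_ident[OF P]] mP(1)])
    show "\<forall>L. \<forall>\<pi> \<in> Hom V (ccar ?E) L. \<pi> \<cdot> comul P = \<pi> \<cdot> ?v \<longrightarrow> (\<pi> \<otimes>\<^sub>a \<pi>) \<cdot> comul ?E \<cdot> comul P = (\<pi> \<otimes>\<^sub>a \<pi>) \<cdot> comul ?E \<cdot> ?v"
      using coideal_left[OF P iP(1)] by (simp only: tensor_comonoid_simps cop_simps) blast
    show "counit ?E \<cdot> comul P = counit ?E \<cdot> ?v"
      by (simp only: tensor_comonoid_simps cop_simps tensor_counit_comul[OF P iP(1)])
    show "e \<cdot> (\<one> (mcar (monoid_of H)) \<otimes>\<^sub>a (?\<theta> \<cdot> comul P)) = e \<cdot> (\<one> (mcar (monoid_of H)) \<otimes>\<^sub>a (?\<theta> \<cdot> ?v))"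
      unfolding v using e_convolution_left ty by simp
  qed (use ty in auto)
  then show ?thesis unfolding v using ty by simp
qed

lemma measuring_bimonoid_is_Hopf_monoid: "is_Hopf_monoid V (measuring_bimonoid V H B P \<Phi>)"
proof -
  have "is_antipode V (measuring_bimonoid V H B P \<Phi>) t"
    unfolding is_antipode_def measuring_bimonoid_simps
    using t_types t_convolution_left t_convolution_right by simp
  then show ?thesis
    using measuring_bimonoid_is_bimonoid unfolding is_Hopf_monoid_def by blast
qed

end

theorem theorem9p1:
  fixes \<kappa> :: "'u rel"
    and V :: "('o, 'a) smc_category"
    and H :: "('o, 'a) bimonoid_obj"
    and B :: "('o, 'a) monoid_obj"
    and P :: "('o, 'a) comonoid_obj"
    and \<Phi> :: "('o, 'a) comonoid_obj \<Rightarrow> 'a \<Rightarrow> 'a"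
  assumes "inaccessible \<kappa>"
    and "symmetric_monoidal_closed_category V"
    and "locally_presentable \<kappa> V"
    and "is_Hopf_monoid V H"
    and "is_cocommutative V (comonoid_of H)"
    and "is_commutative_monoid V B"
    and "is_universal_measuring_comonoid V (monoid_of H) B P \<Phi>"
  shows "is_Hopf_monoid V (measuring_bimonoid V H B P \<Phi>)"
proof -
  interpret symmetric_monoidal_closed_category V by fact
  have H: "is_bimonoid V H" using assms(4) by (simp add: is_Hopf_monoid_def)
  obtain s where s: "is_antipode V H s" using assms(4) by (auto simp: is_Hopf_monoid_def)
  \<comment> \<open>Cocompleteness, contained in local presentability, supplies the coequalizers
    that carry the quotient comonoids.\<close>
  have co: "has_coequalizers V"
    using assms(3) cocomplete_has_coequalizers[OF assms(1)] by (auto simp: locally_presentable_def)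
  interpret universal_measuring_hopf V H B P \<Phi> s
    by unfold_locales (use assms H s co in \<open>auto simp: is_bimonoid_def is_commutative_monoid_def\<close>)
  show ?thesis by (rule measuring_bimonoid_is_Hopf_monoid)
qed

end
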